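(* Let $B=(B_t)_{t\in[0,1]}$ be a fractional Brownian motion with Hurst index $H=\frac14$. Let $f:\mathbb{R}\to\mathbb{R}$ be a function of class $\mathscr{C}^4$ such that $\sup_{t\in[0,1]}E\big(|f^{(i)}(B_t)|^p\big)<\infty$ for every $p\ge 1$ and every $i\in\{0,1,2,3,4\}$. Then, as $n\to\infty$, $$\frac{1}{\sqrt n}\sum_{k=0}^{n-1} f(B_{k/n})\big[\sqrt n\,(B_{(k+1)/n}-B_{k/n})^2-1\big]\ \xrightarrow{\text{Law}}\ C_{1/4}\int_0^1 f(B_s)\,dW_s+\frac14\int_0^1 f''(B_s)\,ds,$$ where $W=(W_t)_{t\in[0,1]}$ is a standard Brownian motion independent of $B$ and $$C_{1/4}=\sqrt{\frac12\sum_{p=-\infty}^{\infty}\big(\sqrt{|p+1|}+\sqrt{|p-1|}-2\sqrt{|p|}\big)^2}\approx 1.535 .$$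
   Context: A fractional Brownian motion with Hurst index $\frac14$ on $[0,1]$ is a centered Gaussian process $B=(B_t)_{t\in[0,1]}$ with covariance $E(B_sB_t)=\frac12(\sqrt t+\sqrt s-\sqrt{|t-s|})$ (with continuous paths). $\xrightarrow{\text{Law}}$ denotes convergence in distribution of real random variables. Since $W$ is independent of $B$, the integral $\int_0^1 f(B_s)\,dW_s$ is an ordinary Itô (Wiener, conditionally on $B$) integral. *)

theory Defs
  imports "HOL-Probability.Probability"
begin

text \<open>Processes on \<open>[0,1]\<close> are functions \<open>X :: real \<Rightarrow> 'a \<Rightarrow> real\<close>, time first; only
  their values at times in \<open>{0..1}\<close> are ever used.\<close>

text \<open>\<open>\<sigma>\<close> is the standard deviation; the degenerate case is a point mass, since
  \<^const>\<open>normal_density\<close> is a density for \<open>\<sigma> > 0\<close> only.\<close>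

definition gaussian_law :: "real \<Rightarrow> real \<Rightarrow> real measure" where
  "gaussian_law \<mu> \<sigma> =
     (if \<sigma> = 0 then return borel \<mu> else density lborel (\<lambda>x. ennreal (normal_density \<mu> \<sigma> x)))"

definition centered_gaussian_process :: "'a measure \<Rightarrow> (real \<Rightarrow> 'a \<Rightarrow> real) \<Rightarrow> bool" where
  "centered_gaussian_process M X \<longleftrightarrow>
     (\<forall>t\<in>{0..1}. X t \<in> borel_measurable M \<and> integral\<^sup>L M (X t) = 0) \<and>
     (\<forall>J c. finite J \<and> J \<subseteq> {0..1} \<longrightarrow>
        (\<exists>\<mu> \<sigma>. \<sigma> \<ge> 0 \<and> distr M borel (\<lambda>\<omega>. \<Sum>t\<in>J. c t * X t \<omega>) = gaussian_law \<mu> \<sigma>))"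

definition fractional_brownian_motion ::
    "'a measure \<Rightarrow> real \<Rightarrow> (real \<Rightarrow> 'a \<Rightarrow> real) \<Rightarrow> bool" where
  "fractional_brownian_motion M H B \<longleftrightarrow>
     centered_gaussian_process M B \<and>
     (\<forall>s\<in>{0..1}. \<forall>t\<in>{0..1}. integral\<^sup>L M (\<lambda>\<omega>. B s \<omega> * B t \<omega>)
        = (t powr (2 * H) + s powr (2 * H) - \<bar>t - s\<bar> powr (2 * H)) / 2) \<and>
     (\<forall>\<omega>\<in>space M. continuous_on {0..1} (\<lambda>t. B t \<omega>))"

lemma fractional_brownian_motion_quarter:
  "fractional_brownian_motion M (1/4) B \<longleftrightarrow>
     centered_gaussian_process M B \<and>
     (\<forall>s\<in>{0..1}. \<forall>t\<in>{0..1}. integral\<^sup>L M (\<lambda>\<omega>. B s \<omega> * B t \<omega>)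
        = (sqrt t + sqrt s - sqrt \<bar>t - s\<bar>) / 2) \<and>
     (\<forall>\<omega>\<in>space M. continuous_on {0..1} (\<lambda>t. B t \<omega>))"
  by (simp add: fractional_brownian_motion_def powr_half_sqrt)

definition standard_brownian_motion :: "'a measure \<Rightarrow> (real \<Rightarrow> 'a \<Rightarrow> real) \<Rightarrow> bool" where
  "standard_brownian_motion M W \<longleftrightarrow>
     (\<forall>t\<in>{0..1}. W t \<in> borel_measurable M) \<and>
     (AE \<omega> in M. W 0 \<omega> = 0) \<and>
     (\<forall>s t. 0 \<le> s \<and> s < t \<and> t \<le> 1 \<longrightarrow>
        distr M borel (\<lambda>\<omega>. W t \<omega> - W s \<omega>) = gaussian_law 0 (sqrt (t - s))) \<and>
     (\<forall>m \<tau>. (\<forall>i\<le>m. \<tau> i \<in> {0..1}) \<and> (\<forall>i<m. \<tau> i \<le> \<tau> (Suc i)) \<longrightarrow>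
        prob_space.indep_vars M (\<lambda>_. borel) (\<lambda>i \<omega>. W (\<tau> (Suc i)) \<omega> - W (\<tau> i) \<omega>) {..<m}) \<and>
     (\<forall>\<omega>\<in>space M. continuous_on {0..1} (\<lambda>t. W t \<omega>))"

definition indep_processes ::
    "'a measure \<Rightarrow> (real \<Rightarrow> 'a \<Rightarrow> real) \<Rightarrow> (real \<Rightarrow> 'a \<Rightarrow> real) \<Rightarrow> bool" where
  "indep_processes M X Y \<longleftrightarrow>
     prob_space.indep_var M
       (Pi\<^sub>M {0..1} (\<lambda>_. borel)) (\<lambda>\<omega>. \<lambda>t\<in>{0..1}. X t \<omega>)
       (Pi\<^sub>M {0..1} (\<lambda>_. borel)) (\<lambda>\<omega>. \<lambda>t\<in>{0..1}. Y t \<omega>)"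

text \<open>The filtration \<open>\<sigma>(B\<^sub>s, s \<in> [0,1]) \<or> \<sigma>(W\<^sub>u, u \<le> t)\<close>: the whole path of \<open>B\<close> is known at
  time \<open>0\<close>. If \<open>W\<close> is independent of \<open>B\<close>, it is still a Brownian motion for this filtration.\<close>

definition initially_enlarged_filtration ::
    "'a measure \<Rightarrow> (real \<Rightarrow> 'a \<Rightarrow> real) \<Rightarrow> (real \<Rightarrow> 'a \<Rightarrow> real) \<Rightarrow> real \<Rightarrow> 'a measure" where
  "initially_enlarged_filtration M B W t =
     sigma (space M)
       ({B s -` A \<inter> space M | s A. s \<in> {0..1} \<and> A \<in> sets borel} \<union>
        {W u -` A \<inter> space M | u A. u \<in> {0..t} \<and> A \<in> sets borel})"

text \<open>A bounded simple adapted process \<open>\<Sum>i<m. \<xi>\<^sub>i 1\<^bsub>(\<tau>\<^sub>i, \<tau>\<^sub>i\<^sub>+\<^sub>1]\<^esub>\<close> is given by \<open>m\<close>, \<open>\<tau>\<close>, \<open>\<xi>\<close>.\<close>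

definition simple_adapted ::
    "'a measure \<Rightarrow> (real \<Rightarrow> 'a measure) \<Rightarrow> nat \<Rightarrow> (nat \<Rightarrow> real) \<Rightarrow> (nat \<Rightarrow> 'a \<Rightarrow> real) \<Rightarrow> bool" where
  "simple_adapted M F m \<tau> \<xi> \<longleftrightarrow>
     (\<forall>i\<le>m. \<tau> i \<in> {0..1}) \<and> (\<forall>i<m. \<tau> i \<le> \<tau> (Suc i)) \<and>
     (\<forall>i<m. \<xi> i \<in> borel_measurable (F (\<tau> i)) \<and> (\<exists>K. \<forall>\<omega>\<in>space M. \<bar>\<xi> i \<omega>\<bar> \<le> K))"

definition simple_process ::
    "nat \<Rightarrow> (nat \<Rightarrow> real) \<Rightarrow> (nat \<Rightarrow> 'a \<Rightarrow> real) \<Rightarrow> real \<Rightarrow> 'a \<Rightarrow> real" where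
  "simple_process m \<tau> \<xi> s \<omega> = (\<Sum>i<m. \<xi> i \<omega> * indicator {\<tau> i<..\<tau> (Suc i)} s)"

definition simple_ito_integral ::
    "(real \<Rightarrow> 'a \<Rightarrow> real) \<Rightarrow> nat \<Rightarrow> (nat \<Rightarrow> real) \<Rightarrow> (nat \<Rightarrow> 'a \<Rightarrow> real) \<Rightarrow> 'a \<Rightarrow> real" where
  "simple_ito_integral W m \<tau> \<xi> \<omega> = (\<Sum>i<m. \<xi> i \<omega> * (W (\<tau> (Suc i)) \<omega> - W (\<tau> i) \<omega>))"

text \<open>\<open>I = \<integral>\<^sub>0\<^sup>1 X\<^sub>s dW\<^sub>s\<close> for square-integrable \<open>X\<close>, as the \<open>L\<^sup>2\<close> extension of the integral of
  simple adapted processes. It is determined by \<open>X\<close> up to almost sure equality.\<close>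

definition has_ito_integral ::
    "'a measure \<Rightarrow> (real \<Rightarrow> 'a measure) \<Rightarrow> (real \<Rightarrow> 'a \<Rightarrow> real) \<Rightarrow> (real \<Rightarrow> 'a \<Rightarrow> real)
       \<Rightarrow> ('a \<Rightarrow> real) \<Rightarrow> bool" where
  "has_ito_integral M F W X I \<longleftrightarrow>
     (\<lambda>(s, \<omega>). X s \<omega>) \<in> borel_measurable (restrict_space borel {0..1} \<Otimes>\<^sub>M M) \<and>
     I \<in> borel_measurable M \<and>
     (\<exists>m \<tau> \<xi>. (\<forall>n. simple_adapted M F (m n) (\<tau> n) (\<xi> n)) \<and>
        (\<lambda>n. \<integral>\<^sup>+ \<omega>. (\<integral>\<^sup>+ s\<in>{0..1}.
            ennreal ((X s \<omega> - simple_process (m n) (\<tau> n) (\<xi> n) s \<omega>)\<^sup>2) \<partial>lborel) \<partial>M)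
          \<longlonglongrightarrow> 0 \<and>
        (\<lambda>n. \<integral>\<^sup>+ \<omega>. ennreal ((I \<omega> - simple_ito_integral W (m n) (\<tau> n) (\<xi> n) \<omega>)\<^sup>2) \<partial>M)
          \<longlonglongrightarrow> 0)"

text \<open>Some version of the integral; a junk value if \<open>X\<close> is not integrable.\<close>

definition ito_integral ::
    "'a measure \<Rightarrow> (real \<Rightarrow> 'a measure) \<Rightarrow> (real \<Rightarrow> 'a \<Rightarrow> real) \<Rightarrow> (real \<Rightarrow> 'a \<Rightarrow> real)
       \<Rightarrow> 'a \<Rightarrow> real" where
  "ito_integral M F W X = (SOME I. has_ito_integral M F W X I)"

definition class_C :: "nat \<Rightarrow> (real \<Rightarrow> real) \<Rightarrow> bool" where
  "class_C k f \<longleftrightarrow>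
     (\<forall>i<k. \<forall>x. (deriv ^^ i) f differentiable (at x)) \<and> continuous_on UNIV ((deriv ^^ k) f)"

definition C_quarter :: real where
  "C_quarter = sqrt (1 / 2 * (\<Sum>\<^sub>\<infinity>p\<in>(UNIV :: int set).
     (sqrt \<bar>real_of_int p + 1\<bar> + sqrt \<bar>real_of_int p - 1\<bar> - 2 * sqrt \<bar>real_of_int p\<bar>)\<^sup>2))"

definition weighted_quadratic_variation ::
    "(real \<Rightarrow> real) \<Rightarrow> (real \<Rightarrow> 'a \<Rightarrow> real) \<Rightarrow> nat \<Rightarrow> 'a \<Rightarrow> real" where
  "weighted_quadratic_variation f B n \<omega> =
     1 / sqrt (real n) * (\<Sum>k<n. f (B (real k / real n) \<omega>) *
       (sqrt (real n) * (B (real (k + 1) / real n) \<omega> - B (real k / real n) \<omega>)\<^sup>2 - 1))"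

end

theory Submission
  imports Defs "HOL-Real_Asymp.Real_Asymp"
begin

text \<open>Let \<open>q\<^sub>n\<close> be the weighted quadratic variation, \<open>a\<^sub>n\<close> and \<open>v\<^sub>n\<close> the Riemann sums of
  \<open>\<integral> f''(B)/4\<close> and \<open>C\<^sup>2 \<integral> f(B)\<^sup>2\<close>, and interpolate between \<open>q\<^sub>n\<close> and its limit by
  \<open>\<Phi>(t) = exp (i t \<mu> q\<^sub>n + i (1 - t) \<mu> a\<^sub>n - (1 - t\<^sup>2) \<mu>\<^sup>2 v\<^sub>n / 2)\<close>. Its derivative contains
  \<open>i \<mu> q\<^sub>n \<Phi>(t)\<close>, and two Gaussian integrations by parts in the \<open>k\<close>-th increment turn the expectation
  of this term into that of \<open>(i \<mu> a\<^sub>n - \<mu>\<^sup>2 t v\<^sub>n) \<Phi>(t)\<close> up to \<open>o(1)\<close>: the derivatives of \<open>f\<close> at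
  \<open>B\<^bsub>k/n\<^esub>\<close> produce \<open>f''/4\<close>, because \<open>B\<^bsub>k/n\<^esub>\<close> and the increment have covariance close to
  \<open>- 1/(2 \<surd>n)\<close>, and those of \<open>\<Phi>\<close> produce the variance. Hence \<open>E \<Phi>(1) - E \<Phi>(0)\<close> tends to \<open>0\<close>,
  when \<open>f\<close> and its derivatives are bounded; a cut-off of \<open>f\<close> outside a large interval,
  which the path leaves with small probability, removes this restriction.

  On the other side, the exponential martingale of simple processes, stopped before their quadratic
  variation exceeds a level so that it stays bounded, identifies the characteristic function of the
  stochastic integral given \<open>B\<close> as that of a centred Gaussian with variance \<open>\<integral> f(B)\<^sup>2\<close>.\<close>

section \<open>Correlations of the increments\<close>

text \<open>The increments of \<open>B\<close> are correlated and \<open>B\<close> is not a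
  semimartingale, so a martingale limit theorem is out of reach; Gaussian integration by parts
  replaces it. The factor \<open>1 - t\<^sup>2\<close> is forced: with frequency
  \<open>s = t * \<mu>\<close> the integration by parts yields the variance term
  \<open>- \<mu>\<^sup>2 * t * v\<close>, which is cancelled by the derivative of
  \<open>- (1 - t\<^sup>2) * \<mu>\<^sup>2 * v / 2\<close>. As \<open>v\<close> is nonnegative, the
  exponent never has a positive real part, so all test functionals are bounded by 1. Four
  derivatives of \<open>f\<close> appear because the drift \<open>f''/4\<close> itself sits in the
  phase and is differentiated twice more. Every error reduces to sums of two kinds of numbers:
  correlations \<open>cr k l\<close> of increments, whose rows are absolutely summable, and
  covariances \<open>wt k l\<close> of an increment with a grid value, which decay so slowly that
  their squares sum to a logarithm. The resulting error for bounded functions is of order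
  \<open>ln n / n powr (1/4)\<close>. On the stochastic side the path of \<open>B\<close> counts as
  known at time 0, so conditioning on \<open>B\<close> becomes multiplication by factors measurable
  at time 0.\<close>

definition sqrt_inc :: "nat \<Rightarrow> real" where
  "sqrt_inc j = sqrt (real j + 1) - sqrt (real j)"

text \<open>The correlation of two increments of \<open>B\<close> over grid cells whose indices
  differ by \<open>p\<close>: half the second difference of the square root of the distance.
  \<open>C_quarter\<close> is built from the sum of its squares.\<close>

definition rho :: "int \<Rightarrow> real" where
  "rho p = (sqrt \<bar>real_of_int p + 1\<bar> + sqrt \<bar>real_of_int p - 1\<bar> - 2 * sqrt \<bar>real_of_int p\<bar>) / 2"

lemma sqrt_inc_nonneg: "0 \<le> sqrt_inc j"
  by (simp add: sqrt_inc_def)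

lemma sqrt_inc_altdef: "sqrt_inc j = 1 / (sqrt (real j + 1) + sqrt (real j))"
proof -
  have "sqrt (real j + 1) + sqrt (real j) > 0"
    by (smt (verit) of_nat_0_le_iff real_sqrt_ge_0_iff real_sqrt_gt_0_iff)
  moreover have "sqrt_inc j * (sqrt (real j + 1) + sqrt (real j)) = 1"
    by (simp add: sqrt_inc_def algebra_simps)
  ultimately show ?thesis by (simp add: field_simps)
qed

lemma sqrt_inc_0 [simp]: "sqrt_inc 0 = 1"
  by (simp add: sqrt_inc_def)

lemma sqrt_inc_antimono: "i \<le> j \<Longrightarrow> sqrt_inc j \<le> sqrt_inc i"
  unfolding sqrt_inc_altdef
  by (intro divide_left_mono add_mono mult_pos_pos add_pos_nonneg) auto

lemma sqrt_inc_le_1: "sqrt_inc j \<le> 1"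
  using sqrt_inc_antimono[of 0 j] by simp

lemma sqrt_inc_le: "sqrt_inc j \<le> 1 / sqrt (real j + 1)"
  unfolding sqrt_inc_altdef by (intro divide_left_mono mult_pos_pos add_pos_nonneg) auto

lemma sum_sqrt_inc: "(\<Sum>j<n. sqrt_inc j) = sqrt (real n)"
  by (induction n) (auto simp: sqrt_inc_def algebra_simps)

text \<open>The squares are at most \<open>1 / (j + 1)\<close>, so this is a harmonic sum. It is the
  source of the logarithm \<open>la\<close> in all later bounds.\<close>

lemma sum_sqrt_inc_sq:
  assumes "n > 0" shows "(\<Sum>j<n. (sqrt_inc j)\<^sup>2) \<le> 1 + ln (real n)"
  using assms
proof (induction n)
  case (Suc n)
  show ?case
  proof (cases "n = 0")
    case False
    have "(sqrt_inc n)\<^sup>2 \<le> (1 / sqrt (real n + 1))\<^sup>2"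
      by (intro power_mono sqrt_inc_le sqrt_inc_nonneg)
    also have "\<dots> = 1 / (real n + 1)" by (simp add: power_divide)
    also have "\<dots> \<le> ln (real n + 1) - ln (real n)"
    proof -
      have "ln (real n / (real n + 1)) \<le> real n / (real n + 1) - 1"
        using False by (intro ln_le_minus_one) auto
      also have "\<dots> = - 1 / (real n + 1)" by (simp add: field_simps)
      finally show ?thesis using False by (simp add: ln_div)
    qed
    finally show ?thesis using Suc False by (simp add: add.commute)
  qed simp
qed simp

lemma rho_0 [simp]: "rho 0 = 1"
  by (simp add: rho_def)

lemma rho_minus [simp]: "rho (- p) = rho p"
  by (simp add: rho_def) (smt (verit))

lemma rho_Suc: "rho (int (Suc j)) = - (sqrt_inc j - sqrt_inc (Suc j)) / 2"
  by (simp add: rho_def sqrt_inc_def algebra_simps)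

lemma abs_rho_Suc: "\<bar>rho (int (Suc j))\<bar> = (sqrt_inc j - sqrt_inc (Suc j)) / 2"
  unfolding rho_Suc using sqrt_inc_antimono[of j "Suc j"] by simp

text \<open>Concavity of the square root makes \<open>rho\<close> nonpositive away from 0 and equal
  to half a difference of the decreasing \<open>sqrt_inc\<close>, so the absolute values
  telescope.\<close>

lemma sum_abs_rho_Suc: "(\<Sum>j<m. \<bar>rho (int (Suc (i + j)))\<bar>) = (sqrt_inc i - sqrt_inc (i + m)) / 2"
  by (induction m) (simp_all add: abs_rho_Suc field_simps del: of_nat_Suc)

lemma abs_rho_le_1: "\<bar>rho p\<bar> \<le> 1"
proof -
  have "\<bar>rho (int j)\<bar> \<le> 1" for j
  proof (cases j)
    case (Suc i)
    have "(sqrt_inc i - sqrt_inc (Suc i)) / 2 \<le> 1" using sqrt_inc_le_1[of i] sqrt_inc_nonneg[of "Suc i"] by simp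
    then show ?thesis unfolding Suc abs_rho_Suc .
  qed simp
  moreover have "p = int (nat p) \<or> p = - int (nat (-p))" by linarith
  ultimately show ?thesis by (metis rho_minus)
qed

text \<open>Cuts row \<open>k\<close> of a Toeplitz matrix at its diagonal, so that each side is a
  sum over positive distances, where the formulas with \<open>sqrt_inc\<close> apply.\<close>

lemma sum_shift_int:
  fixes h :: "int \<Rightarrow> real"
  assumes "k < n"
  shows "(\<Sum>l<n. h (int l - int k)) = h 0 + (\<Sum>j<n - Suc k. h (int (Suc j))) + (\<Sum>j<k. h (- int (Suc j)))"
proof -
  have "(\<Sum>l<n. h (int l - int k)) = (\<Sum>l<k. h (int l - int k)) + (\<Sum>l=k..<n. h (int l - int k))"
    using assms by (metis (no_types, lifting) atLeast0LessThan less_or_eq_imp_le sum.atLeastLessThan_concat zero_le)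
  also have "(\<Sum>l<k. h (int l - int k)) = (\<Sum>j<k. h (- int (Suc j)))"
    by (subst sum.nat_diff_reindex[symmetric], rule sum.cong) (auto simp: of_nat_diff algebra_simps)
  also have "(\<Sum>l=k..<n. h (int l - int k)) = (\<Sum>j<n - k. h (int j))"
    using assms sum.shift_bounds_nat_ivl[of "\<lambda>l. h (int l - int k)" 0 k "n - k"]
    by (simp add: atLeast0LessThan)
  also have "n - k = Suc (n - Suc k)" using assms by simp
  finally show ?thesis by (simp add: sum.lessThan_Suc_shift algebra_simps del: sum.lessThan_Suc)
qed

text \<open>The diagonal contributes 1 and each side telescopes to at most 1/2. What matters later
  is that the bound is independent of \<open>k\<close> and \<open>n\<close>.\<close>

lemma sum_abs_rho_row:
  assumes "k < n" shows "(\<Sum>l<n. \<bar>rho (int l - int k)\<bar>) \<le> 2"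
proof -
  have "(\<Sum>l<n. \<bar>rho (int l - int k)\<bar>)
     = 1 + (1 - sqrt_inc (n - Suc k)) / 2 + (1 - sqrt_inc k) / 2"
    using sum_shift_int[OF assms, of "\<lambda>p. \<bar>rho p\<bar>"] sum_abs_rho_Suc[where i=0]
    by (simp only: rho_minus rho_0 add_0 sqrt_inc_0 abs_one)
  moreover have "1 + (1 - a) / 2 + (1 - b) / 2 \<le> 2" if "0 \<le> a" "0 \<le> b" for a b :: real
    using that by (simp add: field_simps)
  ultimately show ?thesis using sqrt_inc_nonneg by metis
qed

lemma rho_sq_le_abs: "(rho p)\<^sup>2 \<le> \<bar>rho p\<bar>"
  using mult_right_mono[OF abs_rho_le_1[of p], of "\<bar>rho p\<bar>"] by (simp add: power2_eq_square)

lemma sum_Un_le: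
  fixes f :: "'b \<Rightarrow> real"
  assumes "finite A" "finite B" "\<And>x. 0 \<le> f x"
  shows "sum f (A \<union> B) \<le> sum f A + sum f B"
  using assms by (simp add: sum_Un sum_nonneg)

text \<open>Row \<open>k\<close> contains the distances from \<open>-k\<close> to
  \<open>n - 1 - k\<close>. The two missing tails are estimated by
  \<open>(rho p)\<^sup>2 \<le> \<bar>rho p\<bar>\<close> and telescope to \<open>sqrt_inc\<close> at
  the two cut points. Being uniform in \<open>F\<close>, the bound yields summability as well as the
  speed at which row sums approach the full series.\<close>

lemma sum_rho_sq_bound:
  assumes "finite F" "k < n"
  shows "sum (\<lambda>p. (rho p)\<^sup>2) F \<le> (\<Sum>l<n. (rho (int l - int k))\<^sup>2) + (sqrt_inc k + sqrt_inc (n - Suc k)) / 2"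
proof -
  obtain N :: nat where N: "\<forall>p\<in>F. \<bar>p\<bar> \<le> int N"
    using assms(1) by (metis finite_imageI Max_ge abs_ge_zero finite_nat_set_iff_bounded_le imageI nat_le_iff zero_le_imp_eq_int)
  let ?f = "\<lambda>p. (rho p)\<^sup>2"
  let ?A = "(\<lambda>l. int l - int k) ` {..<n}"
  let ?B = "(\<lambda>j. int (Suc (n - Suc k + j))) ` {..<N}" 
  let ?C = "(\<lambda>j. - int (Suc (k + j))) ` {..<N}"
  have "F \<subseteq> ?A \<union> ?B \<union> ?C"
  proof
    fix p assume "p \<in> F"
    then have p: "\<bar>p\<bar> \<le> int N" using N by auto
    consider "- int k \<le> p" "p < int n - int k" | "p \<ge> int n - int k" | "p < - int k" by linarith
    then show "p \<in> ?A \<union> ?B \<union> ?C"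
    proof cases
      case 1 then have "p \<in> ?A" by (intro image_eqI[of _ _ "nat (p + int k)"]) auto
      then show ?thesis by blast
    next
      case 2 then have "p \<in> ?B" using assms(2) p by (intro image_eqI[of _ _ "nat (p - (int n - int k))"]) auto
      then show ?thesis by blast
    next
      case 3 then have "p \<in> ?C" using p by (intro image_eqI[of _ _ "nat (- p - int k - 1)"]) auto
      then show ?thesis by blast
    qed
  qed
  then have "sum ?f F \<le> sum ?f (?A \<union> ?B \<union> ?C)" by (intro sum_mono2) auto
  also have "\<dots> \<le> sum ?f ?A + sum ?f ?B + sum ?f ?C"
    by (intro order_trans[OF sum_Un_le] add_mono order_refl) auto
  also have "sum ?f ?A = (\<Sum>l<n. (rho (int l - int k))\<^sup>2)"
    by (subst sum.reindex) (auto simp: inj_on_def)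
  also have "sum ?f ?B = (\<Sum>j<N. ?f (int (Suc (n - Suc k + j))))"
    by (subst sum.reindex) (auto simp: inj_on_def)
  also have "\<dots> \<le> (\<Sum>j<N. \<bar>rho (int (Suc (n - Suc k + j)))\<bar>)" by (intro sum_mono rho_sq_le_abs)
  also have "\<dots> \<le> sqrt_inc (n - Suc k) / 2" unfolding sum_abs_rho_Suc by (simp add: sqrt_inc_nonneg)
  also have "sum ?f ?C = (\<Sum>j<N. ?f (int (Suc (k + j))))"
    by (subst sum.reindex) (auto simp: inj_on_def simp del: of_nat_Suc)
  also have "\<dots> \<le> (\<Sum>j<N. \<bar>rho (int (Suc (k + j)))\<bar>)" by (intro sum_mono rho_sq_le_abs)
  also have "\<dots> \<le> sqrt_inc k / 2" unfolding sum_abs_rho_Suc by (simp add: sqrt_inc_nonneg)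
  finally show ?thesis by (simp add: algebra_simps add_divide_distrib)
qed

lemma rho_sq_summable: "(\<lambda>p. (rho p)\<^sup>2) summable_on UNIV"
proof (rule nonneg_bdd_above_summable_on)
  show "bdd_above (sum (\<lambda>p. (rho p)\<^sup>2) ` {F. F \<subseteq> UNIV \<and> finite F})"
    using sum_rho_sq_bound[of _ 0 1] by (intro bdd_aboveI2[where M="(\<Sum>l<1. (rho (int l - int 0))\<^sup>2) + (sqrt_inc 0 + sqrt_inc (1 - Suc 0)) / 2"]) auto
qed simp

lemma sum_rho_sq_row:
  assumes "k < n"
  shows "\<bar>(\<Sum>\<^sub>\<infinity>p\<in>UNIV. (rho p)\<^sup>2) - (\<Sum>l<n. (rho (int l - int k))\<^sup>2)\<bar> \<le> (sqrt_inc k + sqrt_inc (n - Suc k)) / 2"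
proof -
  have "(\<Sum>\<^sub>\<infinity>p\<in>UNIV. (rho p)\<^sup>2) \<le> (\<Sum>l<n. (rho (int l - int k))\<^sup>2) + (sqrt_inc k + sqrt_inc (n - Suc k)) / 2"
    by (intro infsum_le_finite_sums rho_sq_summable sum_rho_sq_bound assms)
  moreover have "(\<Sum>p\<in>(\<lambda>l. int l - int k) ` {..<n}. (rho p)\<^sup>2) \<le> (\<Sum>\<^sub>\<infinity>p\<in>UNIV. (rho p)\<^sup>2)"
    by (intro finite_sum_le_infsum rho_sq_summable) auto
  then have "(\<Sum>l<n. (rho (int l - int k))\<^sup>2) \<le> (\<Sum>\<^sub>\<infinity>p\<in>UNIV. (rho p)\<^sup>2)"
    by (subst (asm) sum.reindex) (auto simp: inj_on_def)
  ultimately show ?thesis by linarith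
qed

lemma C_quarter_sq: "C_quarter\<^sup>2 = 2 * (\<Sum>\<^sub>\<infinity>p\<in>UNIV. (rho p)\<^sup>2)"
proof -
  have "(\<Sum>\<^sub>\<infinity>p\<in>(UNIV :: int set). (sqrt \<bar>real_of_int p + 1\<bar> + sqrt \<bar>real_of_int p - 1\<bar> - 2 * sqrt \<bar>real_of_int p\<bar>)\<^sup>2)
     = (\<Sum>\<^sub>\<infinity>p\<in>UNIV. 4 * (rho p)\<^sup>2)"
    by (intro infsum_cong) (simp add: rho_def power_divide)
  also have "\<dots> = 4 * (\<Sum>\<^sub>\<infinity>p\<in>UNIV. (rho p)\<^sup>2)"
    by (rule infsum_cmult_right) (use rho_sq_summable in auto)
  finally show ?thesis
    unfolding C_quarter_def by (simp add: infsum_nonneg)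
qed

lemma C_quarter_nonneg: "0 \<le> C_quarter"
  unfolding C_quarter_def by (simp add: infsum_nonneg)

section \<open>Numerical value of the constant\<close>

lemma sqrt_approx: "a\<^sup>2 \<le> x \<Longrightarrow> x \<le> b\<^sup>2 \<Longrightarrow> 0 \<le> b \<Longrightarrow> a \<le> sqrt x \<and> sqrt x \<le> b"
  by (simp add: real_le_rsqrt real_le_lsqrt)

text \<open>With \<open>m = j + 2\<close>, rationalising twice turns the difference of increments
  into 2 over a product of three sums of square roots, hence at most
  \<open>1 / (4 * m * sqrt m)\<close>. Squaring gives \<open>1 / (16 * m ^ 3)\<close>, and replacing
  \<open>m ^ 3\<close> by the smaller \<open>(m - 1) * m * (m + 1)\<close> makes the bound
  telescope.\<close>

lemma rho_sq_decay: "4 * (rho (int (Suc (Suc (Suc j)))))\<^sup>2 \<le> 1/32 * (1 / ((real j + 1) * (real j + 2)) - 1 / ((real j + 2) * (real j + 3)))"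
proof -
  let ?m = "real j + 2"
  have pos: "sqrt ?m > 0" "0 \<le> sqrt (?m + 1)" "0 \<le> sqrt (?m + 2)" "sqrt ?m \<le> sqrt (?m + 1)" "sqrt ?m \<le> sqrt (?m + 2)" by auto
  have eq: "2 * rho (int (Suc (Suc (Suc j)))) = - (sqrt_inc (Suc (Suc j)) - sqrt_inc (Suc (Suc (Suc j))))"
    unfolding rho_Suc by simp
  have e: "sqrt_inc (Suc (Suc j)) - sqrt_inc (Suc (Suc (Suc j))) = 1 / (sqrt (?m + 1) + sqrt ?m) - 1 / (sqrt (?m + 2) + sqrt (?m + 1))"
    unfolding sqrt_inc_altdef by (simp add: add.commute add.left_commute)
  also have "\<dots> = (sqrt (?m + 2) - sqrt ?m) / ((sqrt (?m + 1) + sqrt ?m) * (sqrt (?m + 2) + sqrt (?m + 1)))"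
  proof -
    have "1 / (b + a) - 1 / (c + b) = (c - a) / ((b + a) * (c + b))" if "0 < a" "0 \<le> b" "0 \<le> c" "a \<le> b" for a b c :: real
      using that by (simp add: field_simps)
    then show ?thesis using pos by simp
  qed
  also have "sqrt (?m + 2) - sqrt ?m = 2 / (sqrt (?m + 2) + sqrt ?m)"
  proof -
    have "c - a = 2 / (c + a)" if "0 < a" "a \<le> c" "c\<^sup>2 = a\<^sup>2 + 2" for a c :: real
      using that by (simp add: field_simps power2_eq_square)
    then show ?thesis using pos by simp
  qed
  also have "2 / (sqrt (?m + 2) + sqrt ?m) / ((sqrt (?m + 1) + sqrt ?m) * (sqrt (?m + 2) + sqrt (?m + 1)))
     \<le> 2 / (2 * sqrt ?m) / ((2 * sqrt ?m) * (2 * sqrt ?m))"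
  proof -
    have "2 / (c + a) / ((b + a) * (c + b)) \<le> 2 / (2 * a) / ((2 * a) * (2 * a))" if "0 < a" "a \<le> b" "a \<le> c" for a b c :: real
      using that by (intro frac_le mult_mono) auto
    then show ?thesis using pos by blast
  qed
  also have "2 / (2 * sqrt ?m) / ((2 * sqrt ?m) * (2 * sqrt ?m)) = 1 / (4 * (sqrt ?m * sqrt ?m) * sqrt ?m)"
    using pos(1) by (simp add: divide_divide_eq_left mult.assoc mult.left_commute del: real_sqrt_mult_self real_sqrt_mult_self)
  finally have u: "sqrt_inc (Suc (Suc j)) - sqrt_inc (Suc (Suc (Suc j))) \<le> 1 / (4 * ?m * sqrt ?m)"
    by (simp only: real_sqrt_mult_self abs_of_nonneg)
  have "4 * (rho (int (Suc (Suc (Suc j)))))\<^sup>2 = (2 * rho (int (Suc (Suc (Suc j)))))\<^sup>2" by (simp add: power_mult_distrib)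
  also have "\<dots> = (sqrt_inc (Suc (Suc j)) - sqrt_inc (Suc (Suc (Suc j))))\<^sup>2" unfolding eq by (rule power2_minus)
  also have "\<dots> \<le> (1 / (4 * ?m * sqrt ?m))\<^sup>2"
    using sqrt_inc_antimono[of "Suc (Suc j)" "Suc (Suc (Suc j))"] u by (intro power_mono) auto
  also have "\<dots> = 1 / (16 * ?m ^ 3)"
    unfolding power_divide power_mult_distrib by (simp add: power2_eq_square power3_eq_cube)
  also have "\<dots> \<le> 1 / (16 * ((real j + 1) * ?m * (real j + 3)))"
    by (intro divide_left_mono mult_left_mono mult_pos_pos zero_less_power) (auto simp: power3_eq_cube algebra_simps)
  also have "\<dots> = 1/32 * (1 / ((real j + 1) * (real j + 2)) - 1 / ((real j + 2) * (real j + 3)))"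
  proof -
    have "1/32 * (1 / (a * b) - 1 / (b * c)) = 1 / (16 * (a * b * c))" if "a > 0" "b > 0" "c > 0" "c = a + 2" for a b c :: real
    proof -
      have "1 / (a * b) - 1 / (b * c) = (c - a) / (a * b * c)" using that(1-3) by (simp add: field_simps)
      then show ?thesis using that(4) by simp
    qed
    from this[of "real j + 1" "real j + 2" "real j + 3"] show ?thesis by simp
  qed
  finally show ?thesis .
qed

lemma sum_rho_sq_tail:
  "(\<Sum>j<m. 4 * (rho (int (Suc (7 + j))))\<^sup>2) \<le> 1 / 1344"
proof -
  have "(\<Sum>j<m. 4 * (rho (int (Suc (7 + j))))\<^sup>2) \<le>
     (\<Sum>j<m. 1/32 * (1 / ((real j + 6) * (real j + 7)) - 1 / ((real (Suc j) + 6) * (real (Suc j) + 7))))"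
  proof (rule sum_mono)
    fix j
    show "4 * (rho (int (Suc (7 + j))))\<^sup>2 \<le> 1/32 * (1 / ((real j + 6) * (real j + 7)) - 1 / ((real (Suc j) + 6) * (real (Suc j) + 7)))"
      \<comment> \<open>The tail starts at distance 8, that is, at index 5 of the decay bound; what
        survives the telescoping is \<open>1 / (6 * 7)\<close> times 1/32.\<close>
      using rho_sq_decay[of "5 + j"] by (simp add: eval_nat_numeral algebra_simps)
  qed
  also have "\<dots> = 1/32 * (1 / 42 - 1 / ((real m + 6) * (real m + 7)))"
    unfolding sum_distrib_left[symmetric]
    by (subst sum_lessThan_telescope') simp
  also have "\<dots> \<le> 1 / 1344" by simp
  finally show ?thesis .
qed

text \<open>Four times the sum of \<open>(rho p)\<^sup>2\<close> over distances up to 7, estimated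
  through rational enclosures of the square roots. The two bounds come from the target:
  \<open>2 * 1.5345\<^sup>2 = 4.7093805\<close> has to lie below the first, and
  \<open>2 * 1.5355\<^sup>2 = 4.7155205\<close> above the second plus the tail
  \<open>2 / 1344\<close>. With six terms the tail bound \<open>2 / 960\<close> would be too
  large.\<close>

lemma rho_sq_numeric:
  "(470939/100000) \<le> 4 + 2 * (\<Sum>j<7. 4 * (rho (int (Suc j)))\<^sup>2)"
  "4 + 2 * (\<Sum>j<7. 4 * (rho (int (Suc j)))\<^sup>2) \<le> (471402/100000)"
proof -
  have s2: "(14142135/10000000) \<le> sqrt 2 \<and> sqrt 2 \<le> (14142136/10000000)"
    by (rule sqrt_approx) (simp_all add: power2_eq_square)
  have s3: "(17320508/10000000) \<le> sqrt 3 \<and> sqrt 3 \<le> (17320509/10000000)"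
    by (rule sqrt_approx) (simp_all add: power2_eq_square)
  have s5: "(22360679/10000000) \<le> sqrt 5 \<and> sqrt 5 \<le> (2236068/1000000)"
    by (rule sqrt_approx) (simp_all add: power2_eq_square)
  have s6: "(24494897/10000000) \<le> sqrt 6 \<and> sqrt 6 \<le> (24494898/10000000)"
    by (rule sqrt_approx) (simp_all add: power2_eq_square)
  have s7: "(26457513/10000000) \<le> sqrt 7 \<and> sqrt 7 \<le> (26457514/10000000)"
    by (rule sqrt_approx) (simp_all add: power2_eq_square)
  have s8: "(28284271/10000000) \<le> sqrt 8 \<and> sqrt 8 \<le> (28284272/10000000)"
    by (rule sqrt_approx) (simp_all add: power2_eq_square)
  have s4: "sqrt 4 = 2" by (rule real_sqrt_unique) auto
  \<comment> \<open>The second differences are negative, so their squares are enclosed through their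
    negatives.\<close>
  have sq: "a\<^sup>2 \<le> x\<^sup>2 \<and> x\<^sup>2 \<le> b\<^sup>2" if "a \<le> - x" "- x \<le> b" "0 \<le> a" for a b x :: real
    using power_mono[of a "-x" 2] power_mono[of "-x" b 2] that by simp
  have r: "4 * (rho (int (Suc j)))\<^sup>2 = (sqrt (real j + 2) + sqrt (real j) - 2 * sqrt (real j + 1))\<^sup>2" for j
    by (simp add: rho_def power_divide add.commute)
  have e: "(\<Sum>j<7. 4 * (rho (int (Suc j)))\<^sup>2) =
     (sqrt 2 - 2)\<^sup>2 + (sqrt 3 + 1 - 2 * sqrt 2)\<^sup>2 + (sqrt 4 + sqrt 2 - 2 * sqrt 3)\<^sup>2 + (sqrt 5 + sqrt 3 - 2 * sqrt 4)\<^sup>2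
     + (sqrt 6 + sqrt 4 - 2 * sqrt 5)\<^sup>2 + (sqrt 7 + sqrt 5 - 2 * sqrt 6)\<^sup>2 + (sqrt 8 + sqrt 6 - 2 * sqrt 7)\<^sup>2"
    unfolding r by (simp add: eval_nat_numeral)
  have c: "(585786/1000000)\<^sup>2 \<le> (sqrt 2 - 2)\<^sup>2 \<and> (sqrt 2 - 2)\<^sup>2 \<le> (585787/1000000)\<^sup>2"
     "(96375/1000000)\<^sup>2 \<le> (sqrt 3 + 1 - 2 * sqrt 2)\<^sup>2 \<and> (sqrt 3 + 1 - 2 * sqrt 2)\<^sup>2 \<le> (96377/1000000)\<^sup>2"
     "(49887/1000000)\<^sup>2 \<le> (sqrt 4 + sqrt 2 - 2 * sqrt 3)\<^sup>2 \<and> (sqrt 4 + sqrt 2 - 2 * sqrt 3)\<^sup>2 \<le> (49889/1000000)\<^sup>2"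
     "(31880/1000000)\<^sup>2 \<le> (sqrt 5 + sqrt 3 - 2 * sqrt 4)\<^sup>2 \<and> (sqrt 5 + sqrt 3 - 2 * sqrt 4)\<^sup>2 \<le> (31882/1000000)\<^sup>2"
     "(22645/1000000)\<^sup>2 \<le> (sqrt 6 + sqrt 4 - 2 * sqrt 5)\<^sup>2 \<and> (sqrt 6 + sqrt 4 - 2 * sqrt 5)\<^sup>2 \<le> (22648/1000000)\<^sup>2"
     "(17157/1000000)\<^sup>2 \<le> (sqrt 7 + sqrt 5 - 2 * sqrt 6)\<^sup>2 \<and> (sqrt 7 + sqrt 5 - 2 * sqrt 6)\<^sup>2 \<le> (17162/1000000)\<^sup>2"
     "(13584/1000000)\<^sup>2 \<le> (sqrt 8 + sqrt 6 - 2 * sqrt 7)\<^sup>2 \<and> (sqrt 8 + sqrt 6 - 2 * sqrt 7)\<^sup>2 \<le> (13589/1000000)\<^sup>2"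
    subgoal using s2 by (intro sq; linarith)
    subgoal using s2 s3 by (intro sq; linarith)
    subgoal using s2 s3 s4 by (intro sq; linarith)
    subgoal using s3 s4 s5 by (intro sq; linarith)
    subgoal using s4 s5 s6 by (intro sq; linarith)
    subgoal using s5 s6 s7 by (intro sq; linarith)
    subgoal using s6 s7 s8 by (intro sq; linarith)
    done
  show "(470939/100000) \<le> 4 + 2 * (\<Sum>j<7. 4 * (rho (int (Suc j)))\<^sup>2)"
    unfolding e using c by (simp add: power2_eq_square)
  show "4 + 2 * (\<Sum>j<7. 4 * (rho (int (Suc j)))\<^sup>2) \<le> (471402/100000)"
    unfolding e using c by (simp add: power2_eq_square)
qed

lemma sqrt_inc_tendsto_0: "sqrt_inc \<longlonglongrightarrow> 0"
proof (rule Lim_null_comparison)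
  show "\<forall>\<^sub>F k in sequentially. norm (sqrt_inc k) \<le> 1 / sqrt (real k + 1)"
    using sqrt_inc_le by (intro always_eventually) (auto simp: sqrt_inc_nonneg)
  show "(\<lambda>k. 1 / sqrt (real k + 1)) \<longlonglongrightarrow> 0"
    by real_asymp
qed

lemma C_quarter_approx: "\<bar>C_quarter - 1.535\<bar> < 0.0005"
proof -
  let ?D = "\<Sum>\<^sub>\<infinity>p\<in>UNIV. (rho p)\<^sup>2"
  have fin: "4 * (\<Sum>l<2 * k + 1. (rho (int l - int k))\<^sup>2) = 4 + 2 * (\<Sum>j<k. 4 * (rho (int (Suc j)))\<^sup>2)" for k
    by (subst sum_shift_int) (auto simp: sum_distrib_left rho_minus simp del: of_nat_Suc)
  have lower: "(470939/100000) \<le> 4 * ?D"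
  proof -
    have "(\<Sum>p\<in>(\<lambda>l. int l - int 7) ` {..<15}. (rho p)\<^sup>2) \<le> ?D"
      by (intro finite_sum_le_infsum rho_sq_summable) auto
    then have "4 * (\<Sum>l<15. (rho (int l - int 7))\<^sup>2) \<le> 4 * ?D"
      by (subst (asm) sum.reindex) (auto simp: inj_on_def)
    then show ?thesis using fin[of 7] rho_sq_numeric(1) by simp
  qed
  have up: "4 + 2 * (\<Sum>j<7 + m. 4 * (rho (int (Suc j)))\<^sup>2) \<le> (471402/100000) + 2 / 1344" for m
  proof -
    have "(\<Sum>j<7 + m. 4 * (rho (int (Suc j)))\<^sup>2) = (\<Sum>j<7. 4 * (rho (int (Suc j)))\<^sup>2) + (\<Sum>j<m. 4 * (rho (int (Suc (7 + j))))\<^sup>2)"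
      by (induction m) (simp_all only: sum.lessThan_Suc add_Suc_right add_0_right lessThan_0 sum.empty add.assoc)
    then show ?thesis using rho_sq_numeric(2) sum_rho_sq_tail[of m] by linarith
  qed
  have upper: "4 * ?D \<le> (471402/100000) + 2 / 1344"
  proof -
    \<comment> \<open>The full series is reached along symmetric windows, that is, rows of length
      \<open>2 * k + 1\<close> seen from their middle; starting at radius 7 lets \<open>up\<close>
      apply to every member of the sequence.\<close>
    have "(\<lambda>k. 4 * (\<Sum>l<2 * (7 + k) + 1. (rho (int l - int (7 + k)))\<^sup>2) + 4 * sqrt_inc (7 + k)) \<longlonglongrightarrow> 4 * ?D + 4 * 0"
    proof (intro tendsto_intros)
      have lim: "(\<lambda>k. sqrt_inc (7 + k)) \<longlonglongrightarrow> 0"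
        using LIMSEQ_ignore_initial_segment[OF sqrt_inc_tendsto_0, of 7] by (simp add: add.commute)
      then show "(\<lambda>k. sqrt_inc (7 + k)) \<longlonglongrightarrow> 0" .
      show "(\<lambda>k. \<Sum>l<2 * (7 + k) + 1. (rho (int l - int (7 + k)))\<^sup>2) \<longlonglongrightarrow> ?D"
      proof (rule LIM_zero_cancel, rule Lim_null_comparison[OF _ lim], intro always_eventually allI)
        fix k
        show "norm ((\<Sum>l<2 * (7 + k) + 1. (rho (int l - int (7 + k)))\<^sup>2) - ?D) \<le> sqrt_inc (7 + k)"
          using sum_rho_sq_row[of "7 + k" "2 * (7 + k) + 1"] by (simp add: abs_minus_commute add.commute)
      qed
    qed
    moreover have "(\<lambda>k. (471402/100000) + 2 / 1344 + 4 * sqrt_inc (7 + k)) \<longlonglongrightarrow> (471402/100000) + 2 / 1344 + 4 * 0"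
      using LIMSEQ_ignore_initial_segment[OF sqrt_inc_tendsto_0, of 7]
      by (intro tendsto_intros) (simp add: add.commute)
    ultimately have "4 * ?D + 4 * 0 \<le> (471402/100000) + 2 / 1344 + 4 * 0"
      by (rule LIMSEQ_le) (intro exI allI impI add_right_mono, unfold fin, rule up)
    then show ?thesis by simp
  qed
  have sq: "C_quarter\<^sup>2 = 2 * ?D" by (rule C_quarter_sq)
  have "(15345/10000) < C_quarter"
    by (rule power_less_imp_less_base[of _ 2]) (use lower sq C_quarter_nonneg in \<open>simp_all add: power2_eq_square\<close>)
  moreover have "C_quarter < (15355/10000)"
    by (rule power_less_imp_less_base[of _ 2]) (use upper sq C_quarter_nonneg in \<open>simp_all add: power2_eq_square\<close>)
  ultimately show ?thesis unfolding abs_less_iff by simp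
qed

section \<open>Gaussian vectors\<close>

interpretation std_normal: real_distribution std_normal_distribution
  by (rule real_dist_normal_dist)

lemma integrable_std_normal_poly:
  "integrable std_normal_distribution (\<lambda>x. (1 + \<bar>x\<bar>) ^ N)"
proof -
  have i: "integrable std_normal_distribution (\<lambda>x. \<bar>x\<bar> ^ k)" for k
    by (auto simp: normal_density_nonneg integrable_std_normal_moment_abs integrable_density)
  show ?thesis
    unfolding binomial_ring by (simp add: i)
qed

text \<open>The characteristic function in real form. A cosine with free phase encodes real and
  imaginary part at once, so the uniqueness arguments below work with real integrands.\<close>

lemma integral_std_normal_cos:
  "(LINT x|std_normal_distribution. cos (a + s * x)) = cos a * exp (- s\<^sup>2 / 2)"
proof -
  have i: "integrable std_normal_distribution (\<lambda>x. iexp (s * x))"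
    by (rule std_normal.integrable_iexp) auto
  have c: "(LINT x|std_normal_distribution. iexp (s * x)) = complex_of_real (exp (- s\<^sup>2 / 2))"
    using fun_cong[OF char_std_normal_distribution, of s] by (simp add: char_def)
  have "(LINT x|std_normal_distribution. iexp a * iexp (s * x)) = iexp a * complex_of_real (exp (- s\<^sup>2 / 2))"
    using c by simp
  then have "Re (LINT x|std_normal_distribution. iexp a * iexp (s * x)) = Re (iexp a * complex_of_real (exp (- s\<^sup>2 / 2)))"
    by simp
  moreover have "Re (LINT x|std_normal_distribution. iexp a * iexp (s * x))
     = (LINT x|std_normal_distribution. Re (iexp a * iexp (s * x)))"
    by (rule integral_Re[symmetric]) (use i in simp)
  moreover have "Re (iexp a * iexp (s * x)) = cos (a + s * x)" for x
    by (simp flip: exp_add add: Re_exp distrib_left[symmetric] of_real_add[symmetric] of_real_mult[symmetric] del: of_real_add of_real_mult)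
  ultimately show ?thesis by (simp add: Re_exp)
qed

text \<open>Covers the point mass and the density case alike, so that moments and characteristic
  functions need to be computed for the standard normal law only.\<close>

lemma gaussian_law_conv_std:
  assumes "0 \<le> \<sigma>"
  shows "gaussian_law \<mu> \<sigma> = distr std_normal_distribution borel (\<lambda>x. \<mu> + \<sigma> * x)"
proof (cases "\<sigma> = 0")
  case True
  then show ?thesis
    by (simp add: gaussian_law_def std_normal.distr_const)
next
  case False
  then have \<sigma>: "\<sigma> > 0" using assms by simp
  have "distributed std_normal_distribution lborel (\<lambda>x. x) (normal_density 0 1)"
    unfolding distributed_def
    by (auto simp: distr_id2)
  from std_normal.normal_density_affine[OF this, of \<sigma> \<mu>] \<sigma>
  have "distributed std_normal_distribution lborel (\<lambda>x. \<mu> + \<sigma> * x) (normal_density \<mu> \<sigma>)"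
    by simp
  then have "distr std_normal_distribution lborel (\<lambda>x. \<mu> + \<sigma> * x) = density lborel (normal_density \<mu> \<sigma>)"
    by (simp add: distributed_def)
  moreover have "distr std_normal_distribution lborel (\<lambda>x. \<mu> + \<sigma> * x) = distr std_normal_distribution borel (\<lambda>x. \<mu> + \<sigma> * x)"
    by (rule distr_cong) auto
  ultimately show ?thesis using \<sigma> by (simp add: gaussian_law_def)
qed

lemma std_normal_moments:
  "(LINT x|std_normal_distribution. x) = 0" "(LINT x|std_normal_distribution. x\<^sup>2) = 1"
  "(LINT x|std_normal_distribution. x^4) = 3"
  using integral_std_normal_distribution_moment_odd[of 1] std_normal_distribution_even_moments(1)[of 1]
    std_normal_distribution_even_moments(1)[of 2]
  by (auto simp: fact_numeral eval_nat_numeral)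

lemma centered_gaussian_facts:
  fixes Z :: "'a \<Rightarrow> real"
  assumes "prob_space M" and Z[measurable]: "Z \<in> borel_measurable M"
    and d: "distr M borel Z = gaussian_law \<mu> \<sigma>" and "0 \<le> \<sigma>" and "integral\<^sup>L M Z = 0"
  shows "integrable M (\<lambda>\<omega>. (1 + \<bar>Z \<omega>\<bar>) ^ N)"
    and "(\<integral>\<omega>. (Z \<omega>)^4 \<partial>M) = 3 * ((\<integral>\<omega>. (Z \<omega>)\<^sup>2 \<partial>M))\<^sup>2"
    and "(\<integral>\<omega>. cos (Z \<omega> + \<gamma>) \<partial>M) = cos \<gamma> * exp (- (\<integral>\<omega>. (Z \<omega>)\<^sup>2 \<partial>M) / 2)"
proof -
  note law = gaussian_law_conv_std[OF assms(4), of \<mu>]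
  have tr: "(\<integral>\<omega>. g (Z \<omega>) \<partial>M) = (LINT x|std_normal_distribution. g (\<mu> + \<sigma> * x))"
    if [measurable]: "g \<in> borel_measurable borel" for g :: "real \<Rightarrow> real"
    using integral_distr[of Z M borel g] integral_distr[of "\<lambda>x. \<mu> + \<sigma> * x" std_normal_distribution borel g]
    by (simp add: d law)
  have tri: "integrable M (\<lambda>\<omega>. g (Z \<omega>)) \<longleftrightarrow> integrable std_normal_distribution (\<lambda>x. g (\<mu> + \<sigma> * x))"
    if [measurable]: "g \<in> borel_measurable borel" for g :: "real \<Rightarrow> real"
    using integrable_distr_eq[of Z M borel g] integrable_distr_eq[of "\<lambda>x. \<mu> + \<sigma> * x" std_normal_distribution borel g]
    by (simp add: d law)
  have i1: "integrable std_normal_distribution (\<lambda>x. x)"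
    using integrable_std_normal_distribution_moment[of 1] by simp
  have \<mu>: "\<mu> = 0"
  proof -
    have "0 = (LINT x|std_normal_distribution. \<mu> + \<sigma> * x)"
      using tr[OF measurable_ident, unfolded id_apply] unfolding assms(5) .
    also have "\<dots> = \<mu> + \<sigma> * (LINT x|std_normal_distribution. x)"
      using Bochner_Integration.integral_add[OF std_normal.integrable_const integrable_mult_right[OF i1], of \<mu> \<sigma>]
      by (simp only: integral_mult_right_zero lebesgue_integral_const std_normal.prob_space scaleR_one)
    finally show ?thesis unfolding std_normal_moments(1) by simp
  qed
  have v: "(\<integral>\<omega>. (Z \<omega>)\<^sup>2 \<partial>M) = \<sigma>\<^sup>2"
    using tr[of "\<lambda>x. x\<^sup>2"] std_normal_moments(2) by (simp add: power_mult_distrib \<mu>)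
  have "integrable std_normal_distribution (\<lambda>x. (1 + \<bar>\<sigma> * x\<bar>) ^ N)"
  proof (rule Bochner_Integration.integrable_bound)
    show "integrable std_normal_distribution (\<lambda>x. (1 + \<sigma>) ^ N * (1 + \<bar>x\<bar>) ^ N)"
      using integrable_std_normal_poly by simp
    show "AE x in std_normal_distribution. norm ((1 + \<bar>\<sigma> * x\<bar>) ^ N) \<le> norm ((1 + \<sigma>) ^ N * (1 + \<bar>x\<bar>) ^ N)"
    proof (intro AE_I2)
      fix x :: real
      have "1 + \<bar>\<sigma> * x\<bar> \<le> (1 + \<sigma>) * (1 + \<bar>x\<bar>)"
        using assms(4) by (simp add: abs_mult distrib_left distrib_right)
      then have "(1 + \<bar>\<sigma> * x\<bar>) ^ N \<le> ((1 + \<sigma>) * (1 + \<bar>x\<bar>)) ^ N"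
        by (intro power_mono) auto
      then show "norm ((1 + \<bar>\<sigma> * x\<bar>) ^ N) \<le> norm ((1 + \<sigma>) ^ N * (1 + \<bar>x\<bar>) ^ N)"
        using assms(4) by (simp only: power_mult_distrib) simp
    qed
  qed simp
  then show "integrable M (\<lambda>\<omega>. (1 + \<bar>Z \<omega>\<bar>) ^ N)"
    using tri[of "\<lambda>x. (1 + \<bar>x\<bar>) ^ N"] by (simp add: \<mu>)
  show "(\<integral>\<omega>. (Z \<omega>)^4 \<partial>M) = 3 * ((\<integral>\<omega>. (Z \<omega>)\<^sup>2 \<partial>M))\<^sup>2"
    unfolding v using tr[of "\<lambda>x. x^4"] std_normal_moments(3) by (simp add: power_mult_distrib \<mu>)
  show "(\<integral>\<omega>. cos (Z \<omega> + \<gamma>) \<partial>M) = cos \<gamma> * exp (- (\<integral>\<omega>. (Z \<omega>)\<^sup>2 \<partial>M) / 2)"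
    unfolding v using tr[of "\<lambda>x. cos (x + \<gamma>)"] integral_std_normal_cos[of \<gamma> \<sigma>] by (simp add: \<mu> add.commute)
qed

text \<open>\<open>x\<^sup>2 - 1\<close> is the second Hermite polynomial: the second derivative of
  the Gaussian density \<open>p\<close> is \<open>(x\<^sup>2 - 1) * p\<close>. Polynomial growth
  kills the boundary terms.\<close>

lemma std_normal_second_ibp:
  fixes h h1 h2 :: "real \<Rightarrow> complex"
  assumes h: "\<And>x. (h has_vector_derivative h1 x) (at x)"
    and h1: "\<And>x. (h1 has_vector_derivative h2 x) (at x)"
    and h2: "continuous_on UNIV h2"
    and bd: "\<And>x. norm (h x) \<le> K * (1 + \<bar>x\<bar>) ^ N" "\<And>x. norm (h1 x) \<le> K * (1 + \<bar>x\<bar>) ^ N"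
      "\<And>x. norm (h2 x) \<le> K * (1 + \<bar>x\<bar>) ^ N"
  shows "(LINT x|std_normal_distribution. of_real (x\<^sup>2 - 1) * h x) = (LINT x|std_normal_distribution. h2 x)"
proof -
  let ?p = "std_normal_density"
  have ch: "continuous_on UNIV h" "continuous_on UNIV h1"
    using h h1 by (auto intro!: continuous_at_imp_continuous_on has_vector_derivative_continuous)
  have [measurable]: "h \<in> borel_measurable borel" "h1 \<in> borel_measurable borel" "h2 \<in> borel_measurable borel"
    using ch h2 by (auto intro!: borel_measurable_continuous_onI)
  have K: "0 \<le> K" using order_trans[OF norm_ge_zero bd(1)[of 0]] by simp
  have pd: "(?p has_real_derivative - x * ?p x) (at x)" for x
    unfolding std_normal_density_def by (auto intro!: derivative_eq_intros simp: field_simps power2_eq_square)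
  \<comment> \<open>A primitive that carries out both integrations by parts in one step.\<close>
  let ?F = "\<lambda>x. - (of_real (x * ?p x) * h x + of_real (?p x) * h1 x)"
  let ?f = "\<lambda>x. of_real (?p x) * (of_real (x\<^sup>2 - 1) * h x - h2 x)"
  have F: "(?F has_vector_derivative ?f x) (at x)" for x
  proof -
    have d1: "((\<lambda>x. complex_of_real (x * ?p x)) has_vector_derivative of_real (?p x + x * (- x * ?p x))) (at x)"
      by (rule has_vector_derivative_of_real) (auto intro!: derivative_eq_intros pd)
    have d2: "((\<lambda>x. complex_of_real (?p x)) has_vector_derivative of_real (- x * ?p x)) (at x)"
      by (rule has_vector_derivative_of_real) (rule pd)
    show ?thesis
      by (rule has_vector_derivative_eq_rhs[OF has_vector_derivative_minus[OF has_vector_derivative_add[OF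
            has_vector_derivative_mult[OF d1 h] has_vector_derivative_mult[OF d2 h1]]]])
         (simp add: algebra_simps power2_eq_square)
  qed
  have int: "integrable std_normal_distribution g" if [measurable]: "g \<in> borel_measurable borel"
     and "\<And>x. norm (g x) \<le> L * (1 + \<bar>x\<bar>) ^ m" for g :: "real \<Rightarrow> complex" and L m
  proof (rule Bochner_Integration.integrable_bound)
    show "integrable std_normal_distribution (\<lambda>x. L * (1 + \<bar>x\<bar>) ^ m)" using integrable_std_normal_poly by simp
    show "AE x in std_normal_distribution. norm (g x) \<le> norm (L * (1 + \<bar>x\<bar>) ^ m)"
      using that(2) by (intro AE_I2) (smt (verit) real_norm_def)
  qed simp
  have i1: "integrable std_normal_distribution (\<lambda>x. of_real (x\<^sup>2 - 1) * h x)"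
  proof (rule int[of _ K "N + 2"])
    fix x :: real
    have "\<bar>x\<^sup>2 - 1\<bar> \<le> \<bar>x\<bar>\<^sup>2 + 1"
      unfolding power2_abs using zero_le_power2[of x] by linarith
    also have "\<dots> \<le> (1 + \<bar>x\<bar>)\<^sup>2" unfolding power2_sum by simp
    finally have "norm (complex_of_real (x\<^sup>2 - 1)) * norm (h x) \<le> (1 + \<bar>x\<bar>)\<^sup>2 * (K * (1 + \<bar>x\<bar>) ^ N)"
      unfolding norm_of_real by (intro mult_mono bd) auto
    also have "\<dots> = K * (1 + \<bar>x\<bar>) ^ (N + 2)" by (subst power_add) (rule mult.left_commute[THEN trans], rule arg_cong[where f="times K"], rule mult.commute)
    finally show "norm (of_real (x\<^sup>2 - 1) * h x) \<le> K * (1 + \<bar>x\<bar>) ^ (N + 2)"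
      unfolding norm_mult .
  qed measurable
  have i2: "integrable std_normal_distribution h2" by (rule int[OF _ bd(3)]) measurable
  have i3: "integrable std_normal_distribution (\<lambda>x. of_real (x\<^sup>2 - 1) * h x - h2 x)"
    by (intro Bochner_Integration.integrable_diff i1 i2)
  have m: "(\<lambda>x. of_real (x\<^sup>2 - 1) * h x - h2 x) \<in> borel_measurable lborel" by measurable
  have dm: "?p \<in> borel_measurable lborel" by simp
  have nn: "AE x in lborel. 0 \<le> ?p x" by (simp add: normal_density_nonneg)
  have fe: "?f = (\<lambda>x. ?p x *\<^sub>R (of_real (x\<^sup>2 - 1) * h x - h2 x))"
    by (rule ext) (rule scaleR_conv_of_real[symmetric])
  have i4: "integrable lborel ?f"
    unfolding fe by (rule iffD1[OF integrable_density[OF m dm nn] i3])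
  \<comment> \<open>From 4 on, \<open>x\<^sup>2 / 2\<close> exceeds \<open>1 + x\<close>, which
    reduces the limit to a power divided by an exponential.\<close>
  have lim0: "((\<lambda>x. ?p x * (1 + \<bar>x\<bar>) ^ m) \<longlongrightarrow> 0) at_top" for m
  proof (rule Lim_null_comparison)
    show "((\<lambda>x::real. (1 + x) ^ m / exp (1 + x)) \<longlongrightarrow> 0) at_top"
      using filterlim_compose[OF tendsto_power_div_exp_0[of m] filterlim_tendsto_add_at_top[OF tendsto_const[of "1::real"] filterlim_ident]]
      by simp
    show "\<forall>\<^sub>F x in at_top. norm (?p x * (1 + \<bar>x\<bar>) ^ m) \<le> (1 + x) ^ m / exp (1 + x)"
      using eventually_ge_at_top[of 4]
    proof eventually_elim
      case (elim x)
      have x4: "4 * x \<le> x * x" using elim by (intro mult_right_mono) auto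
      have "1 \<le> sqrt (2 * pi)" using pi_gt3 by (simp add: real_le_rsqrt)
      then have "?p x \<le> exp (- x\<^sup>2 / 2)"
        unfolding std_normal_density_def by (intro mult_left_le_one_le) auto
      also have "exp (- x\<^sup>2 / 2) \<le> exp (- (1 + x))" 
      proof -
        have "2 + x * 2 \<le> x * x" using x4 elim by linarith
        then show ?thesis by (simp add: power2_eq_square field_simps)
      qed
      finally have "?p x * (1 + x) ^ m \<le> exp (- (1 + x)) * (1 + x) ^ m"
        using elim by (intro mult_right_mono) auto
      moreover have "norm (?p x * (1 + \<bar>x\<bar>) ^ m) = ?p x * (1 + x) ^ m"
        using elim by (simp add: abs_mult normal_density_nonneg)
      moreover have "exp (- (1 + x)) * (1 + x) ^ m = (1 + x) ^ m / exp (1 + x)"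
        by (simp only: exp_minus field_class.field_divide_inverse mult.commute)
      ultimately show ?case by linarith
    qed
  qed
  have lim0': "((\<lambda>x. ?p x * (1 + \<bar>x\<bar>) ^ m) \<longlongrightarrow> 0) at_bot" for m
    using filterlim_compose[OF lim0[of m] filterlim_uminus_at_top_at_bot] by (simp add: std_normal_density_def)
  have Fb: "norm (?F x) \<le> 2 * K * (?p x * (1 + \<bar>x\<bar>) ^ (N + 1))" for x
  proof -
    have p0: "0 \<le> ?p x" by simp
    have "norm (?F x) \<le> norm (of_real (x * ?p x) * h x) + norm (of_real (?p x) * h1 x)"
      unfolding norm_minus_cancel by (rule norm_triangle_ineq)
    also have "\<dots> = \<bar>x\<bar> * ?p x * norm (h x) + ?p x * norm (h1 x)"
      unfolding norm_mult norm_of_real abs_mult abs_of_nonneg[OF p0] ..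
    also have "\<dots> \<le> (1 + \<bar>x\<bar>) * ?p x * (K * (1 + \<bar>x\<bar>) ^ N) + (1 + \<bar>x\<bar>) * ?p x * (K * (1 + \<bar>x\<bar>) ^ N)"
    proof (intro add_mono mult_mono bd)
      show "?p x \<le> (1 + \<bar>x\<bar>) * ?p x" using mult_right_mono[of 1 "1 + \<bar>x\<bar>" "?p x"] p0 by simp
    qed (use p0 in auto)
    also have "\<dots> = 2 * K * (?p x * ((1 + \<bar>x\<bar>) * (1 + \<bar>x\<bar>) ^ N))" by (simp add: mult_ac)
    finally show ?thesis by simp
  qed
  have l1: "(?F \<longlongrightarrow> 0) at_top"
    by (rule Lim_null_comparison[OF always_eventually tendsto_mult_right_zero[OF lim0]]) (rule allI, rule Fb)
  have l2: "(?F \<longlongrightarrow> 0) at_bot"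
    by (rule Lim_null_comparison[OF always_eventually tendsto_mult_right_zero[OF lim0']]) (rule allI, rule Fb)
  have ic: "isCont h x" "isCont h1 x" "isCont h2 x" "isCont ?p x" for x
    using ch h2 by (simp_all add: continuous_on_eq_continuous_at DERIV_isCont[OF pd])
  have cont: "isCont ?f x" for x
    by (intro continuous_intros ic)
  have "(LBINT x=-\<infinity>..\<infinity>. ?f x) = 0 - 0"
  proof (rule interval_integral_FTC_integrable[where F="?F"])
    show "set_integrable lborel (einterval (- \<infinity>) \<infinity>) ?f" using i4 by (simp add: set_integrable_def)
    show "((?F \<circ> real_of_ereal) \<longlongrightarrow> 0) (at_right (- \<infinity>))" unfolding ereal_tendsto_simps by (rule l2)
    show "((?F \<circ> real_of_ereal) \<longlongrightarrow> 0) (at_left \<infinity>)" unfolding ereal_tendsto_simps by (rule l1)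
  qed (rule F cont | simp)+
  then have "integral\<^sup>L lborel ?f = 0"
    by (simp add: interval_lebesgue_integral_def set_lebesgue_integral_def)
  then have "(LINT x|std_normal_distribution. of_real (x\<^sup>2 - 1) * h x - h2 x) = 0"
    using integral_density[OF m dm nn] unfolding fe by simp
  then show ?thesis unfolding Bochner_Integration.integral_diff[OF i1 i2] by simp
qed

section \<open>Joint laws determined by characteristic functions\<close>

text \<open>Normalising the weight \<open>v\<close> turns a weighted integral into an integral
  against a probability law, so that Levy's uniqueness theorem can be applied to it. The phases
  \<open>0\<close> and \<open>- pi / 2\<close> pick out the cosine and the sine.\<close>

lemma weighted_law:
  fixes v Z :: "'a \<Rightarrow> real"
  assumes P: "prob_space P" and [measurable]: "v \<in> borel_measurable P" "Z \<in> borel_measurable P"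
    and v: "\<And>\<omega>. 0 \<le> v \<omega>" "\<And>\<omega>. v \<omega> \<le> K" and iv: "integral\<^sup>L P v = m" and m: "0 < m"
    and A[measurable]: "A \<in> sets borel"
  defines "D \<equiv> distr (density P (\<lambda>\<omega>. ennreal (v \<omega> / m))) borel Z"
  shows "real_distribution D \<and>
    (\<forall>t. char D t = Complex ((\<integral>\<omega>. v \<omega> * cos (t * Z \<omega> + 0) \<partial>P) / m) ((\<integral>\<omega>. v \<omega> * cos (t * Z \<omega> + (- pi / 2)) \<partial>P) / m)) \<and>
    measure D A = (\<integral>\<omega>. v \<omega> * indicator A (Z \<omega>) \<partial>P) / m"
proof -
  interpret P: prob_space P by fact
  let ?Q = "density P (\<lambda>\<omega>. ennreal (v \<omega> / m))"
  have iP: "integrable P v" using v by (auto intro!: P.integrable_const_bound[of _ K])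
  have "prob_space ?Q"
  proof
    have "emeasure ?Q (space ?Q) = (\<integral>\<^sup>+\<omega>. ennreal (v \<omega> / m) \<partial>P)"
      by (simp add: emeasure_density)
    also have "\<dots> = ennreal (\<integral>\<omega>. v \<omega> / m \<partial>P)"
      by (rule nn_integral_eq_integral) (use iP v m in auto)
    also have "\<dots> = 1" using iv m by simp
    finally show "emeasure ?Q (space ?Q) = 1" .
  qed
  then interpret Q: prob_space ?Q .
  interpret D: real_distribution "distr ?Q borel Z"
    by (rule Q.real_distribution_distr) simp
  have tr: "(\<integral>x. g x \<partial>distr ?Q borel Z) = (\<integral>\<omega>. v \<omega> * g (Z \<omega>) \<partial>P) / m"
    if [measurable]: "g \<in> borel_measurable borel" for g :: "real \<Rightarrow> real"
  proof -
    have "(\<integral>x. g x \<partial>distr ?Q borel Z) = (\<integral>\<omega>. (v \<omega> / m) *\<^sub>R g (Z \<omega>) \<partial>P)"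
      by (subst integral_distr, simp, simp, subst integral_density) (use v m in auto)
    also have "\<dots> = (\<integral>\<omega>. v \<omega> * g (Z \<omega>) / m \<partial>P)"
      by (intro Bochner_Integration.integral_cong) auto
    finally show ?thesis by simp
  qed
  have ce: "char (distr ?Q borel Z) t =
     Complex ((\<integral>\<omega>. v \<omega> * cos (t * Z \<omega> + 0) \<partial>P) / m) ((\<integral>\<omega>. v \<omega> * cos (t * Z \<omega> + (- pi / 2)) \<partial>P) / m)" for t
  proof (rule complex_eqI)
    have i: "integrable (distr ?Q borel Z) (\<lambda>x. iexp (t * x))"
      by (rule D.integrable_iexp) auto
    have "Re (char (distr ?Q borel Z) t) = (\<integral>x. Re (iexp (t * x)) \<partial>distr ?Q borel Z)"
      unfolding char_def by (rule integral_Re[OF i, symmetric])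
    also have "\<dots> = (\<integral>x. cos (t * x) \<partial>distr ?Q borel Z)" by (simp add: Re_exp)
    finally show "Re (char (distr ?Q borel Z) t) = Re (Complex ((\<integral>\<omega>. v \<omega> * cos (t * Z \<omega> + 0) \<partial>P) / m) ((\<integral>\<omega>. v \<omega> * cos (t * Z \<omega> + (- pi / 2)) \<partial>P) / m))"
      using tr[of "\<lambda>x. cos (t * x)"] by simp
    have "Im (char (distr ?Q borel Z) t) = (\<integral>x. Im (iexp (t * x)) \<partial>distr ?Q borel Z)"
      unfolding char_def by (rule integral_Im[OF i, symmetric])
    also have "\<dots> = (\<integral>x. sin (t * x) \<partial>distr ?Q borel Z)" by (simp add: Im_exp)
    finally show "Im (char (distr ?Q borel Z) t) = Im (Complex ((\<integral>\<omega>. v \<omega> * cos (t * Z \<omega> + 0) \<partial>P) / m) ((\<integral>\<omega>. v \<omega> * cos (t * Z \<omega> + (- pi / 2)) \<partial>P) / m))"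
      using tr[of "\<lambda>x. sin (t * x)"] by (simp add: cos_add sin_diff cos_diff)
  qed
  have "measure (distr ?Q borel Z) A = (\<integral>x. indicator A x \<partial>distr ?Q borel Z)" by simp
  also have "\<dots> = (\<integral>\<omega>. v \<omega> * indicator A (Z \<omega>) \<partial>P) / m" by (rule tr) simp
  finally show ?thesis unfolding D_def using ce D.real_distribution_axioms by blast
qed

lemma weighted_uniqueness:
  fixes u :: "'a \<Rightarrow> real" and u' :: "'b \<Rightarrow> real"
  assumes "prob_space M" "prob_space N"
    and [measurable]: "u \<in> borel_measurable M" "u' \<in> borel_measurable N"
      "X \<in> borel_measurable M" "Y \<in> borel_measurable N"
    and bd: "\<And>\<omega>. 0 \<le> u \<omega>" "\<And>\<omega>. u \<omega> \<le> K" "\<And>\<omega>. 0 \<le> u' \<omega>" "\<And>\<omega>. u' \<omega> \<le> K"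
    and eq: "\<And>t \<gamma>. (\<integral>\<omega>. u \<omega> * cos (t * X \<omega> + \<gamma>) \<partial>M) = (\<integral>\<omega>. u' \<omega> * cos (t * Y \<omega> + \<gamma>) \<partial>N)"
    and A: "A \<in> sets borel"
  shows "(\<integral>\<omega>. u \<omega> * indicator A (X \<omega>) \<partial>M) = (\<integral>\<omega>. u' \<omega> * indicator A (Y \<omega>) \<partial>N)"
proof -
  interpret M: prob_space M by fact
  interpret N: prob_space N by fact
  have iu: "integrable M u" "integrable N u'"
    using bd by (auto intro!: M.integrable_const_bound[of _ K] N.integrable_const_bound[of _ K])
  define m where "m = integral\<^sup>L M u"
  have m': "integral\<^sup>L N u' = m" using eq[of 0 0] by (simp add: m_def)
  have m0: "0 \<le> m" unfolding m_def using bd by (intro integral_nonneg_AE) auto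
  have [measurable]: "A \<in> sets borel" by fact
  show ?thesis
  proof (cases "m = 0")
    case True
    have "AE \<omega> in M. u \<omega> = 0" "AE \<omega> in N. u' \<omega> = 0"
      using integral_nonneg_eq_0_iff_AE[OF iu(1)] integral_nonneg_eq_0_iff_AE[OF iu(2)] True m' bd
      by (auto simp: m_def)
    then have "(\<integral>\<omega>. u \<omega> * indicator A (X \<omega>) \<partial>M) = 0" "(\<integral>\<omega>. u' \<omega> * indicator A (Y \<omega>) \<partial>N) = 0"
      by (auto intro!: integral_eq_zero_AE)
    then show ?thesis by simp
  next
    case False
    with m0 have m: "0 < m" by simp
    note a = weighted_law[OF assms(1,3,5) bd(1,2) m_def[symmetric] m A]
    note b = weighted_law[OF assms(2,4,6) bd(3,4) m' m A]
    have "distr (density M (\<lambda>\<omega>. ennreal (u \<omega> / m))) borel X = distr (density N (\<lambda>\<omega>. ennreal (u' \<omega> / m))) borel Y"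
    proof (rule Levy_uniqueness)
      show "char (distr (density M (\<lambda>\<omega>. ennreal (u \<omega> / m))) borel X) = char (distr (density N (\<lambda>\<omega>. ennreal (u' \<omega> / m))) borel Y)"
        unfolding fun_eq_iff a[THEN conjunct2, THEN conjunct1, rule_format] b[THEN conjunct2, THEN conjunct1, rule_format] eq
        by (rule allI) (rule refl)
    qed (use a b in blast)+
    then show ?thesis using a b m by auto
  qed
qed

lemma cos_lin:
  fixes p :: real
  shows "p * (1 + cos (L + g)) * cos (x + d) =
    p * cos (x + 0 * L + d) + (p * cos (x + 1 * L + (d + g)) / 2 + p * cos (x + -1 * L + (d - g)) / 2)"
proof -
  have "cos (L + g) * cos (x + d) = (cos (x + 1 * L + (d + g)) + cos (x + -1 * L + (d - g))) / 2"
    using cos_times_cos[of "x + d" "L + g"] by (simp add: algebra_simps)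
  then have "p * (cos (L + g) * cos (x + d)) = p * ((cos (x + 1 * L + (d + g)) + cos (x + -1 * L + (d - g))) / 2)"
    by simp
  then show ?thesis by (simp add: distrib_left distrib_right add_divide_distrib mult.assoc)
qed

lemma integral_lin3:
  fixes a b c :: "'a \<Rightarrow> real"
  assumes "integrable M a" "integrable M b" "integrable M c"
  shows "(\<integral>\<omega>. a \<omega> + (b \<omega> / 2 + c \<omega> / 2) \<partial>M) = integral\<^sup>L M a + (integral\<^sup>L M b / 2 + integral\<^sup>L M c / 2)"
  using assms by simp

text \<open>A Cramer-Wold argument: the coordinates are converted one after the other from an
  argument of the cosine into an indicator. \<open>weighted_uniqueness\<close> asks for nonnegative
  weights, so the remaining cosine enters as \<open>1 + cos\<close>, and the contribution of the
  weight without the cosine is subtracted afterwards.\<close>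

lemma joint_uniqueness:
  fixes X :: "'i \<Rightarrow> 'a \<Rightarrow> real" and Y :: "'i \<Rightarrow> 'b \<Rightarrow> real"
  assumes "prob_space M" "prob_space N" and J: "finite J"
    and [measurable]: "\<And>j. j \<in> J \<Longrightarrow> X j \<in> borel_measurable M" "\<And>j. j \<in> J \<Longrightarrow> Y j \<in> borel_measurable N"
    and eq: "\<And>c \<gamma>. (\<integral>\<omega>. cos ((\<Sum>j\<in>J. c j * X j \<omega>) + \<gamma>) \<partial>M) = (\<integral>\<omega>. cos ((\<Sum>j\<in>J. c j * Y j \<omega>) + \<gamma>) \<partial>N)"
  shows "distr M (Pi\<^sub>M J (\<lambda>_. borel)) (\<lambda>\<omega>. \<lambda>j\<in>J. X j \<omega>) = distr N (Pi\<^sub>M J (\<lambda>_. borel)) (\<lambda>\<omega>. \<lambda>j\<in>J. Y j \<omega>)"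
proof -
  interpret M: prob_space M by fact
  interpret N: prob_space N by fact
  have step: "\<forall>c \<gamma>. (\<integral>\<omega>. (\<Prod>j\<in>S. indicator (A j) (X j \<omega>)) * cos ((\<Sum>j\<in>J - S. c j * X j \<omega>) + \<gamma>) \<partial>M)
       = (\<integral>\<omega>. (\<Prod>j\<in>S. indicator (A j) (Y j \<omega>)) * cos ((\<Sum>j\<in>J - S. c j * Y j \<omega>) + \<gamma>) \<partial>N)"
    if "S \<subseteq> J" and A[measurable]: "\<And>j. j \<in> J \<Longrightarrow> A j \<in> sets borel" for S and A :: "'i \<Rightarrow> real set"
    using finite_subset[OF that(1) J] that(1)
  proof (induction S rule: finite_subset_induct')
    case empty
    then show ?case using eq by simp
  next
    case (insert k S)
    have fJ: "finite (J - insert k S)" using J by simp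
    have JS: "J - S = insert k (J - insert k S)" using insert by auto
    have SJ: "\<And>j. j \<in> S \<Longrightarrow> j \<in> J" using insert by auto
    have k[measurable]: "X k \<in> borel_measurable M" "Y k \<in> borel_measurable N" "A k \<in> sets borel" using insert by auto
    show ?case
    proof (intro allI)
      fix c \<gamma>
      define p where "p \<omega> = (\<Prod>j\<in>S. indicator (A j) (X j \<omega>) :: real)" for \<omega>
      define q where "q \<omega> = (\<Prod>j\<in>S. indicator (A j) (Y j \<omega>) :: real)" for \<omega>
      define L where "L \<omega> = (\<Sum>j\<in>J - insert k S. c j * X j \<omega>)" for \<omega>
      define R where "R \<omega> = (\<Sum>j\<in>J - insert k S. c j * Y j \<omega>)" for \<omega>
      have [measurable]: "p \<in> borel_measurable M" "q \<in> borel_measurable N"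
        unfolding p_def q_def by (intro borel_measurable_prod; use SJ in measurable)+
      have [measurable]: "L \<in> borel_measurable M" "R \<in> borel_measurable N"
        unfolding L_def R_def by measurable
      have pq: "0 \<le> p \<omega>" "p \<omega> \<le> 1" "0 \<le> q \<omega>'" "q \<omega>' \<le> 1" for \<omega> \<omega>'
        unfolding p_def q_def by (auto intro!: prod_nonneg prod_le_1)
      \<comment> \<open>The induction hypothesis with coefficient \<open>t\<close> at
        \<open>k\<close> and all other coefficients scaled by \<open>s\<close>. The values 0, 1 and
        -1 of \<open>s\<close> are those that the product-to-sum formula \<open>cos_lin\<close>
        produces.\<close>
      have ih: "(\<integral>\<omega>. p \<omega> * cos (t * X k \<omega> + s * L \<omega> + \<delta>) \<partial>M) = (\<integral>\<omega>. q \<omega> * cos (t * Y k \<omega> + s * R \<omega> + \<delta>) \<partial>N)" for t s \<delta>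
      proof -
        have "(\<Sum>j\<in>J - S. (if j = k then t else s * c j) * X j \<omega>) = t * X k \<omega> + s * L \<omega>" for \<omega>
          unfolding JS L_def using fJ by (subst sum.insert) (auto simp: sum_distrib_left mult.assoc intro!: sum.cong)
        moreover have "(\<Sum>j\<in>J - S. (if j = k then t else s * c j) * Y j \<omega>) = t * Y k \<omega> + s * R \<omega>" for \<omega>
          unfolding JS R_def using fJ by (subst sum.insert) (auto simp: sum_distrib_left mult.assoc intro!: sum.cong)
        ultimately show ?thesis
          using insert.IH[rule_format, of "\<lambda>j. if j = k then t else s * c j" \<delta>] by (simp add: p_def q_def)
      qed
      have i: "integrable M (\<lambda>\<omega>. p \<omega> * g \<omega>)" if [measurable]: "g \<in> borel_measurable M" and "\<And>\<omega>. \<bar>g \<omega>\<bar> \<le> 1" for g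
        by (rule M.integrable_const_bound[of _ 1])
           (use pq that in \<open>auto simp: abs_mult intro!: mult_le_one\<close>)
      have i': "integrable N (\<lambda>\<omega>. q \<omega> * g \<omega>)" if [measurable]: "g \<in> borel_measurable N" and "\<And>\<omega>. \<bar>g \<omega>\<bar> \<le> 1" for g
        by (rule N.integrable_const_bound[of _ 1])
           (use pq that in \<open>auto simp: abs_mult intro!: mult_le_one\<close>)
      have e0: "(\<integral>\<omega>. p \<omega> * indicator (A k) (X k \<omega>) \<partial>M) = (\<integral>\<omega>. q \<omega> * indicator (A k) (Y k \<omega>) \<partial>N)"
        by (rule weighted_uniqueness[OF assms(1,2), where K=1]) (use pq ih[of _ 0] in auto)
      have e1: "(\<integral>\<omega>. (p \<omega> * (1 + cos (L \<omega> + \<gamma>))) * indicator (A k) (X k \<omega>) \<partial>M)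
         = (\<integral>\<omega>. (q \<omega> * (1 + cos (R \<omega> + \<gamma>))) * indicator (A k) (Y k \<omega>) \<partial>N)"
      proof (rule weighted_uniqueness[OF assms(1,2), where K=2])
        fix t \<delta>
        have "(\<integral>\<omega>. (p \<omega> * (1 + cos (L \<omega> + \<gamma>))) * cos (t * X k \<omega> + \<delta>) \<partial>M) =
           (\<integral>\<omega>. p \<omega> * cos (t * X k \<omega> + 0 * L \<omega> + \<delta>) + (p \<omega> * cos (t * X k \<omega> + 1 * L \<omega> + (\<delta> + \<gamma>)) / 2
              + p \<omega> * cos (t * X k \<omega> + -1 * L \<omega> + (\<delta> - \<gamma>)) / 2) \<partial>M)"
          by (intro Bochner_Integration.integral_cong refl)
             (rule cos_lin)
        also have "\<dots> = (\<integral>\<omega>. p \<omega> * cos (t * X k \<omega> + 0 * L \<omega> + \<delta>) \<partial>M) + ((\<integral>\<omega>. p \<omega> * cos (t * X k \<omega> + 1 * L \<omega> + (\<delta> + \<gamma>)) \<partial>M) / 2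
              + (\<integral>\<omega>. p \<omega> * cos (t * X k \<omega> + -1 * L \<omega> + (\<delta> - \<gamma>)) \<partial>M) / 2)"
          by (intro integral_lin3 i) simp_all
        also have "\<dots> = (\<integral>\<omega>. q \<omega> * cos (t * Y k \<omega> + 0 * R \<omega> + \<delta>) \<partial>N) + ((\<integral>\<omega>. q \<omega> * cos (t * Y k \<omega> + 1 * R \<omega> + (\<delta> + \<gamma>)) \<partial>N) / 2
              + (\<integral>\<omega>. q \<omega> * cos (t * Y k \<omega> + -1 * R \<omega> + (\<delta> - \<gamma>)) \<partial>N) / 2)"
          unfolding ih ..
        also have "\<dots> = (\<integral>\<omega>. q \<omega> * cos (t * Y k \<omega> + 0 * R \<omega> + \<delta>) + (q \<omega> * cos (t * Y k \<omega> + 1 * R \<omega> + (\<delta> + \<gamma>)) / 2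
              + q \<omega> * cos (t * Y k \<omega> + -1 * R \<omega> + (\<delta> - \<gamma>)) / 2) \<partial>N)"
          by (intro integral_lin3[symmetric] i') simp_all
        also have "\<dots> = (\<integral>\<omega>. (q \<omega> * (1 + cos (R \<omega> + \<gamma>))) * cos (t * Y k \<omega> + \<delta>) \<partial>N)"
          by (intro Bochner_Integration.integral_cong refl)
             (rule cos_lin[symmetric])
        finally show "(\<integral>\<omega>. (p \<omega> * (1 + cos (L \<omega> + \<gamma>))) * cos (t * X k \<omega> + \<delta>) \<partial>M)
           = (\<integral>\<omega>. (q \<omega> * (1 + cos (R \<omega> + \<gamma>))) * cos (t * Y k \<omega> + \<delta>) \<partial>N)" .
      next
        have b: "0 \<le> 1 + cos x" "1 + cos x \<le> 2" for x :: real
          using cos_ge_minus_one[of x] cos_le_one[of x] by linarith+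
        have m2: "p \<omega> * (1 + cos x) \<le> 1 * 2" "q \<omega>' * (1 + cos x) \<le> 1 * 2" for \<omega> \<omega>' x
          by (intro mult_mono pq b; simp)+
        show "0 \<le> p \<omega> * (1 + cos (L \<omega> + \<gamma>))" "0 \<le> q \<omega>' * (1 + cos (R \<omega>' + \<gamma>))"
          "p \<omega> * (1 + cos (L \<omega> + \<gamma>)) \<le> 2" "q \<omega>' * (1 + cos (R \<omega>' + \<gamma>)) \<le> 2" for \<omega> \<omega>'
          using m2 by (auto intro!: mult_nonneg_nonneg pq b)
      qed simp_all
      have "(\<integral>\<omega>. p \<omega> * (indicator (A k) (X k \<omega>) * cos (L \<omega> + \<gamma>)) \<partial>M) =
         (\<integral>\<omega>. (p \<omega> * (1 + cos (L \<omega> + \<gamma>))) * indicator (A k) (X k \<omega>) - p \<omega> * indicator (A k) (X k \<omega>) \<partial>M)"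
        by (intro Bochner_Integration.integral_cong refl) (simp add: algebra_simps)
      also have "\<dots> = (\<integral>\<omega>. (p \<omega> * (1 + cos (L \<omega> + \<gamma>))) * indicator (A k) (X k \<omega>) \<partial>M) - (\<integral>\<omega>. p \<omega> * indicator (A k) (X k \<omega>) \<partial>M)"
      proof (rule Bochner_Integration.integral_diff)
        have "integrable M (\<lambda>\<omega>. p \<omega> * indicator (A k) (X k \<omega>) + p \<omega> * (indicator (A k) (X k \<omega>) * cos (L \<omega> + \<gamma>)))"
          by (intro Bochner_Integration.integrable_add i) (auto simp: indicator_def abs_mult)
        then show "integrable M (\<lambda>\<omega>. (p \<omega> * (1 + cos (L \<omega> + \<gamma>))) * indicator (A k) (X k \<omega>))"
          by (simp add: algebra_simps)
      qed (intro i, auto simp: indicator_def)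
      also have "\<dots> = (\<integral>\<omega>. (q \<omega> * (1 + cos (R \<omega> + \<gamma>))) * indicator (A k) (Y k \<omega>) \<partial>N) - (\<integral>\<omega>. q \<omega> * indicator (A k) (Y k \<omega>) \<partial>N)"
        unfolding e0 e1 ..
      also have "\<dots> = (\<integral>\<omega>. (q \<omega> * (1 + cos (R \<omega> + \<gamma>))) * indicator (A k) (Y k \<omega>) - q \<omega> * indicator (A k) (Y k \<omega>) \<partial>N)"
      proof (rule Bochner_Integration.integral_diff[symmetric])
        have "integrable N (\<lambda>\<omega>. q \<omega> * indicator (A k) (Y k \<omega>) + q \<omega> * (indicator (A k) (Y k \<omega>) * cos (R \<omega> + \<gamma>)))"
          by (intro Bochner_Integration.integrable_add i') (auto simp: indicator_def abs_mult)
        then show "integrable N (\<lambda>\<omega>. (q \<omega> * (1 + cos (R \<omega> + \<gamma>))) * indicator (A k) (Y k \<omega>))"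
          by (simp add: algebra_simps)
      qed (intro i', auto simp: indicator_def)
      also have "\<dots> = (\<integral>\<omega>. q \<omega> * (indicator (A k) (Y k \<omega>) * cos (R \<omega> + \<gamma>)) \<partial>N)"
        by (intro Bochner_Integration.integral_cong refl) (simp add: algebra_simps)
      finally show "(\<integral>\<omega>. (\<Prod>j\<in>insert k S. indicator (A j) (X j \<omega>)) * cos ((\<Sum>j\<in>J - insert k S. c j * X j \<omega>) + \<gamma>) \<partial>M)
       = (\<integral>\<omega>. (\<Prod>j\<in>insert k S. indicator (A j) (Y j \<omega>)) * cos ((\<Sum>j\<in>J - insert k S. c j * Y j \<omega>) + \<gamma>) \<partial>N)"
        using insert by (simp add: p_def q_def L_def R_def mult_ac)
    qed
  qed
  have mX[measurable]: "(\<lambda>\<omega>. \<lambda>j\<in>J. X j \<omega>) \<in> measurable M (Pi\<^sub>M J (\<lambda>_. borel))"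
    by (rule measurable_restrict) (rule assms(4))
  have mY[measurable]: "(\<lambda>\<omega>. \<lambda>j\<in>J. Y j \<omega>) \<in> measurable N (Pi\<^sub>M J (\<lambda>_. borel))"
    by (rule measurable_restrict) (rule assms(5))
  show ?thesis
  proof (rule measure_eqI_PiM_finite[OF J, where A="\<lambda>_. space (Pi\<^sub>M J (\<lambda>_. borel))"])
    fix A :: "'i \<Rightarrow> real set" assume A: "\<And>i. i \<in> J \<Longrightarrow> A i \<in> sets borel"
    have s[measurable]: "Pi\<^sub>E J A \<in> sets (Pi\<^sub>M J (\<lambda>_. borel))" using A J by (intro sets_PiM_I_finite) auto
    have pr: "(\<Prod>j\<in>J. indicator (A j) (x j)) = (indicator (Pi\<^sub>E J A) (\<lambda>j\<in>J. x j) :: real)" for x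
    proof (cases "\<forall>j\<in>J. x j \<in> A j")
      case True then show ?thesis by (auto simp: indicator_def PiE_iff)
    next
      case False
      then show ?thesis using J by (auto simp: indicator_def PiE_iff intro!: prod_zero)
    qed
    have "measure (distr M (Pi\<^sub>M J (\<lambda>_. borel)) (\<lambda>\<omega>. \<lambda>j\<in>J. X j \<omega>)) (Pi\<^sub>E J A) = (\<integral>x. indicator (Pi\<^sub>E J A) x \<partial>distr M (Pi\<^sub>M J (\<lambda>_. borel)) (\<lambda>\<omega>. \<lambda>j\<in>J. X j \<omega>))"
      by simp
    also have "\<dots> = (\<integral>\<omega>. indicator (Pi\<^sub>E J A) (\<lambda>j\<in>J. X j \<omega>) \<partial>M)" by (rule integral_distr[OF mX]) simp
    also have "\<dots> = (\<integral>\<omega>. indicator (Pi\<^sub>E J A) (\<lambda>j\<in>J. Y j \<omega>) \<partial>N)"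
      using spec[OF spec[OF step[of J A, OF subset_refl A], of "\<lambda>_. 0"], of 0] by (simp add: pr)
    also have "\<dots> = (\<integral>x. indicator (Pi\<^sub>E J A) x \<partial>distr N (Pi\<^sub>M J (\<lambda>_. borel)) (\<lambda>\<omega>. \<lambda>j\<in>J. Y j \<omega>))" by (rule integral_distr[OF mY, symmetric]) simp
    finally have "measure (distr M (Pi\<^sub>M J (\<lambda>_. borel)) (\<lambda>\<omega>. \<lambda>j\<in>J. X j \<omega>)) (Pi\<^sub>E J A) = measure (distr N (Pi\<^sub>M J (\<lambda>_. borel)) (\<lambda>\<omega>. \<lambda>j\<in>J. Y j \<omega>)) (Pi\<^sub>E J A)"
      by simp
    then show "emeasure (distr M (Pi\<^sub>M J (\<lambda>_. borel)) (\<lambda>\<omega>. \<lambda>j\<in>J. X j \<omega>)) (Pi\<^sub>E J A) = emeasure (distr N (Pi\<^sub>M J (\<lambda>_. borel)) (\<lambda>\<omega>. \<lambda>j\<in>J. Y j \<omega>)) (Pi\<^sub>E J A)"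
      using M.emeasure_eq_measure N.emeasure_eq_measure
      by (metis M.prob_space_distr N.prob_space_distr finite_measure.emeasure_eq_measure mX mY prob_space.finite_measure)
  next
    show "range (\<lambda>_. space (Pi\<^sub>M J (\<lambda>_. borel))) \<subseteq> prod_algebra J (\<lambda>_. borel :: real measure)"
      by (auto simp: space_PiM intro!: prod_algebraI_finite J)
    show "emeasure (distr M (Pi\<^sub>M J (\<lambda>_. borel)) (\<lambda>\<omega>. \<lambda>j\<in>J. X j \<omega>)) (space (Pi\<^sub>M J (\<lambda>_. borel))) \<noteq> \<infinity>"
      by (simp add: emeasure_distr)
  qed auto
qed

text \<open>Subtracting from each \<open>b\<^sub>j\<close> its projection on the unit Gaussian \<open>\<xi> = \<Sum>\<^sub>j a\<^sub>j b\<^sub>j\<close> leaves a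
  vector independent of \<open>\<xi>\<close>, so that the one-dimensional formula applies along the direction \<open>w\<close>.\<close>

lemma gaussian_second_ibp:
  fixes b :: "'i \<Rightarrow> 'a \<Rightarrow> real" and F F1 F2 :: "('i \<Rightarrow> real) \<Rightarrow> complex"
  assumes M: "prob_space M" and J: "finite J"
    and meas[measurable]: "\<And>j. j \<in> J \<Longrightarrow> b j \<in> borel_measurable M"
    and gauss: "\<And>c \<gamma>. (\<integral>\<omega>. cos ((\<Sum>j\<in>J. c j * b j \<omega>) + \<gamma>) \<partial>M) =
      cos \<gamma> * exp (- (\<integral>\<omega>. (\<Sum>j\<in>J. c j * b j \<omega>)\<^sup>2 \<partial>M) / 2)"
    and mom: "\<And>N. integrable M (\<lambda>\<omega>. (1 + (\<Sum>j\<in>J. \<bar>b j \<omega>\<bar>)) ^ N)"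
    and var1: "(\<integral>\<omega>. (\<Sum>j\<in>J. a j * b j \<omega>)\<^sup>2 \<partial>M) = 1"
    and w: "\<And>j. j \<in> J \<Longrightarrow> w j = (\<integral>\<omega>. (\<Sum>i\<in>J. a i * b i \<omega>) * b j \<omega> \<partial>M)"
    and mF: "F \<in> borel_measurable (Pi\<^sub>M J (\<lambda>_. borel))" and mF2: "F2 \<in> borel_measurable (Pi\<^sub>M J (\<lambda>_. borel))"
    and dF: "\<And>y x. ((\<lambda>x. F (\<lambda>j\<in>J. y j + x * w j)) has_vector_derivative F1 (\<lambda>j\<in>J. y j + x * w j)) (at x)"
    and dF1: "\<And>y x. ((\<lambda>x. F1 (\<lambda>j\<in>J. y j + x * w j)) has_vector_derivative F2 (\<lambda>j\<in>J. y j + x * w j)) (at x)"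
    and cF2: "\<And>y. continuous_on UNIV (\<lambda>x. F2 (\<lambda>j\<in>J. y j + x * w j))"
    and bd: "\<And>y. norm (F y) \<le> K * (1 + (\<Sum>j\<in>J. \<bar>y j\<bar>)) ^ N" "\<And>y. norm (F1 y) \<le> K * (1 + (\<Sum>j\<in>J. \<bar>y j\<bar>)) ^ N"
      "\<And>y. norm (F2 y) \<le> K * (1 + (\<Sum>j\<in>J. \<bar>y j\<bar>)) ^ N"
  shows "(\<integral>\<omega>. of_real ((\<Sum>j\<in>J. a j * b j \<omega>)\<^sup>2 - 1) * F (\<lambda>j\<in>J. b j \<omega>) \<partial>M) = (\<integral>\<omega>. F2 (\<lambda>j\<in>J. b j \<omega>) \<partial>M)"
proof -
  interpret M: prob_space M by fact
  interpret P: pair_prob_space M std_normal_distribution ..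
  let ?S = std_normal_distribution and ?\<Pi> = "M \<Otimes>\<^sub>M std_normal_distribution"
  define L where "L c \<omega> = (\<Sum>j\<in>J. c j * b j \<omega>)" for c \<omega>
  have mL[measurable]: "L c \<in> borel_measurable M" for c unfolding L_def by measurable
  have ibb: "integrable M (\<lambda>\<omega>. b i \<omega> * b j \<omega>)" if "i \<in> J" "j \<in> J" for i j
  proof (rule Bochner_Integration.integrable_bound[OF mom[of 2]])
    show "AE \<omega> in M. norm (b i \<omega> * b j \<omega>) \<le> norm ((1 + (\<Sum>j\<in>J. \<bar>b j \<omega>\<bar>))\<^sup>2)"
    proof (intro AE_I2)
      fix \<omega>
      have "\<bar>b k \<omega>\<bar> \<le> 1 + (\<Sum>j\<in>J. \<bar>b j \<omega>\<bar>)" if "k \<in> J" for k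
        using member_le_sum[of k J "\<lambda>j. \<bar>b j \<omega>\<bar>"] that J by simp
      then have "\<bar>b i \<omega>\<bar> * \<bar>b j \<omega>\<bar> \<le> (1 + (\<Sum>j\<in>J. \<bar>b j \<omega>\<bar>)) * (1 + (\<Sum>j\<in>J. \<bar>b j \<omega>\<bar>))"
        using \<open>i \<in> J\<close> \<open>j \<in> J\<close> by (intro mult_mono) (auto intro!: add_nonneg_nonneg sum_nonneg)
      then show "norm (b i \<omega> * b j \<omega>) \<le> norm ((1 + (\<Sum>j\<in>J. \<bar>b j \<omega>\<bar>))\<^sup>2)"
        by (simp add: abs_mult power2_eq_square)
    qed
  qed (use that in measurable)
  have iLb: "integrable M (\<lambda>\<omega>. L c \<omega> * b j \<omega>)" if "j \<in> J" for c j
    unfolding L_def sum_distrib_right mult.assoc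
    using that by (intro Bochner_Integration.integrable_sum integrable_mult_right ibb)
  have iLL: "integrable M (\<lambda>\<omega>. L c \<omega> * L d \<omega>)" for c d
  proof -
    have "(\<lambda>\<omega>. L c \<omega> * L d \<omega>) = (\<lambda>\<omega>. \<Sum>j\<in>J. d j * (L c \<omega> * b j \<omega>))"
      unfolding L_def[of d] sum_distrib_left by (simp add: mult_ac)
    then show ?thesis using iLb by simp
  qed
  define s where "s c = (\<Sum>j\<in>J. c j * w j)" for c
  have EL: "(\<integral>\<omega>. L a \<omega> * L c \<omega> \<partial>M) = s c" for c
  proof -
    have "(\<integral>\<omega>. L a \<omega> * L c \<omega> \<partial>M) = (\<integral>\<omega>. (\<Sum>j\<in>J. c j * (L a \<omega> * b j \<omega>)) \<partial>M)"
      unfolding L_def[of c] sum_distrib_left by (simp add: mult_ac)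
    also have "\<dots> = (\<Sum>j\<in>J. c j * (\<integral>\<omega>. L a \<omega> * b j \<omega> \<partial>M))"
      using iLb by (subst Bochner_Integration.integral_sum) auto
    also have "\<dots> = s c" unfolding s_def using w by (intro sum.cong) (auto simp: L_def)
    finally show ?thesis .
  qed
  have Ea: "(\<integral>\<omega>. L a \<omega> * L a \<omega> \<partial>M) = 1" using var1 by (simp add: L_def power2_eq_square)
  then have sa: "s a = 1" using EL by simp
  \<comment> \<open>Pythagoras: \<open>s c\<close> is the coefficient of the projection of
    \<open>L c\<close> on the unit Gaussian \<open>L a\<close>.\<close>
  have EZ: "(\<integral>\<omega>. (L (\<lambda>j. c j - s c * a j) \<omega>)\<^sup>2 \<partial>M) = (\<integral>\<omega>. (L c \<omega>)\<^sup>2 \<partial>M) - (s c)\<^sup>2" for c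
  proof -
    have "(L (\<lambda>j. c j - s c * a j) \<omega>)\<^sup>2 = L c \<omega> * L c \<omega> - 2 * s c * (L a \<omega> * L c \<omega>) + (s c)\<^sup>2 * (L a \<omega> * L a \<omega>)" for \<omega>
    proof -
      have "L (\<lambda>j. c j - s c * a j) \<omega> = L c \<omega> - s c * L a \<omega>"
        unfolding L_def by (simp add: left_diff_distrib sum_subtractf sum_distrib_left mult.assoc)
      then show ?thesis by (simp only:) (simp add: power2_eq_square algebra_simps)
    qed
    then show ?thesis using iLL EL Ea by (simp add: power2_eq_square)
  qed
  \<comment> \<open>In \<open>Y\<close> the component of the vector along \<open>L a\<close> is
    exchanged for an independent standard normal coordinate. By \<open>EZ\<close> all linear forms
    keep their variance, so the joint law is unchanged.\<close>
  define Y where "Y j p = (b j (fst p) - w j * L a (fst p)) + snd p * w j" for j p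
  have mY[measurable]: "Y j \<in> borel_measurable ?\<Pi>" if "j \<in> J" for j
    unfolding Y_def using that by measurable
  have LY: "(\<Sum>j\<in>J. c j * Y j p) = L (\<lambda>j. c j - s c * a j) (fst p) + s c * snd p" for c p
  proof -
    have "(\<Sum>j\<in>J. c j * Y j p) = (\<Sum>j\<in>J. c j * b j (fst p)) - (\<Sum>j\<in>J. c j * w j) * L a (fst p) + (\<Sum>j\<in>J. c j * w j) * snd p"
      unfolding Y_def sum_distrib_right sum_subtractf[symmetric] sum.distrib[symmetric]
      by (intro sum.cong refl) (simp add: algebra_simps)
    also have "(\<Sum>j\<in>J. c j * b j (fst p)) - (\<Sum>j\<in>J. c j * w j) * L a (fst p) = L (\<lambda>j. c j - s c * a j) (fst p)"
      unfolding L_def s_def by (simp add: left_diff_distrib sum_subtractf sum_distrib_left mult.assoc)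
    finally show ?thesis by (simp add: s_def)
  qed
  have eq: "distr M (Pi\<^sub>M J (\<lambda>_. borel)) (\<lambda>\<omega>. \<lambda>j\<in>J. b j \<omega>) = distr ?\<Pi> (Pi\<^sub>M J (\<lambda>_. borel)) (\<lambda>p. \<lambda>j\<in>J. Y j p)"
  proof (rule joint_uniqueness[OF M _ J meas mY])
    show "prob_space ?\<Pi>" by (rule P.prob_space_axioms)
    fix c \<gamma>
    let ?Z = "L (\<lambda>j. c j - s c * a j)"
    have "(\<integral>p. cos ((\<Sum>j\<in>J. c j * Y j p) + \<gamma>) \<partial>?\<Pi>) = (\<integral>\<omega>. (\<integral>x. cos ((?Z \<omega> + s c * x) + \<gamma>) \<partial>?S) \<partial>M)"
    proof -
      have "integrable ?\<Pi> (\<lambda>p. cos ((?Z (fst p) + s c * snd p) + \<gamma>))"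
        by (rule P.integrable_const_bound[of _ 1]) auto
      from P.integral_fst'[OF this] show ?thesis unfolding LY by simp
    qed
    also have "\<dots> = (\<integral>\<omega>. cos (?Z \<omega> + \<gamma>) * exp (- (s c)\<^sup>2 / 2) \<partial>M)"
    proof -
      have "(\<integral>x. cos ((z + s c * x) + \<gamma>) \<partial>?S) = cos (z + \<gamma>) * exp (- (s c)\<^sup>2 / 2)" for z
        using integral_std_normal_cos[of "z + \<gamma>" "s c"] by (simp add: add_ac)
      then show ?thesis by simp
    qed
    also have "\<dots> = cos \<gamma> * exp (- (\<integral>\<omega>. (?Z \<omega>)\<^sup>2 \<partial>M) / 2) * exp (- (s c)\<^sup>2 / 2)"
      using gauss[of "\<lambda>j. c j - s c * a j" \<gamma>] by (simp add: L_def)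
    also have "\<dots> = cos \<gamma> * exp (- (\<integral>\<omega>. (L c \<omega>)\<^sup>2 \<partial>M) / 2)"
      unfolding EZ by (simp add: mult.assoc exp_add[symmetric] diff_divide_distrib del: exp_diff)
    also have "\<dots> = (\<integral>\<omega>. cos ((\<Sum>j\<in>J. c j * b j \<omega>) + \<gamma>) \<partial>M)"
      using gauss[of c \<gamma>] by (simp add: L_def)
    finally show "(\<integral>\<omega>. cos ((\<Sum>j\<in>J. c j * b j \<omega>) + \<gamma>) \<partial>M) = (\<integral>p. cos ((\<Sum>j\<in>J. c j * Y j p) + \<gamma>) \<partial>?\<Pi>)" ..
  qed
  have rb: "(\<lambda>\<omega>. \<lambda>j\<in>J. b j \<omega>) \<in> measurable M (Pi\<^sub>M J (\<lambda>_. borel))" by (rule measurable_restrict) (rule meas)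
  have rY: "(\<lambda>p. \<lambda>j\<in>J. Y j p) \<in> measurable ?\<Pi> (Pi\<^sub>M J (\<lambda>_. borel))" by (rule measurable_restrict) (rule mY)
  have transport: "(\<integral>\<omega>. G (\<lambda>j\<in>J. b j \<omega>) \<partial>M) = (\<integral>\<omega>. (\<integral>x. G (\<lambda>j\<in>J. Y j (\<omega>, x)) \<partial>?S) \<partial>M)"
    if G: "G \<in> borel_measurable (Pi\<^sub>M J (\<lambda>_. borel))" and Gb: "\<And>y. norm (G y) \<le> C * (1 + (\<Sum>j\<in>J. \<bar>y j\<bar>)) ^ m"
    for G :: "('i \<Rightarrow> real) \<Rightarrow> complex" and C m
  proof -
    have "integrable M (\<lambda>\<omega>. G (\<lambda>j\<in>J. b j \<omega>))"
    proof (rule Bochner_Integration.integrable_bound)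
      show "integrable M (\<lambda>\<omega>. C * (1 + (\<Sum>j\<in>J. \<bar>b j \<omega>\<bar>)) ^ m)" using mom by simp
      show "(\<lambda>\<omega>. G (\<lambda>j\<in>J. b j \<omega>)) \<in> borel_measurable M" using measurable_comp[OF rb G] by (simp add: comp_def)
      show "AE \<omega> in M. norm (G (\<lambda>j\<in>J. b j \<omega>)) \<le> norm (C * (1 + (\<Sum>j\<in>J. \<bar>b j \<omega>\<bar>)) ^ m)"
      proof (intro AE_I2)
        fix \<omega>
        have "norm (G (\<lambda>j\<in>J. b j \<omega>)) \<le> C * (1 + (\<Sum>j\<in>J. \<bar>b j \<omega>\<bar>)) ^ m"
          using Gb[of "\<lambda>j\<in>J. b j \<omega>"] by simp
        then show "norm (G (\<lambda>j\<in>J. b j \<omega>)) \<le> norm (C * (1 + (\<Sum>j\<in>J. \<bar>b j \<omega>\<bar>)) ^ m)" by simp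
      qed
    qed
    then have "integrable (distr M (Pi\<^sub>M J (\<lambda>_. borel)) (\<lambda>\<omega>. \<lambda>j\<in>J. b j \<omega>)) G"
      using integrable_distr_eq[OF rb G] by simp
    then have i: "integrable ?\<Pi> (\<lambda>p. G (\<lambda>j\<in>J. Y j p))"
      unfolding eq using integrable_distr_eq[OF rY G] by simp
    have "(\<integral>\<omega>. G (\<lambda>j\<in>J. b j \<omega>) \<partial>M) = (\<integral>p. G (\<lambda>j\<in>J. Y j p) \<partial>?\<Pi>)"
      using integral_distr[OF rb G] integral_distr[OF rY G] eq by simp
    also have "\<dots> = (\<integral>\<omega>. (\<integral>x. G (\<lambda>j\<in>J. Y j (\<omega>, x)) \<partial>?S) \<partial>M)"
      using P.integral_fst'[OF i] by simp
    finally show ?thesis .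
  qed
  have K: "0 \<le> K"
  proof -
    have "0 \<le> K * (1 + (\<Sum>j\<in>J. \<bar>0::real\<bar>)) ^ N" using order_trans[OF norm_ge_zero bd(1)[of "\<lambda>_. 0"]] .
    then show ?thesis by simp
  qed
  define A where "A = 1 + (\<Sum>j\<in>J. \<bar>a j\<bar>)"
  have Lq: "\<bar>(\<Sum>j\<in>J. a j * y j)\<^sup>2 - 1\<bar> \<le> A\<^sup>2 * (1 + (\<Sum>j\<in>J. \<bar>y j\<bar>))\<^sup>2" for y
  proof -
    let ?Y = "\<Sum>j\<in>J. \<bar>y j\<bar>"
    have "\<bar>\<Sum>j\<in>J. a j * y j\<bar> \<le> (\<Sum>j\<in>J. \<bar>a j\<bar> * \<bar>y j\<bar>)" by (rule order_trans[OF sum_abs]) (simp add: abs_mult)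
    also have "\<dots> \<le> (\<Sum>j\<in>J. (\<Sum>i\<in>J. \<bar>a i\<bar>) * \<bar>y j\<bar>)"
      using J by (intro sum_mono mult_right_mono member_le_sum) auto
    also have "\<dots> = (\<Sum>j\<in>J. \<bar>a j\<bar>) * ?Y" by (simp add: sum_distrib_left)
    finally have "(\<Sum>j\<in>J. a j * y j)\<^sup>2 \<le> ((\<Sum>j\<in>J. \<bar>a j\<bar>) * ?Y)\<^sup>2"
      using power_mono[of "\<bar>\<Sum>j\<in>J. a j * y j\<bar>" _ 2] by simp
    moreover have "\<dots> \<le> ((\<Sum>j\<in>J. \<bar>a j\<bar>) * ?Y)\<^sup>2 + 1" by simp
    moreover have "((\<Sum>j\<in>J. \<bar>a j\<bar>) * ?Y)\<^sup>2 + 1 \<le> (A * (1 + ?Y))\<^sup>2"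
    proof -
      have n: "0 \<le> (\<Sum>j\<in>J. \<bar>a j\<bar>)" "0 \<le> ?Y" by (auto intro: sum_nonneg)
      have "A * (1 + ?Y) = 1 + (\<Sum>j\<in>J. \<bar>a j\<bar>) * ?Y + ((\<Sum>j\<in>J. \<bar>a j\<bar>) + ?Y)" by (simp add: A_def algebra_simps)
      then have "1 + (\<Sum>j\<in>J. \<bar>a j\<bar>) * ?Y \<le> A * (1 + ?Y)" using n by simp
      then have "(1 + (\<Sum>j\<in>J. \<bar>a j\<bar>) * ?Y)\<^sup>2 \<le> (A * (1 + ?Y))\<^sup>2" using n by (intro power_mono) auto
      moreover have "(1 + u)\<^sup>2 \<ge> u\<^sup>2 + 1" if "0 \<le> u" for u :: real using that by (simp add: power2_sum)
      ultimately show ?thesis using n by (meson mult_nonneg_nonneg order_trans)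
    qed
    ultimately have "\<bar>(\<Sum>j\<in>J. a j * y j)\<^sup>2 - 1\<bar> \<le> (A * (1 + ?Y))\<^sup>2"
      using zero_le_power2[of "\<Sum>j\<in>J. a j * y j"] by linarith
    then show ?thesis by (simp add: power_mult_distrib)
  qed
  have "(\<integral>\<omega>. of_real ((\<Sum>j\<in>J. a j * b j \<omega>)\<^sup>2 - 1) * F (\<lambda>j\<in>J. b j \<omega>) \<partial>M) =
     (\<integral>\<omega>. (\<lambda>y. of_real ((\<Sum>j\<in>J. a j * y j)\<^sup>2 - 1) * F y) (\<lambda>j\<in>J. b j \<omega>) \<partial>M)"
    by simp
  also have "\<dots> = (\<integral>\<omega>. (\<integral>x. (\<lambda>y. of_real ((\<Sum>j\<in>J. a j * y j)\<^sup>2 - 1) * F y) (\<lambda>j\<in>J. Y j (\<omega>, x)) \<partial>?S) \<partial>M)"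
  proof (rule transport)
    show "(\<lambda>y. of_real ((\<Sum>j\<in>J. a j * y j)\<^sup>2 - 1) * F y) \<in> borel_measurable (Pi\<^sub>M J (\<lambda>_. borel))"
      using mF by measurable
    fix y
    have "norm (complex_of_real ((\<Sum>j\<in>J. a j * y j)\<^sup>2 - 1)) * norm (F y) \<le> (A\<^sup>2 * (1 + (\<Sum>j\<in>J. \<bar>y j\<bar>))\<^sup>2) * (K * (1 + (\<Sum>j\<in>J. \<bar>y j\<bar>)) ^ N)"
      unfolding norm_of_real by (intro mult_mono Lq bd) auto
    then show "norm (of_real ((\<Sum>j\<in>J. a j * y j)\<^sup>2 - 1) * F y) \<le> A\<^sup>2 * K * (1 + (\<Sum>j\<in>J. \<bar>y j\<bar>)) ^ (2 + N)"
      unfolding norm_mult power_add by (simp only: mult_ac)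
  qed
  also have "\<dots> = (\<integral>\<omega>. (\<integral>x. of_real (x\<^sup>2 - 1) * F (\<lambda>j\<in>J. Y j (\<omega>, x)) \<partial>?S) \<partial>M)"
  proof -
    \<comment> \<open>Since \<open>s a = 1\<close>, the coefficients \<open>a j - s a * a j\<close>
      vanish, and the linear form reduces to the fresh coordinate.\<close>
    have "(\<Sum>j\<in>J. a j * (\<lambda>j\<in>J. Y j (\<omega>, x)) j) = x" for \<omega> x
    proof -
      have "(\<Sum>j\<in>J. a j * (\<lambda>j\<in>J. Y j (\<omega>, x)) j) = (\<Sum>j\<in>J. a j * Y j (\<omega>, x))" by simp
      also have "\<dots> = x" unfolding LY by (simp add: sa L_def)
      finally show ?thesis .
    qed
    then show ?thesis by simp
  qed
  also have "\<dots> = (\<integral>\<omega>. (\<integral>x. F2 (\<lambda>j\<in>J. Y j (\<omega>, x)) \<partial>?S) \<partial>M)"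
  proof (rule Bochner_Integration.integral_cong[OF refl])
    fix \<omega>
    define v where "v j = b j \<omega> - w j * L a \<omega>" for j
    have Yv: "(\<lambda>j\<in>J. Y j (\<omega>, x)) = (\<lambda>j\<in>J. v j + x * w j)" for x by (simp add: Y_def v_def)
    define D where "D = (1 + (\<Sum>j\<in>J. \<bar>v j\<bar>)) * (1 + (\<Sum>j\<in>J. \<bar>w j\<bar>))"
    have lin: "K * (1 + (\<Sum>j\<in>J. \<bar>(\<lambda>j\<in>J. v j + x * w j) j\<bar>)) ^ N \<le> (K * D ^ N) * (1 + \<bar>x\<bar>) ^ N" for x
    proof -
      have "(\<Sum>j\<in>J. \<bar>(\<lambda>j\<in>J. v j + x * w j) j\<bar>) \<le> (\<Sum>j\<in>J. \<bar>v j\<bar> + \<bar>x\<bar> * \<bar>w j\<bar>)"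
        by (intro sum_mono) (auto simp: abs_mult[symmetric])
      also have "\<dots> = (\<Sum>j\<in>J. \<bar>v j\<bar>) + \<bar>x\<bar> * (\<Sum>j\<in>J. \<bar>w j\<bar>)" by (simp add: sum.distrib sum_distrib_left)
      finally have "1 + (\<Sum>j\<in>J. \<bar>(\<lambda>j\<in>J. v j + x * w j) j\<bar>) \<le> 1 + (\<Sum>j\<in>J. \<bar>v j\<bar>) + \<bar>x\<bar> * (\<Sum>j\<in>J. \<bar>w j\<bar>)" by simp
      also have "\<dots> \<le> D * (1 + \<bar>x\<bar>)"
      proof -
        have "1 + u + z * q \<le> (1 + u) * (1 + q) * (1 + z)" if "0 \<le> u" "0 \<le> q" "0 \<le> z" for u q z :: real
        proof -
          have "(1 + u) * (1 + q) * (1 + z) - (1 + u + z * q) = q + z + u * q + u * z + u * q * z"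
            by (simp add: algebra_simps)
          moreover have "0 \<le> q + z + u * q + u * z + u * q * z" using that by simp
          ultimately show ?thesis by linarith
        qed
        then show ?thesis unfolding D_def by (simp add: sum_nonneg)
      qed
      finally have "(1 + (\<Sum>j\<in>J. \<bar>(\<lambda>j\<in>J. v j + x * w j) j\<bar>)) ^ N \<le> (D * (1 + \<bar>x\<bar>)) ^ N"
        by (intro power_mono) (auto intro!: add_nonneg_nonneg sum_nonneg)
      then have "K * (1 + (\<Sum>j\<in>J. \<bar>(\<lambda>j\<in>J. v j + x * w j) j\<bar>)) ^ N \<le> K * (D * (1 + \<bar>x\<bar>)) ^ N"
        using K by (rule mult_left_mono)
      then show ?thesis by (simp only: power_mult_distrib mult.assoc)
    qed
    show "(\<integral>x. of_real (x\<^sup>2 - 1) * F (\<lambda>j\<in>J. Y j (\<omega>, x)) \<partial>?S) = (\<integral>x. F2 (\<lambda>j\<in>J. Y j (\<omega>, x)) \<partial>?S)"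
      unfolding Yv
      by (rule std_normal_second_ibp[OF dF dF1 cF2 order_trans[OF bd(1) lin] order_trans[OF bd(2) lin] order_trans[OF bd(3) lin]])
  qed
  also have "\<dots> = (\<integral>\<omega>. F2 (\<lambda>j\<in>J. b j \<omega>) \<partial>M)"
    by (rule transport[OF mF2 bd(3), symmetric])
  finally show ?thesis .
qed

section \<open>The process on a grid\<close>

locale quarter_fbm = prob_space M for M :: "'a measure" +
  fixes B :: "real \<Rightarrow> 'a \<Rightarrow> real"
  assumes fbm: "fractional_brownian_motion M (1/4) B"
begin

lemma measurable_B: "t \<in> {0..1} \<Longrightarrow> B t \<in> borel_measurable M"
  using fbm by (simp add: fractional_brownian_motion_quarter centered_gaussian_process_def)

lemma expectation_B: "t \<in> {0..1} \<Longrightarrow> expectation (B t) = 0"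
  using fbm by (simp add: fractional_brownian_motion_quarter centered_gaussian_process_def)

lemma cov_B: "s \<in> {0..1} \<Longrightarrow> t \<in> {0..1} \<Longrightarrow> expectation (\<lambda>\<omega>. B s \<omega> * B t \<omega>) = (sqrt t + sqrt s - sqrt \<bar>t - s\<bar>) / 2"
  using fbm by (simp add: fractional_brownian_motion_quarter)

lemma continuous_B: "\<omega> \<in> space M \<Longrightarrow> continuous_on {0..1} (\<lambda>t. B t \<omega>)"
  using fbm by (simp add: fractional_brownian_motion_quarter)

lemma law_B:
  assumes "finite I" "I \<subseteq> {0..1}"
  shows "\<exists>\<mu> \<sigma>. 0 \<le> \<sigma> \<and> distr M borel (\<lambda>\<omega>. \<Sum>t\<in>I. c t * B t \<omega>) = gaussian_law \<mu> \<sigma>"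
  using fbm assms by (auto simp: fractional_brownian_motion_quarter centered_gaussian_process_def)

lemma integrable_B_power:
  assumes "t \<in> {0..1}" shows "integrable M (\<lambda>\<omega>. (1 + \<bar>B t \<omega>\<bar>) ^ N)"
proof -
  obtain \<mu> \<sigma> where *: "0 \<le> \<sigma>" "distr M borel (\<lambda>\<omega>. \<Sum>t\<in>{t}. (\<lambda>_. 1) t * B t \<omega>) = gaussian_law \<mu> \<sigma>"
    using law_B[of "{t}" "\<lambda>_. 1"] assms by auto
  then have "distr M borel (B t) = gaussian_law \<mu> \<sigma>" by simp
  from centered_gaussian_facts(1)[OF prob_space_axioms measurable_B[OF assms] this *(1) expectation_B[OF assms]]
  show ?thesis .
qed

lemma integrable_B: "t \<in> {0..1} \<Longrightarrow> integrable M (B t)"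
  by (rule Bochner_Integration.integrable_bound[OF integrable_B_power[of t 1]])
     (auto simp: measurable_B)

text \<open>The hypothesis speaks of sets of times, the grid of indexed families; injectivity of
  \<open>\<tau>\<close> lets each time carry the coefficient of its index.\<close>

lemma gaussian_sum:
  fixes \<tau> c :: "nat \<Rightarrow> real"
  assumes I: "finite I" and \<tau>: "inj_on \<tau> I" "\<tau> ` I \<subseteq> {0..1}"
  defines "Z \<equiv> \<lambda>\<omega>. \<Sum>l\<in>I. c l * B (\<tau> l) \<omega>"
  shows "integrable M (\<lambda>\<omega>. (1 + \<bar>Z \<omega>\<bar>) ^ N)"
    and "expectation (\<lambda>\<omega>. (Z \<omega>)^4) = 3 * (expectation (\<lambda>\<omega>. (Z \<omega>)\<^sup>2))\<^sup>2"
    and "expectation (\<lambda>\<omega>. cos (Z \<omega> + \<gamma>)) = cos \<gamma> * exp (- expectation (\<lambda>\<omega>. (Z \<omega>)\<^sup>2) / 2)"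
proof -
  have Z: "Z = (\<lambda>\<omega>. \<Sum>t\<in>\<tau> ` I. c (inv_into I \<tau> t) * B t \<omega>)"
  proof (rule ext)
    fix \<omega>
    have "(\<Sum>t\<in>\<tau> ` I. c (inv_into I \<tau> t) * B t \<omega>) = (\<Sum>l\<in>I. c (inv_into I \<tau> (\<tau> l)) * B (\<tau> l) \<omega>)"
      by (rule sum.reindex[OF \<tau>(1), unfolded o_def])
    also have "\<dots> = Z \<omega>"
      unfolding Z_def by (intro sum.cong refl) (simp only: inv_into_f_f[OF \<tau>(1)])
    finally show "Z \<omega> = (\<Sum>t\<in>\<tau> ` I. c (inv_into I \<tau> t) * B t \<omega>)" ..
  qed
  have m: "\<And>l. l \<in> I \<Longrightarrow> B (\<tau> l) \<in> borel_measurable M" using measurable_B \<tau>(2) by auto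
  have [measurable]: "Z \<in> borel_measurable M" unfolding Z_def using m by measurable
  obtain \<mu> \<sigma> where *: "0 \<le> \<sigma>" "distr M borel Z = gaussian_law \<mu> \<sigma>"
    using law_B[OF finite_imageI[OF I] \<tau>(2), of "\<lambda>t. c (inv_into I \<tau> t)"] unfolding Z[symmetric] by (elim exE conjE)
  have "expectation Z = (\<Sum>l\<in>I. c l * expectation (B (\<tau> l)))"
    unfolding Z_def using integrable_B \<tau>(2) by (subst Bochner_Integration.integral_sum) auto
  also have "\<dots> = 0" using expectation_B \<tau>(2) by (intro sum.neutral) auto
  finally have E: "expectation Z = 0" .
  note c = centered_gaussian_facts[OF prob_space_axioms _ *(2,1) E]
  show "integrable M (\<lambda>\<omega>. (1 + \<bar>Z \<omega>\<bar>) ^ N)"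
    "expectation (\<lambda>\<omega>. (Z \<omega>)^4) = 3 * (expectation (\<lambda>\<omega>. (Z \<omega>)\<^sup>2))\<^sup>2"
    "expectation (\<lambda>\<omega>. cos (Z \<omega> + \<gamma>)) = cos \<gamma> * exp (- expectation (\<lambda>\<omega>. (Z \<omega>)\<^sup>2) / 2)"
    by (rule c; simp)+
qed

end

section \<open>Functionals of polynomial growth\<close>

text \<open>Constant and degree stay hidden, which makes the class closed under the algebraic
  operations below. Since Gaussian vectors have all moments, membership gives integrability of each
  functional of the grid values without a separate estimate.\<close>

definition polybd :: "nat \<Rightarrow> ((nat \<Rightarrow> real) \<Rightarrow> 'b::real_normed_vector) \<Rightarrow> bool" where
  "polybd n F \<longleftrightarrow> (\<exists>K N. \<forall>y. norm (F y) \<le> K * (1 + (\<Sum>j\<le>n. \<bar>y j\<bar>)) ^ N)"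

lemma polybd_base: "1 \<le> 1 + (\<Sum>j\<le>n. \<bar>y j\<bar>)" for y :: "nat \<Rightarrow> real"
  by (simp add: sum_nonneg)

lemma polybd_bounded: "(\<And>y. norm (F y) \<le> c) \<Longrightarrow> polybd n F"
  unfolding polybd_def by (intro exI[of _ c] exI[of _ 0]) simp

lemma polybd_weaken:
  fixes y :: "nat \<Rightarrow> real"
  assumes "norm z \<le> K * (1 + (\<Sum>j\<le>n. \<bar>y j\<bar>)) ^ N" "K \<le> K'" "N \<le> N'"
  shows "norm z \<le> K' * (1 + (\<Sum>j\<le>n. \<bar>y j\<bar>)) ^ N'"
proof -
  let ?T = "1 + (\<Sum>j\<le>n. \<bar>y j\<bar>)"
  have T: "1 \<le> ?T" by (rule polybd_base)
  have "0 \<le> K * ?T ^ N" using assms(1) norm_ge_zero order_trans by blast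
  moreover have "0 < ?T ^ N" using T by (intro zero_less_power) linarith
  ultimately have "0 \<le> K" by (simp add: zero_le_mult_iff)
  then have "K * ?T ^ N \<le> K' * ?T ^ N'"
    using T assms by (intro mult_mono power_increasing) auto
  then show ?thesis using assms(1) by linarith
qed

lemma polybd_add: assumes "polybd n F" "polybd n G" shows "polybd n (\<lambda>y. F y + G y)"
proof -
  obtain K N L m where *: "\<And>y. norm (F y) \<le> K * (1 + (\<Sum>j\<le>n. \<bar>y j\<bar>)) ^ N" "\<And>y. norm (G y) \<le> L * (1 + (\<Sum>j\<le>n. \<bar>y j\<bar>)) ^ m"
    using assms unfolding polybd_def by blast
  have "norm (F y + G y) \<le> (max K L + max K L) * (1 + (\<Sum>j\<le>n. \<bar>y j\<bar>)) ^ (max N m)" for y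
    using polybd_weaken[OF *(1)[of y], of "max K L" "max N m"] polybd_weaken[OF *(2)[of y], of "max K L" "max N m"] norm_triangle_ineq[of "F y" "G y"]
    by (simp add: distrib_right)
  then show ?thesis unfolding polybd_def by blast
qed

lemma polybd_mult:
  fixes F G :: "(nat \<Rightarrow> real) \<Rightarrow> 'b::real_normed_algebra"
  assumes "polybd n F" "polybd n G" shows "polybd n (\<lambda>y. F y * G y)"
proof -
  obtain K N L m where *: "\<And>y. norm (F y) \<le> K * (1 + (\<Sum>j\<le>n. \<bar>y j\<bar>)) ^ N" "\<And>y. norm (G y) \<le> L * (1 + (\<Sum>j\<le>n. \<bar>y j\<bar>)) ^ m"
    using assms unfolding polybd_def by blast
  have "norm (F y * G y) \<le> (K * L) * (1 + (\<Sum>j\<le>n. \<bar>y j\<bar>)) ^ (N + m)" for y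
  proof -
    have "norm (F y * G y) \<le> norm (F y) * norm (G y)" by (rule norm_mult_ineq)
    also have "\<dots> \<le> (K * (1 + (\<Sum>j\<le>n. \<bar>y j\<bar>)) ^ N) * (L * (1 + (\<Sum>j\<le>n. \<bar>y j\<bar>)) ^ m)"
      by (intro mult_mono * order_trans[OF norm_ge_zero *(1)]) auto
    finally show ?thesis by (simp only: power_add mult_ac)
  qed
  then show ?thesis unfolding polybd_def by blast
qed

lemma polybd_sum: "(\<And>i. i \<in> I \<Longrightarrow> polybd n (F i)) \<Longrightarrow> polybd n (\<lambda>y. \<Sum>i\<in>I. F i y)"
proof (induction I rule: infinite_finite_induct)
  case (insert i I)
  then show ?case by (simp add: polybd_add)
qed (auto intro!: polybd_bounded[of _ 0])

lemma polybd_coord: "j \<le> n \<Longrightarrow> polybd n (\<lambda>y. y j)"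
  unfolding polybd_def
proof (intro exI allI)
  fix y :: "nat \<Rightarrow> real" assume "j \<le> n"
  then show "norm (y j) \<le> 1 * (1 + (\<Sum>j\<le>n. \<bar>y j\<bar>)) ^ 1"
    using member_le_sum[of j "{..n}" "\<lambda>j. \<bar>y j\<bar>"] by simp
qed

lemma polybd_norm_le: "polybd n G \<Longrightarrow> (\<And>y. norm (F y) \<le> norm (G y)) \<Longrightarrow> polybd n F"
  unfolding polybd_def by (meson order_trans)

lemma polybd_uminus: "polybd n F \<Longrightarrow> polybd n (\<lambda>y. - F y)"
  by (erule polybd_norm_le) simp

lemma polybd_diff: "polybd n F \<Longrightarrow> polybd n G \<Longrightarrow> polybd n (\<lambda>y. F y - G y)"
  using polybd_add[OF _ polybd_uminus, of n F G] by simp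

lemma polybd_of_real: "polybd n F \<Longrightarrow> polybd n (\<lambda>y. of_real (F y) :: complex)"
  by (erule polybd_norm_le) simp

lemma polybd_power: "polybd n F \<Longrightarrow> polybd n (\<lambda>y. F y ^ m)" for F :: "_ \<Rightarrow> 'b::real_normed_field"
proof (induction m)
  case (Suc m)
  then show ?case by (simp add: polybd_mult)
qed (auto intro!: polybd_bounded[of _ 1])

lemma polybd_divide: "polybd n F \<Longrightarrow> polybd n (\<lambda>y. F y / d)" for F :: "_ \<Rightarrow> 'b::real_normed_field"
  using polybd_mult[of n F "\<lambda>_. inverse d", OF _ polybd_bounded[of _ "norm (inverse d)"]] by (simp add: field_simps)

lemma polybd_const: "polybd n (\<lambda>_. z)"
  by (rule polybd_bounded) (rule order_refl)

lemmas polybd_intros = polybd_const polybd_add polybd_mult polybd_sum polybd_coord polybd_uminus polybd_diff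
  polybd_of_real polybd_power polybd_divide

section \<open>Covariances on the grid\<close>

text \<open>The first difference of the square root of the distance. It is the part of the
  covariance between an increment and a grid value that depends on their distance; the other part,
  \<open>sqrt_inc\<close>, depends on the position of the increment.\<close>

definition hinc :: "int \<Rightarrow> real" where
  "hinc j = sqrt \<bar>real_of_int j\<bar> - sqrt \<bar>real_of_int j - 1\<bar>"

lemma hinc_Suc: "hinc (int (Suc i)) = sqrt_inc i"
  by (simp add: hinc_def sqrt_inc_def add.commute)

lemma hinc_minus: "hinc (- int i) = - sqrt_inc i"
  by (simp add: hinc_def sqrt_inc_def)

lemma hinc_0: "hinc 0 = -1"
  using hinc_minus[of 0] by simp

lemma abs_hinc_le_1: "\<bar>hinc j\<bar> \<le> 1"
proof -
  have "(\<exists>i. j = int (Suc i)) \<or> (\<exists>i. j = - int i)"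
  proof (cases "0 < j")
    case True
    then have "j = int (Suc (nat (j - 1)))" by simp
    then show ?thesis by blast
  next
    case False
    then have "j = - int (nat (-j))" by simp
    then show ?thesis by blast
  qed
  then show ?thesis by (metis abs_minus_cancel abs_of_nonneg hinc_Suc hinc_minus sqrt_inc_le_1 sqrt_inc_nonneg)
qed

lemma hinc_diff: "hinc (j + 1) - hinc j = 2 * rho j"
  by (simp add: hinc_def rho_def)

text \<open>On either side of the diagonal the terms are values of \<open>sqrt_inc\<close>, whose
  sum telescopes to a square root.\<close>

lemma sum_abs_hinc:
  assumes "k < n" shows "(\<Sum>l<n. \<bar>hinc (int l - int k)\<bar>) \<le> 2 * sqrt n"
proof -
  have "(\<Sum>l<n. \<bar>hinc (int l - int k)\<bar>) = 1 + (\<Sum>j<n - Suc k. sqrt_inc j) + (\<Sum>j<k. sqrt_inc (Suc j))"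
    using sum_shift_int[OF assms, of "\<lambda>j. \<bar>hinc j\<bar>"]
    by (simp only: hinc_Suc hinc_minus hinc_0 abs_minus_cancel abs_one abs_of_nonneg[OF sqrt_inc_nonneg])
  also have "\<dots> = (\<Sum>j<n - Suc k. sqrt_inc j) + (\<Sum>j<Suc k. sqrt_inc j)"
    by (simp add: sum.lessThan_Suc_shift del: sum.lessThan_Suc)
  also have "\<dots> \<le> sqrt n + sqrt n"
    unfolding sum_sqrt_inc using assms by (intro add_mono) auto
  finally show ?thesis by simp
qed

lemma sum_hinc_sq:
  assumes "k < n" shows "(\<Sum>l<n. (hinc (int l - int k))\<^sup>2) \<le> 2 * (1 + ln n)"
proof -
  have "(\<Sum>l<n. (hinc (int l - int k))\<^sup>2) = 1 + (\<Sum>j<n - Suc k. (sqrt_inc j)\<^sup>2) + (\<Sum>j<k. (sqrt_inc (Suc j))\<^sup>2)"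
    using sum_shift_int[OF assms, of "\<lambda>j. (hinc j)\<^sup>2"]
    by (simp only: hinc_Suc hinc_minus hinc_0 power2_minus) simp
  also have "\<dots> = (\<Sum>j<n - Suc k. (sqrt_inc j)\<^sup>2) + (\<Sum>j<Suc k. (sqrt_inc j)\<^sup>2)"
    by (simp add: sum.lessThan_Suc_shift del: sum.lessThan_Suc)
  also have "\<dots> \<le> (\<Sum>j<n. (sqrt_inc j)\<^sup>2) + (\<Sum>j<n. (sqrt_inc j)\<^sup>2)"
    using assms by (intro add_mono sum_mono2) auto
  also have "\<dots> \<le> 2 * (1 + ln n)" using sum_sqrt_inc_sq[of n] assms by simp
  finally show ?thesis .
qed

locale fbm_grid = quarter_fbm +
  fixes n :: nat
  assumes n_pos: "0 < n"
begin

text \<open>The reciprocal of the standard deviation of one increment, whose variance is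
  \<open>1 / sqrt n\<close>; the \<open>Xf l\<close> are thus unit Gaussians.\<close>

definition q :: real where "q = real n powr (1/4)"

definition bv :: "'a \<Rightarrow> nat \<Rightarrow> real" where
  "bv \<omega> = (\<lambda>j\<in>{..n}. B (real j / real n) \<omega>)"

definition Xf :: "nat \<Rightarrow> (nat \<Rightarrow> real) \<Rightarrow> real" where
  "Xf l y = q * (y (Suc l) - y l)"

text \<open>The covariance of the normalised increment \<open>k\<close> with the grid value
  \<open>l\<close>, as \<open>expectation_X_b\<close> shows. As a vector in \<open>l\<close> it is
  also the direction along which functionals are differentiated when integrating by parts in the
  increment \<open>k\<close>.\<close>

definition wt :: "nat \<Rightarrow> nat \<Rightarrow> real" where
  "wt k l = (sqrt_inc k + hinc (int l - int k)) / (2 * q)"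

definition cr :: "nat \<Rightarrow> nat \<Rightarrow> real" where
  "cr k l = rho (int l - int k)"

definition la :: real where "la = 1 + ln (real n)"

lemma q_ge_1: "1 \<le> q" unfolding q_def using n_pos by (simp add: ge_one_powr_ge_zero)

lemma q_sq: "q * q = sqrt (real n)"
  unfolding q_def using n_pos by (simp add: powr_add[symmetric] powr_half_sqrt)

lemma la_ge_1: "1 \<le> la" unfolding la_def using n_pos by simp

lemma bv_apply: "j \<le> n \<Longrightarrow> bv \<omega> j = B (real j / real n) \<omega>"
  by (simp add: bv_def)

lemma grid_time: "j \<le> n \<Longrightarrow> real j / real n \<in> {0..1}"
  using n_pos by simp

lemma measurable_bv: "bv \<in> measurable M (Pi\<^sub>M {..n} (\<lambda>_. borel))"
  unfolding bv_def by (rule measurable_restrict) (auto intro: measurable_B grid_time)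

lemma measurable_bv_compose: "F \<in> borel_measurable (Pi\<^sub>M {..n} (\<lambda>_. borel)) \<Longrightarrow> (\<lambda>\<omega>. F (bv \<omega>)) \<in> borel_measurable M"
  using measurable_comp[OF measurable_bv] by (simp add: comp_def)

lemma inj_grid: "inj_on (\<lambda>j. real j / real n) {..n}"
  using n_pos by (auto simp: inj_on_def)

lemma gaussian_bv:
  "integrable M (\<lambda>\<omega>. (1 + \<bar>\<Sum>j\<le>n. c j * bv \<omega> j\<bar>) ^ N)"
  "expectation (\<lambda>\<omega>. (\<Sum>j\<le>n. c j * bv \<omega> j)^4) = 3 * (expectation (\<lambda>\<omega>. (\<Sum>j\<le>n. c j * bv \<omega> j)\<^sup>2))\<^sup>2"
  "expectation (\<lambda>\<omega>. cos ((\<Sum>j\<le>n. c j * bv \<omega> j) + \<gamma>)) = cos \<gamma> * exp (- expectation (\<lambda>\<omega>. (\<Sum>j\<le>n. c j * bv \<omega> j)\<^sup>2) / 2)"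
proof -
  have e: "(\<Sum>j\<le>n. c j * bv \<omega> j) = (\<Sum>j\<le>n. c j * B (real j / real n) \<omega>)" for \<omega>
    by (intro sum.cong) (auto simp: bv_apply)
  have s: "(\<lambda>j. real j / real n) ` {..n} \<subseteq> {0..1}" using grid_time by auto
  show "integrable M (\<lambda>\<omega>. (1 + \<bar>\<Sum>j\<le>n. c j * bv \<omega> j\<bar>) ^ N)"
    "expectation (\<lambda>\<omega>. (\<Sum>j\<le>n. c j * bv \<omega> j)^4) = 3 * (expectation (\<lambda>\<omega>. (\<Sum>j\<le>n. c j * bv \<omega> j)\<^sup>2))\<^sup>2"
    "expectation (\<lambda>\<omega>. cos ((\<Sum>j\<le>n. c j * bv \<omega> j) + \<gamma>)) = cos \<gamma> * exp (- expectation (\<lambda>\<omega>. (\<Sum>j\<le>n. c j * bv \<omega> j)\<^sup>2) / 2)"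
    unfolding e by (rule gaussian_sum[OF _ inj_grid s]; simp)+
qed

lemma integrable_bv_power: "integrable M (\<lambda>\<omega>. (1 + (\<Sum>j\<le>n. \<bar>bv \<omega> j\<bar>)) ^ N)"
proof -
  have m: "(\<lambda>\<omega>. bv \<omega> j) \<in> borel_measurable M" if "j \<le> n" for j
    by (rule measurable_bv_compose) (use that in simp)
  \<comment> \<open>Bounding all coordinates by the largest one replaces the power of a sum by a sum
    of powers, each integrable by the one-dimensional moments.\<close>
  have pw: "(1 + (\<Sum>j\<in>S. \<bar>bv \<omega> j\<bar>)) ^ N \<le> (real (card S) + 1) ^ N * (1 + (\<Sum>j\<in>S. (1 + \<bar>bv \<omega> j\<bar>) ^ N))" if "finite S" for S \<omega>
  proof -
    define m where "m = Max (insert 0 ((\<lambda>j. \<bar>bv \<omega> j\<bar>) ` S))"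
    have m0: "0 \<le> m" and mj: "\<And>j. j \<in> S \<Longrightarrow> \<bar>bv \<omega> j\<bar> \<le> m" unfolding m_def using that by auto
    have "(\<Sum>j\<in>S. \<bar>bv \<omega> j\<bar>) \<le> real (card S) * m" using sum_bounded_above[of S "\<lambda>j. \<bar>bv \<omega> j\<bar>" m] mj by simp
    then have "1 + (\<Sum>j\<in>S. \<bar>bv \<omega> j\<bar>) \<le> (real (card S) + 1) * (1 + m)" using m0 by (simp add: algebra_simps)
    then have "(1 + (\<Sum>j\<in>S. \<bar>bv \<omega> j\<bar>)) ^ N \<le> ((real (card S) + 1) * (1 + m)) ^ N"
      by (intro power_mono) (auto intro!: add_nonneg_nonneg sum_nonneg)
    also have "\<dots> = (real (card S) + 1) ^ N * (1 + m) ^ N" by (rule power_mult_distrib)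
    also have "(1 + m) ^ N \<le> 1 + (\<Sum>j\<in>S. (1 + \<bar>bv \<omega> j\<bar>) ^ N)"
    proof (cases "m = 0")
      case True then show ?thesis by (simp add: sum_nonneg)
    next
      case False
      have "m \<in> insert 0 ((\<lambda>j. \<bar>bv \<omega> j\<bar>) ` S)" unfolding m_def using that by (intro Max_in) auto
      then obtain j where j: "j \<in> S" "m = \<bar>bv \<omega> j\<bar>" using False by auto
      then show ?thesis using member_le_sum[of j S "\<lambda>j. (1 + \<bar>bv \<omega> j\<bar>) ^ N"] that by simp
    qed
    finally show ?thesis by (simp add: mult_left_mono)
  qed
  show ?thesis
  proof (rule Bochner_Integration.integrable_bound)
    show "integrable M (\<lambda>\<omega>. (real (card {..n}) + 1) ^ N * (1 + (\<Sum>j\<le>n. (1 + \<bar>bv \<omega> j\<bar>) ^ N)))"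
      using integrable_B_power grid_time by (auto simp: bv_apply intro!: Bochner_Integration.integrable_add Bochner_Integration.integrable_sum)
    show "(\<lambda>\<omega>. (1 + (\<Sum>j\<le>n. \<bar>bv \<omega> j\<bar>)) ^ N) \<in> borel_measurable M" using m by measurable
    show "AE \<omega> in M. norm ((1 + (\<Sum>j\<le>n. \<bar>bv \<omega> j\<bar>)) ^ N) \<le> norm ((real (card {..n}) + 1) ^ N * (1 + (\<Sum>j\<le>n. (1 + \<bar>bv \<omega> j\<bar>) ^ N)))"
    proof (intro AE_I2)
      fix \<omega>
      have "0 \<le> (1 + (\<Sum>j\<le>n. \<bar>bv \<omega> j\<bar>)) ^ N" by (intro zero_le_power add_nonneg_nonneg sum_nonneg) auto
      then show "norm ((1 + (\<Sum>j\<le>n. \<bar>bv \<omega> j\<bar>)) ^ N) \<le> norm ((real (card {..n}) + 1) ^ N * (1 + (\<Sum>j\<le>n. (1 + \<bar>bv \<omega> j\<bar>) ^ N)))"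
        using pw[of "{..n}" \<omega>] by simp
    qed
  qed
qed

lemma integrable_polybd:
  fixes F :: "(nat \<Rightarrow> real) \<Rightarrow> 'b::{banach, second_countable_topology}"
  assumes "polybd n F" "F \<in> borel_measurable (Pi\<^sub>M {..n} (\<lambda>_. borel))"
  shows "integrable M (\<lambda>\<omega>. F (bv \<omega>))"
proof -
  obtain K N where *: "\<And>y. norm (F y) \<le> K * (1 + (\<Sum>j\<le>n. \<bar>y j\<bar>)) ^ N" using assms(1) unfolding polybd_def by blast
  show ?thesis
    by (rule Bochner_Integration.integrable_bound[OF integrable_mult_right[OF integrable_bv_power[of N], of K] measurable_bv_compose[OF assms(2)]])
       (intro AE_I2, rule order_trans[OF *], simp)
qed

lemma cov_bv: "i \<le> n \<Longrightarrow> j \<le> n \<Longrightarrow> expectation (\<lambda>\<omega>. bv \<omega> i * bv \<omega> j) = (sqrt (real i) + sqrt (real j) - sqrt \<bar>real j - real i\<bar>) / (2 * sqrt (real n))"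
proof -
  assume ij: "i \<le> n" "j \<le> n"
  have "\<bar>real j / real n - real i / real n\<bar> = \<bar>real j - real i\<bar> / real n"
    using n_pos by (simp add: diff_divide_distrib[symmetric])
  then show ?thesis
    using cov_B[OF grid_time[OF ij(1)] grid_time[OF ij(2)]] ij n_pos
    by (simp add: bv_apply real_sqrt_divide add_divide_distrib diff_divide_distrib)
qed

lemma measurable_Xf: "l < n \<Longrightarrow> Xf l \<in> borel_measurable (Pi\<^sub>M {..n} (\<lambda>_. borel))"
  unfolding Xf_def by simp

lemma measurable_coord: "l \<le> n \<Longrightarrow> (\<lambda>y. y l) \<in> borel_measurable (Pi\<^sub>M {..n} (\<lambda>_. borel))"
  by simp

lemma polybd_Xf: "l < n \<Longrightarrow> polybd n (Xf l)"
  unfolding Xf_def by (intro polybd_intros) auto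

lemma expectation_X_b: "k < n \<Longrightarrow> l \<le> n \<Longrightarrow> expectation (\<lambda>\<omega>. Xf k (bv \<omega>) * bv \<omega> l) = wt k l"
proof -
  assume kl: "k < n" "l \<le> n"
  have i: "integrable M (\<lambda>\<omega>. bv \<omega> i * bv \<omega> l)" if "i \<le> n" for i
    by (rule integrable_polybd[of "\<lambda>y. y i * y l"]) (use that kl in \<open>auto intro!: polybd_intros\<close>)
  have "expectation (\<lambda>\<omega>. Xf k (bv \<omega>) * bv \<omega> l) = expectation (\<lambda>\<omega>. q * (bv \<omega> (Suc k) * bv \<omega> l) - q * (bv \<omega> k * bv \<omega> l))"
    by (simp add: Xf_def algebra_simps)
  also have "\<dots> = q * expectation (\<lambda>\<omega>. bv \<omega> (Suc k) * bv \<omega> l) - q * expectation (\<lambda>\<omega>. bv \<omega> k * bv \<omega> l)"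
    using i kl by (subst Bochner_Integration.integral_diff) auto
  also have "\<dots> = q * ((sqrt_inc k + hinc (int l - int k)) / (2 * (q * q)))"
  proof -
    have "hinc (int l - int k) = sqrt \<bar>real l - real k\<bar> - sqrt \<bar>real l - real (Suc k)\<bar>"
      by (simp add: hinc_def)
    then show ?thesis using kl by (simp add: cov_bv q_sq sqrt_inc_def right_diff_distrib[symmetric] diff_divide_distrib[symmetric] add.commute)
  qed
  also have "\<dots> = wt k l" using q_ge_1 by (simp add: wt_def)
  finally show ?thesis .
qed

text \<open>When all grid values move along \<open>wt k\<close>, the increment \<open>l\<close>
  moves with speed \<open>cr k l\<close>. Correlations of increments therefore arise as derivatives
  of \<open>Xf l\<close>.\<close>

lemma wt_diff: "q * (wt k (Suc l) - wt k l) = cr k l"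
proof -
  have "hinc (int (Suc l) - int k) - hinc (int l - int k) = 2 * rho (int l - int k)"
    using hinc_diff[of "int l - int k"] by (simp add: algebra_simps)
  then have "wt k (Suc l) - wt k l = 2 * rho (int l - int k) / (2 * q)"
    by (simp add: wt_def diff_divide_distrib[symmetric])
  then show ?thesis using q_ge_1 by (simp add: cr_def)
qed

lemma expectation_X_X: "k < n \<Longrightarrow> l < n \<Longrightarrow> expectation (\<lambda>\<omega>. Xf k (bv \<omega>) * Xf l (bv \<omega>)) = cr k l"
proof -
  assume kl: "k < n" "l < n"
  have i: "integrable M (\<lambda>\<omega>. Xf k (bv \<omega>) * bv \<omega> j)" if "j \<le> n" for j
    using that kl by (intro integrable_polybd[of "\<lambda>y. Xf k y * y j"] polybd_mult polybd_coord polybd_Xf borel_measurable_times measurable_Xf measurable_coord)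
  have "expectation (\<lambda>\<omega>. Xf k (bv \<omega>) * Xf l (bv \<omega>)) = expectation (\<lambda>\<omega>. q * (Xf k (bv \<omega>) * bv \<omega> (Suc l)) - q * (Xf k (bv \<omega>) * bv \<omega> l))"
    by (simp add: Xf_def[of l] algebra_simps)
  also have "\<dots> = q * wt k (Suc l) - q * wt k l"
    using i kl expectation_X_b by (subst Bochner_Integration.integral_diff) auto
  also have "\<dots> = cr k l" using wt_diff[of k l] by (simp add: algebra_simps)
  finally show ?thesis .
qed

definition ca :: "nat \<Rightarrow> nat \<Rightarrow> real" where
  "ca k j = (if j = Suc k then q else if j = k then - q else 0)"

lemma sum_ca: "k < n \<Longrightarrow> (\<Sum>j\<le>n. ca k j * y j) = Xf k y"
proof -
  assume k: "k < n"
  have "(\<Sum>j\<le>n. ca k j * y j) = (\<Sum>j\<in>{k, Suc k}. ca k j * y j)"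
    using k by (intro sum.mono_neutral_right) (auto simp: ca_def)
  also have "\<dots> = Xf k y" by (simp add: ca_def Xf_def algebra_simps)
  finally show ?thesis .
qed

lemma X_moments:
  assumes "k < n"
  shows "expectation (\<lambda>\<omega>. (Xf k (bv \<omega>))\<^sup>2) = 1" "expectation (\<lambda>\<omega>. (Xf k (bv \<omega>))^4) = 3"
    "expectation (\<lambda>\<omega>. ((Xf k (bv \<omega>))\<^sup>2 - 1)\<^sup>2) = 2"
    "expectation (\<lambda>\<omega>. \<bar>Xf k (bv \<omega>)\<bar>) \<le> 1" "expectation (\<lambda>\<omega>. \<bar>(Xf k (bv \<omega>))\<^sup>2 - 1\<bar>) \<le> 2"
proof -
  have i: "integrable M (\<lambda>\<omega>. (Xf k (bv \<omega>)) ^ m)" for m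
    by (intro integrable_polybd[of "\<lambda>y. Xf k y ^ m"] polybd_power polybd_Xf borel_measurable_power measurable_Xf assms)
  have i1: "integrable M (\<lambda>\<omega>. Xf k (bv \<omega>))" using i[of 1] by simp
  show 2: "expectation (\<lambda>\<omega>. (Xf k (bv \<omega>))\<^sup>2) = 1"
    using expectation_X_X[OF assms assms] by (simp add: power2_eq_square cr_def)
  show 4: "expectation (\<lambda>\<omega>. (Xf k (bv \<omega>))^4) = 3"
    using gaussian_bv(2)[of "ca k"] 2 unfolding sum_ca[OF assms] by simp
  have "expectation (\<lambda>\<omega>. ((Xf k (bv \<omega>))\<^sup>2 - 1)\<^sup>2) = expectation (\<lambda>\<omega>. (Xf k (bv \<omega>))^4 - 2 * (Xf k (bv \<omega>))\<^sup>2 + 1)"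
    by (intro Bochner_Integration.integral_cong refl) (simp add: power2_diff power_mult[symmetric])
  also have "\<dots> = 3 - 2 * 1 + 1" using i 2 4 prob_space by simp
  finally show "expectation (\<lambda>\<omega>. ((Xf k (bv \<omega>))\<^sup>2 - 1)\<^sup>2) = 2" by simp
  have "expectation (\<lambda>\<omega>. \<bar>Xf k (bv \<omega>)\<bar>) \<le> expectation (\<lambda>\<omega>. ((Xf k (bv \<omega>))\<^sup>2 + 1) / 2)"
  proof (intro integral_mono)
    fix \<omega>
    show "\<bar>Xf k (bv \<omega>)\<bar> \<le> ((Xf k (bv \<omega>))\<^sup>2 + 1) / 2"
      using zero_le_power2[of "\<bar>Xf k (bv \<omega>)\<bar> - 1"] by (simp add: power2_diff)
  qed (use i i1 in auto)
  also have "\<dots> = 1" using i 2 prob_space by simp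
  finally show "expectation (\<lambda>\<omega>. \<bar>Xf k (bv \<omega>)\<bar>) \<le> 1" .
  have "expectation (\<lambda>\<omega>. \<bar>(Xf k (bv \<omega>))\<^sup>2 - 1\<bar>) \<le> expectation (\<lambda>\<omega>. (Xf k (bv \<omega>))\<^sup>2 + 1)"
  proof (intro integral_mono)
    fix \<omega>
    show "\<bar>(Xf k (bv \<omega>))\<^sup>2 - 1\<bar> \<le> (Xf k (bv \<omega>))\<^sup>2 + 1"
      using zero_le_power2[of "Xf k (bv \<omega>)"] by linarith
  qed (use i in auto)
  also have "\<dots> = 2" using i 2 prob_space by simp
  finally show "expectation (\<lambda>\<omega>. \<bar>(Xf k (bv \<omega>))\<^sup>2 - 1\<bar>) \<le> 2" .
qed

lemma abs_wt_le: "\<bar>wt k l\<bar> \<le> (sqrt_inc k + \<bar>hinc (int l - int k)\<bar>) / (2 * q)"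
  using q_ge_1 sqrt_inc_nonneg[of k] by (simp add: wt_def divide_right_mono)

lemma abs_wt_le': "\<bar>wt k l\<bar> \<le> 1 / q"
proof -
  have "(sqrt_inc k + \<bar>hinc (int l - int k)\<bar>) / (2 * q) \<le> 2 / (2 * q)"
    using q_ge_1 sqrt_inc_le_1[of k] abs_hinc_le_1[of "int l - int k"] by (intro divide_right_mono) auto
  then show ?thesis using abs_wt_le[of k l] by simp
qed

lemma wt_sq_le: "(wt k l)\<^sup>2 \<le> ((sqrt_inc k)\<^sup>2 + (hinc (int l - int k))\<^sup>2) / (2 * sqrt n)"
proof -
  have "(wt k l)\<^sup>2 = (sqrt_inc k + hinc (int l - int k))\<^sup>2 / (4 * (q * q))"
    by (simp add: wt_def power_divide power2_eq_square)
  also have "\<dots> \<le> (2 * (sqrt_inc k)\<^sup>2 + 2 * (hinc (int l - int k))\<^sup>2) / (4 * (q * q))"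
    using q_ge_1 zero_le_power2[of "sqrt_inc k - hinc (int l - int k)"]
    by (intro divide_right_mono) (auto simp: power2_sum power2_diff)
  also have "\<dots> = ((sqrt_inc k)\<^sup>2 + (hinc (int l - int k))\<^sup>2) / (2 * sqrt n)"
  proof -
    have "(2 * u + 2 * v) / (4 * z) = (u + v) / (2 * z)" for u v z :: real
      using mult_divide_mult_cancel_left[of 2 "u + v" "2 * z"] by (simp add: distrib_left)
    then show ?thesis unfolding q_sq .
  qed
  finally show ?thesis .
qed

lemma sum_wt_sq: "k < n \<Longrightarrow> (\<Sum>l<n. (wt k l)\<^sup>2) \<le> (n * (sqrt_inc k)\<^sup>2 + 2 * la) / (2 * sqrt n)"
proof -
  assume k: "k < n"
  have "(\<Sum>l<n. (wt k l)\<^sup>2) \<le> (\<Sum>l<n. ((sqrt_inc k)\<^sup>2 + (hinc (int l - int k))\<^sup>2) / (2 * sqrt n))"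
    by (intro sum_mono wt_sq_le)
  also have "\<dots> = (n * (sqrt_inc k)\<^sup>2 + (\<Sum>l<n. (hinc (int l - int k))\<^sup>2)) / (2 * sqrt n)"
    by (simp add: sum_divide_distrib[symmetric] sum.distrib)
  also have "\<dots> \<le> (n * (sqrt_inc k)\<^sup>2 + 2 * la) / (2 * sqrt n)"
    using sum_hinc_sq[OF k] by (intro divide_right_mono) (auto simp: la_def)
  finally show ?thesis .
qed

text \<open>The crude estimate \<open>abs_wt_le'\<close> gives \<open>n * sqrt n\<close>. The decay
  of \<open>sqrt_inc\<close> in \<open>k\<close> and of \<open>hinc\<close> in the distance saves a
  factor \<open>n\<close> up to the logarithm.\<close>

lemma sum_sum_wt_sq: "(\<Sum>k<n. \<Sum>l<n. (wt k l)\<^sup>2) \<le> 3 / 2 * sqrt n * la"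
proof -
  have "(\<Sum>k<n. \<Sum>l<n. (wt k l)\<^sup>2) \<le> (\<Sum>k<n. (n * (sqrt_inc k)\<^sup>2 + 2 * la) / (2 * sqrt n))"
    by (intro sum_mono sum_wt_sq) auto
  also have "\<dots> = (n * (\<Sum>k<n. (sqrt_inc k)\<^sup>2) + n * (2 * la)) / (2 * sqrt n)"
    by (simp add: sum_divide_distrib[symmetric] sum.distrib sum_distrib_left)
  also have "\<dots> \<le> (n * la + n * (2 * la)) / (2 * sqrt n)"
    using sum_sqrt_inc_sq[OF n_pos] by (intro divide_right_mono add_mono mult_left_mono) (auto simp: la_def)
  also have "\<dots> = 3 / 2 * (real n / sqrt n) * la"
  proof -
    have "(u * v + u * (2 * v)) / (2 * z) = 3 / 2 * (u / z) * v" for u v z :: real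
      by (cases "z = 0") (auto simp: field_simps)
    then show ?thesis .
  qed
  also have "real n / sqrt n = sqrt n" by (rule real_div_sqrt) simp
  finally show ?thesis .
qed

text \<open>In row \<open>k\<close> the position part contributes \<open>n * sqrt_inc k\<close>, the
  distance part only \<open>2 * sqrt n\<close>. After squaring, the first again leads to the
  harmonic sum, while the second gives the summand 4.\<close>

lemma sum_sum_abs_wt_sq: "(\<Sum>k<n. (\<Sum>l<n. \<bar>wt k l\<bar>)\<^sup>2) \<le> n * sqrt n * (la + 4) / 2"
proof -
  have "(\<Sum>l<n. \<bar>wt k l\<bar>)\<^sup>2 \<le> (real n * real n * (sqrt_inc k)\<^sup>2 + 4 * n) / (2 * sqrt n)" if k: "k < n" for k
  proof -
    have "(\<Sum>l<n. \<bar>wt k l\<bar>) \<le> (\<Sum>l<n. (sqrt_inc k + \<bar>hinc (int l - int k)\<bar>) / (2 * q))"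
      by (intro sum_mono abs_wt_le)
    also have "\<dots> = (n * sqrt_inc k + (\<Sum>l<n. \<bar>hinc (int l - int k)\<bar>)) / (2 * q)"
      by (simp add: sum_divide_distrib[symmetric] sum.distrib)
    also have "\<dots> \<le> (n * sqrt_inc k + 2 * sqrt n) / (2 * q)"
      using sum_abs_hinc[OF k] q_ge_1 by (intro divide_right_mono) auto
    finally have "(\<Sum>l<n. \<bar>wt k l\<bar>)\<^sup>2 \<le> ((n * sqrt_inc k + 2 * sqrt n) / (2 * q))\<^sup>2"
      by (intro power_mono) (auto intro: sum_nonneg)
    also have "\<dots> = (n * sqrt_inc k + 2 * sqrt n)\<^sup>2 / (4 * (q * q))"
      by (simp add: power_divide power2_eq_square)
    also have "\<dots> \<le> (2 * (n * sqrt_inc k)\<^sup>2 + 2 * (2 * sqrt n)\<^sup>2) / (4 * (q * q))"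
      using q_ge_1 zero_le_power2[of "n * sqrt_inc k - 2 * sqrt n"]
      by (intro divide_right_mono) (auto simp: power2_sum power2_diff)
    also have "\<dots> = (real n * real n * (sqrt_inc k)\<^sup>2 + 4 * n) / (2 * sqrt n)"
    proof -
      have 1: "(real n * sqrt_inc k)\<^sup>2 = real n * real n * (sqrt_inc k)\<^sup>2" by (simp add: power2_eq_square)
      have 2: "(2 * sqrt (real n))\<^sup>2 = 4 * real n" by (simp add: power_mult_distrib)
      have 3: "(2 * u + 2 * v) / (4 * z) = (u + v) / (2 * z)" for u v z :: real
        using mult_divide_mult_cancel_left[of 2 "u + v" "2 * z"] by (simp add: distrib_left)
      show ?thesis by (simp only: 1 2 3 q_sq of_nat_mult of_nat_numeral)
    qed
    finally show ?thesis .
  qed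
  then have "(\<Sum>k<n. (\<Sum>l<n. \<bar>wt k l\<bar>)\<^sup>2) \<le> (\<Sum>k<n. (real n * real n * (sqrt_inc k)\<^sup>2 + 4 * n) / (2 * sqrt n))"
    by (intro sum_mono) auto
  also have "\<dots> = (real n * real n * (\<Sum>k<n. (sqrt_inc k)\<^sup>2) + n * (4 * n)) / (2 * sqrt n)"
    by (simp add: sum_divide_distrib[symmetric] sum.distrib sum_distrib_left)
  also have "\<dots> \<le> (real n * real n * la + n * (4 * n)) / (2 * sqrt n)"
    using sum_sqrt_inc_sq[OF n_pos] by (intro divide_right_mono add_mono mult_left_mono) (auto simp: la_def)
  also have "\<dots> = n * (real n / sqrt n) * (la + 4) / 2"
  proof -
    have "(u * u * v + u * (4 * u)) / (2 * z) = u * (u / z) * (v + 4) / 2" for u v z :: real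
      by (cases "z = 0") (auto simp: field_simps)
    then show ?thesis by simp
  qed
  also have "real n / sqrt n = sqrt n" by (rule real_div_sqrt) simp
  finally show ?thesis .
qed

lemma abs_cr_le_1: "\<bar>cr k l\<bar> \<le> 1"
  by (simp add: cr_def abs_rho_le_1)

lemma cr_commute: "cr k l = cr l k"
  using rho_minus[of "int l - int k"] by (simp add: cr_def)

lemma sum_abs_cr: "k < n \<Longrightarrow> (\<Sum>l<n. \<bar>cr k l\<bar>) \<le> 2"
  unfolding cr_def by (rule sum_abs_rho_row)

lemma shift_simps:
  "l \<le> n \<Longrightarrow> (\<lambda>j\<in>{..n}. v j + x * wt k j) l = v l + x * wt k l"
  "l < n \<Longrightarrow> Xf l (\<lambda>j\<in>{..n}. v j + x * wt k j) = Xf l v + x * cr k l"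
  using wt_diff[of k l] by (simp_all add: Xf_def algebra_simps)

text \<open>The formula for Gaussian vectors with the unit Gaussian \<open>Xf k\<close>, whose
  coefficients on the grid are \<open>ca k\<close> and whose covariances with the grid values are
  \<open>wt k\<close>.\<close>

lemma grid_ibp:
  fixes F F1 F2 :: "(nat \<Rightarrow> real) \<Rightarrow> complex"
  assumes k: "k < n"
    and mF: "F \<in> borel_measurable (Pi\<^sub>M {..n} (\<lambda>_. borel))" and mF2: "F2 \<in> borel_measurable (Pi\<^sub>M {..n} (\<lambda>_. borel))"
    and dF: "\<And>y x. ((\<lambda>x. F (\<lambda>j\<in>{..n}. y j + x * wt k j)) has_vector_derivative F1 (\<lambda>j\<in>{..n}. y j + x * wt k j)) (at x)"
    and dF1: "\<And>y x. ((\<lambda>x. F1 (\<lambda>j\<in>{..n}. y j + x * wt k j)) has_vector_derivative F2 (\<lambda>j\<in>{..n}. y j + x * wt k j)) (at x)"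
    and cF2: "\<And>y. continuous_on UNIV (\<lambda>x. F2 (\<lambda>j\<in>{..n}. y j + x * wt k j))"
    and bd: "polybd n F" "polybd n F1" "polybd n F2"
  shows "expectation (\<lambda>\<omega>. of_real ((Xf k (bv \<omega>))\<^sup>2 - 1) * F (bv \<omega>)) = expectation (\<lambda>\<omega>. F2 (bv \<omega>))"
proof -
  obtain K N K1 N1 K2 N2 where *: "\<And>y. norm (F y) \<le> K * (1 + (\<Sum>j\<le>n. \<bar>y j\<bar>)) ^ N"
      "\<And>y. norm (F1 y) \<le> K1 * (1 + (\<Sum>j\<le>n. \<bar>y j\<bar>)) ^ N1" "\<And>y. norm (F2 y) \<le> K2 * (1 + (\<Sum>j\<le>n. \<bar>y j\<bar>)) ^ N2"
    using bd unfolding polybd_def by metis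
  have r: "(\<lambda>j\<in>{..n}. bv \<omega> j) = bv \<omega>" for \<omega> by (auto simp: bv_def fun_eq_iff restrict_def)
  have "expectation (\<lambda>\<omega>. of_real ((\<Sum>j\<le>n. ca k j * bv \<omega> j)\<^sup>2 - 1) * F (\<lambda>j\<in>{..n}. bv \<omega> j)) = expectation (\<lambda>\<omega>. F2 (\<lambda>j\<in>{..n}. bv \<omega> j))"
  proof (rule gaussian_second_ibp[where b="\<lambda>j \<omega>. bv \<omega> j" and w="wt k" and ?F1.0=F1 and K="max K (max K1 K2)" and N="max N (max N1 N2)"])
    show "(\<lambda>\<omega>. bv \<omega> j) \<in> borel_measurable M" if "j \<in> {..n}" for j
      by (rule measurable_bv_compose) (use that in simp)
    show "expectation (\<lambda>\<omega>. (\<Sum>j\<le>n. ca k j * bv \<omega> j)\<^sup>2) = 1"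
      unfolding sum_ca[OF k] by (rule X_moments(1)[OF k])
    show "wt k j = expectation (\<lambda>\<omega>. (\<Sum>i\<le>n. ca k i * bv \<omega> i) * bv \<omega> j)" if "j \<in> {..n}" for j
      unfolding sum_ca[OF k] using expectation_X_b[OF k] that by simp
    show "cmod (F y) \<le> max K (max K1 K2) * (1 + (\<Sum>j\<le>n. \<bar>y j\<bar>)) ^ max N (max N1 N2)" for y
      by (rule polybd_weaken[OF *(1)]) auto
    show "cmod (F1 y) \<le> max K (max K1 K2) * (1 + (\<Sum>j\<le>n. \<bar>y j\<bar>)) ^ max N (max N1 N2)" for y
      by (rule polybd_weaken[OF *(2)]) auto
    show "cmod (F2 y) \<le> max K (max K1 K2) * (1 + (\<Sum>j\<le>n. \<bar>y j\<bar>)) ^ max N (max N1 N2)" for y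
      by (rule polybd_weaken[OF *(3)]) auto
  qed (rule prob_space_axioms finite_atMost gaussian_bv(3) integrable_bv_power mF mF2 dF dF1 cF2)+
  then show ?thesis unfolding r sum_ca[OF k] .
qed

end

section \<open>Interpolation between the quadratic variation and its limit\<close>

lemma DERIV_times_hermite2:
  fixes P X :: "real \<Rightarrow> real"
  assumes "(P has_real_derivative p) (at x)" "(X has_real_derivative r) (at x)"
  shows "((\<lambda>x. P x * ((X x)\<^sup>2 - 1)) has_real_derivative p * ((X x)\<^sup>2 - 1) + P x * (2 * r * X x)) (at x)"
  using assms by (auto intro!: derivative_eq_intros simp: algebra_simps)

lemma DERIV_times_hermite2':
  fixes P P1 X :: "real \<Rightarrow> real"
  assumes "(P has_real_derivative P1 x) (at x)" "(P1 has_real_derivative p2) (at x)" "(X has_real_derivative r) (at x)"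
  shows "((\<lambda>x. P1 x * ((X x)\<^sup>2 - 1) + P x * (2 * r * X x)) has_real_derivative
    p2 * ((X x)\<^sup>2 - 1) + 2 * P1 x * (2 * r * X x) + P x * (2 * r\<^sup>2)) (at x)"
  using assms by (auto intro!: derivative_eq_intros simp: algebra_simps power2_eq_square)

lemma DERIV_line:
  fixes g g1 :: "real \<Rightarrow> real"
  assumes "\<And>x. (g has_real_derivative g1 x) (at x)"
  shows "((\<lambda>x. g (v + x * w)) has_real_derivative g1 (v + x * w) * w) (at x)"
  by (rule DERIV_chain2[OF assms]) (auto intro!: derivative_eq_intros)

lemma continuous_on_line:
  fixes g :: "real \<Rightarrow> real"
  assumes "continuous_on UNIV g"
  shows "continuous_on UNIV (\<lambda>x. g (v + x * w))"
  by (rule continuous_on_compose2[OF assms]) (auto intro!: continuous_intros)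

lemma DERIV_continuous_on_UNIV: "(\<And>x. (g has_real_derivative g1 x) (at x)) \<Longrightarrow> continuous_on UNIV g"
  by (meson DERIV_isCont continuous_at_imp_continuous_on)

lemma sum_weighted_square:
  fixes a x :: "'b \<Rightarrow> real"
  assumes "\<And>i. i \<in> I \<Longrightarrow> 0 \<le> a i"
  shows "(\<Sum>i\<in>I. a i * x i)\<^sup>2 \<le> (\<Sum>i\<in>I. a i) * (\<Sum>i\<in>I. a i * (x i)\<^sup>2)"
proof -
  have "(\<Sum>i\<in>I. a i * x i) = (\<Sum>i\<in>I. sqrt (a i) * (sqrt (a i) * x i))"
    using assms by (intro sum.cong refl) (simp add: mult.assoc[symmetric])
  also have "\<dots>\<^sup>2 \<le> (\<Sum>i\<in>I. (sqrt (a i))\<^sup>2) * (\<Sum>i\<in>I. (sqrt (a i) * x i)\<^sup>2)"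
    by (rule Cauchy_Schwarz_ineq_sum)
  also have "\<dots> = (\<Sum>i\<in>I. a i) * (\<Sum>i\<in>I. a i * (x i)\<^sup>2)"
    using assms by (simp add: power_mult_distrib cong: sum.cong)
  finally show ?thesis .
qed

context fbm_grid
begin

lemma grid_ibp_real:
  fixes F F1 F2 :: "(nat \<Rightarrow> real) \<Rightarrow> real"
  assumes k: "k < n"
    and mF: "F \<in> borel_measurable (Pi\<^sub>M {..n} (\<lambda>_. borel))" and mF2: "F2 \<in> borel_measurable (Pi\<^sub>M {..n} (\<lambda>_. borel))"
    and dF: "\<And>y x. ((\<lambda>x. F (\<lambda>j\<in>{..n}. y j + x * wt k j)) has_real_derivative F1 (\<lambda>j\<in>{..n}. y j + x * wt k j)) (at x)"
    and dF1: "\<And>y x. ((\<lambda>x. F1 (\<lambda>j\<in>{..n}. y j + x * wt k j)) has_real_derivative F2 (\<lambda>j\<in>{..n}. y j + x * wt k j)) (at x)"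
    and cF2: "\<And>y. continuous_on UNIV (\<lambda>x. F2 (\<lambda>j\<in>{..n}. y j + x * wt k j))"
    and bd: "polybd n F" "polybd n F1" "polybd n F2"
  shows "expectation (\<lambda>\<omega>. ((Xf k (bv \<omega>))\<^sup>2 - 1) * F (bv \<omega>)) = expectation (\<lambda>\<omega>. F2 (bv \<omega>))"
proof -
  have "expectation (\<lambda>\<omega>. of_real ((Xf k (bv \<omega>))\<^sup>2 - 1) * complex_of_real (F (bv \<omega>))) = expectation (\<lambda>\<omega>. complex_of_real (F2 (bv \<omega>)))"
  proof (rule grid_ibp[OF k, where F="\<lambda>y. complex_of_real (F y)" and ?F1.0="\<lambda>y. complex_of_real (F1 y)" and ?F2.0="\<lambda>y. complex_of_real (F2 y)"])
    show "((\<lambda>x. complex_of_real (F (\<lambda>j\<in>{..n}. y j + x * wt k j))) has_vector_derivative complex_of_real (F1 (\<lambda>j\<in>{..n}. y j + x * wt k j))) (at x)" for y x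
      by (rule has_vector_derivative_of_real[OF dF])
    show "((\<lambda>x. complex_of_real (F1 (\<lambda>j\<in>{..n}. y j + x * wt k j))) has_vector_derivative complex_of_real (F2 (\<lambda>j\<in>{..n}. y j + x * wt k j))) (at x)" for y x
      by (rule has_vector_derivative_of_real[OF dF1])
    show "continuous_on UNIV (\<lambda>x. complex_of_real (F2 (\<lambda>j\<in>{..n}. y j + x * wt k j)))" for y
      by (intro continuous_intros cF2)
    show "polybd n (\<lambda>y. complex_of_real (F y))" "polybd n (\<lambda>y. complex_of_real (F1 y))" "polybd n (\<lambda>y. complex_of_real (F2 y))"
      by (intro polybd_of_real bd)+
    show "(\<lambda>y. complex_of_real (F y)) \<in> borel_measurable (Pi\<^sub>M {..n} (\<lambda>_. borel))"
      "(\<lambda>y. complex_of_real (F2 y)) \<in> borel_measurable (Pi\<^sub>M {..n} (\<lambda>_. borel))"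
      using mF mF2 by measurable
  qed
  then have "complex_of_real (expectation (\<lambda>\<omega>. ((Xf k (bv \<omega>))\<^sup>2 - 1) * F (bv \<omega>))) = complex_of_real (expectation (\<lambda>\<omega>. F2 (bv \<omega>)))"
    by (simp only: of_real_mult[symmetric] integral_complex_of_real)
  then show ?thesis by (simp only: of_real_eq_iff)
qed

text \<open>One integration by parts already decouples the two factors up to the correlation
  of the increments and the squared correlation \<open>O(n\<^sup>-\<^sup>1\<^sup>/\<^sup>2)\<close> of an increment with the weights.\<close>

lemma kernel_bound:
  fixes g g1 g2 :: "real \<Rightarrow> real"
  assumes l: "l < n" and m: "m < n"
    and d1: "\<And>x. (g has_real_derivative g1 x) (at x)" and d2: "\<And>x. (g1 has_real_derivative g2 x) (at x)"
    and cg2: "continuous_on UNIV g2"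
    and bd: "\<And>x. \<bar>g x\<bar> \<le> c" "\<And>x. \<bar>g1 x\<bar> \<le> c" "\<And>x. \<bar>g2 x\<bar> \<le> c"
  shows "\<bar>expectation (\<lambda>\<omega>. (g (bv \<omega> l) * ((Xf l (bv \<omega>))\<^sup>2 - 1)) * (g (bv \<omega> m) * ((Xf m (bv \<omega>))\<^sup>2 - 1)))\<bar>
    \<le> 10 * c\<^sup>2 * (\<bar>cr l m\<bar> + 1 / sqrt n)"
proof -
  have c0: "0 \<le> c" using bd(1)[of 0] by linarith
  have cg: "continuous_on UNIV g" "continuous_on UNIV g1" using d1 d2 by (auto intro: DERIV_continuous_on_UNIV)
  have [measurable]: "g \<in> borel_measurable borel" "g1 \<in> borel_measurable borel" "g2 \<in> borel_measurable borel"
    using cg cg2 by (auto intro!: borel_measurable_continuous_onI)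
  \<comment> \<open>The integration by parts takes place in the increment \<open>m\<close>. Along
    its direction the increment \<open>l\<close> moves with speed \<open>r\<close>, the grid values
    \<open>l\<close> and \<open>m\<close> with speeds \<open>a\<close> and \<open>e\<close>, both at
    most \<open>1 / q\<close>.\<close>
  define r where "r = cr m l"
  define a where "a = wt m l"
  define e where "e = wt m m"
  have ae: "\<bar>a\<bar> \<le> 1 / q" "\<bar>e\<bar> \<le> 1 / q" unfolding a_def e_def by (rule abs_wt_le')+
  have q: "0 < q" "1 / q * (1 / q) = 1 / sqrt n" "1 / q \<le> 1" using q_ge_1 q_sq by auto
  define p where "p y = g (y l) * g (y m)" for y
  define p1 where "p1 y = (g1 (y l) * a) * g (y m) + g (y l) * (g1 (y m) * e)" for y
  define p2 where "p2 y = (g2 (y l) * a * a) * g (y m) + 2 * (g1 (y l) * a) * (g1 (y m) * e) + g (y l) * (g2 (y m) * e * e)" for y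
  define F where "F y = p y * ((Xf l y)\<^sup>2 - 1)" for y
  define F1 where "F1 y = p1 y * ((Xf l y)\<^sup>2 - 1) + p y * (2 * r * Xf l y)" for y
  define F2 where "F2 y = p2 y * ((Xf l y)\<^sup>2 - 1) + 2 * p1 y * (2 * r * Xf l y) + p y * (2 * r\<^sup>2)" for y
  have mc[measurable]: "(\<lambda>y. y l) \<in> borel_measurable (Pi\<^sub>M {..n} (\<lambda>_. borel))" "(\<lambda>y. y m) \<in> borel_measurable (Pi\<^sub>M {..n} (\<lambda>_. borel))"
    "Xf l \<in> borel_measurable (Pi\<^sub>M {..n} (\<lambda>_. borel))"
    using l m by (auto intro!: measurable_Xf)
  have mp[measurable]: "p \<in> borel_measurable (Pi\<^sub>M {..n} (\<lambda>_. borel))" "p1 \<in> borel_measurable (Pi\<^sub>M {..n} (\<lambda>_. borel))" "p2 \<in> borel_measurable (Pi\<^sub>M {..n} (\<lambda>_. borel))"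
    unfolding p_def p1_def p2_def by measurable
  have bp: "\<bar>p y\<bar> \<le> c\<^sup>2" for y
    unfolding p_def abs_mult power2_eq_square using c0 by (intro mult_mono bd) auto
  have bp1: "\<bar>p1 y\<bar> \<le> 2 * c\<^sup>2 * (1 / q)" for y
  proof -
    have "\<bar>p1 y\<bar> \<le> \<bar>g1 (y l)\<bar> * \<bar>a\<bar> * \<bar>g (y m)\<bar> + \<bar>g (y l)\<bar> * (\<bar>g1 (y m)\<bar> * \<bar>e\<bar>)"
      unfolding p1_def by (rule order_trans[OF abs_triangle_ineq]) (simp add: abs_mult)
    also have "\<dots> \<le> c * (1 / q) * c + c * (c * (1 / q))"
      using c0 q by (intro add_mono mult_mono bd ae) auto
    finally show ?thesis by (simp add: power2_eq_square)
  qed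
  have bp2: "\<bar>p2 y\<bar> \<le> 4 * c\<^sup>2 * (1 / sqrt n)" for y
  proof -
    have "\<bar>p2 y\<bar> \<le> \<bar>g2 (y l)\<bar> * \<bar>a\<bar> * \<bar>a\<bar> * \<bar>g (y m)\<bar> + 2 * (\<bar>g1 (y l)\<bar> * \<bar>a\<bar>) * (\<bar>g1 (y m)\<bar> * \<bar>e\<bar>) + \<bar>g (y l)\<bar> * (\<bar>g2 (y m)\<bar> * \<bar>e\<bar> * \<bar>e\<bar>)"
      unfolding p2_def by (rule order_trans[OF abs_triangle_ineq] add_mono order_trans[OF abs_triangle_ineq] | simp add: abs_mult)+
    also have "\<dots> \<le> c * (1 / q) * (1 / q) * c + 2 * (c * (1 / q)) * (c * (1 / q)) + c * (c * (1 / q) * (1 / q))"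
      using c0 q by (intro add_mono mult_mono bd ae order_refl) auto
    also have "\<dots> = 4 * c\<^sup>2 * (1 / q * (1 / q))" by (simp add: power2_eq_square)
    finally show ?thesis unfolding q(2) .
  qed
  have line: "(\<lambda>j\<in>{..n}. y j + x * wt m j) l = y l + x * a" "(\<lambda>j\<in>{..n}. y j + x * wt m j) m = y m + x * e"
    "Xf l (\<lambda>j\<in>{..n}. y j + x * wt m j) = Xf l y + x * r" for y x
    using l m shift_simps(2)[OF l] by (simp_all add: a_def e_def r_def)
  have dX: "((\<lambda>x. Xf l y + x * r) has_real_derivative r) (at x)" for y x by (auto intro!: derivative_eq_intros)
  have dp: "((\<lambda>x. g (y l + x * a) * g (y m + x * e)) has_real_derivative
      (g1 (y l + x * a) * a) * g (y m + x * e) + g (y l + x * a) * (g1 (y m + x * e) * e)) (at x)" for y x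
    by (rule derivative_eq_intros DERIV_line d1 refl)+ simp
  have dp1: "((\<lambda>x. (g1 (y l + x * a) * a) * g (y m + x * e) + g (y l + x * a) * (g1 (y m + x * e) * e)) has_real_derivative
      (g2 (y l + x * a) * a * a) * g (y m + x * e) + 2 * (g1 (y l + x * a) * a) * (g1 (y m + x * e) * e) + g (y l + x * a) * (g2 (y m + x * e) * e * e)) (at x)" for y x
    by (rule derivative_eq_intros DERIV_line d1 d2 refl)+ (simp add: algebra_simps)
  have iq: "integrable M (\<lambda>\<omega>. \<bar>(Xf l (bv \<omega>))\<^sup>2 - 1\<bar>)" "integrable M (\<lambda>\<omega>. \<bar>Xf l (bv \<omega>)\<bar>)"
    by (rule integrable_abs, rule integrable_polybd[of "\<lambda>y. (Xf l y)\<^sup>2 - 1"], intro polybd_intros polybd_Xf l, measurable)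
       (rule integrable_abs, rule integrable_polybd[of "Xf l"], intro polybd_Xf l, measurable)
  have "expectation (\<lambda>\<omega>. (g (bv \<omega> l) * ((Xf l (bv \<omega>))\<^sup>2 - 1)) * (g (bv \<omega> m) * ((Xf m (bv \<omega>))\<^sup>2 - 1)))
     = expectation (\<lambda>\<omega>. ((Xf m (bv \<omega>))\<^sup>2 - 1) * F (bv \<omega>))"
    by (intro Bochner_Integration.integral_cong refl) (simp add: F_def p_def)
  also have "\<dots> = expectation (\<lambda>\<omega>. F2 (bv \<omega>))"
  proof (rule grid_ibp_real[where F=F and ?F1.0=F1 and ?F2.0=F2, OF m])
    show "((\<lambda>x. F (\<lambda>j\<in>{..n}. y j + x * wt m j)) has_real_derivative F1 (\<lambda>j\<in>{..n}. y j + x * wt m j)) (at x)" for y x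
      unfolding F_def F1_def p_def p1_def line by (rule DERIV_times_hermite2[OF dp dX])
    show "((\<lambda>x. F1 (\<lambda>j\<in>{..n}. y j + x * wt m j)) has_real_derivative F2 (\<lambda>j\<in>{..n}. y j + x * wt m j)) (at x)" for y x
      unfolding F1_def F2_def p_def p1_def p2_def line by (rule DERIV_times_hermite2'[OF dp dp1 dX])
    show "continuous_on UNIV (\<lambda>x. F2 (\<lambda>j\<in>{..n}. y j + x * wt m j))" for y
      unfolding F2_def p_def p1_def p2_def line by (intro continuous_intros continuous_on_line cg cg2)
    have pp: "polybd n p" "polybd n p1" "polybd n p2"
      using bp bp1 bp2 by (auto intro!: polybd_bounded)
    show "polybd n F" "polybd n F1" "polybd n F2"
      unfolding F_def F1_def F2_def by (intro polybd_intros pp polybd_Xf l)+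
    show "F \<in> borel_measurable (Pi\<^sub>M {..n} (\<lambda>_. borel))" "F2 \<in> borel_measurable (Pi\<^sub>M {..n} (\<lambda>_. borel))"
      unfolding F_def F2_def by measurable
  qed
  finally have E: "expectation (\<lambda>\<omega>. (g (bv \<omega> l) * ((Xf l (bv \<omega>))\<^sup>2 - 1)) * (g (bv \<omega> m) * ((Xf m (bv \<omega>))\<^sup>2 - 1))) = expectation (\<lambda>\<omega>. F2 (bv \<omega>))" .
  have F2b: "\<bar>F2 y\<bar> \<le> 4 * c\<^sup>2 * (1 / sqrt n) * \<bar>(Xf l y)\<^sup>2 - 1\<bar> + 4 * c\<^sup>2 * 2 * \<bar>r\<bar> * \<bar>Xf l y\<bar> + c\<^sup>2 * (2 * \<bar>r\<bar>)" for y
  proof -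
    have "\<bar>p2 y * ((Xf l y)\<^sup>2 - 1)\<bar> \<le> 4 * c\<^sup>2 * (1 / sqrt n) * \<bar>(Xf l y)\<^sup>2 - 1\<bar>"
      unfolding abs_mult by (intro mult_right_mono bp2) auto
    moreover have "\<bar>2 * p1 y * (2 * r * Xf l y)\<bar> \<le> 4 * c\<^sup>2 * 2 * \<bar>r\<bar> * \<bar>Xf l y\<bar>"
    proof -
      have "\<bar>p1 y\<bar> \<le> 2 * c\<^sup>2" using bp1[of y] mult_left_mono[OF q(3), of "2 * c\<^sup>2"] by simp
      then have "\<bar>p1 y\<bar> * (4 * \<bar>r\<bar> * \<bar>Xf l y\<bar>) \<le> 2 * c\<^sup>2 * (4 * \<bar>r\<bar> * \<bar>Xf l y\<bar>)"
        by (intro mult_right_mono) auto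
      then show ?thesis by (simp add: abs_mult)
    qed
    moreover have "\<bar>p y * (2 * r\<^sup>2)\<bar> \<le> c\<^sup>2 * (2 * \<bar>r\<bar>)"
    proof -
      have "\<bar>r\<bar> * \<bar>r\<bar> \<le> \<bar>r\<bar> * 1" unfolding r_def by (intro mult_left_mono abs_cr_le_1) auto
      then have "r\<^sup>2 \<le> \<bar>r\<bar>" by (simp add: power2_eq_square)
      then show ?thesis unfolding abs_mult by (intro mult_mono bp) auto
    qed
    ultimately show ?thesis unfolding F2_def by linarith
  qed
  have "\<bar>expectation (\<lambda>\<omega>. F2 (bv \<omega>))\<bar> \<le> expectation (\<lambda>\<omega>. \<bar>F2 (bv \<omega>)\<bar>)" by (rule integral_abs_bound)
  also have "\<dots> \<le> expectation (\<lambda>\<omega>. 4 * c\<^sup>2 * (1 / sqrt n) * \<bar>(Xf l (bv \<omega>))\<^sup>2 - 1\<bar> + 4 * c\<^sup>2 * 2 * \<bar>r\<bar> * \<bar>Xf l (bv \<omega>)\<bar> + c\<^sup>2 * (2 * \<bar>r\<bar>))"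
  proof (rule integral_mono)
    have pp: "polybd n p" "polybd n p1" "polybd n p2"
      using bp bp1 bp2 by (auto intro!: polybd_bounded)
    have "polybd n F2" unfolding F2_def by (intro polybd_intros pp polybd_Xf l)
    then show "integrable M (\<lambda>\<omega>. \<bar>F2 (bv \<omega>)\<bar>)"
      by (intro integrable_abs integrable_polybd[of F2]) (simp_all add: F2_def[abs_def])
  qed (use iq F2b in auto)
  also have "\<dots> = 4 * c\<^sup>2 * (1 / sqrt n) * expectation (\<lambda>\<omega>. \<bar>(Xf l (bv \<omega>))\<^sup>2 - 1\<bar>) + 4 * c\<^sup>2 * 2 * \<bar>r\<bar> * expectation (\<lambda>\<omega>. \<bar>Xf l (bv \<omega>)\<bar>) + c\<^sup>2 * (2 * \<bar>r\<bar>)"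
    using iq prob_space by simp
  also have "\<dots> \<le> 4 * c\<^sup>2 * (1 / sqrt n) * 2 + 4 * c\<^sup>2 * 2 * \<bar>r\<bar> * 1 + c\<^sup>2 * (2 * \<bar>r\<bar>)"
    by (intro add_mono mult_left_mono X_moments l) auto
  also have "\<dots> \<le> 10 * c\<^sup>2 * (\<bar>r\<bar> + 1 / sqrt n)"
  proof -
    have h: "4 * u * z * 2 + 4 * u * 2 * v * 1 + u * (2 * v) \<le> 10 * u * (v + z)" if "0 \<le> u * z" for u v z :: real
      using that by (simp add: algebra_simps)
    show ?thesis by (rule h) simp
  qed
  finally show ?thesis unfolding E r_def cr_commute[of m l] .
qed

text \<open>Expanding the square leaves the pairs treated in \<open>kernel_bound\<close>. For the
  part with \<open>cr\<close> a Schur test with row sums at most 2 gives the squared l2 norm of the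
  weights; the uniform part \<open>1 / sqrt n\<close> gives their squared l1 norm.\<close>

lemma variation_sq_bound:
  fixes g g1 g2 :: "real \<Rightarrow> real"
  assumes d1: "\<And>x. (g has_real_derivative g1 x) (at x)" and d2: "\<And>x. (g1 has_real_derivative g2 x) (at x)"
    and cg2: "continuous_on UNIV g2"
    and bd: "\<And>x. \<bar>g x\<bar> \<le> c" "\<And>x. \<bar>g1 x\<bar> \<le> c" "\<And>x. \<bar>g2 x\<bar> \<le> c"
  shows "expectation (\<lambda>\<omega>. (\<Sum>l<n. w l * (g (bv \<omega> l) * ((Xf l (bv \<omega>))\<^sup>2 - 1)))\<^sup>2)
    \<le> 10 * c\<^sup>2 * (2 * (\<Sum>l<n. (w l)\<^sup>2) + (\<Sum>l<n. \<bar>w l\<bar>)\<^sup>2 / sqrt n)"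
proof -
  define \<zeta> where "\<zeta> l y = g (y l) * ((Xf l y)\<^sup>2 - 1)" for l y
  have [measurable]: "g \<in> borel_measurable borel"
    using DERIV_continuous_on_UNIV[OF d1] by (rule borel_measurable_continuous_onI)
  have pz: "polybd n (\<zeta> l)" "\<zeta> l \<in> borel_measurable (Pi\<^sub>M {..n} (\<lambda>_. borel))" if "l < n" for l
  proof -
    have "polybd n (\<lambda>y. g (y l))" using bd by (intro polybd_bounded) auto
    then show "polybd n (\<zeta> l)" unfolding \<zeta>_def by (intro polybd_intros polybd_Xf that)
    have [measurable]: "Xf l \<in> borel_measurable (Pi\<^sub>M {..n} (\<lambda>_. borel))" "(\<lambda>y. y l) \<in> borel_measurable (Pi\<^sub>M {..n} (\<lambda>_. borel))"
      using that by (auto intro!: measurable_Xf)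
    show "\<zeta> l \<in> borel_measurable (Pi\<^sub>M {..n} (\<lambda>_. borel))" unfolding \<zeta>_def by measurable
  qed
  have i: "integrable M (\<lambda>\<omega>. \<zeta> l (bv \<omega>) * \<zeta> m (bv \<omega>))" if "l < n" "m < n" for l m
    by (rule integrable_polybd[of "\<lambda>y. \<zeta> l y * \<zeta> m y"]) (intro polybd_mult pz that borel_measurable_times)+
  have "expectation (\<lambda>\<omega>. (\<Sum>l<n. w l * \<zeta> l (bv \<omega>))\<^sup>2) = expectation (\<lambda>\<omega>. \<Sum>l<n. \<Sum>m<n. w l * w m * (\<zeta> l (bv \<omega>) * \<zeta> m (bv \<omega>)))"
    by (intro Bochner_Integration.integral_cong refl) (simp add: power2_eq_square sum_product mult_ac)
  also have "\<dots> = (\<Sum>l<n. expectation (\<lambda>\<omega>. \<Sum>m<n. w l * w m * (\<zeta> l (bv \<omega>) * \<zeta> m (bv \<omega>))))"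
    by (rule Bochner_Integration.integral_sum)
       (intro Bochner_Integration.integrable_sum integrable_mult_right i; simp)
  also have "\<dots> = (\<Sum>l<n. \<Sum>m<n. w l * w m * expectation (\<lambda>\<omega>. \<zeta> l (bv \<omega>) * \<zeta> m (bv \<omega>)))"
  proof (intro sum.cong refl)
    fix l assume l: "l \<in> {..<n}"
    have "expectation (\<lambda>\<omega>. \<Sum>m<n. w l * w m * (\<zeta> l (bv \<omega>) * \<zeta> m (bv \<omega>))) = (\<Sum>m<n. expectation (\<lambda>\<omega>. w l * w m * (\<zeta> l (bv \<omega>) * \<zeta> m (bv \<omega>))))"
      by (rule Bochner_Integration.integral_sum) (intro integrable_mult_right i; use l in simp)
    then show "expectation (\<lambda>\<omega>. \<Sum>m<n. w l * w m * (\<zeta> l (bv \<omega>) * \<zeta> m (bv \<omega>))) = (\<Sum>m<n. w l * w m * expectation (\<lambda>\<omega>. \<zeta> l (bv \<omega>) * \<zeta> m (bv \<omega>)))"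
      by simp
  qed
  also have "\<dots> \<le> (\<Sum>l<n. \<Sum>m<n. \<bar>w l\<bar> * \<bar>w m\<bar> * (10 * c\<^sup>2 * (\<bar>cr l m\<bar> + 1 / sqrt n)))"
  proof (intro sum_mono)
    fix l m assume lm: "l \<in> {..<n}" "m \<in> {..<n}"
    have "w l * w m * expectation (\<lambda>\<omega>. \<zeta> l (bv \<omega>) * \<zeta> m (bv \<omega>)) \<le> \<bar>w l * w m * expectation (\<lambda>\<omega>. \<zeta> l (bv \<omega>) * \<zeta> m (bv \<omega>))\<bar>"
      by (rule abs_ge_self)
    also have "\<dots> \<le> \<bar>w l\<bar> * \<bar>w m\<bar> * (10 * c\<^sup>2 * (\<bar>cr l m\<bar> + 1 / sqrt n))"
      unfolding abs_mult using kernel_bound[OF _ _ d1 d2 cg2 bd, of l m] lm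
      by (intro mult_left_mono) (auto simp: \<zeta>_def)
    finally show "w l * w m * expectation (\<lambda>\<omega>. \<zeta> l (bv \<omega>) * \<zeta> m (bv \<omega>)) \<le> \<bar>w l\<bar> * \<bar>w m\<bar> * (10 * c\<^sup>2 * (\<bar>cr l m\<bar> + 1 / sqrt n))" .
  qed
  also have "\<dots> = 10 * c\<^sup>2 * ((\<Sum>l<n. \<Sum>m<n. \<bar>w l\<bar> * \<bar>w m\<bar> * \<bar>cr l m\<bar>) + (\<Sum>l<n. \<bar>w l\<bar>)\<^sup>2 / sqrt n)"
    by (simp add: power2_eq_square sum_product sum_distrib_left sum_divide_distrib sum.distrib algebra_simps)
  also have "(\<Sum>l<n. \<Sum>m<n. \<bar>w l\<bar> * \<bar>w m\<bar> * \<bar>cr l m\<bar>) \<le> 2 * (\<Sum>l<n. (w l)\<^sup>2)"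
  proof -
    have "(\<Sum>l<n. \<Sum>m<n. \<bar>w l\<bar> * \<bar>w m\<bar> * \<bar>cr l m\<bar>) \<le> (\<Sum>l<n. \<Sum>m<n. (w l)\<^sup>2 / 2 * \<bar>cr l m\<bar> + (w m)\<^sup>2 / 2 * \<bar>cr l m\<bar>)"
    proof (intro sum_mono)
      fix l m
      have "\<bar>w l\<bar> * \<bar>w m\<bar> \<le> (w l)\<^sup>2 / 2 + (w m)\<^sup>2 / 2"
        using zero_le_power2[of "\<bar>w l\<bar> - \<bar>w m\<bar>"] by (simp add: power2_diff)
      then show "\<bar>w l\<bar> * \<bar>w m\<bar> * \<bar>cr l m\<bar> \<le> (w l)\<^sup>2 / 2 * \<bar>cr l m\<bar> + (w m)\<^sup>2 / 2 * \<bar>cr l m\<bar>"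
        unfolding distrib_right[symmetric] by (intro mult_right_mono) auto
    qed
    also have "\<dots> = (\<Sum>l<n. (w l)\<^sup>2 / 2 * (\<Sum>m<n. \<bar>cr l m\<bar>)) + (\<Sum>m<n. (w m)\<^sup>2 / 2 * (\<Sum>l<n. \<bar>cr m l\<bar>))"
      unfolding sum.distrib sum_distrib_left
      by (subst (2) sum.swap) (simp add: cr_commute)
    also have "\<dots> \<le> (\<Sum>l<n. (w l)\<^sup>2 / 2 * 2) + (\<Sum>m<n. (w m)\<^sup>2 / 2 * 2)"
      by (intro add_mono sum_mono mult_left_mono sum_abs_cr) auto
    finally show ?thesis by simp
  qed
  finally show ?thesis by (simp add: \<zeta>_def mult_left_mono)
qed

end

lemma has_vector_derivative_Complex:
  assumes "(u has_real_derivative u') (at x)" "(v has_real_derivative v') (at x)"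
  shows "((\<lambda>x. Complex (- u x) (v x)) has_vector_derivative Complex (- u') v') (at x)"
  using has_vector_derivative_add[OF has_vector_derivative_minus[OF has_vector_derivative_of_real[OF assms(1)]]
      has_vector_derivative_mult_right[OF has_vector_derivative_of_real[OF assms(2)], of \<i>]]
  by (simp add: Complex_eq)

section \<open>The test functional and its derivatives\<close>

text \<open>\<open>\<alpha>\<close> and \<open>\<beta>\<close> are later instantiated with multiples
  of the second derivative and of the square of \<open>f\<close>, and \<open>s\<close> with
  \<open>t * \<mu>\<close>. Nonnegativity of \<open>\<beta>\<close> keeps the test functional in the
  unit disc. \<open>c\<close> bounds \<open>f\<close> and its derivatives, \<open>d\<close> those of
  the phase and damping terms, which involve the frequency.\<close>

locale interpolation = fbm_grid +
  fixes f f1 f2 f3 \<alpha> \<alpha>1 \<alpha>2 \<beta> \<beta>1 \<beta>2 :: "real \<Rightarrow> real" and c d s :: real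
  assumes df: "\<And>x. (f has_real_derivative f1 x) (at x)" "\<And>x. (f1 has_real_derivative f2 x) (at x)"
      "\<And>x. (f2 has_real_derivative f3 x) (at x)"
    and cf3: "continuous_on UNIV f3"
    and bf: "\<And>x. \<bar>f x\<bar> \<le> c" "\<And>x. \<bar>f1 x\<bar> \<le> c" "\<And>x. \<bar>f2 x\<bar> \<le> c" "\<And>x. \<bar>f3 x\<bar> \<le> c"
    and d\<alpha>: "\<And>x. (\<alpha> has_real_derivative \<alpha>1 x) (at x)" "\<And>x. (\<alpha>1 has_real_derivative \<alpha>2 x) (at x)"
    and d\<beta>: "\<And>x. (\<beta> has_real_derivative \<beta>1 x) (at x)" "\<And>x. (\<beta>1 has_real_derivative \<beta>2 x) (at x)"
    and c\<alpha>\<beta>: "continuous_on UNIV \<alpha>2" "continuous_on UNIV \<beta>2"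
    and b\<alpha>: "\<And>x. \<bar>\<alpha>1 x\<bar> \<le> d" "\<And>x. \<bar>\<alpha>2 x\<bar> \<le> d"
    and b\<beta>: "\<And>x. 0 \<le> \<beta> x" "\<And>x. \<bar>\<beta>1 x\<bar> \<le> d" "\<And>x. \<bar>\<beta>2 x\<bar> \<le> d"
begin

lemma cont: "continuous_on UNIV f" "continuous_on UNIV f1" "continuous_on UNIV f2"
  "continuous_on UNIV \<alpha>" "continuous_on UNIV \<alpha>1" "continuous_on UNIV \<beta>" "continuous_on UNIV \<beta>1"
  by (rule DERIV_continuous_on_UNIV, rule df d\<alpha> d\<beta>)+

lemma meas[measurable]: "f \<in> borel_measurable borel" "f1 \<in> borel_measurable borel" "f2 \<in> borel_measurable borel"
  "\<alpha> \<in> borel_measurable borel" "\<alpha>1 \<in> borel_measurable borel" "\<alpha>2 \<in> borel_measurable borel"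
  "\<beta> \<in> borel_measurable borel" "\<beta>1 \<in> borel_measurable borel" "\<beta>2 \<in> borel_measurable borel"
  using cont c\<alpha>\<beta> by (auto intro!: borel_measurable_continuous_onI)

lemma cd_nonneg: "0 \<le> c" "0 \<le> d"
  using bf(1)[of 0] b\<alpha>(1)[of 0] by linarith+

text \<open>\<open>\<theta>\<close> is the phase and \<open>\<pi>0\<close> the damping of the test
  functional \<open>\<Psi>\<close>. In this block the suffixes 1 and 2 stand for the first and
  second derivative along \<open>wt k\<close>; \<open>U1\<close> and \<open>U2\<close> are those of
  the whole exponent, and \<open>F0\<close>, \<open>F1\<close>, \<open>F2\<close> those of
  \<open>f\<close> at the grid value \<open>k\<close> times \<open>\<Psi>\<close>.\<close>

definition qv where "qv y = (\<Sum>l<n. f (y l) * ((Xf l y)\<^sup>2 - 1)) / sqrt n" for y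
definition \<theta> where "\<theta> y = s * qv y + (\<Sum>l<n. \<alpha> (y l)) / n" for y
definition \<theta>1 where "\<theta>1 k y = s * ((\<Sum>l<n. (f1 (y l) * wt k l) * ((Xf l y)\<^sup>2 - 1) + f (y l) * (2 * cr k l * Xf l y)) / sqrt n)
   + (\<Sum>l<n. \<alpha>1 (y l) * wt k l) / n" for k y
definition \<theta>2 where "\<theta>2 k y = s * ((\<Sum>l<n. (f2 (y l) * wt k l * wt k l) * ((Xf l y)\<^sup>2 - 1) + 2 * (f1 (y l) * wt k l) * (2 * cr k l * Xf l y)
   + f (y l) * (2 * (cr k l)\<^sup>2)) / sqrt n) + (\<Sum>l<n. \<alpha>2 (y l) * wt k l * wt k l) / n" for k y
definition \<pi>0 where "\<pi>0 y = (\<Sum>l<n. \<beta> (y l)) / n" for y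
definition \<pi>1 where "\<pi>1 k y = (\<Sum>l<n. \<beta>1 (y l) * wt k l) / n" for k y
definition \<pi>2 where "\<pi>2 k y = (\<Sum>l<n. \<beta>2 (y l) * wt k l * wt k l) / n" for k y
definition \<Psi> where "\<Psi> y = exp (Complex (- \<pi>0 y) (\<theta> y))" for y
definition U1 where "U1 k y = Complex (- \<pi>1 k y) (\<theta>1 k y)" for k y
definition U2 where "U2 k y = Complex (- \<pi>2 k y) (\<theta>2 k y)" for k y
definition F0 where "F0 k y = of_real (f (y k)) * \<Psi> y" for k y
definition F1 where "F1 k y = (of_real (f1 (y k) * wt k k) + of_real (f (y k)) * U1 k y) * \<Psi> y" for k y
definition F2 where "F2 k y = (of_real (f2 (y k) * wt k k * wt k k) + 2 * of_real (f1 (y k) * wt k k) * U1 k y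
   + of_real (f (y k)) * (U2 k y + U1 k y * U1 k y)) * \<Psi> y" for k y

lemma norm_\<Psi>: "norm (\<Psi> y) \<le> 1"
  unfolding \<Psi>_def by (simp add: \<pi>0_def sum_nonneg b\<beta>)

abbreviation shift :: "nat \<Rightarrow> (nat \<Rightarrow> real) \<Rightarrow> real \<Rightarrow> nat \<Rightarrow> real" where
  "shift k y x \<equiv> (\<lambda>j\<in>{..n}. y j + x * wt k j)"

lemma at_shift: "l < n \<Longrightarrow> shift k y x l = y l + x * wt k l" "l < n \<Longrightarrow> Xf l (shift k y x) = Xf l y + x * cr k l"
  using shift_simps(1)[of l y x k] shift_simps(2)[of l y x k] by auto

lemma DERIV_X: "((\<lambda>x. Xf l y + x * r) has_real_derivative r) (at x)"
  by (auto intro!: derivative_eq_intros)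

lemma D_\<theta>: "((\<lambda>x. \<theta> (shift k y x)) has_real_derivative \<theta>1 k (shift k y x)) (at x)"
proof -
  have e: "(\<lambda>x. \<theta> (shift k y x)) = (\<lambda>x. s * ((\<Sum>l<n. f (y l + x * wt k l) * ((Xf l y + x * cr k l)\<^sup>2 - 1)) / sqrt n) + (\<Sum>l<n. \<alpha> (y l + x * wt k l)) / n)"
    unfolding \<theta>_def qv_def by (intro ext arg_cong2[where f="(+)"] arg_cong2[where f=times] arg_cong2[where f="(/)"] sum.cong refl) (simp_all only: at_shift lessThan_iff)
  have e1: "\<theta>1 k (shift k y x) = s * ((\<Sum>l<n. (f1 (y l + x * wt k l) * wt k l) * ((Xf l y + x * cr k l)\<^sup>2 - 1) + f (y l + x * wt k l) * (2 * cr k l * (Xf l y + x * cr k l))) / sqrt n)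
   + (\<Sum>l<n. \<alpha>1 (y l + x * wt k l) * wt k l) / n"
    unfolding \<theta>1_def by (intro arg_cong2[where f="(+)"] arg_cong2[where f=times] arg_cong2[where f="(/)"] sum.cong refl) (simp_all only: at_shift lessThan_iff)
  show ?thesis unfolding e e1
    by (intro DERIV_add DERIV_cmult DERIV_cdivide DERIV_sum DERIV_times_hermite2 DERIV_line df d\<alpha> DERIV_X)
qed

lemma D_\<theta>1: "((\<lambda>x. \<theta>1 k (shift k y x)) has_real_derivative \<theta>2 k (shift k y x)) (at x)"
proof -
  have e: "(\<lambda>x. \<theta>1 k (shift k y x)) = (\<lambda>x. s * ((\<Sum>l<n. (f1 (y l + x * wt k l) * wt k l) * ((Xf l y + x * cr k l)\<^sup>2 - 1) + f (y l + x * wt k l) * (2 * cr k l * (Xf l y + x * cr k l))) / sqrt n)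
   + (\<Sum>l<n. \<alpha>1 (y l + x * wt k l) * wt k l) / n)"
    unfolding \<theta>1_def by (intro ext arg_cong2[where f="(+)"] arg_cong2[where f=times] arg_cong2[where f="(/)"] sum.cong refl) (simp_all only: at_shift lessThan_iff)
  have e1: "\<theta>2 k (shift k y x) = s * ((\<Sum>l<n. (f2 (y l + x * wt k l) * wt k l * wt k l) * ((Xf l y + x * cr k l)\<^sup>2 - 1) + 2 * (f1 (y l + x * wt k l) * wt k l) * (2 * cr k l * (Xf l y + x * cr k l))
   + f (y l + x * wt k l) * (2 * (cr k l)\<^sup>2)) / sqrt n) + (\<Sum>l<n. \<alpha>2 (y l + x * wt k l) * wt k l * wt k l) / n"
    unfolding \<theta>2_def by (intro arg_cong2[where f="(+)"] arg_cong2[where f=times] arg_cong2[where f="(/)"] sum.cong refl) (simp_all only: at_shift lessThan_iff)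
  show ?thesis unfolding e e1
    by (intro DERIV_add DERIV_cmult DERIV_cdivide DERIV_sum DERIV_times_hermite2' DERIV_cmult_right DERIV_line df d\<alpha> DERIV_X)
qed

lemma D_\<pi>: "((\<lambda>x. \<pi>0 (shift k y x)) has_real_derivative \<pi>1 k (shift k y x)) (at x)"
  "((\<lambda>x. \<pi>1 k (shift k y x)) has_real_derivative \<pi>2 k (shift k y x)) (at x)"
proof -
  have e: "(\<lambda>x. \<pi>0 (shift k y x)) = (\<lambda>x. (\<Sum>l<n. \<beta> (y l + x * wt k l)) / n)"
      "(\<lambda>x. \<pi>1 k (shift k y x)) = (\<lambda>x. (\<Sum>l<n. \<beta>1 (y l + x * wt k l) * wt k l) / n)"
      "\<pi>1 k (shift k y x) = (\<Sum>l<n. \<beta>1 (y l + x * wt k l) * wt k l) / n"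
      "\<pi>2 k (shift k y x) = (\<Sum>l<n. \<beta>2 (y l + x * wt k l) * wt k l * wt k l) / n"
    unfolding \<pi>0_def \<pi>1_def \<pi>2_def by (intro ext arg_cong2[where f="(/)"] sum.cong refl; simp only: at_shift lessThan_iff)+
  show "((\<lambda>x. \<pi>0 (shift k y x)) has_real_derivative \<pi>1 k (shift k y x)) (at x)" unfolding e(1,3)
    by (intro DERIV_cdivide DERIV_sum DERIV_line d\<beta>)
  show "((\<lambda>x. \<pi>1 k (shift k y x)) has_real_derivative \<pi>2 k (shift k y x)) (at x)" unfolding e(2,4)
    by (intro DERIV_cdivide DERIV_sum DERIV_cmult_right DERIV_line d\<beta>)
qed

lemma D_\<Psi>: "((\<lambda>x. \<Psi> (shift k y x)) has_vector_derivative U1 k (shift k y x) * \<Psi> (shift k y x)) (at x)"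
  unfolding \<Psi>_def U1_def
  by (rule field_vector_diff_chain_at[OF has_vector_derivative_Complex[OF D_\<pi>(1) D_\<theta>] DERIV_exp, unfolded o_def])

lemma D_U1: "((\<lambda>x. U1 k (shift k y x)) has_vector_derivative U2 k (shift k y x)) (at x)"
  unfolding U1_def U2_def by (rule has_vector_derivative_Complex[OF D_\<pi>(2) D_\<theta>1])

lemma D_f:
  assumes "k < n"
  shows "((\<lambda>x. complex_of_real (f (shift k y x k))) has_vector_derivative of_real (f1 (shift k y x k) * wt k k)) (at x)"
    "((\<lambda>x. complex_of_real (f1 (shift k y x k) * wt k k)) has_vector_derivative of_real (f2 (shift k y x k) * wt k k * wt k k)) (at x)"
  unfolding at_shift[OF assms]
  by (intro has_vector_derivative_of_real DERIV_cmult_right DERIV_line df)+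

lemma D_F0: "k < n \<Longrightarrow> ((\<lambda>x. F0 k (shift k y x)) has_vector_derivative F1 k (shift k y x)) (at x)"
  unfolding F0_def F1_def
  by (rule has_vector_derivative_eq_rhs[OF has_vector_derivative_mult[OF D_f(1) D_\<Psi>]]) (simp_all add: algebra_simps)

lemma D_F1: "k < n \<Longrightarrow> ((\<lambda>x. F1 k (shift k y x)) has_vector_derivative F2 k (shift k y x)) (at x)"
  unfolding F1_def F2_def
  by (rule has_vector_derivative_eq_rhs[OF has_vector_derivative_mult[OF has_vector_derivative_add[OF D_f(2)
        has_vector_derivative_mult[OF D_f(1) D_U1]] D_\<Psi>]]) (simp_all add: algebra_simps)

lemma meas_grid:
  fixes g :: "real \<Rightarrow> real"
  assumes "l < n"
  shows "(\<lambda>y. y l) \<in> borel_measurable (Pi\<^sub>M {..n} (\<lambda>_. borel))"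
    and "g \<in> borel_measurable borel \<Longrightarrow> (\<lambda>y. g (y l)) \<in> borel_measurable (Pi\<^sub>M {..n} (\<lambda>_. borel))"
proof -
  show 1: "(\<lambda>y. y l) \<in> borel_measurable (Pi\<^sub>M {..n} (\<lambda>_. borel))"
    using assms by (intro measurable_coord) simp
  show "(\<lambda>y. g (y l)) \<in> borel_measurable (Pi\<^sub>M {..n} (\<lambda>_. borel))" if "g \<in> borel_measurable borel"
    by (rule measurable_compose[OF 1 that])
qed

lemma measurable_parts:
  "qv \<in> borel_measurable (Pi\<^sub>M {..n} (\<lambda>_. borel))" "\<theta> \<in> borel_measurable (Pi\<^sub>M {..n} (\<lambda>_. borel))"
  "\<theta>1 k \<in> borel_measurable (Pi\<^sub>M {..n} (\<lambda>_. borel))" "\<theta>2 k \<in> borel_measurable (Pi\<^sub>M {..n} (\<lambda>_. borel))"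
  "\<pi>0 \<in> borel_measurable (Pi\<^sub>M {..n} (\<lambda>_. borel))" "\<pi>1 k \<in> borel_measurable (Pi\<^sub>M {..n} (\<lambda>_. borel))"
  "\<pi>2 k \<in> borel_measurable (Pi\<^sub>M {..n} (\<lambda>_. borel))"
  unfolding qv_def[abs_def] \<theta>_def[abs_def] \<theta>1_def[abs_def] \<theta>2_def[abs_def] \<pi>0_def[abs_def] \<pi>1_def[abs_def] \<pi>2_def[abs_def]
  by (intro borel_measurable_add borel_measurable_times borel_measurable_divide borel_measurable_const borel_measurable_sum
      borel_measurable_diff borel_measurable_power meas_grid meas measurable_Xf; simp)+

lemma Complex_parts: "Complex (- u) v = of_real (- u) + \<i> * of_real v"
  by (simp add: Complex_eq)

lemma measurable_complex_parts:
  "\<Psi> \<in> borel_measurable (Pi\<^sub>M {..n} (\<lambda>_. borel))" "U1 k \<in> borel_measurable (Pi\<^sub>M {..n} (\<lambda>_. borel))"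
  "U2 k \<in> borel_measurable (Pi\<^sub>M {..n} (\<lambda>_. borel))"
  unfolding \<Psi>_def[abs_def] U1_def[abs_def] U2_def[abs_def] Complex_parts
  using measurable_parts by measurable

lemma measurable_F: assumes "k < n"
  shows "F0 k \<in> borel_measurable (Pi\<^sub>M {..n} (\<lambda>_. borel))" "F2 k \<in> borel_measurable (Pi\<^sub>M {..n} (\<lambda>_. borel))"
proof -
  note [measurable] = measurable_complex_parts meas_grid(1)[OF assms]
  show "F0 k \<in> borel_measurable (Pi\<^sub>M {..n} (\<lambda>_. borel))" "F2 k \<in> borel_measurable (Pi\<^sub>M {..n} (\<lambda>_. borel))"
    unfolding F0_def[abs_def] F2_def[abs_def] by measurable
qed

lemma polybd_parts:
  "polybd n qv" "polybd n (\<theta>1 k)" "polybd n (\<theta>2 k)" "polybd n (\<pi>1 k)" "polybd n (\<pi>2 k)"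
proof -
  have b: "polybd n (\<lambda>y. f (y l))" "polybd n (\<lambda>y. f1 (y l))" "polybd n (\<lambda>y. f2 (y l))"
     "polybd n (\<lambda>y. \<alpha>1 (y l))" "polybd n (\<lambda>y. \<alpha>2 (y l))" "polybd n (\<lambda>y. \<beta>1 (y l))" "polybd n (\<lambda>y. \<beta>2 (y l))" for l
    using bf b\<alpha> b\<beta> by (auto intro!: polybd_bounded)
  show "polybd n qv" "polybd n (\<theta>1 k)" "polybd n (\<theta>2 k)" "polybd n (\<pi>1 k)" "polybd n (\<pi>2 k)"
    unfolding qv_def[abs_def] \<theta>1_def[abs_def] \<theta>2_def[abs_def] \<pi>1_def[abs_def] \<pi>2_def[abs_def]
    by (intro polybd_intros polybd_Xf b; simp)+
qed

lemma polybd_complex_parts: "polybd n (U1 k)" "polybd n (U2 k)" "polybd n \<Psi>" "polybd n (\<lambda>y. complex_of_real (f (y k)))"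
  "polybd n (\<lambda>y. complex_of_real (f1 (y k)))" "polybd n (\<lambda>y. complex_of_real (f2 (y k)))"
proof -
  show "polybd n (U1 k)" "polybd n (U2 k)"
    unfolding U1_def[abs_def] U2_def[abs_def] Complex_parts
    by (intro polybd_intros polybd_parts)+
  show "polybd n \<Psi>" using norm_\<Psi> by (rule polybd_bounded)
  show "polybd n (\<lambda>y. complex_of_real (f (y k)))"
    "polybd n (\<lambda>y. complex_of_real (f1 (y k)))" "polybd n (\<lambda>y. complex_of_real (f2 (y k)))"
    using bf by (auto intro!: polybd_bounded)
qed

lemma polybd_F: "polybd n (F0 k)" "polybd n (F1 k)" "polybd n (F2 k)"
  unfolding F0_def[abs_def] F1_def[abs_def] F2_def[abs_def] of_real_mult
  by (intro polybd_complex_parts polybd_add polybd_mult polybd_const)+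

lemma continuous_F2: "k < n \<Longrightarrow> continuous_on UNIV (\<lambda>x. F2 k (shift k y x))"
proof -
  assume k: "k < n"
  have U: "continuous_on UNIV (\<lambda>x. U1 k (shift k y x))" "continuous_on UNIV (\<lambda>x. \<Psi> (shift k y x))"
    using D_U1 D_\<Psi> by (auto intro!: continuous_at_imp_continuous_on has_vector_derivative_continuous)
  have e: "(\<lambda>x. U2 k (shift k y x)) = (\<lambda>x. Complex (- ((\<Sum>l<n. \<beta>2 (y l + x * wt k l) * wt k l * wt k l) / n))
     (s * ((\<Sum>l<n. (f2 (y l + x * wt k l) * wt k l * wt k l) * ((Xf l y + x * cr k l)\<^sup>2 - 1) + 2 * (f1 (y l + x * wt k l) * wt k l) * (2 * cr k l * (Xf l y + x * cr k l))
   + f (y l + x * wt k l) * (2 * (cr k l)\<^sup>2)) / sqrt n) + (\<Sum>l<n. \<alpha>2 (y l + x * wt k l) * wt k l * wt k l) / n))"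
    unfolding U2_def \<theta>2_def \<pi>2_def
    by (intro ext arg_cong2[where f=Complex] arg_cong[where f=uminus] arg_cong2[where f="(+)"] arg_cong2[where f=times] arg_cong2[where f="(/)"] sum.cong refl)
       (simp_all only: at_shift lessThan_iff)
  have U2: "continuous_on UNIV (\<lambda>x. U2 k (shift k y x))"
    unfolding e Complex_parts using n_pos by (intro continuous_intros continuous_on_line cont c\<alpha>\<beta>) auto
  show ?thesis
    unfolding F2_def at_shift[OF k] by (intro continuous_intros U U2 continuous_on_line cont)
qed

lemma ibp_F: "k < n \<Longrightarrow> expectation (\<lambda>\<omega>. of_real ((Xf k (bv \<omega>))\<^sup>2 - 1) * F0 k (bv \<omega>)) = expectation (\<lambda>\<omega>. F2 k (bv \<omega>))"
  by (rule grid_ibp[where F="F0 k" and ?F1.0="F1 k" and ?F2.0="F2 k"]) (intro measurable_F D_F0 D_F1 continuous_F2 polybd_F | assumption)+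

text \<open>The origin of the quarter in the drift: \<open>1 / (4 * sqrt n)\<close> is the weight
  with which the second derivative of \<open>f\<close> enters \<open>F2\<close>, and dividing by
  \<open>sqrt n\<close> once more gives a quarter of a Riemann mean. The deviation is an effect of
  the initial time and fades as \<open>k\<close> grows.\<close>

lemma wt_kk_sq: "\<bar>wt k k * wt k k - 1 / (4 * sqrt n)\<bar> \<le> sqrt_inc k / (2 * sqrt n)"
proof -
  have "wt k k * wt k k = (sqrt_inc k - 1)\<^sup>2 / (4 * (q * q))"
    by (simp add: wt_def hinc_0 power2_eq_square)
  then have e: "wt k k * wt k k - 1 / (4 * sqrt n) = ((sqrt_inc k)\<^sup>2 - 2 * sqrt_inc k) / (4 * sqrt n)"
    unfolding q_sq by (simp add: power2_diff diff_divide_distrib[symmetric])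
  have "(sqrt_inc k)\<^sup>2 \<le> sqrt_inc k * 1"
    unfolding power2_eq_square by (intro mult_left_mono sqrt_inc_le_1 sqrt_inc_nonneg)
  then have "\<bar>(sqrt_inc k)\<^sup>2 - 2 * sqrt_inc k\<bar> \<le> 2 * sqrt_inc k"
    using sqrt_inc_nonneg[of k] zero_le_power2[of "sqrt_inc k"] by linarith
  then have "\<bar>(sqrt_inc k)\<^sup>2 - 2 * sqrt_inc k\<bar> / (4 * sqrt n) \<le> 2 * sqrt_inc k / (4 * sqrt n)"
    by (intro divide_right_mono) auto
  then show ?thesis unfolding e by simp
qed

lemma wt_kk: "\<bar>wt k k\<bar> \<le> 1 / (2 * q)"
proof -
  have "\<bar>sqrt_inc k - 1\<bar> \<le> 1" using sqrt_inc_nonneg[of k] sqrt_inc_le_1[of k] by linarith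
  then have "\<bar>sqrt_inc k - 1\<bar> / (2 * q) \<le> 1 / (2 * q)" using q_ge_1 by (intro divide_right_mono) auto
  then show ?thesis using q_ge_1 by (simp add: wt_def hinc_0)
qed

definition SW where "SW k = (\<Sum>l<n. \<bar>wt k l\<bar>)" for k
definition QW where "QW k = (\<Sum>l<n. (wt k l)\<^sup>2)" for k

text \<open>\<open>rest k\<close> bounds the terms of \<open>F2 k\<close> that vanish in the limit; the two that survive produce
  the drift and the variance.\<close>

definition Dk where "Dk k y = of_real (f2 (y k) / (4 * sqrt n)) + \<i> * of_real (s / sqrt n * (\<Sum>l<n. 2 * f (y k) * f (y l) * (cr k l)\<^sup>2))" for k y

definition rest where "rest k y = c * sqrt_inc k / (2 * sqrt n) + c * ((1 / q ^ 3 + q * (norm (U1 k y))\<^sup>2) / 2) + c * (norm (U1 k y))\<^sup>2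
   + c * (2 * (d / n * QW k) + \<bar>s\<bar> / sqrt n * (\<Sum>l<n. c * (wt k l)\<^sup>2 * \<bar>(Xf l y)\<^sup>2 - 1\<bar> + 4 * c * \<bar>wt k l\<bar> * \<bar>cr k l\<bar> * \<bar>Xf l y\<bar>))" for k y

lemma abs_mean_wt_sq:
  assumes "\<And>x. \<bar>g x\<bar> \<le> d"
  shows "\<bar>(\<Sum>l<n. g (y l) * wt k l * wt k l) / n\<bar> \<le> d / n * QW k"
proof -
  have "\<bar>\<Sum>l<n. g (y l) * wt k l * wt k l\<bar> \<le> (\<Sum>l<n. d * (wt k l)\<^sup>2)"
  proof (rule order_trans[OF sum_abs sum_mono])
    fix l
    show "\<bar>g (y l) * wt k l * wt k l\<bar> \<le> d * (wt k l)\<^sup>2"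
      unfolding mult.assoc power2_eq_square[symmetric] abs_mult abs_power2 by (intro mult_right_mono assms) auto
  qed
  then have "\<bar>\<Sum>l<n. g (y l) * wt k l * wt k l\<bar> / n \<le> (\<Sum>l<n. d * (wt k l)\<^sup>2) / n"
    by (intro divide_right_mono) auto
  then show ?thesis unfolding QW_def abs_divide sum_distrib_left[symmetric] by simp
qed

lemma abs_mean_wt:
  assumes "\<And>x. \<bar>g x\<bar> \<le> d"
  shows "\<bar>(\<Sum>l<n. g (y l) * wt k l) / n\<bar> \<le> d / n * SW k"
proof -
  have "\<bar>\<Sum>l<n. g (y l) * wt k l\<bar> \<le> (\<Sum>l<n. d * \<bar>wt k l\<bar>)"
    by (rule order_trans[OF sum_abs sum_mono]) (simp add: abs_mult mult_right_mono assms)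
  then have "\<bar>\<Sum>l<n. g (y l) * wt k l\<bar> / n \<le> (\<Sum>l<n. d * \<bar>wt k l\<bar>) / n"
    by (intro divide_right_mono) auto
  then show ?thesis unfolding SW_def abs_divide sum_distrib_left[symmetric] by simp
qed

text \<open>Two pieces of the second derivative are kept: the derivative of \<open>f\<close> taken
  twice, with \<open>wt k k * wt k k\<close> replaced by its limit, and the squared correlations in
  \<open>\<theta>2\<close>. All others carry a factor \<open>wt\<close> or \<open>U1\<close>, or the
  error of that replacement.\<close>

lemma F2_rest:
  assumes k: "k < n"
  shows "norm (F2 k y - Dk k y * \<Psi> y) \<le> rest k y"
proof -
  \<comment> \<open>\<open>E\<close> is \<open>U2\<close> without the squared correlations; each of
    its terms has at least one factor \<open>wt\<close>.\<close>
  define E where "E = Complex (- \<pi>2 k y) (s * ((\<Sum>l<n. (f2 (y l) * wt k l * wt k l) * ((Xf l y)\<^sup>2 - 1) + 2 * (f1 (y l) * wt k l) * (2 * cr k l * Xf l y)) / sqrt n)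
     + (\<Sum>l<n. \<alpha>2 (y l) * wt k l * wt k l) / n)"
  have U2e: "U2 k y = E + \<i> * of_real (s / sqrt n * (\<Sum>l<n. 2 * f (y l) * (cr k l)\<^sup>2))"
    unfolding U2_def E_def \<theta>2_def
    unfolding complex_eq_iff sum.distrib add_divide_distrib distrib_left
    by (simp add: sum_distrib_left sum_divide_distrib mult_ac)
  have E: "norm E \<le> 2 * (d / n * QW k) + \<bar>s\<bar> / sqrt n * (\<Sum>l<n. c * (wt k l)\<^sup>2 * \<bar>(Xf l y)\<^sup>2 - 1\<bar> + 4 * c * \<bar>wt k l\<bar> * \<bar>cr k l\<bar> * \<bar>Xf l y\<bar>)"
  proof -
    let ?S = "\<Sum>l<n. (f2 (y l) * wt k l * wt k l) * ((Xf l y)\<^sup>2 - 1) + 2 * (f1 (y l) * wt k l) * (2 * cr k l * Xf l y)"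
    have "norm E \<le> \<bar>\<pi>2 k y\<bar> + \<bar>s * (?S / sqrt n) + (\<Sum>l<n. \<alpha>2 (y l) * wt k l * wt k l) / n\<bar>"
      unfolding E_def using cmod_le[of "Complex (- \<pi>2 k y) (s * (?S / sqrt n) + (\<Sum>l<n. \<alpha>2 (y l) * wt k l * wt k l) / n)"] by simp
    also have "\<dots> \<le> d / n * QW k + (\<bar>s * (?S / sqrt n)\<bar> + d / n * QW k)"
      unfolding \<pi>2_def by (intro add_mono order_trans[OF abs_triangle_ineq add_mono] abs_mean_wt_sq b\<alpha> b\<beta> order_refl)
    also have "\<bar>s * (?S / sqrt n)\<bar> = \<bar>s\<bar> / sqrt n * \<bar>?S\<bar>" by (simp add: abs_mult)
    also have "\<dots> \<le> \<bar>s\<bar> / sqrt n * (\<Sum>l<n. c * (wt k l)\<^sup>2 * \<bar>(Xf l y)\<^sup>2 - 1\<bar> + 4 * c * \<bar>wt k l\<bar> * \<bar>cr k l\<bar> * \<bar>Xf l y\<bar>)"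
    proof (intro mult_left_mono order_trans[OF sum_abs sum_mono] order_trans[OF abs_triangle_ineq add_mono])
      fix l
      have "\<bar>(f2 (y l) * wt k l * wt k l) * ((Xf l y)\<^sup>2 - 1)\<bar> = \<bar>f2 (y l)\<bar> * ((wt k l)\<^sup>2 * \<bar>(Xf l y)\<^sup>2 - 1\<bar>)"
        by (simp add: abs_mult power2_eq_square mult.assoc)
      also have "\<dots> \<le> c * ((wt k l)\<^sup>2 * \<bar>(Xf l y)\<^sup>2 - 1\<bar>)" by (intro mult_right_mono bf) auto
      finally show "\<bar>(f2 (y l) * wt k l * wt k l) * ((Xf l y)\<^sup>2 - 1)\<bar> \<le> c * (wt k l)\<^sup>2 * \<bar>(Xf l y)\<^sup>2 - 1\<bar>" by (simp add: mult.assoc)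
      have "\<bar>2 * (f1 (y l) * wt k l) * (2 * cr k l * Xf l y)\<bar> = \<bar>f1 (y l)\<bar> * (4 * \<bar>wt k l\<bar> * \<bar>cr k l\<bar> * \<bar>Xf l y\<bar>)"
        by (simp add: abs_mult)
      also have "\<dots> \<le> c * (4 * \<bar>wt k l\<bar> * \<bar>cr k l\<bar> * \<bar>Xf l y\<bar>)" by (intro mult_right_mono bf) auto
      finally show "\<bar>2 * (f1 (y l) * wt k l) * (2 * cr k l * Xf l y)\<bar> \<le> 4 * c * \<bar>wt k l\<bar> * \<bar>cr k l\<bar> * \<bar>Xf l y\<bar>" by (simp add: mult_ac)
    qed auto
    finally show ?thesis by simp
  qed
  have dec: "F2 k y - Dk k y * \<Psi> y = (of_real (f2 (y k) * (wt k k * wt k k - 1 / (4 * sqrt n))) + 2 * of_real (f1 (y k) * wt k k) * U1 k y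
     + of_real (f (y k)) * (U1 k y * U1 k y) + of_real (f (y k)) * E) * \<Psi> y"
  proof -
    have sf: "(\<Sum>l<n. 2 * f (y k) * f (y l) * (cr k l)\<^sup>2) = f (y k) * (\<Sum>l<n. 2 * f (y l) * (cr k l)\<^sup>2)"
      by (simp add: sum_distrib_left mult_ac)
    have alg: "(A + 2 * b * u + g * ((E' + \<i> * z) + u * u)) * p - (A0 + \<i> * (g * z)) * p = ((A - A0) + 2 * b * u + g * (u * u) + g * E') * p"
      for A A0 b u g E' z p :: complex by (simp add: algebra_simps)
    have e1: "complex_of_real (f2 (y k) * (wt k k * wt k k - 1 / (4 * sqrt n))) = of_real (f2 (y k) * wt k k * wt k k) - of_real (f2 (y k) / (4 * sqrt n))"
      unfolding of_real_diff[symmetric] by (simp add: right_diff_distrib)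
    have e2: "complex_of_real (s / sqrt n * (f (y k) * (\<Sum>l<n. 2 * f (y l) * (cr k l)\<^sup>2))) = of_real (f (y k)) * of_real (s / sqrt n * (\<Sum>l<n. 2 * f (y l) * (cr k l)\<^sup>2))"
      unfolding of_real_mult[symmetric] by (simp only: mult_ac)
    show ?thesis
      unfolding F2_def Dk_def U2e sf e1 e2 by (rule alg)
  qed
  have "norm (F2 k y - Dk k y * \<Psi> y) \<le> norm (of_real (f2 (y k) * (wt k k * wt k k - 1 / (4 * sqrt n))) + 2 * of_real (f1 (y k) * wt k k) * U1 k y
     + of_real (f (y k)) * (U1 k y * U1 k y) + of_real (f (y k)) * E) * 1"
    unfolding dec norm_mult by (intro mult_left_mono norm_\<Psi>) auto
  also have "\<dots> \<le> \<bar>f2 (y k)\<bar> * \<bar>wt k k * wt k k - 1 / (4 * sqrt n)\<bar> + 2 * \<bar>f1 (y k)\<bar> * \<bar>wt k k\<bar> * norm (U1 k y)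
     + \<bar>f (y k)\<bar> * (norm (U1 k y))\<^sup>2 + \<bar>f (y k)\<bar> * norm E"
    unfolding mult_1_right
    by (intro order_trans[OF norm_triangle_ineq] add_mono) (simp_all only: norm_mult norm_of_real abs_mult power2_eq_square norm_numeral mult.assoc order_refl)
  also have "\<dots> \<le> c * (sqrt_inc k / (2 * sqrt n)) + 2 * c * (1 / (2 * q)) * norm (U1 k y) + c * (norm (U1 k y))\<^sup>2 + c * norm E"
    using cd_nonneg q_ge_1 by (intro add_mono mult_mono bf wt_kk_sq wt_kk order_refl) auto
  also have "\<dots> \<le> rest k y"
  proof -
    \<comment> \<open>Young's inequality leaves the second moment of \<open>U1\<close> as the one
      quantity to estimate. The weight \<open>q\<close> balances both sides: summed over
      \<open>k\<close> and divided by \<open>sqrt n\<close>, the first is of order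
      \<open>1 / q\<close>, and so is the second up to the logarithm.\<close>
    have "1 / q * norm (U1 k y) \<le> (1 / q ^ 3 + q * (norm (U1 k y))\<^sup>2) / 2"
    proof -
      have "0 \<le> q * (norm (U1 k y) - 1 / q\<^sup>2)\<^sup>2" using q_ge_1 by simp
      also have "\<dots> = q * (norm (U1 k y))\<^sup>2 - 2 * (1 / q * norm (U1 k y)) + 1 / q ^ 3"
        using q_ge_1 by (simp add: power2_diff field_simps eval_nat_numeral)
      finally show ?thesis by simp
    qed
    then have "c * (1 / q * norm (U1 k y)) \<le> c * ((1 / q ^ 3 + q * (norm (U1 k y))\<^sup>2) / 2)"
      by (intro mult_left_mono cd_nonneg)
    moreover have "c * norm E \<le> c * (2 * (d / n * QW k) + \<bar>s\<bar> / sqrt n * (\<Sum>l<n. c * (wt k l)\<^sup>2 * \<bar>(Xf l y)\<^sup>2 - 1\<bar> + 4 * c * \<bar>wt k l\<bar> * \<bar>cr k l\<bar> * \<bar>Xf l y\<bar>))"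
      by (intro mult_left_mono E cd_nonneg)
    moreover have "c * (sqrt_inc k / (2 * sqrt n)) = c * sqrt_inc k / (2 * sqrt n)" "2 * c * (1 / (2 * q)) * norm (U1 k y) = c * (1 / q * norm (U1 k y))"
      by simp_all
    ultimately show ?thesis unfolding rest_def by linarith
  qed
  finally show ?thesis .
qed

end

lemma polybd_norm: "polybd n F \<Longrightarrow> polybd n (\<lambda>y. norm (F y))"
  by (erule polybd_norm_le) simp

lemma measurable_complex_of_real: "g \<in> borel_measurable N \<Longrightarrow> (\<lambda>x. complex_of_real (g x)) \<in> borel_measurable N"
  by measurable

section \<open>Size of the error terms\<close>

context interpolation
begin

lemma measurable_norm_U1: "(\<lambda>y. norm (U1 k y)) \<in> borel_measurable (Pi\<^sub>M {..n} (\<lambda>_. borel))"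
  using measurable_complex_parts(2) by measurable

definition dv where "dv y = 2 / n * (\<Sum>k<n. \<Sum>l<n. f (y k) * f (y l) * (cr k l)\<^sup>2)" for y

text \<open>Bounds the second moments of all \<open>U1 k\<close>, summed over \<open>k\<close> and
  divided by \<open>sqrt n\<close>. It is of order \<open>ln n / sqrt n\<close>, so it still
  vanishes after multiplication by \<open>q\<close>, as happens in \<open>ebound\<close>.\<close>

definition tbound :: real where
  "tbound = 30 * s\<^sup>2 * c\<^sup>2 * (3 * la / n + (la + 4) / (2 * sqrt n)) + 48 * s\<^sup>2 * c\<^sup>2 / sqrt n + 2 * d\<^sup>2 * (la + 4) / n"

definition ebound :: real where
  "ebound = c / (2 * sqrt n) + c / (2 * q) + 3 / 2 * c * q * tbound + 3 * c * d * la / n + c\<^sup>2 * \<bar>s\<bar> * (3 * la / sqrt n + 8 / q)"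

lemma sqrt_n: "0 < sqrt n" "sqrt n * sqrt n = n" "0 < real n"
  using n_pos by auto

text \<open>The derivative of the phase splits in three. \<open>P\<close> is a weighted variation of
  \<open>f1\<close> with weights \<open>wt k\<close>, covered by \<open>variation_sq_bound\<close>;
  \<open>R\<close> is a combination of increments with coefficients \<open>cr k l\<close>, treated
  by Cauchy-Schwarz with weights \<open>\<bar>cr k l\<bar>\<close>; the means of
  \<open>\<alpha>1\<close> and \<open>\<beta>1\<close> are bounded pathwise.\<close>

lemma expectation_U1:
  assumes k: "k < n"
  shows "expectation (\<lambda>\<omega>. (norm (U1 k (bv \<omega>)))\<^sup>2)
    \<le> 3 * s\<^sup>2 * (10 * c\<^sup>2 * (2 * QW k + (SW k)\<^sup>2 / sqrt n) / n) + 3 * s\<^sup>2 * (16 * c\<^sup>2 / n) + 4 * (d / n * SW k)\<^sup>2"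
proof -
  define P where "P y = (\<Sum>l<n. wt k l * (f1 (y l) * ((Xf l y)\<^sup>2 - 1)))" for y
  define R where "R y = (\<Sum>l<n. f (y l) * (2 * cr k l * Xf l y))" for y
  have mP: "P \<in> borel_measurable (Pi\<^sub>M {..n} (\<lambda>_. borel))" "R \<in> borel_measurable (Pi\<^sub>M {..n} (\<lambda>_. borel))"
    unfolding P_def[abs_def] R_def[abs_def]
    by (intro borel_measurable_times borel_measurable_const borel_measurable_sum
      borel_measurable_diff borel_measurable_power meas_grid meas measurable_Xf; simp)+
  have b: "polybd n (\<lambda>y. f (y l))" "polybd n (\<lambda>y. f1 (y l))" for l
    using bf by (auto intro!: polybd_bounded)
  have pP: "polybd n P" "polybd n R"
    unfolding P_def[abs_def] R_def[abs_def] by (intro polybd_intros polybd_Xf b; simp)+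
  have iX: "integrable M (\<lambda>\<omega>. (Xf l (bv \<omega>))\<^sup>2)" if "l < n" for l
    by (rule integrable_polybd[of "\<lambda>y. (Xf l y)\<^sup>2"]) (intro polybd_power polybd_Xf that borel_measurable_power measurable_Xf)+
  have iP: "integrable M (\<lambda>\<omega>. (P (bv \<omega>))\<^sup>2)" "integrable M (\<lambda>\<omega>. (R (bv \<omega>))\<^sup>2)"
    by (rule integrable_polybd[of "\<lambda>y. (P y)\<^sup>2"], intro polybd_power pP, intro borel_measurable_power mP)
       (rule integrable_polybd[of "\<lambda>y. (R y)\<^sup>2"], intro polybd_power pP, intro borel_measurable_power mP)
  have EP: "expectation (\<lambda>\<omega>. (P (bv \<omega>))\<^sup>2) \<le> 10 * c\<^sup>2 * (2 * QW k + (SW k)\<^sup>2 / sqrt n)"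
    unfolding P_def QW_def SW_def by (rule variation_sq_bound[OF df(2,3) cf3 bf(2,3,4)])
  have ER: "expectation (\<lambda>\<omega>. (R (bv \<omega>))\<^sup>2) \<le> 16 * c\<^sup>2"
  proof -
    have Rb: "(R y)\<^sup>2 \<le> 8 * c\<^sup>2 * (\<Sum>l<n. \<bar>cr k l\<bar> * (Xf l y)\<^sup>2)" for y
    proof -
      have "\<bar>R y\<bar> \<le> 2 * c * (\<Sum>l<n. \<bar>cr k l\<bar> * \<bar>Xf l y\<bar>)"
        unfolding R_def sum_distrib_left
      proof (rule order_trans[OF sum_abs sum_mono])
        fix l
        have "\<bar>f (y l) * (2 * cr k l * Xf l y)\<bar> = \<bar>f (y l)\<bar> * (2 * (\<bar>cr k l\<bar> * \<bar>Xf l y\<bar>))" by (simp add: abs_mult)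
        also have "\<dots> \<le> c * (2 * (\<bar>cr k l\<bar> * \<bar>Xf l y\<bar>))" by (intro mult_right_mono bf) auto
        finally show "\<bar>f (y l) * (2 * cr k l * Xf l y)\<bar> \<le> 2 * c * (\<bar>cr k l\<bar> * \<bar>Xf l y\<bar>)" by simp
      qed
      then have "\<bar>R y\<bar>\<^sup>2 \<le> (2 * c * (\<Sum>l<n. \<bar>cr k l\<bar> * \<bar>Xf l y\<bar>))\<^sup>2" by (intro power_mono) auto
      also have "\<dots> = 4 * c\<^sup>2 * (\<Sum>l<n. \<bar>cr k l\<bar> * \<bar>Xf l y\<bar>)\<^sup>2" by (simp add: power_mult_distrib)
      also have "\<dots> \<le> 4 * c\<^sup>2 * ((\<Sum>l<n. \<bar>cr k l\<bar>) * (\<Sum>l<n. \<bar>cr k l\<bar> * \<bar>Xf l y\<bar>\<^sup>2))"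
        by (intro mult_left_mono sum_weighted_square) auto
      also have "\<dots> \<le> 4 * c\<^sup>2 * (2 * (\<Sum>l<n. \<bar>cr k l\<bar> * \<bar>Xf l y\<bar>\<^sup>2))"
        by (intro mult_left_mono mult_right_mono sum_abs_cr k sum_nonneg) auto
      finally show ?thesis by simp
    qed
    have "expectation (\<lambda>\<omega>. (R (bv \<omega>))\<^sup>2) \<le> expectation (\<lambda>\<omega>. 8 * c\<^sup>2 * (\<Sum>l<n. \<bar>cr k l\<bar> * (Xf l (bv \<omega>))\<^sup>2))"
      by (rule integral_mono[OF iP(2) _ Rb]) (use iX in \<open>intro integrable_mult_right Bochner_Integration.integrable_sum; simp\<close>)
    also have "\<dots> = 8 * c\<^sup>2 * (\<Sum>l<n. expectation (\<lambda>\<omega>. \<bar>cr k l\<bar> * (Xf l (bv \<omega>))\<^sup>2))"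
      using iX by (subst integral_mult_right_zero, subst Bochner_Integration.integral_sum) auto
    also have "\<dots> = 8 * c\<^sup>2 * (\<Sum>l<n. \<bar>cr k l\<bar>)" 
      by (intro arg_cong2[where f=times] sum.cong refl) (simp add: X_moments(1))
    also have "\<dots> \<le> 8 * c\<^sup>2 * 2" by (intro mult_left_mono sum_abs_cr k) auto
    finally show ?thesis by simp
  qed
  have pt: "(norm (U1 k y))\<^sup>2 \<le> 3 * s\<^sup>2 / n * (P y)\<^sup>2 + 3 * s\<^sup>2 / n * (R y)\<^sup>2 + 4 * (d / n * SW k)\<^sup>2" for y
  proof -
    define a where "a = (\<Sum>l<n. \<alpha>1 (y l) * wt k l) / n"
    have th: "\<theta>1 k y = s * P y / sqrt n + s * R y / sqrt n + a"
      unfolding \<theta>1_def P_def R_def a_def by (simp add: sum.distrib add_divide_distrib distrib_left mult_ac)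
    have sq3: "(x + v + z)\<^sup>2 \<le> 3 * x\<^sup>2 + 3 * v\<^sup>2 + 3 * z\<^sup>2" for x v z :: real
    proof -
      \<comment> \<open>The difference of the two sides of the claim is exactly this sum of
        squares.\<close>
      have "0 \<le> (x - v)\<^sup>2 + (x - z)\<^sup>2 + (v - z)\<^sup>2" by simp
      then show ?thesis by (simp add: power2_sum power2_diff algebra_simps)
    qed
    have "(norm (U1 k y))\<^sup>2 = (\<pi>1 k y)\<^sup>2 + (\<theta>1 k y)\<^sup>2" unfolding U1_def cmod_power2 by simp
    also have "\<dots> \<le> (\<pi>1 k y)\<^sup>2 + (3 * (s * P y / sqrt n)\<^sup>2 + 3 * (s * R y / sqrt n)\<^sup>2 + 3 * a\<^sup>2)"
      unfolding th by (intro add_left_mono sq3)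
    also have "(\<pi>1 k y)\<^sup>2 \<le> (d / n * SW k)\<^sup>2"
      unfolding \<pi>1_def using abs_mean_wt[of \<beta>1 y k] b\<beta>(2) by (metis abs_ge_zero power2_abs power_mono)
    also have "a\<^sup>2 \<le> (d / n * SW k)\<^sup>2"
      unfolding a_def using abs_mean_wt[of \<alpha>1 y k] b\<alpha>(1) by (metis abs_ge_zero power2_abs power_mono)
    also have "(s * P y / sqrt n)\<^sup>2 = s\<^sup>2 / n * (P y)\<^sup>2" by (simp add: power_divide power_mult_distrib)
    also have "(s * R y / sqrt n)\<^sup>2 = s\<^sup>2 / n * (R y)\<^sup>2" by (simp add: power_divide power_mult_distrib)
    finally show ?thesis by simp
  qed
  have "expectation (\<lambda>\<omega>. (norm (U1 k (bv \<omega>)))\<^sup>2) \<le> expectation (\<lambda>\<omega>. 3 * s\<^sup>2 / n * (P (bv \<omega>))\<^sup>2 + 3 * s\<^sup>2 / n * (R (bv \<omega>))\<^sup>2 + 4 * (d / n * SW k)\<^sup>2)"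
  proof (rule integral_mono[OF _ _ pt])
    show "integrable M (\<lambda>\<omega>. (norm (U1 k (bv \<omega>)))\<^sup>2)"
      by (rule integrable_polybd[of "\<lambda>y. (norm (U1 k y))\<^sup>2"])
         (intro polybd_power polybd_norm polybd_complex_parts borel_measurable_power measurable_norm_U1)+
    show "integrable M (\<lambda>\<omega>. 3 * s\<^sup>2 / n * (P (bv \<omega>))\<^sup>2 + 3 * s\<^sup>2 / n * (R (bv \<omega>))\<^sup>2 + 4 * (d / n * SW k)\<^sup>2)"
      by (intro Bochner_Integration.integrable_add integrable_mult_right iP integrable_const)
  qed
  also have "\<dots> = 3 * s\<^sup>2 / n * expectation (\<lambda>\<omega>. (P (bv \<omega>))\<^sup>2) + 3 * s\<^sup>2 / n * expectation (\<lambda>\<omega>. (R (bv \<omega>))\<^sup>2) + 4 * (d / n * SW k)\<^sup>2"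
    using iP prob_space
    by (subst Bochner_Integration.integral_add, (intro Bochner_Integration.integrable_add integrable_mult_right iP integrable_const)+)
       (subst Bochner_Integration.integral_add, (intro Bochner_Integration.integrable_add integrable_mult_right iP integrable_const)+, simp)
  also have "\<dots> \<le> 3 * s\<^sup>2 / n * (10 * c\<^sup>2 * (2 * QW k + (SW k)\<^sup>2 / sqrt n)) + 3 * s\<^sup>2 / n * (16 * c\<^sup>2) + 4 * (d / n * SW k)\<^sup>2"
    by (intro add_mono mult_left_mono EP ER order_refl) auto
  finally show ?thesis by (simp add: mult_ac)
qed

lemma sum_expectation_U1: "(\<Sum>k<n. expectation (\<lambda>\<omega>. (norm (U1 k (bv \<omega>)))\<^sup>2)) / sqrt n \<le> tbound"
proof -
  have "(\<Sum>k<n. expectation (\<lambda>\<omega>. (norm (U1 k (bv \<omega>)))\<^sup>2)) \<le>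
     (\<Sum>k<n. 3 * s\<^sup>2 * (10 * c\<^sup>2 * (2 * QW k + (SW k)\<^sup>2 / sqrt n) / n) + 3 * s\<^sup>2 * (16 * c\<^sup>2 / n) + 4 * (d / n * SW k)\<^sup>2)"
    by (intro sum_mono expectation_U1) simp
  also have "\<dots> = (\<Sum>k<n. 60 * s\<^sup>2 * c\<^sup>2 / n * QW k + 30 * s\<^sup>2 * c\<^sup>2 / n / sqrt n * (SW k)\<^sup>2 + 48 * s\<^sup>2 * c\<^sup>2 / n + 4 * d\<^sup>2 / (n * n) * (SW k)\<^sup>2)"
  proof (intro sum.cong refl)
    fix k
    have "3 * S * (10 * C * (2 * Q + W\<^sup>2 / r) / N) + 3 * S * (16 * C / N) + 4 * (d / N * W)\<^sup>2
      = 60 * S * C / N * Q + 30 * S * C / N / r * W\<^sup>2 + 48 * S * C / N + 4 * d\<^sup>2 / (N * N) * W\<^sup>2" for S C Q W r N :: real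
      by (simp add: algebra_simps add_divide_distrib power2_eq_square)
    then show "3 * s\<^sup>2 * (10 * c\<^sup>2 * (2 * QW k + (SW k)\<^sup>2 / sqrt n) / n) + 3 * s\<^sup>2 * (16 * c\<^sup>2 / n) + 4 * (d / n * SW k)\<^sup>2
      = 60 * s\<^sup>2 * c\<^sup>2 / n * QW k + 30 * s\<^sup>2 * c\<^sup>2 / n / sqrt n * (SW k)\<^sup>2 + 48 * s\<^sup>2 * c\<^sup>2 / n + 4 * d\<^sup>2 / (n * n) * (SW k)\<^sup>2" by simp
  qed
  also have "\<dots> = 60 * s\<^sup>2 * c\<^sup>2 / n * (\<Sum>k<n. QW k) + 30 * s\<^sup>2 * c\<^sup>2 / n / sqrt n * (\<Sum>k<n. (SW k)\<^sup>2) + n * (48 * s\<^sup>2 * c\<^sup>2 / n) + 4 * d\<^sup>2 / (n * n) * (\<Sum>k<n. (SW k)\<^sup>2)"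
    by (simp only: sum.distrib sum_distrib_left[symmetric] sum_constant card_lessThan)
  also have "\<dots> \<le> 60 * s\<^sup>2 * c\<^sup>2 / n * (3 / 2 * sqrt n * la) + 30 * s\<^sup>2 * c\<^sup>2 / n / sqrt n * (n * sqrt n * (la + 4) / 2) + n * (48 * s\<^sup>2 * c\<^sup>2 / n) + 4 * d\<^sup>2 / (n * n) * (n * sqrt n * (la + 4) / 2)"
    using sum_sum_wt_sq sum_sum_abs_wt_sq unfolding QW_def SW_def
    by (intro add_mono mult_left_mono order_refl) auto
  finally have "(\<Sum>k<n. expectation (\<lambda>\<omega>. (norm (U1 k (bv \<omega>)))\<^sup>2)) / sqrt n \<le>
     (60 * s\<^sup>2 * c\<^sup>2 / n * (3 / 2 * sqrt n * la) + 30 * s\<^sup>2 * c\<^sup>2 / n / sqrt n * (n * sqrt n * (la + 4) / 2) + n * (48 * s\<^sup>2 * c\<^sup>2 / n) + 4 * d\<^sup>2 / (n * n) * (n * sqrt n * (la + 4) / 2)) / sqrt n"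
    by (intro divide_right_mono) auto
  also have "\<dots> = tbound"
  proof -
    have "(60 * S * C / N * (3 / 2 * r * L) + 30 * S * C / N / r * (N * r * (L + 4) / 2) + N * (48 * S * C / N) + 4 * D / (N * N) * (N * r * (L + 4) / 2)) / r
       = 30 * S * C * (3 * L / N + (L + 4) / (2 * r)) + 48 * S * C / r + 2 * D * (L + 4) / N" if "0 < r" "0 < N" for S C N r L D :: real
      using that by (simp add: field_simps)
    from this[OF sqrt_n(1,3)] show ?thesis unfolding tbound_def of_nat_mult .
  qed
  finally show ?thesis .
qed

lemma polybd_rest: "polybd n (rest k)"
  and measurable_rest: "rest k \<in> borel_measurable (Pi\<^sub>M {..n} (\<lambda>_. borel))"
proof -
  have a: "(\<lambda>y::nat \<Rightarrow> real. \<bar>g y\<bar>) = (\<lambda>y. norm (g y))" for g by simp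
  show "polybd n (rest k)"
    unfolding rest_def[abs_def] real_norm_def[symmetric]
    by (intro polybd_intros polybd_norm polybd_complex_parts polybd_Xf; simp)
  show "rest k \<in> borel_measurable (Pi\<^sub>M {..n} (\<lambda>_. borel))"
    unfolding rest_def[abs_def]
    by (intro borel_measurable_add borel_measurable_times borel_measurable_divide borel_measurable_const borel_measurable_sum
      borel_measurable_diff borel_measurable_power borel_measurable_abs measurable_norm_U1 measurable_Xf; simp)
qed

lemma expectation_rest:
  assumes k: "k < n"
  shows "expectation (\<lambda>\<omega>. rest k (bv \<omega>)) \<le> c / (2 * sqrt n) * sqrt_inc k
    + (c / (2 * q ^ 3) + (c * q / 2 + c) * expectation (\<lambda>\<omega>. (norm (U1 k (bv \<omega>)))\<^sup>2))
    + (2 * c * d / n * QW k + c\<^sup>2 * \<bar>s\<bar> / sqrt n * (2 * QW k + 8 / q))"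
proof -
  let ?u = "expectation (\<lambda>\<omega>. (norm (U1 k (bv \<omega>)))\<^sup>2)"
  define z where "z l y = c * (wt k l)\<^sup>2 * \<bar>(Xf l y)\<^sup>2 - 1\<bar> + 4 * c * \<bar>wt k l\<bar> * \<bar>cr k l\<bar> * \<bar>Xf l y\<bar>" for l y
  have iu: "integrable M (\<lambda>\<omega>. (norm (U1 k (bv \<omega>)))\<^sup>2)"
    by (rule integrable_polybd[of "\<lambda>y. (norm (U1 k y))\<^sup>2"])
         (intro polybd_power polybd_norm polybd_complex_parts borel_measurable_power measurable_norm_U1)+
  have iq: "integrable M (\<lambda>\<omega>. \<bar>(Xf l (bv \<omega>))\<^sup>2 - 1\<bar>)" "integrable M (\<lambda>\<omega>. \<bar>Xf l (bv \<omega>)\<bar>)" if l: "l < n" for l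
    by (rule integrable_abs, rule integrable_polybd[of "\<lambda>y. (Xf l y)\<^sup>2 - 1"], intro polybd_intros polybd_Xf l,
         intro borel_measurable_diff borel_measurable_power borel_measurable_const measurable_Xf l)
       (rule integrable_abs, rule integrable_polybd[of "Xf l"], intro polybd_Xf l, intro measurable_Xf l)
  have iz: "integrable M (\<lambda>\<omega>. z l (bv \<omega>))" if "l < n" for l
    unfolding z_def using iq[OF that] by (intro Bochner_Integration.integrable_add integrable_mult_right)
  have Ez: "expectation (\<lambda>\<omega>. z l (bv \<omega>)) \<le> 2 * c * (wt k l)\<^sup>2 + 4 * c / q * \<bar>cr k l\<bar>" if l: "l < n" for l
  proof -
    have "expectation (\<lambda>\<omega>. z l (bv \<omega>)) = c * (wt k l)\<^sup>2 * expectation (\<lambda>\<omega>. \<bar>(Xf l (bv \<omega>))\<^sup>2 - 1\<bar>) + 4 * c * \<bar>wt k l\<bar> * \<bar>cr k l\<bar> * expectation (\<lambda>\<omega>. \<bar>Xf l (bv \<omega>)\<bar>)"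
      unfolding z_def using iq[OF l] by simp
    also have "\<dots> \<le> c * (wt k l)\<^sup>2 * 2 + 4 * c * (1 / q) * \<bar>cr k l\<bar> * 1"
      using cd_nonneg by (intro add_mono mult_mono X_moments l abs_wt_le' order_refl) (use q_ge_1 in auto)
    finally show ?thesis by (simp add: mult_ac)
  qed
  have "expectation (\<lambda>\<omega>. rest k (bv \<omega>)) = expectation (\<lambda>\<omega>. (c * sqrt_inc k / (2 * sqrt n) + c / (2 * q ^ 3) + 2 * c * d / n * QW k)
      + ((c * q / 2 + c) * (norm (U1 k (bv \<omega>)))\<^sup>2 + c * \<bar>s\<bar> / sqrt n * (\<Sum>l<n. z l (bv \<omega>))))"
  proof (intro Bochner_Integration.integral_cong refl)
    fix \<omega>
    have "A / (2 * r) + c * ((1 / w + q * U) / 2) + c * U + c * (2 * (d / n * Q) + S / r * Z) =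
       (A / (2 * r) + c / (2 * w) + 2 * c * d / n * Q) + ((c * q / 2 + c) * U + c * S / r * Z)" for A r w U Q S Z :: real
      by (simp add: algebra_simps add_divide_distrib)
    then show "rest k (bv \<omega>) = (c * sqrt_inc k / (2 * sqrt n) + c / (2 * q ^ 3) + 2 * c * d / n * QW k)
      + ((c * q / 2 + c) * (norm (U1 k (bv \<omega>)))\<^sup>2 + c * \<bar>s\<bar> / sqrt n * (\<Sum>l<n. z l (bv \<omega>)))"
      unfolding rest_def z_def .
  qed
  also have "\<dots> = (c * sqrt_inc k / (2 * sqrt n) + c / (2 * q ^ 3) + 2 * c * d / n * QW k)
      + ((c * q / 2 + c) * ?u + c * \<bar>s\<bar> / sqrt n * (\<Sum>l<n. expectation (\<lambda>\<omega>. z l (bv \<omega>))))"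
  proof -
    have 1: "integrable M (\<lambda>\<omega>. \<Sum>l<n. z l (bv \<omega>))"
      by (intro Bochner_Integration.integrable_sum) (use iz in simp)
    have 2: "expectation (\<lambda>\<omega>. \<Sum>l<n. z l (bv \<omega>)) = (\<Sum>l<n. expectation (\<lambda>\<omega>. z l (bv \<omega>)))"
      by (rule Bochner_Integration.integral_sum) (use iz in simp)
    show ?thesis using iu 1 prob_space by (simp add: 2)
  qed
  also have "(\<Sum>l<n. expectation (\<lambda>\<omega>. z l (bv \<omega>))) \<le> (\<Sum>l<n. 2 * c * (wt k l)\<^sup>2 + 4 * c / q * \<bar>cr k l\<bar>)"
    by (intro sum_mono Ez) simp
  also have "\<dots> = 2 * c * QW k + 4 * c / q * (\<Sum>l<n. \<bar>cr k l\<bar>)"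
    by (simp add: QW_def sum.distrib sum_distrib_left)
  also have "\<dots> \<le> 2 * c * QW k + 4 * c / q * 2"
    using cd_nonneg q_ge_1 by (intro add_left_mono mult_left_mono sum_abs_cr k) auto
  finally have "expectation (\<lambda>\<omega>. rest k (bv \<omega>)) \<le> (c * sqrt_inc k / (2 * sqrt n) + c / (2 * q ^ 3) + 2 * c * d / n * QW k)
      + ((c * q / 2 + c) * ?u + c * \<bar>s\<bar> / sqrt n * (2 * c * QW k + 4 * c / q * 2))"
    using cd_nonneg by (simp add: mult_left_mono divide_right_mono)
  also have "\<dots> = c / (2 * sqrt n) * sqrt_inc k
    + (c / (2 * q ^ 3) + (c * q / 2 + c) * ?u)
    + (2 * c * d / n * QW k + c\<^sup>2 * \<bar>s\<bar> / sqrt n * (2 * QW k + 8 / q))"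
    by (simp add: algebra_simps power2_eq_square)
  finally show ?thesis .
qed

lemma sum_expectation_rest: "(\<Sum>k<n. expectation (\<lambda>\<omega>. rest k (bv \<omega>))) / sqrt n \<le> ebound"
proof -
  let ?u = "\<lambda>k. expectation (\<lambda>\<omega>. (norm (U1 k (bv \<omega>)))\<^sup>2)"
  have Q: "(\<Sum>k<n. QW k) \<le> 3 / 2 * sqrt n * la" using sum_sum_wt_sq unfolding QW_def .
  have U: "(\<Sum>k<n. ?u k) \<le> tbound * sqrt n" using sum_expectation_U1 unfolding pos_divide_le_eq[OF sqrt_n(1)] .
  have t0: "0 \<le> tbound" using la_ge_1 unfolding tbound_def by simp
  have "(\<Sum>k<n. expectation (\<lambda>\<omega>. rest k (bv \<omega>))) \<le> (\<Sum>k<n. c / (2 * sqrt n) * sqrt_inc k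
    + (c / (2 * q ^ 3) + (c * q / 2 + c) * ?u k)
    + (2 * c * d / n * QW k + c\<^sup>2 * \<bar>s\<bar> / sqrt n * (2 * QW k + 8 / q)))"
    by (intro sum_mono expectation_rest) simp
  also have "\<dots> = c / (2 * sqrt n) * (\<Sum>k<n. sqrt_inc k) + (n * (c / (2 * q ^ 3)) + (c * q / 2 + c) * (\<Sum>k<n. ?u k))
    + (2 * c * d / n * (\<Sum>k<n. QW k) + c\<^sup>2 * \<bar>s\<bar> / sqrt n * (2 * (\<Sum>k<n. QW k) + n * (8 / q)))"
    by (simp add: sum.distrib sum_distrib_left distrib_left)
  also have "\<dots> \<le> c / (2 * sqrt n) * sqrt n + (n * (c / (2 * q ^ 3)) + (3 / 2 * c * q) * (tbound * sqrt n))
    + (2 * c * d / n * (3 / 2 * sqrt n * la) + c\<^sup>2 * \<bar>s\<bar> / sqrt n * (2 * (3 / 2 * sqrt n * la) + n * (8 / q)))"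
  proof (intro add_mono mult_mono order_refl mult_left_mono Q U)
    have "c * 1 \<le> c * q" using cd_nonneg q_ge_1 by (intro mult_left_mono) auto
    then show "c * q / 2 + c \<le> 3 / 2 * c * q" by (simp add: field_simps)
    show "(\<Sum>k<n. sqrt_inc k) \<le> sqrt n" by (simp add: sum_sqrt_inc)
  qed (use cd_nonneg q_ge_1 in \<open>auto intro!: sum_nonneg add_nonneg_nonneg sqrt_inc_nonneg simp: QW_def\<close>)
  finally have "(\<Sum>k<n. expectation (\<lambda>\<omega>. rest k (bv \<omega>))) / sqrt n \<le> (c / (2 * sqrt n) * sqrt n + (n * (c / (2 * q ^ 3)) + (3 / 2 * c * q) * (tbound * sqrt n))
    + (2 * c * d / n * (3 / 2 * sqrt n * la) + c\<^sup>2 * \<bar>s\<bar> / sqrt n * (2 * (3 / 2 * sqrt n * la) + n * (8 / q)))) / sqrt n"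
    by (intro divide_right_mono) auto
  also have "\<dots> = ebound"
  proof -
    \<comment> \<open>Written in powers of \<open>q\<close>, the claim becomes an identity of
      rational functions.\<close>
    have n4: "real n = q ^ 4" "sqrt n = q ^ 2"
    proof -
      show "sqrt n = q ^ 2" using q_sq by (simp add: power2_eq_square)
      then show "real n = q ^ 4" using sqrt_n(2) by (simp add: eval_nat_numeral)
    qed
    have "(c / (2 * p\<^sup>2) * p\<^sup>2 + (p ^ 4 * (c / (2 * p ^ 3)) + (3 / 2 * c * p) * (t * p\<^sup>2))
    + (2 * c * d / p ^ 4 * (3 / 2 * p\<^sup>2 * L) + c\<^sup>2 * S / p\<^sup>2 * (2 * (3 / 2 * p\<^sup>2 * L) + p ^ 4 * (8 / p)))) / p\<^sup>2
     = c / (2 * p\<^sup>2) + c / (2 * p) + 3 / 2 * c * p * t + 3 * c * d * L / p ^ 4 + c\<^sup>2 * S * (3 * L / p\<^sup>2 + 8 / p)" if "0 < p" for p t L S :: real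
      using that by (simp add: field_simps eval_nat_numeral)
    from this[of q tbound la "\<bar>s\<bar>"] q_ge_1 show ?thesis unfolding ebound_def n4(2) unfolding n4(1) by simp
  qed
  finally show ?thesis .
qed

text \<open>\<open>ibp_F\<close> is summed over \<open>k\<close>: the surviving parts
  \<open>Dk\<close> add up to the drift and to the double sum \<open>dv\<close>, and
  \<open>rest\<close> adds up to at most \<open>ebound\<close>. The limit variance still has to be
  extracted from \<open>dv\<close>.\<close>

theorem interpolation_bound:
  "norm (expectation (\<lambda>\<omega>. of_real (qv (bv \<omega>)) * \<Psi> (bv \<omega>))
     - expectation (\<lambda>\<omega>. (of_real ((\<Sum>k<n. f2 (bv \<omega> k)) / (4 * n)) + \<i> * of_real (s * dv (bv \<omega>))) * \<Psi> (bv \<omega>))) \<le> ebound"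
proof -
  have mD: "Dk k \<in> borel_measurable (Pi\<^sub>M {..n} (\<lambda>_. borel))" if "k < n" for k
    unfolding Dk_def[abs_def]
    by (intro borel_measurable_add borel_measurable_times borel_measurable_divide borel_measurable_const borel_measurable_sum
        measurable_complex_of_real meas_grid meas that; simp)
  have pD: "polybd n (Dk k)" for k
  proof -
    have b: "polybd n (\<lambda>y. f (y l))" "polybd n (\<lambda>y. f2 (y l))" for l
      using bf by (auto intro!: polybd_bounded)
    show ?thesis unfolding Dk_def[abs_def] by (intro polybd_intros b)
  qed
  have i1: "integrable M (\<lambda>\<omega>. of_real ((Xf k (bv \<omega>))\<^sup>2 - 1) * F0 k (bv \<omega>))" if "k < n" for k
    by (rule integrable_polybd[of "\<lambda>y. of_real ((Xf k y)\<^sup>2 - 1) * F0 k y"])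
       (intro polybd_mult polybd_of_real polybd_diff polybd_power polybd_const polybd_Xf polybd_F that
         borel_measurable_times measurable_complex_of_real borel_measurable_diff borel_measurable_power borel_measurable_const measurable_Xf measurable_F)+
  have i2: "integrable M (\<lambda>\<omega>. F2 k (bv \<omega>))" if "k < n" for k
    by (rule integrable_polybd[of "F2 k"]) (intro polybd_F measurable_F that)+
  have i3: "integrable M (\<lambda>\<omega>. Dk k (bv \<omega>) * \<Psi> (bv \<omega>))" if "k < n" for k
    by (rule integrable_polybd[of "\<lambda>y. Dk k y * \<Psi> y"]) (intro polybd_mult pD polybd_complex_parts borel_measurable_times mD measurable_complex_parts that)+
  have i4: "integrable M (\<lambda>\<omega>. rest k (bv \<omega>))" for k
    by (rule integrable_polybd[of "rest k"]) (intro polybd_rest measurable_rest)+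
  have "expectation (\<lambda>\<omega>. of_real (qv (bv \<omega>)) * \<Psi> (bv \<omega>)) = expectation (\<lambda>\<omega>. (\<Sum>k<n. of_real ((Xf k (bv \<omega>))\<^sup>2 - 1) * F0 k (bv \<omega>)) / of_real (sqrt n))"
  proof (intro Bochner_Integration.integral_cong refl)
    fix \<omega>
    have "(\<Sum>k<n. of_real ((Xf k y)\<^sup>2 - 1) * (of_real (f (y k)) * \<Psi> y)) = of_real (\<Sum>l<n. f (y l) * ((Xf l y)\<^sup>2 - 1)) * \<Psi> y" for y
      unfolding of_real_sum sum_distrib_right by (intro sum.cong refl) (simp only: of_real_mult mult_ac)
    then show "of_real (qv (bv \<omega>)) * \<Psi> (bv \<omega>) = (\<Sum>k<n. of_real ((Xf k (bv \<omega>))\<^sup>2 - 1) * F0 k (bv \<omega>)) / of_real (sqrt n)"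
      unfolding qv_def F0_def of_real_divide times_divide_eq_left by simp
  qed
  also have "\<dots> = (\<Sum>k<n. expectation (\<lambda>\<omega>. F2 k (bv \<omega>))) / of_real (sqrt n)"
  proof -
    have "expectation (\<lambda>\<omega>. \<Sum>k<n. of_real ((Xf k (bv \<omega>))\<^sup>2 - 1) * F0 k (bv \<omega>)) = (\<Sum>k<n. expectation (\<lambda>\<omega>. of_real ((Xf k (bv \<omega>))\<^sup>2 - 1) * F0 k (bv \<omega>)))"
      by (intro Bochner_Integration.integral_sum i1) simp
    also have "\<dots> = (\<Sum>k<n. expectation (\<lambda>\<omega>. F2 k (bv \<omega>)))"
      by (intro sum.cong refl ibp_F) simp
    finally show ?thesis by (simp only: integral_divide_zero)
  qed
  finally have e1: "expectation (\<lambda>\<omega>. of_real (qv (bv \<omega>)) * \<Psi> (bv \<omega>)) = (\<Sum>k<n. expectation (\<lambda>\<omega>. F2 k (bv \<omega>))) / of_real (sqrt n)" .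
  have D: "(of_real ((\<Sum>k<n. f2 (y k)) / (4 * n)) + \<i> * of_real (s * dv y)) = (\<Sum>k<n. Dk k y) / of_real (sqrt n)" for y
  proof -
    have 1: "(\<Sum>k<n. f2 (y k)) / (4 * n) = (\<Sum>k<n. f2 (y k) / (4 * sqrt n)) / sqrt n"
      using sqrt_n by (simp add: sum_divide_distrib[symmetric] mult.assoc)
    have 2: "s * dv y = (\<Sum>k<n. s / sqrt n * (\<Sum>l<n. 2 * f (y k) * f (y l) * (cr k l)\<^sup>2)) / sqrt n"
    proof -
      have "(\<Sum>k<n. s / sqrt n * (\<Sum>l<n. 2 * f (y k) * f (y l) * (cr k l)\<^sup>2)) = s / sqrt n * (2 * (\<Sum>k<n. \<Sum>l<n. f (y k) * f (y l) * (cr k l)\<^sup>2))"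
        by (simp add: sum_distrib_left mult.assoc)
      then have "(\<Sum>k<n. s / sqrt n * (\<Sum>l<n. 2 * f (y k) * f (y l) * (cr k l)\<^sup>2)) / sqrt n = s / (sqrt n * sqrt n) * (2 * (\<Sum>k<n. \<Sum>l<n. f (y k) * f (y l) * (cr k l)\<^sup>2))"
        by simp
      then show ?thesis unfolding sqrt_n(2) dv_def by simp
    qed
    show ?thesis unfolding 1 2 Dk_def by (simp add: sum.distrib add_divide_distrib sum_distrib_left)
  qed
  have e2: "expectation (\<lambda>\<omega>. (of_real ((\<Sum>k<n. f2 (bv \<omega> k)) / (4 * n)) + \<i> * of_real (s * dv (bv \<omega>))) * \<Psi> (bv \<omega>))
     = (\<Sum>k<n. expectation (\<lambda>\<omega>. Dk k (bv \<omega>) * \<Psi> (bv \<omega>))) / of_real (sqrt n)"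
    unfolding D times_divide_eq_left sum_distrib_right using i3 by (simp add: Bochner_Integration.integral_sum)
  have "norm ((\<Sum>k<n. expectation (\<lambda>\<omega>. F2 k (bv \<omega>))) / of_real (sqrt n) - (\<Sum>k<n. expectation (\<lambda>\<omega>. Dk k (bv \<omega>) * \<Psi> (bv \<omega>))) / of_real (sqrt n))
     = norm (\<Sum>k<n. expectation (\<lambda>\<omega>. F2 k (bv \<omega>) - Dk k (bv \<omega>) * \<Psi> (bv \<omega>))) / sqrt n"
  proof -
    have "(\<Sum>k<n. expectation (\<lambda>\<omega>. F2 k (bv \<omega>) - Dk k (bv \<omega>) * \<Psi> (bv \<omega>))) = (\<Sum>k<n. expectation (\<lambda>\<omega>. F2 k (bv \<omega>)) - expectation (\<lambda>\<omega>. Dk k (bv \<omega>) * \<Psi> (bv \<omega>)))"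
      by (intro sum.cong refl Bochner_Integration.integral_diff i2 i3) auto
    then show ?thesis
      unfolding diff_divide_distrib[symmetric] sum_subtractf[symmetric] norm_divide by simp
  qed
  also have "\<dots> \<le> (\<Sum>k<n. expectation (\<lambda>\<omega>. rest k (bv \<omega>))) / sqrt n"
  proof (intro divide_right_mono order_trans[OF norm_sum sum_mono])
    fix k assume k: "k \<in> {..<n}"
    show "norm (expectation (\<lambda>\<omega>. F2 k (bv \<omega>) - Dk k (bv \<omega>) * \<Psi> (bv \<omega>))) \<le> expectation (\<lambda>\<omega>. rest k (bv \<omega>))"
    proof (rule order_trans[OF integral_norm_bound integral_mono])
      show "integrable M (\<lambda>\<omega>. norm (F2 k (bv \<omega>) - Dk k (bv \<omega>) * \<Psi> (bv \<omega>)))"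
        using k by (intro integrable_norm Bochner_Integration.integrable_diff i2 i3) auto
    qed (use k i4 F2_rest in auto)
  qed auto
  also have "\<dots> \<le> ebound" by (rule sum_expectation_rest)
  finally show ?thesis unfolding e1 e2 .
qed

end

section \<open>The limit for bounded functions\<close>

lemma integral_uniform_partition:
  fixes g :: "real \<Rightarrow> real"
  assumes g: "continuous_on {0..1} g" and n: "0 < n" and m: "m \<le> n"
  shows "integral {0..real m / n} g = (\<Sum>l<m. integral {real l / n..real (Suc l) / n} g)"
  using m
proof (induction m)
  case (Suc m)
  have "integral {0..real m / n} g + integral {real m / n..real (Suc m) / n} g = integral {0..real (Suc m) / n} g"
  proof (rule Henstock_Kurzweil_Integration.integral_combine)
    show "g integrable_on {0..real (Suc m) / n}"
      using Suc.prems n by (intro integrable_continuous_real continuous_on_subset[OF g]) auto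
  qed (use n in \<open>auto simp: divide_right_mono\<close>)
  then show ?case using Suc by simp
qed simp

text \<open>Uniform continuity makes \<open>g\<close> differ from its left-endpoint value by less
  than \<open>r / 2\<close> on each cell of a fine partition.\<close>

lemma riemann_sum_tendsto:
  fixes g :: "real \<Rightarrow> real"
  assumes g: "continuous_on {0..1} g"
  shows "(\<lambda>n. (\<Sum>l<n. g (real l / n)) / n) \<longlonglongrightarrow> (LINT s:{0..1}|lborel. g s)"
proof -
  have L: "(LINT s:{0..1}|lborel. g s) = integral {0..1} g"
    by (intro set_borel_integral_eq_integral borel_integrable_atLeastAtMost' g)
  have "uniformly_continuous_on {0..1} g"
    using g by (intro compact_uniformly_continuous) auto
  show ?thesis unfolding L
  proof (rule LIMSEQ_I)
    fix r :: real assume r: "0 < r"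
    then obtain \<delta> where \<delta>: "0 < \<delta>" "\<And>x y. x \<in> {0..1} \<Longrightarrow> y \<in> {0..1} \<Longrightarrow> dist y x < \<delta> \<Longrightarrow> dist (g y) (g x) < r / 2"
      using \<open>uniformly_continuous_on {0..1} g\<close> unfolding uniformly_continuous_on_def by (metis half_gt_zero)
    obtain N :: nat where N: "1 / \<delta> < N" using reals_Archimedean2 by blast
    show "\<exists>no. \<forall>n\<ge>no. norm ((\<Sum>l<n. g (real l / n)) / n - integral {0..1} g) < r"
    proof (intro exI allI impI)
      fix n assume n: "Suc N \<le> n"
      then have n0: "0 < n" by simp
      have "1 / \<delta> < n" using N n by linarith
      then have nd: "1 / n < \<delta>" using \<delta>(1) n0 by (simp add: field_simps)
      have sub: "{real l / n..real (Suc l) / n} \<subseteq> {0..1}" if "l < n" for l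
        using that n0 by (auto simp: field_simps)
      have "(\<Sum>l<n. g (real l / n)) / n - integral {0..1} g = (\<Sum>l<n. g (real l / n) / n - integral {real l / n..real (Suc l) / n} g)"
        using integral_uniform_partition[OF g n0 order_refl] n0 by (simp add: sum_subtractf sum_divide_distrib)
      also have "norm \<dots> \<le> (\<Sum>l<n. r / 2 / n)"
      proof (rule order_trans[OF norm_sum sum_mono])
        fix l assume l: "l \<in> {..<n}"
        have le: "real l / n \<le> real (Suc l) / n" by (simp add: divide_right_mono)
        have gi: "g integrable_on {real l / n..real (Suc l) / n}"
          using sub l by (intro integrable_continuous_real continuous_on_subset[OF g]) auto
        have len: "real (Suc l) / n - real l / n = 1 / n" by (simp add: diff_divide_distrib[symmetric])
        have "g (real l / n) / n - integral {real l / n..real (Suc l) / n} g = integral {real l / n..real (Suc l) / n} (\<lambda>x. g (real l / n) - g x)"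
          using gi le len by (subst Henstock_Kurzweil_Integration.integral_diff) (auto simp: mult.commute)
        also have "norm \<dots> \<le> r / 2 * (real (Suc l) / n - real l / n)"
        proof (rule integral_bound[OF le])
          show "continuous_on {real l / n..real (Suc l) / n} (\<lambda>x. g (real l / n) - g x)"
            using sub l by (intro continuous_intros continuous_on_subset[OF g]) auto
          fix t assume t: "t \<in> {real l / n..real (Suc l) / n}"
          have "dist (real l / n) t < \<delta>"
            using t len nd by (simp add: dist_real_def)
          moreover have "real l / n \<in> {0..1}" "t \<in> {0..1}"
            using subsetD[OF sub, of l "real l / n"] subsetD[OF sub, of l t] l t le by auto
          ultimately show "norm (g (real l / n) - g t) \<le> r / 2"
            using \<delta>(2)[of t "real l / n"] by (simp add: dist_norm)
        qed
        finally show "norm (g (real l / n) / n - integral {real l / n..real (Suc l) / n} g) \<le> r / 2 / n"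
          unfolding len by simp
      qed
      also have "\<dots> < r" using n0 r by simp
      finally show "norm ((\<Sum>l<n. g (real l / n)) / n - integral {0..1} g) < r" .
    qed
  qed
qed

context quarter_fbm
begin

lemma continuous_f_B:
  "\<omega> \<in> space M \<Longrightarrow> continuous_on UNIV g \<Longrightarrow> continuous_on {0..1} (\<lambda>t. g (B t \<omega>))" for g :: "real \<Rightarrow> real"
  by (rule continuous_on_compose2[OF _ continuous_B]) auto

lemma riemann_B:
  fixes g :: "real \<Rightarrow> real"
  assumes "\<omega> \<in> space M" "continuous_on UNIV g"
  shows "(\<lambda>n. (\<Sum>l<n. g (B (real l / n) \<omega>)) / n) \<longlonglongrightarrow> (LINT s:{0..1}|lborel. g (B s \<omega>))"
  by (rule riemann_sum_tendsto[OF continuous_f_B[OF assms]])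

lemma measurable_mean_B:
  fixes g :: "real \<Rightarrow> real"
  assumes "continuous_on UNIV g"
  shows "(\<lambda>\<omega>. (\<Sum>l<n. g (B (real l / n) \<omega>)) / n) \<in> borel_measurable M"
proof -
  have "(\<lambda>\<omega>. g (B (real l / n) \<omega>)) \<in> borel_measurable M" if "l < n" for l
    using that by (intro measurable_compose[OF measurable_B borel_measurable_continuous_onI[OF assms]]) auto
  then show ?thesis by (intro borel_measurable_divide borel_measurable_sum borel_measurable_const) auto
qed

text \<open>Measurability in \<open>\<omega>\<close> is inherited from the Riemann sums, which
  converge on every path.\<close>

lemma measurable_integral_B:
  fixes g :: "real \<Rightarrow> real"
  assumes "continuous_on UNIV g"
  shows "(\<lambda>\<omega>. LINT s:{0..1}|lborel. g (B s \<omega>)) \<in> borel_measurable M"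
  by (rule borel_measurable_LIMSEQ_real[OF riemann_B[OF _ assms] measurable_mean_B[OF assms]])

end

lemma real_norm_cmod_exp: "0 \<le> p \<Longrightarrow> norm (exp (Complex (- p) t)) \<le> 1"
  by simp

section \<open>From the double sum of correlations to the limit variance\<close>

context interpolation
begin

text \<open>Compensates the factor \<open>sqrt \<bar>real l - real k\<bar>\<close> of
  \<open>expectation_abs_increment\<close>: distant pairs have large increments but small
  correlation.\<close>

lemma abs_rho_sqrt: "\<bar>cr k l\<bar> * sqrt \<bar>real l - real k\<bar> \<le> 1 / 2"
proof -
  have j: "\<bar>rho (int j)\<bar> * sqrt (real j) \<le> 1 / 2" for j
  proof (cases j)
    case (Suc i)
    have "\<bar>rho (int (Suc i))\<bar> \<le> sqrt_inc i / 2"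
      unfolding abs_rho_Suc using sqrt_inc_nonneg[of "Suc i"] by (intro divide_right_mono) auto
    also have "\<dots> \<le> 1 / sqrt (real i + 1) / 2" by (intro divide_right_mono sqrt_inc_le) auto
    finally have "\<bar>rho (int (Suc i))\<bar> * sqrt (real i + 1) \<le> 1 / sqrt (real i + 1) / 2 * sqrt (real i + 1)"
      by (rule mult_right_mono) auto
    also have "\<dots> = 1 / 2"
    proof -
      have "sqrt (real i + 1) > 0" by simp
      then show ?thesis by (simp add: field_simps del: real_sqrt_gt_0_iff)
    qed
    finally show ?thesis by (simp add: Suc add.commute)
  qed simp
  define m where "m = nat \<bar>int l - int k\<bar>"
  have "\<bar>real l - real k\<bar> = real m" "int l - int k = int m \<or> int l - int k = - int m"
    unfolding m_def by linarith+
  then show ?thesis using j[of m] by (auto simp: cr_def)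
qed

text \<open>Completing the square bounds \<open>\<bar>x\<bar>\<close> by
  \<open>1 / (2 * q) + q / 2 * x\<^sup>2\<close>, so the second moment suffices. The bound grows
  like the square root of the distance instead of its fourth root; the decay of \<open>rho\<close>
  can afford this.\<close>

lemma expectation_abs_increment:
  assumes "k < n" "l < n"
  shows "expectation (\<lambda>\<omega>. \<bar>bv \<omega> l - bv \<omega> k\<bar>) \<le> (1 + sqrt \<bar>real l - real k\<bar>) / (2 * q)"
proof -
  have ib: "integrable M (\<lambda>\<omega>. bv \<omega> i * bv \<omega> j)" if "i < n" "j < n" for i j
    using that by (intro integrable_polybd[of "\<lambda>y. y i * y j"] polybd_mult polybd_coord borel_measurable_times measurable_coord) auto
  have i1: "integrable M (\<lambda>\<omega>. \<bar>bv \<omega> l - bv \<omega> k\<bar>)"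
    using assms by (intro integrable_abs integrable_polybd[of "\<lambda>y. y l - y k"] polybd_diff polybd_coord borel_measurable_diff measurable_coord) auto
  have i2: "integrable M (\<lambda>\<omega>. (bv \<omega> l - bv \<omega> k)\<^sup>2)"
    using assms by (intro integrable_polybd[of "\<lambda>y. (y l - y k)\<^sup>2"] polybd_power polybd_diff polybd_coord borel_measurable_power borel_measurable_diff measurable_coord) auto
  have "expectation (\<lambda>\<omega>. (bv \<omega> l - bv \<omega> k)\<^sup>2) = expectation (\<lambda>\<omega>. bv \<omega> l * bv \<omega> l - 2 * (bv \<omega> k * bv \<omega> l) + bv \<omega> k * bv \<omega> k)"
    by (intro Bochner_Integration.integral_cong refl) (simp add: power2_eq_square algebra_simps)
  also have "\<dots> = expectation (\<lambda>\<omega>. bv \<omega> l * bv \<omega> l) - 2 * expectation (\<lambda>\<omega>. bv \<omega> k * bv \<omega> l) + expectation (\<lambda>\<omega>. bv \<omega> k * bv \<omega> k)"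
    using ib assms by simp
  also have "\<dots> = sqrt \<bar>real l - real k\<bar> / (q * q)"
    using assms sqrt_n(1) unfolding q_sq by (simp add: cov_bv field_simps)
  finally have E2: "expectation (\<lambda>\<omega>. (bv \<omega> l - bv \<omega> k)\<^sup>2) = sqrt \<bar>real l - real k\<bar> / (q * q)" .
  have "expectation (\<lambda>\<omega>. \<bar>bv \<omega> l - bv \<omega> k\<bar>) \<le> expectation (\<lambda>\<omega>. 1 / (2 * q) + q / 2 * (bv \<omega> l - bv \<omega> k)\<^sup>2)"
  proof (intro integral_mono i1)
    fix \<omega>
    have e: "q / 2 * (z - 1 / q)\<^sup>2 = q / 2 * z\<^sup>2 - z + 1 / (2 * q)" for z
      using q_ge_1 by (simp add: power2_eq_square field_simps)
    have "0 \<le> q / 2 * (\<bar>bv \<omega> l - bv \<omega> k\<bar> - 1 / q)\<^sup>2" using q_ge_1 by simp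
    also have "\<dots> = q / 2 * (bv \<omega> l - bv \<omega> k)\<^sup>2 - \<bar>bv \<omega> l - bv \<omega> k\<bar> + 1 / (2 * q)"
      unfolding e by simp
    finally show "\<bar>bv \<omega> l - bv \<omega> k\<bar> \<le> 1 / (2 * q) + q / 2 * (bv \<omega> l - bv \<omega> k)\<^sup>2" by simp
  qed (use i2 in simp)
  also have "\<dots> = 1 / (2 * q) + q / 2 * (sqrt \<bar>real l - real k\<bar> / (q * q))"
    using i2 E2 prob_space by simp
  also have "\<dots> = (1 + sqrt \<bar>real l - real k\<bar>) / (2 * q)" using q_ge_1 by (simp add: field_simps)
  finally show ?thesis .
qed

definition sv where "sv y = C_quarter\<^sup>2 / n * (\<Sum>k<n. (f (y k))\<^sup>2)" for y

text \<open>In the double sum \<open>f (y l)\<close> is replaced by \<open>f (y k)\<close>, at the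
  price of the Lipschitz constant times a mean increment, and each row sum of squared correlations
  by the full series, at the price of a boundary term that sums to order
  \<open>sqrt n\<close>.\<close>

lemma expectation_dv_sv: "expectation (\<lambda>\<omega>. \<bar>dv (bv \<omega>) - sv (bv \<omega>)\<bar>) \<le> 4 * c\<^sup>2 / q + 2 * c\<^sup>2 / sqrt n"
proof -
  define D where "D = (\<Sum>\<^sub>\<infinity>p\<in>UNIV. (rho p)\<^sup>2)"
  have lip: "\<bar>f x - f z\<bar> \<le> c * \<bar>x - z\<bar>" for x z
    using field_differentiable_bound[of UNIV f f1 c x z] df(1) bf(2) by (auto simp: has_field_derivative_at_within)
  have pt: "\<bar>dv y - sv y\<bar> \<le> 2 / n * (\<Sum>k<n. c\<^sup>2 * (\<Sum>l<n. \<bar>y l - y k\<bar> * (cr k l)\<^sup>2) + c\<^sup>2 * ((sqrt_inc k + sqrt_inc (n - Suc k)) / 2))" for y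
  proof -
    \<comment> \<open>The two replacements separated: the first summand exchanges the argument of
      \<open>f\<close>, the second completes the row to the series \<open>D\<close>.\<close>
    have "dv y - sv y = 2 / n * (\<Sum>k<n. f (y k) * (\<Sum>l<n. (f (y l) - f (y k)) * (cr k l)\<^sup>2) + (f (y k))\<^sup>2 * ((\<Sum>l<n. (cr k l)\<^sup>2) - D))"
    proof -
      have "sv y = 2 / n * (\<Sum>k<n. (f (y k))\<^sup>2 * D)" unfolding sv_def C_quarter_sq D_def
        by (simp add: sum_distrib_right[symmetric])
      moreover have "dv y = 2 / n * (\<Sum>k<n. f (y k) * (\<Sum>l<n. f (y l) * (cr k l)\<^sup>2))"
        unfolding dv_def by (simp add: sum_distrib_left mult.assoc)
      ultimately have "dv y - sv y = 2 / n * (\<Sum>k<n. f (y k) * (\<Sum>l<n. f (y l) * (cr k l)\<^sup>2) - (f (y k))\<^sup>2 * D)"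
        by (simp add: sum_subtractf right_diff_distrib)
      also have "(\<lambda>k. f (y k) * (\<Sum>l<n. f (y l) * (cr k l)\<^sup>2) - (f (y k))\<^sup>2 * D) =
         (\<lambda>k. f (y k) * (\<Sum>l<n. (f (y l) - f (y k)) * (cr k l)\<^sup>2) + (f (y k))\<^sup>2 * ((\<Sum>l<n. (cr k l)\<^sup>2) - D))"
        by (rule ext) (simp add: left_diff_distrib sum_subtractf sum_distrib_left[symmetric] power2_eq_square[of "f _"] algebra_simps)
      finally show ?thesis .
    qed
    then have "\<bar>dv y - sv y\<bar> = 2 / n * \<bar>\<Sum>k<n. f (y k) * (\<Sum>l<n. (f (y l) - f (y k)) * (cr k l)\<^sup>2) + (f (y k))\<^sup>2 * ((\<Sum>l<n. (cr k l)\<^sup>2) - D)\<bar>"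
      by (simp add: abs_mult)
    also have "\<dots> \<le> 2 / n * (\<Sum>k<n. c\<^sup>2 * (\<Sum>l<n. \<bar>y l - y k\<bar> * (cr k l)\<^sup>2) + c\<^sup>2 * ((sqrt_inc k + sqrt_inc (n - Suc k)) / 2))"
    proof (intro mult_left_mono order_trans[OF sum_abs sum_mono] order_trans[OF abs_triangle_ineq add_mono])
      fix k assume k: "k \<in> {..<n}"
      have "\<bar>\<Sum>l<n. (f (y l) - f (y k)) * (cr k l)\<^sup>2\<bar> \<le> (\<Sum>l<n. c * (\<bar>y l - y k\<bar> * (cr k l)\<^sup>2))"
      proof (rule order_trans[OF sum_abs sum_mono])
        fix l
        have "\<bar>f (y l) - f (y k)\<bar> * (cr k l)\<^sup>2 \<le> c * \<bar>y l - y k\<bar> * (cr k l)\<^sup>2" by (intro mult_right_mono lip) auto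
        then show "\<bar>(f (y l) - f (y k)) * (cr k l)\<^sup>2\<bar> \<le> c * (\<bar>y l - y k\<bar> * (cr k l)\<^sup>2)" by (simp add: abs_mult)
      qed
      then have "\<bar>f (y k)\<bar> * \<bar>\<Sum>l<n. (f (y l) - f (y k)) * (cr k l)\<^sup>2\<bar> \<le> c * (\<Sum>l<n. c * (\<bar>y l - y k\<bar> * (cr k l)\<^sup>2))"
        using cd_nonneg by (intro mult_mono bf) auto
      then show "\<bar>f (y k) * (\<Sum>l<n. (f (y l) - f (y k)) * (cr k l)\<^sup>2)\<bar> \<le> c\<^sup>2 * (\<Sum>l<n. \<bar>y l - y k\<bar> * (cr k l)\<^sup>2)"
        by (simp add: abs_mult power2_eq_square sum_distrib_left[symmetric] mult.assoc)
      have "(f (y k))\<^sup>2 \<le> c\<^sup>2" using power_mono[OF bf(1)[of "y k"], of 2] by simp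
      moreover have "\<bar>(\<Sum>l<n. (cr k l)\<^sup>2) - D\<bar> \<le> (sqrt_inc k + sqrt_inc (n - Suc k)) / 2"
        using sum_rho_sq_row[of k n] k unfolding cr_def D_def by (simp add: abs_minus_commute)
      ultimately show "\<bar>(f (y k))\<^sup>2 * ((\<Sum>l<n. (cr k l)\<^sup>2) - D)\<bar> \<le> c\<^sup>2 * ((sqrt_inc k + sqrt_inc (n - Suc k)) / 2)"
        unfolding abs_mult abs_power2 by (intro mult_mono) auto
    qed auto
    finally show ?thesis .
  qed
  have ii: "integrable M (\<lambda>\<omega>. \<bar>bv \<omega> l - bv \<omega> k\<bar>)" if "k < n" "l < n" for k l
    using that by (intro integrable_abs integrable_polybd[of "\<lambda>y. y l - y k"] polybd_diff polybd_coord borel_measurable_diff measurable_coord) auto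
  have im: "integrable M (\<lambda>\<omega>. \<Sum>l<n. \<bar>bv \<omega> l - bv \<omega> k\<bar> * (cr k l)\<^sup>2)" if "k < n" for k
    using that by (intro Bochner_Integration.integrable_sum integrable_mult_left ii) auto
  have mm: "dv \<in> borel_measurable (Pi\<^sub>M {..n} (\<lambda>_. borel))" "sv \<in> borel_measurable (Pi\<^sub>M {..n} (\<lambda>_. borel))"
    unfolding dv_def[abs_def] sv_def[abs_def]
    by (intro borel_measurable_times borel_measurable_const borel_measurable_sum borel_measurable_power meas_grid meas; simp)+
  have b: "polybd n (\<lambda>y. f (y l))" for l using bf by (auto intro!: polybd_bounded)
  have pp: "polybd n dv" "polybd n sv"
    unfolding dv_def[abs_def] sv_def[abs_def] by (intro polybd_intros b)+
  have "expectation (\<lambda>\<omega>. \<bar>dv (bv \<omega>) - sv (bv \<omega>)\<bar>) \<le> expectation (\<lambda>\<omega>. 2 / n * (\<Sum>k<n. c\<^sup>2 * (\<Sum>l<n. \<bar>bv \<omega> l - bv \<omega> k\<bar> * (cr k l)\<^sup>2) + c\<^sup>2 * ((sqrt_inc k + sqrt_inc (n - Suc k)) / 2)))"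
  proof (rule integral_mono[OF _ _ pt])
    show "integrable M (\<lambda>\<omega>. \<bar>dv (bv \<omega>) - sv (bv \<omega>)\<bar>)"
      by (intro integrable_abs integrable_polybd[of "\<lambda>y. dv y - sv y"] polybd_diff pp borel_measurable_diff mm)
    show "integrable M (\<lambda>\<omega>. 2 / n * (\<Sum>k<n. c\<^sup>2 * (\<Sum>l<n. \<bar>bv \<omega> l - bv \<omega> k\<bar> * (cr k l)\<^sup>2) + c\<^sup>2 * ((sqrt_inc k + sqrt_inc (n - Suc k)) / 2)))"
      by (intro integrable_mult_right Bochner_Integration.integrable_sum Bochner_Integration.integrable_add im integrable_const) auto
  qed
  also have "\<dots> = 2 / n * (\<Sum>k<n. c\<^sup>2 * (\<Sum>l<n. expectation (\<lambda>\<omega>. \<bar>bv \<omega> l - bv \<omega> k\<bar>) * (cr k l)\<^sup>2) + c\<^sup>2 * ((sqrt_inc k + sqrt_inc (n - Suc k)) / 2))"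
  proof -
    have "expectation (\<lambda>\<omega>. \<Sum>k<n. c\<^sup>2 * (\<Sum>l<n. \<bar>bv \<omega> l - bv \<omega> k\<bar> * (cr k l)\<^sup>2) + c\<^sup>2 * ((sqrt_inc k + sqrt_inc (n - Suc k)) / 2))
      = (\<Sum>k<n. expectation (\<lambda>\<omega>. c\<^sup>2 * (\<Sum>l<n. \<bar>bv \<omega> l - bv \<omega> k\<bar> * (cr k l)\<^sup>2) + c\<^sup>2 * ((sqrt_inc k + sqrt_inc (n - Suc k)) / 2)))"
      by (intro Bochner_Integration.integral_sum Bochner_Integration.integrable_add integrable_mult_right im integrable_const) auto
    also have "\<dots> = (\<Sum>k<n. c\<^sup>2 * (\<Sum>l<n. expectation (\<lambda>\<omega>. \<bar>bv \<omega> l - bv \<omega> k\<bar>) * (cr k l)\<^sup>2) + c\<^sup>2 * ((sqrt_inc k + sqrt_inc (n - Suc k)) / 2))"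
    proof (intro sum.cong refl)
      fix k assume k: "k \<in> {..<n}"
      have "expectation (\<lambda>\<omega>. \<Sum>l<n. \<bar>bv \<omega> l - bv \<omega> k\<bar> * (cr k l)\<^sup>2) = (\<Sum>l<n. expectation (\<lambda>\<omega>. \<bar>bv \<omega> l - bv \<omega> k\<bar> * (cr k l)\<^sup>2))"
        using k by (intro Bochner_Integration.integral_sum integrable_mult_left ii) auto
      then show "expectation (\<lambda>\<omega>. c\<^sup>2 * (\<Sum>l<n. \<bar>bv \<omega> l - bv \<omega> k\<bar> * (cr k l)\<^sup>2) + c\<^sup>2 * ((sqrt_inc k + sqrt_inc (n - Suc k)) / 2))
        = c\<^sup>2 * (\<Sum>l<n. expectation (\<lambda>\<omega>. \<bar>bv \<omega> l - bv \<omega> k\<bar>) * (cr k l)\<^sup>2) + c\<^sup>2 * ((sqrt_inc k + sqrt_inc (n - Suc k)) / 2)"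
        using im[of k] k prob_space by simp
    qed
    finally show ?thesis by simp
  qed
  also have "\<dots> \<le> 2 / n * (\<Sum>k<n. c\<^sup>2 * (2 / q) + c\<^sup>2 * ((sqrt_inc k + sqrt_inc (n - Suc k)) / 2))"
  proof (intro mult_left_mono sum_mono add_right_mono)
    fix k assume k: "k \<in> {..<n}"
    have "(\<Sum>l<n. expectation (\<lambda>\<omega>. \<bar>bv \<omega> l - bv \<omega> k\<bar>) * (cr k l)\<^sup>2) \<le> (\<Sum>l<n. \<bar>cr k l\<bar> / q)"
    proof (rule sum_mono)
      fix l assume l: "l \<in> {..<n}"
      have sq: "(cr k l)\<^sup>2 \<le> \<bar>cr k l\<bar>" unfolding cr_def by (rule rho_sq_le_abs)
      have "(1 + z) * u\<^sup>2 = u\<^sup>2 + \<bar>u\<bar> * (\<bar>u\<bar> * z)" for u z :: real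
        unfolding mult.assoc[symmetric] abs_mult_self_eq by (simp add: power2_eq_square algebra_simps)
      then have "(1 + sqrt \<bar>real l - real k\<bar>) * (cr k l)\<^sup>2 = (cr k l)\<^sup>2 + \<bar>cr k l\<bar> * (\<bar>cr k l\<bar> * sqrt \<bar>real l - real k\<bar>)" .
      also have "\<dots> \<le> \<bar>cr k l\<bar> + \<bar>cr k l\<bar> * (1 / 2)"
        by (intro add_mono sq mult_left_mono abs_rho_sqrt) auto
      finally have w: "(1 + sqrt \<bar>real l - real k\<bar>) * (cr k l)\<^sup>2 \<le> 2 * \<bar>cr k l\<bar>" by simp
      have "expectation (\<lambda>\<omega>. \<bar>bv \<omega> l - bv \<omega> k\<bar>) * (cr k l)\<^sup>2 \<le> (1 + sqrt \<bar>real l - real k\<bar>) / (2 * q) * (cr k l)\<^sup>2"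
        using k l by (intro mult_right_mono expectation_abs_increment) auto
      also have "\<dots> = (1 + sqrt \<bar>real l - real k\<bar>) * (cr k l)\<^sup>2 / (2 * q)" by simp
      also have "\<dots> \<le> 2 * \<bar>cr k l\<bar> / (2 * q)" using q_ge_1 by (intro divide_right_mono w) auto
      finally show "expectation (\<lambda>\<omega>. \<bar>bv \<omega> l - bv \<omega> k\<bar>) * (cr k l)\<^sup>2 \<le> \<bar>cr k l\<bar> / q" by simp
    qed
    also have "\<dots> \<le> 2 / q" unfolding sum_divide_distrib[symmetric]
      using k q_ge_1 by (intro divide_right_mono sum_abs_cr) auto
    finally show "(\<Sum>l<n. expectation (\<lambda>\<omega>. \<bar>bv \<omega> l - bv \<omega> k\<bar>) * (cr k l)\<^sup>2) \<le> 2 / q" .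
  qed auto
  also have "\<dots> = 4 * c\<^sup>2 / q + 2 * c\<^sup>2 / sqrt n"
  proof -
    have r: "(\<Sum>k<n. sqrt_inc (n - Suc k)) = sqrt n" using sum.nat_diff_reindex[of sqrt_inc n] by (simp add: sum_sqrt_inc)
    have "(\<Sum>k<n. c\<^sup>2 * (2 / q) + c\<^sup>2 * ((sqrt_inc k + sqrt_inc (n - Suc k)) / 2)) = n * (c\<^sup>2 * (2 / q)) + c\<^sup>2 * ((sqrt n + sqrt n) / 2)"
      by (simp only: sum.distrib sum_distrib_left[symmetric] sum_divide_distrib[symmetric] r sum_sqrt_inc sum_constant card_lessThan) simp
    moreover have h: "2 / N * (N * (u * (2 / w)) + u * ((r + r) / 2)) = 4 * u / w + 2 * u / r" if "0 < r" "N = r * r" for N u w r :: real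
      using that by (simp add: field_simps)
    ultimately show ?thesis using h[OF sqrt_n(1) sqrt_n(2)[symmetric]] by (simp only:)
  qed
  finally show ?thesis .
qed

lemma interpolation_bound':
  "norm (expectation (\<lambda>\<omega>. (of_real (qv (bv \<omega>)) - of_real ((\<Sum>k<n. f2 (bv \<omega> k)) / (4 * n)) - \<i> * of_real (s * sv (bv \<omega>))) * \<Psi> (bv \<omega>)))
    \<le> ebound + \<bar>s\<bar> * (4 * c\<^sup>2 / q + 2 * c\<^sup>2 / sqrt n)"
proof -
  have b: "polybd n (\<lambda>y. f (y l))" "polybd n (\<lambda>y. f2 (y l))" for l using bf by (auto intro!: polybd_bounded)
  define a where "a y = (\<Sum>k<n. f2 (y k)) / (4 * n)" for y
  have mm: "dv \<in> borel_measurable (Pi\<^sub>M {..n} (\<lambda>_. borel))" "sv \<in> borel_measurable (Pi\<^sub>M {..n} (\<lambda>_. borel))"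
     "a \<in> borel_measurable (Pi\<^sub>M {..n} (\<lambda>_. borel))"
    unfolding dv_def[abs_def] sv_def[abs_def] a_def[abs_def]
    by (intro borel_measurable_times borel_measurable_const borel_measurable_sum borel_measurable_power borel_measurable_divide meas_grid meas; simp)+
  have pp: "polybd n dv" "polybd n sv" "polybd n a"
    unfolding dv_def[abs_def] sv_def[abs_def] a_def[abs_def] by (intro polybd_intros b)+
  note mi = borel_measurable_times borel_measurable_add borel_measurable_diff measurable_complex_of_real mm measurable_parts measurable_complex_parts borel_measurable_const
  note pi = polybd_mult polybd_add polybd_diff polybd_of_real polybd_const pp polybd_parts polybd_complex_parts
  have i1: "integrable M (\<lambda>\<omega>. of_real (qv (bv \<omega>)) * \<Psi> (bv \<omega>))"
    by (rule integrable_polybd[of "\<lambda>y. of_real (qv y) * \<Psi> y"]) (intro pi mi)+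
  have i2: "integrable M (\<lambda>\<omega>. (of_real (a (bv \<omega>)) + \<i> * of_real (s * dv (bv \<omega>))) * \<Psi> (bv \<omega>))"
    by (rule integrable_polybd[of "\<lambda>y. (of_real (a y) + \<i> * of_real (s * dv y)) * \<Psi> y"]) (intro pi mi)+
  have i3: "integrable M (\<lambda>\<omega>. of_real (dv (bv \<omega>) - sv (bv \<omega>)) * \<Psi> (bv \<omega>))"
    by (rule integrable_polybd[of "\<lambda>y. of_real (dv y - sv y) * \<Psi> y"]) (intro pi mi)+
  have i4: "integrable M (\<lambda>\<omega>. \<bar>dv (bv \<omega>) - sv (bv \<omega>)\<bar>)"
    by (intro integrable_abs integrable_polybd[of "\<lambda>y. dv y - sv y"] polybd_diff pp borel_measurable_diff mm)
  have "expectation (\<lambda>\<omega>. (of_real (qv (bv \<omega>)) - of_real (a (bv \<omega>)) - \<i> * of_real (s * sv (bv \<omega>))) * \<Psi> (bv \<omega>))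
    = expectation (\<lambda>\<omega>. of_real (qv (bv \<omega>)) * \<Psi> (bv \<omega>) - (of_real (a (bv \<omega>)) + \<i> * of_real (s * dv (bv \<omega>))) * \<Psi> (bv \<omega>)
       + \<i> * of_real s * (of_real (dv (bv \<omega>) - sv (bv \<omega>)) * \<Psi> (bv \<omega>)))"
    by (intro Bochner_Integration.integral_cong refl) (simp add: algebra_simps)
  also have "\<dots> = (expectation (\<lambda>\<omega>. of_real (qv (bv \<omega>)) * \<Psi> (bv \<omega>)) - expectation (\<lambda>\<omega>. (of_real (a (bv \<omega>)) + \<i> * of_real (s * dv (bv \<omega>))) * \<Psi> (bv \<omega>)))
       + \<i> * of_real s * expectation (\<lambda>\<omega>. of_real (dv (bv \<omega>) - sv (bv \<omega>)) * \<Psi> (bv \<omega>))"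
    by (subst Bochner_Integration.integral_add[OF Bochner_Integration.integrable_diff[OF i1 i2] integrable_mult_right[OF i3]])
       (subst Bochner_Integration.integral_diff[OF i1 i2], simp only: integral_mult_right_zero)
  also have "norm \<dots> \<le> ebound + \<bar>s\<bar> * (4 * c\<^sup>2 / q + 2 * c\<^sup>2 / sqrt n)"
  proof (rule order_trans[OF norm_triangle_ineq add_mono])
    show "norm (expectation (\<lambda>\<omega>. of_real (qv (bv \<omega>)) * \<Psi> (bv \<omega>)) - expectation (\<lambda>\<omega>. (of_real (a (bv \<omega>)) + \<i> * of_real (s * dv (bv \<omega>))) * \<Psi> (bv \<omega>))) \<le> ebound"
      unfolding a_def by (rule interpolation_bound)
    have "norm (expectation (\<lambda>\<omega>. of_real (dv (bv \<omega>) - sv (bv \<omega>)) * \<Psi> (bv \<omega>))) \<le> expectation (\<lambda>\<omega>. norm (of_real (dv (bv \<omega>) - sv (bv \<omega>)) * \<Psi> (bv \<omega>)))"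
      by (rule integral_norm_bound)
    also have "\<dots> \<le> expectation (\<lambda>\<omega>. \<bar>dv (bv \<omega>) - sv (bv \<omega>)\<bar>)"
    proof (rule integral_mono[OF integrable_norm[OF i3] i4])
      fix \<omega>
      show "norm (of_real (dv (bv \<omega>) - sv (bv \<omega>)) * \<Psi> (bv \<omega>)) \<le> \<bar>dv (bv \<omega>) - sv (bv \<omega>)\<bar>"
        unfolding norm_mult norm_of_real by (rule mult_left_le[OF norm_\<Psi>]) simp
    qed
    also have "\<dots> \<le> 4 * c\<^sup>2 / q + 2 * c\<^sup>2 / sqrt n" by (rule expectation_dv_sv)
    finally have "norm (expectation (\<lambda>\<omega>. of_real (dv (bv \<omega>) - sv (bv \<omega>)) * \<Psi> (bv \<omega>))) \<le> 4 * c\<^sup>2 / q + 2 * c\<^sup>2 / sqrt n" .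
    then have "\<bar>s\<bar> * norm (expectation (\<lambda>\<omega>. of_real (dv (bv \<omega>) - sv (bv \<omega>)) * \<Psi> (bv \<omega>))) \<le> \<bar>s\<bar> * (4 * c\<^sup>2 / q + 2 * c\<^sup>2 / sqrt n)"
      by (rule mult_left_mono) simp
    then show "norm (\<i> * of_real s * expectation (\<lambda>\<omega>. of_real (dv (bv \<omega>) - sv (bv \<omega>)) * \<Psi> (bv \<omega>))) \<le> \<bar>s\<bar> * (4 * c\<^sup>2 / q + 2 * c\<^sup>2 / sqrt n)"
      by (simp add: norm_mult)
  qed
  finally show ?thesis unfolding a_def .
qed

end

text \<open>The total error with \<open>q\<close> and \<open>la\<close> written out, as a function
  of \<open>x = n\<close> alone. \<open>m\<close> replaces \<open>\<bar>s\<bar>\<close>; with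
  \<open>m = \<bar>\<mu>\<bar>\<close> it serves all interpolation parameters
  simultaneously.\<close>

definition rate :: "real \<Rightarrow> real \<Rightarrow> real \<Rightarrow> real \<Rightarrow> real" where
  "rate c d m x = c / 2 * (1 / sqrt x) + c / 2 * (1 / x powr (1/4))
    + 3 / 2 * c * (30 * m\<^sup>2 * c\<^sup>2 * (3 * (x powr (1/4) * (1 + ln x) / x) + x powr (1/4) * (1 + ln x + 4) / sqrt x / 2)
       + 48 * m\<^sup>2 * c\<^sup>2 * (x powr (1/4) / sqrt x) + 2 * d\<^sup>2 * (x powr (1/4) * (1 + ln x + 4) / x))
    + 3 * c * d * ((1 + ln x) / x) + c\<^sup>2 * m * (3 * ((1 + ln x) / sqrt x) + 8 * (1 / x powr (1/4)))
    + m * (4 * c\<^sup>2 * (1 / x powr (1/4)) + 2 * c\<^sup>2 * (1 / sqrt x))"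

lemma rate_tendsto: "((\<lambda>n. rate c d m (real n)) \<longlongrightarrow> 0) sequentially"
proof -
  have t: "(\<lambda>n. 1 / sqrt (real n)) \<longlonglongrightarrow> 0" "(\<lambda>n. 1 / real n powr (1/4)) \<longlonglongrightarrow> 0"
    "(\<lambda>n. real n powr (1/4) * (1 + ln (real n)) / real n) \<longlonglongrightarrow> 0"
    "(\<lambda>n. real n powr (1/4) * (1 + ln (real n) + 4) / sqrt (real n)) \<longlonglongrightarrow> 0"
    "(\<lambda>n. real n powr (1/4) / sqrt (real n)) \<longlonglongrightarrow> 0"
    "(\<lambda>n. real n powr (1/4) * (1 + ln (real n) + 4) / real n) \<longlonglongrightarrow> 0"
    "(\<lambda>n. (1 + ln (real n)) / real n) \<longlonglongrightarrow> 0" "(\<lambda>n. (1 + ln (real n)) / sqrt (real n)) \<longlonglongrightarrow> 0"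
    by real_asymp+
  have "(\<lambda>n. rate c d m (real n)) \<longlonglongrightarrow> c / 2 * 0 + c / 2 * 0
    + 3 / 2 * c * (30 * m\<^sup>2 * c\<^sup>2 * (3 * 0 + 0 / 2) + 48 * m\<^sup>2 * c\<^sup>2 * 0 + 2 * d\<^sup>2 * 0)
    + 3 * c * d * 0 + c\<^sup>2 * m * (3 * 0 + 8 * 0) + m * (4 * c\<^sup>2 * 0 + 2 * c\<^sup>2 * 0)"
    unfolding rate_def by (intro tendsto_add tendsto_mult_left tendsto_divide tendsto_const t) simp_all
  then show ?thesis by simp
qed

lemma (in interpolation) bound_le_rate:
  assumes m: "\<bar>s\<bar> \<le> m"
  shows "ebound + \<bar>s\<bar> * (4 * c\<^sup>2 / q + 2 * c\<^sup>2 / sqrt n) \<le> rate c d m n"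
proof -
  have m2: "s\<^sup>2 \<le> m\<^sup>2" using power_mono[OF m, of 2] by simp
  have la: "0 \<le> la" using la_ge_1 by simp
  have "ebound + \<bar>s\<bar> * (4 * c\<^sup>2 / q + 2 * c\<^sup>2 / sqrt n) =
    c / 2 * (1 / sqrt n) + c / 2 * (1 / q)
    + 3 / 2 * c * (30 * s\<^sup>2 * c\<^sup>2 * (3 * (q * la / n) + q * (la + 4) / sqrt n / 2)
       + 48 * s\<^sup>2 * c\<^sup>2 * (q / sqrt n) + 2 * d\<^sup>2 * (q * (la + 4) / n))
    + 3 * c * d * (la / n) + c\<^sup>2 * \<bar>s\<bar> * (3 * (la / sqrt n) + 8 * (1 / q))
    + \<bar>s\<bar> * (4 * c\<^sup>2 * (1 / q) + 2 * c\<^sup>2 * (1 / sqrt n))"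
    unfolding ebound_def tbound_def by (simp add: algebra_simps)
  also have "\<dots> \<le> c / 2 * (1 / sqrt n) + c / 2 * (1 / q)
    + 3 / 2 * c * (30 * m\<^sup>2 * c\<^sup>2 * (3 * (q * la / n) + q * (la + 4) / sqrt n / 2)
       + 48 * m\<^sup>2 * c\<^sup>2 * (q / sqrt n) + 2 * d\<^sup>2 * (q * (la + 4) / n))
    + 3 * c * d * (la / n) + c\<^sup>2 * m * (3 * (la / sqrt n) + 8 * (1 / q))
    + m * (4 * c\<^sup>2 * (1 / q) + 2 * c\<^sup>2 * (1 / sqrt n))"
    using cd_nonneg q_ge_1 la m m2 by (intro add_mono mult_mono order_refl) (auto intro!: add_nonneg_nonneg mult_nonneg_nonneg)
  also have "\<dots> = rate c d m n" unfolding rate_def q_def la_def ..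
  finally show ?thesis .
qed

section \<open>Integration over the interpolation parameter\<close>

context quarter_fbm
begin

text \<open>The difference of \<open>\<Phi>\<close> at 1 and at 0 is the integral of its derivative
  \<open>g\<close> over the unit interval. After Fubini the mean of each \<open>g t\<close> is
  estimated by \<open>interpolation_bound'\<close>, uniformly in \<open>t\<close>.\<close>

lemma interpolation_step:
  fixes f f1 f2 f3 f4 :: "real \<Rightarrow> real" and \<mu> c :: real
  assumes df: "\<And>x. (f has_real_derivative f1 x) (at x)" "\<And>x. (f1 has_real_derivative f2 x) (at x)"
      "\<And>x. (f2 has_real_derivative f3 x) (at x)" "\<And>x. (f3 has_real_derivative f4 x) (at x)"
    and cf4: "continuous_on UNIV f4"
    and bf: "\<And>x. \<bar>f x\<bar> \<le> c" "\<And>x. \<bar>f1 x\<bar> \<le> c" "\<And>x. \<bar>f2 x\<bar> \<le> c" "\<And>x. \<bar>f3 x\<bar> \<le> c" "\<And>x. \<bar>f4 x\<bar> \<le> c"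
    and n: "0 < n"
  defines "a \<equiv> \<lambda>\<omega>. (\<Sum>k<n. f2 (B (real k / n) \<omega>)) / n / 4"
    and "v \<equiv> \<lambda>\<omega>. C_quarter\<^sup>2 * ((\<Sum>k<n. (f (B (real k / n) \<omega>))\<^sup>2) / n)"
    and "d \<equiv> \<bar>\<mu>\<bar> * c + 2 * \<mu>\<^sup>2 * C_quarter\<^sup>2 * c\<^sup>2"
  shows "norm (expectation (\<lambda>\<omega>. iexp (\<mu> * weighted_quadratic_variation f B n \<omega>))
    - expectation (\<lambda>\<omega>. exp (Complex (- (\<mu>\<^sup>2 / 2 * v \<omega>)) (\<mu> * a \<omega>)))) \<le> \<bar>\<mu>\<bar> * rate c d \<bar>\<mu>\<bar> n"
proof -
  interpret G: fbm_grid M B n by unfold_locales (rule n)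
  have c0: "0 \<le> c" using bf(1)[of 0] by linarith
  define qq where "qq = weighted_quadratic_variation f B n"
  define \<Phi> where "\<Phi> t \<omega> = exp (Complex (- ((1 - t\<^sup>2) * (\<mu>\<^sup>2 / 2 * v \<omega>))) (t * \<mu> * qq \<omega> + (1 - t) * \<mu> * a \<omega>))" for t \<omega>
  define g where "g t \<omega> = (of_real (\<mu>\<^sup>2 * t * v \<omega>) + \<i> * of_real (\<mu> * qq \<omega> - \<mu> * a \<omega>)) * \<Phi> t \<omega>" for t \<omega>
  have cf: "continuous_on UNIV f" "continuous_on UNIV f1" "continuous_on UNIV f2" "continuous_on UNIV f3"
    by (rule DERIV_continuous_on_UNIV, rule df)+
  have v0: "0 \<le> v \<omega>" for \<omega> unfolding v_def by (simp add: sum_nonneg)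
  have bv: "G.bv \<omega> k = B (real k / n) \<omega>" if "k \<le> n" for k \<omega> using G.bv_apply[OF that] .
  have sqn: "G.q\<^sup>2 = sqrt n" using G.q_sq by (simp add: power2_eq_square)
  have bound: "integrable M qq \<and> (t \<in> {0..1} \<longrightarrow> integrable M (g t) \<and> norm (expectation (g t)) \<le> \<bar>\<mu>\<bar> * rate c d \<bar>\<mu>\<bar> n)" for t
  proof -
    \<comment> \<open>Clamping makes the locale available for every real \<open>t\<close>; the
      claims about \<open>g\<close> concern the unit interval, where \<open>t' = t\<close>.\<close>
    define t' where "t' = max 0 (min 1 t)"
    have t: "0 \<le> t'" "t' \<le> 1" "t \<in> {0..1} \<Longrightarrow> t' = t" unfolding t'_def by auto
    \<comment> \<open>\<open>m\<close> and \<open>z\<close> are read off the exponent of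
      \<open>\<Phi>\<close>: the coefficients of the means of \<open>f2\<close> and of
      \<open>(f x)\<^sup>2\<close>, including the quarter of the drift and the constant of the
      variance.\<close>
    define m where "m = \<mu> * (1 - t') / 4"
    define z where "z = \<mu>\<^sup>2 * (1 - t'\<^sup>2) / 2 * C_quarter\<^sup>2"
    have t2: "0 \<le> 1 - t'\<^sup>2" "1 - t'\<^sup>2 \<le> 1" using t by (auto simp: power_le_one)
    have m: "\<bar>m\<bar> \<le> \<bar>\<mu>\<bar>"
    proof -
      have "\<bar>\<mu>\<bar> * (1 - t') \<le> \<bar>\<mu>\<bar> * 1" using t by (intro mult_left_mono) auto
      then show ?thesis unfolding m_def using t by (simp add: abs_mult)
    qed
    have z: "0 \<le> z" "z \<le> \<mu>\<^sup>2 / 2 * C_quarter\<^sup>2"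
    proof -
      show "0 \<le> z" unfolding z_def using t2 by simp
      have "\<mu>\<^sup>2 * (1 - t'\<^sup>2) \<le> \<mu>\<^sup>2 * 1" using t2 by (intro mult_left_mono) auto
      then show "z \<le> \<mu>\<^sup>2 / 2 * C_quarter\<^sup>2" unfolding z_def by (intro mult_right_mono divide_right_mono) auto
    qed
    have zb: "z * (4 * c\<^sup>2) \<le> d"
    proof -
      have "z * (4 * c\<^sup>2) \<le> \<mu>\<^sup>2 / 2 * C_quarter\<^sup>2 * (4 * c\<^sup>2)" by (intro mult_right_mono z) auto
      also have "\<dots> \<le> d" unfolding d_def using c0 by simp
      finally show ?thesis .
    qed
    have mb: "\<bar>m\<bar> * c \<le> d"
    proof -
      have "\<bar>m\<bar> * c \<le> \<bar>\<mu>\<bar> * c" by (intro mult_right_mono m c0)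
      then show ?thesis unfolding d_def using c0 by (simp add: add_increasing2)
    qed
    have pb: "\<bar>u * w\<bar> \<le> c\<^sup>2" if "\<bar>u\<bar> \<le> c" "\<bar>w\<bar> \<le> c" for u w :: real
      unfolding abs_mult power2_eq_square using that c0 by (intro mult_mono) auto
    interpret I: interpolation M B n f f1 f2 f3 "\<lambda>x. m * f2 x" "\<lambda>x. m * f3 x" "\<lambda>x. m * f4 x"
      "\<lambda>x. z * (f x * f x)" "\<lambda>x. z * (f1 x * f x + f x * f1 x)" "\<lambda>x. z * ((f2 x * f x + f1 x * f1 x) + (f1 x * f1 x + f x * f2 x))" c d "t' * \<mu>"
    proof unfold_locales
      fix x
      show "((\<lambda>x. m * f2 x) has_real_derivative m * f3 x) (at x)" "((\<lambda>x. m * f3 x) has_real_derivative m * f4 x) (at x)"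
        by (intro DERIV_cmult df)+
      show "((\<lambda>x. z * (f x * f x)) has_real_derivative z * (f1 x * f x + f x * f1 x)) (at x)"
        by (rule derivative_eq_intros df refl)+ (simp add: algebra_simps)
      show "((\<lambda>x. z * (f1 x * f x + f x * f1 x)) has_real_derivative z * ((f2 x * f x + f1 x * f1 x) + (f1 x * f1 x + f x * f2 x))) (at x)"
        by (rule derivative_eq_intros df refl)+ (simp add: algebra_simps)
      show "\<bar>m * f3 x\<bar> \<le> d" "\<bar>m * f4 x\<bar> \<le> d"
        unfolding abs_mult by (rule order_trans[OF mult_left_mono[OF bf(4)] mb] order_trans[OF mult_left_mono[OF bf(5)] mb], simp)+
      show "0 \<le> z * (f x * f x)" using z by simp
      have "\<bar>f1 x * f x + f x * f1 x\<bar> \<le> 4 * c\<^sup>2"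
        using pb[OF bf(2) bf(1), of x x] pb[OF bf(1) bf(2), of x x] c0 by (smt (verit) zero_le_power2)
      then show "\<bar>z * (f1 x * f x + f x * f1 x)\<bar> \<le> d"
        unfolding abs_mult abs_of_nonneg[OF z(1)] using z(1) by (intro order_trans[OF mult_left_mono zb])
      have "\<bar>(f2 x * f x + f1 x * f1 x) + (f1 x * f1 x + f x * f2 x)\<bar> \<le> 4 * c\<^sup>2"
        using pb[OF bf(3) bf(1), of x x] pb[OF bf(1) bf(3), of x x] pb[OF bf(2) bf(2), of x x] by (smt (verit))
      then show "\<bar>z * ((f2 x * f x + f1 x * f1 x) + (f1 x * f1 x + f x * f2 x))\<bar> \<le> d"
        unfolding abs_mult abs_of_nonneg[OF z(1)] using z(1) by (intro order_trans[OF mult_left_mono zb])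
      show "continuous_on UNIV (\<lambda>x. m * f4 x)" "continuous_on UNIV (\<lambda>x. z * ((f2 x * f x + f1 x * f1 x) + (f1 x * f1 x + f x * f2 x)))"
        by (intro continuous_intros cf cf4)+
    qed (rule df cf bf)+
    have Q: "I.qv (G.bv \<omega>) = qq \<omega>" for \<omega>
    proof -
      have "I.qv (G.bv \<omega>) = (\<Sum>l<n. f (B (real l / n) \<omega>) * (sqrt n * (B (real (l + 1) / n) \<omega> - B (real l / n) \<omega>)\<^sup>2 - 1)) / sqrt n"
        unfolding I.qv_def G.Xf_def
        by (intro arg_cong2[where f="(/)"] sum.cong refl) (simp add: bv power_mult_distrib sqn)
      then show ?thesis unfolding qq_def weighted_quadratic_variation_def by simp
    qed
    have bs: "(\<Sum>k<n. h (G.bv \<omega> k)) = (\<Sum>k<n. h (B (real k / n) \<omega>))" for h :: "real \<Rightarrow> real" and \<omega>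
      by (intro sum.cong refl) (simp add: bv)
    have A: "(\<Sum>k<n. f2 (G.bv \<omega> k)) / (4 * n) = a \<omega>" for \<omega>
      unfolding a_def bs by (simp add: mult.commute)
    have V: "I.sv (G.bv \<omega>) = v \<omega>" for \<omega>
      unfolding I.sv_def v_def bs[of "\<lambda>x. (f x)\<^sup>2"] by simp
    have P: "I.\<Psi> (G.bv \<omega>) = \<Phi> t' \<omega>" for \<omega>
    proof -
      have p: "I.\<pi>0 y = (1 - t'\<^sup>2) * (\<mu>\<^sup>2 / 2 * I.sv y)" for y
        unfolding I.\<pi>0_def I.sv_def sum_distrib_left[symmetric] by (simp add: z_def power2_eq_square)
      have th: "I.\<theta> (G.bv \<omega>) = t' * \<mu> * qq \<omega> + (1 - t') * \<mu> * a \<omega>"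
        unfolding I.\<theta>_def Q sum_distrib_left[symmetric] A[symmetric] by (simp add: m_def)
      show ?thesis unfolding I.\<Psi>_def \<Phi>_def p V th ..
    qed
    \<comment> \<open>Because \<open>\<i> * \<mu> * (- \<i> * t' * \<mu> * v)\<close> equals
      \<open>\<mu>\<^sup>2 * t' * v\<close>, the derivative of \<open>\<Phi>\<close> is
      \<open>\<i> * \<mu>\<close> times the expression bounded in
      \<open>interpolation_bound'\<close>.\<close>
    have e: "g t' \<omega> = \<i> * of_real \<mu> * ((of_real (I.qv (G.bv \<omega>)) - of_real ((\<Sum>k<n. f2 (G.bv \<omega> k)) / (4 * n)) - \<i> * of_real (t' * \<mu> * I.sv (G.bv \<omega>))) * I.\<Psi> (G.bv \<omega>))" for \<omega>
      unfolding Q A V P g_def by (simp add: algebra_simps power2_eq_square)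
    have iq: "integrable M qq"
      using G.integrable_polybd[OF I.polybd_parts(1) I.measurable_parts(1)] unfolding Q .
    have "integrable M (\<lambda>\<omega>. \<i> * of_real \<mu> * ((of_real (I.qv (G.bv \<omega>)) - of_real ((\<Sum>k<n. f2 (G.bv \<omega> k)) / (4 * n)) - \<i> * of_real (t' * \<mu> * I.sv (G.bv \<omega>))) * I.\<Psi> (G.bv \<omega>)))"
    proof (rule G.integrable_polybd[of "\<lambda>y. \<i> * of_real \<mu> * ((of_real (I.qv y) - of_real ((\<Sum>k<n. f2 (y k)) / (4 * n)) - \<i> * of_real (t' * \<mu> * I.sv y)) * I.\<Psi> y)"])
      have b: "polybd n (\<lambda>y. f (y l))" "polybd n (\<lambda>y. f2 (y l))" for l using bf by (auto intro!: polybd_bounded)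
      show "polybd n (\<lambda>y. \<i> * of_real \<mu> * ((of_real (I.qv y) - of_real ((\<Sum>k<n. f2 (y k)) / (4 * n)) - \<i> * of_real (t' * \<mu> * I.sv y)) * I.\<Psi> y))"
        unfolding I.sv_def by (intro polybd_intros b I.polybd_parts I.polybd_complex_parts)
      show "(\<lambda>y. \<i> * of_real \<mu> * ((of_real (I.qv y) - of_real ((\<Sum>k<n. f2 (y k)) / (4 * n)) - \<i> * of_real (t' * \<mu> * I.sv y)) * I.\<Psi> y)) \<in> borel_measurable (Pi\<^sub>M {..n} (\<lambda>_. borel))"
        unfolding I.sv_def
        by (intro borel_measurable_times borel_measurable_const borel_measurable_diff measurable_complex_of_real borel_measurable_divide
            borel_measurable_sum borel_measurable_power I.measurable_parts I.measurable_complex_parts I.meas_grid I.meas; simp)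
    qed
    then have ig: "integrable M (g t')" unfolding e[symmetric] .
    have "expectation (g t') = \<i> * of_real \<mu> * expectation (\<lambda>\<omega>. (of_real (I.qv (G.bv \<omega>)) - of_real ((\<Sum>k<n. f2 (G.bv \<omega> k)) / (4 * n)) - \<i> * of_real (t' * \<mu> * I.sv (G.bv \<omega>))) * I.\<Psi> (G.bv \<omega>))"
      unfolding e[abs_def] by (rule integral_mult_right_zero)
    then have "norm (expectation (g t')) = \<bar>\<mu>\<bar> * norm (expectation (\<lambda>\<omega>. (of_real (I.qv (G.bv \<omega>)) - of_real ((\<Sum>k<n. f2 (G.bv \<omega> k)) / (4 * n)) - \<i> * of_real (t' * \<mu> * I.sv (G.bv \<omega>))) * I.\<Psi> (G.bv \<omega>)))"
      by (simp add: norm_mult)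
    also have "\<dots> \<le> \<bar>\<mu>\<bar> * (I.ebound + \<bar>t' * \<mu>\<bar> * (4 * c\<^sup>2 / G.q + 2 * c\<^sup>2 / sqrt n))"
      by (intro mult_left_mono I.interpolation_bound') auto
    also have "\<dots> \<le> \<bar>\<mu>\<bar> * rate c d \<bar>\<mu>\<bar> n"
    proof (intro mult_left_mono I.bound_le_rate)
      show "\<bar>t' * \<mu>\<bar> \<le> \<bar>\<mu>\<bar>" using t by (simp add: abs_mult mult_left_le_one_le)
    qed auto
    finally show ?thesis using iq ig t(3) by auto
  qed
  have mqq[measurable]: "qq \<in> borel_measurable M" using bound[of 0] by auto
  have ma[measurable]: "a \<in> borel_measurable M" "v \<in> borel_measurable M"
    unfolding a_def v_def
    by (intro borel_measurable_divide borel_measurable_times borel_measurable_const measurable_mean_B cf(3)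
        measurable_mean_B[of "\<lambda>x. (f x)\<^sup>2"] continuous_intros cf(1))+
  have nphi: "norm (\<Phi> t \<omega>) \<le> 1" if "t \<in> {0..1}" for t \<omega>
    unfolding \<Phi>_def using that v0[of \<omega>] by (intro real_norm_cmod_exp mult_nonneg_nonneg) (auto simp: power_le_one)
  have va: "\<bar>v \<omega>\<bar> \<le> C_quarter\<^sup>2 * c\<^sup>2" "\<bar>a \<omega>\<bar> \<le> c" for \<omega>
  proof -
    have mean: "\<bar>(\<Sum>k<n. h k) / n\<bar> \<le> K" if "\<And>k. \<bar>h k\<bar> \<le> K" for h :: "nat \<Rightarrow> real" and K
    proof -
      have "\<bar>\<Sum>k<n. h k\<bar> \<le> (\<Sum>k<n. K)" by (rule order_trans[OF sum_abs sum_mono]) (rule that)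
      then show ?thesis using n by (simp add: field_simps)
    qed
    show "\<bar>a \<omega>\<bar> \<le> c" unfolding a_def using mean[of "\<lambda>k. f2 (B (real k / n) \<omega>)" c] bf(3) c0 by auto
    have "\<bar>(f x)\<^sup>2\<bar> \<le> c\<^sup>2" for x using power_mono[OF bf(1)[of x], of 2] by simp
    then show "\<bar>v \<omega>\<bar> \<le> C_quarter\<^sup>2 * c\<^sup>2" unfolding v_def abs_mult abs_power2
      by (intro mult_left_mono mean) auto
  qed
  \<comment> \<open>An integrable majorant of \<open>g t\<close>, uniform in \<open>t\<close>, which
    justifies Fubini; \<open>v\<close> and \<open>a\<close> are bounded, and \<open>qq\<close> is
    integrable.\<close>
  define K where "K \<omega> = \<mu>\<^sup>2 * (C_quarter\<^sup>2 * c\<^sup>2) + (\<bar>\<mu>\<bar> * \<bar>qq \<omega>\<bar> + \<bar>\<mu>\<bar> * c)" for \<omega>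
  have iK: "integrable M K" unfolding K_def using bound[of 0] by (intro Bochner_Integration.integrable_add integrable_mult_right integrable_abs integrable_const) auto
  have gK: "norm (indicator {0..1} t *\<^sub>R g t \<omega>) \<le> indicator {0..1} t * K \<omega>" for t \<omega>
  proof (cases "t \<in> {0..1}")
    case True
    have "norm (g t \<omega>) \<le> norm (of_real (\<mu>\<^sup>2 * t * v \<omega>) + \<i> * of_real (\<mu> * qq \<omega> - \<mu> * a \<omega>)) * 1"
      unfolding g_def norm_mult by (intro mult_left_mono nphi True) auto
    also have "\<dots> \<le> \<bar>\<mu>\<^sup>2 * t * v \<omega>\<bar> + \<bar>\<mu> * qq \<omega> - \<mu> * a \<omega>\<bar>"
      unfolding mult_1_right by (rule order_trans[OF norm_triangle_ineq]) (simp add: norm_mult del: of_real_mult of_real_diff)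
    also have "\<dots> \<le> K \<omega>"
    proof -
      have "\<mu>\<^sup>2 * (t * \<bar>v \<omega>\<bar>) \<le> \<mu>\<^sup>2 * (1 * (C_quarter\<^sup>2 * c\<^sup>2))" using True va(1)[of \<omega>] by (intro mult_left_mono mult_mono) auto
      then have "\<bar>\<mu>\<^sup>2 * t * v \<omega>\<bar> \<le> \<mu>\<^sup>2 * (C_quarter\<^sup>2 * c\<^sup>2)" using True by (simp add: abs_mult)
      moreover have "\<bar>\<mu> * qq \<omega> - \<mu> * a \<omega>\<bar> \<le> \<bar>\<mu>\<bar> * \<bar>qq \<omega>\<bar> + \<bar>\<mu>\<bar> * \<bar>a \<omega>\<bar>"
        unfolding abs_mult[symmetric] by (rule abs_triangle_ineq4)
      moreover have "\<bar>\<mu>\<bar> * \<bar>a \<omega>\<bar> \<le> \<bar>\<mu>\<bar> * c" by (intro mult_left_mono va) auto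
      ultimately show ?thesis unfolding K_def by linarith
    qed
    finally show ?thesis using True by simp
  qed simp
  have igt: "integrable M (\<lambda>\<omega>. indicator {0..1} t *\<^sub>R g t \<omega>)" for t
    using bound[of t] by (cases "t \<in> {0..1}") auto
  interpret P: pair_sigma_finite lborel M ..
  have mg[measurable]: "(\<lambda>(t, \<omega>). indicator {0..1} t *\<^sub>R g t \<omega>) \<in> borel_measurable (lborel \<Otimes>\<^sub>M M)"
    unfolding g_def \<Phi>_def Complex_eq by measurable
  have int: "integrable (lborel \<Otimes>\<^sub>M M) (\<lambda>(t, \<omega>). indicator {0..1} t *\<^sub>R g t \<omega>)"
  proof (rule P.Fubini_integrable[OF mg])
    have "integrable lborel (\<lambda>t::real. indicator {0..1} t * expectation K)"
      by (intro integrable_mult_left integrable_real_indicator) auto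
    then show "integrable lborel (\<lambda>t. \<integral>\<omega>. norm (case (t, \<omega>) of (t, \<omega>) \<Rightarrow> indicator {0..1} t *\<^sub>R g t \<omega>) \<partial>M)"
    proof (rule Bochner_Integration.integrable_bound)
      show "(\<lambda>t. \<integral>\<omega>. norm (case (t, \<omega>) of (t, \<omega>) \<Rightarrow> indicator {0..1} t *\<^sub>R g t \<omega>) \<partial>M) \<in> borel_measurable lborel"
        by measurable
      show "AE t in lborel. norm (\<integral>\<omega>. norm (case (t, \<omega>) of (t, \<omega>) \<Rightarrow> indicator {0..1} t *\<^sub>R g t \<omega>) \<partial>M) \<le> norm (indicator {0..1} t * expectation K)"
      proof (intro AE_I2)
        fix t :: real
        have "(\<integral>\<omega>. norm (indicator {0..1} t *\<^sub>R g t \<omega>) \<partial>M) \<le> (\<integral>\<omega>. indicator {0..1} t * K \<omega> \<partial>M)"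
          by (rule integral_mono[OF integrable_norm[OF igt] integrable_mult_right[OF iK] gK])
        moreover have "0 \<le> (\<integral>\<omega>. norm (indicator {0..1} t *\<^sub>R g t \<omega>) \<partial>M)" by simp
        ultimately show "norm (\<integral>\<omega>. norm (case (t, \<omega>) of (t, \<omega>) \<Rightarrow> indicator {0..1} t *\<^sub>R g t \<omega>) \<partial>M) \<le> norm (indicator {0..1} t * expectation K)"
          by simp
      qed
    qed
    show "AE t in lborel. integrable M (\<lambda>\<omega>. case (t, \<omega>) of (t, \<omega>) \<Rightarrow> indicator {0..1} t *\<^sub>R g t \<omega>)"
      using igt by simp
  qed
  have FTC: "(\<integral>t. indicator {0..1} t *\<^sub>R g t \<omega> \<partial>lborel) = \<Phi> 1 \<omega> - \<Phi> 0 \<omega>" for \<omega>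
  proof (rule integral_FTC_atLeastAtMost)
    have w: "((\<lambda>t. Complex (- ((1 - t\<^sup>2) * (\<mu>\<^sup>2 / 2 * v \<omega>))) (t * \<mu> * qq \<omega> + (1 - t) * \<mu> * a \<omega>)) has_vector_derivative
       Complex (- (- \<mu>\<^sup>2 * t * v \<omega>)) (\<mu> * qq \<omega> - \<mu> * a \<omega>)) (at t)" for t
      by (rule has_vector_derivative_Complex) (auto intro!: derivative_eq_intros simp: algebra_simps)
    show "((\<lambda>t. \<Phi> t \<omega>) has_vector_derivative g t \<omega>) (at t within {0..1})" if "0 \<le> t" "t \<le> 1" for t
    proof -
      have "((\<lambda>t. \<Phi> t \<omega>) has_vector_derivative (Complex (- (- \<mu>\<^sup>2 * t * v \<omega>)) (\<mu> * qq \<omega> - \<mu> * a \<omega>)) * \<Phi> t \<omega>) (at t)"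
        unfolding \<Phi>_def by (rule field_vector_diff_chain_at[OF w DERIV_exp, unfolded o_def])
      then show ?thesis
        unfolding g_def by (rule has_vector_derivative_at_within[OF has_vector_derivative_eq_rhs]) (simp add: Complex_eq)
    qed
    show "continuous_on {0..1} (\<lambda>t. g t \<omega>)"
      unfolding g_def \<Phi>_def Complex_eq by (intro continuous_intros)
  qed auto
  have i\<Phi>: "integrable M (\<Phi> t)" if "t \<in> {0..1}" for t
  proof (rule integrable_const_bound[of _ 1])
    show "\<Phi> t \<in> borel_measurable M" unfolding \<Phi>_def[abs_def] Complex_eq by measurable
  qed (use nphi that in auto)
  have "expectation (\<Phi> 1) - expectation (\<Phi> 0) = (\<integral>\<omega>. (\<integral>t. indicator {0..1} t *\<^sub>R g t \<omega> \<partial>lborel) \<partial>M)"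
    unfolding FTC using i\<Phi>[of 0] i\<Phi>[of 1] by simp
  also have "\<dots> = (\<integral>t. (\<integral>\<omega>. indicator {0..1} t *\<^sub>R g t \<omega> \<partial>M) \<partial>lborel)"
    by (rule P.Fubini_integral[OF int])
  also have "norm \<dots> \<le> (\<integral>t. indicator {0..1} t * (\<bar>\<mu>\<bar> * rate c d \<bar>\<mu>\<bar> n) \<partial>(lborel :: real measure))"
  proof (rule order_trans[OF integral_norm_bound integral_mono])
    show "integrable lborel (\<lambda>t. norm (\<integral>\<omega>. indicator {0..1} t *\<^sub>R g t \<omega> \<partial>M))"
      using P.integrable_fst'[OF int] by (intro integrable_norm) simp
    show "norm (\<integral>\<omega>. indicator {0..1} t *\<^sub>R g t \<omega> \<partial>M) \<le> indicator {0..1} t * (\<bar>\<mu>\<bar> * rate c d \<bar>\<mu>\<bar> n)" for t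
      using bound[of t] by (cases "t \<in> {0..1}") auto
    show "integrable lborel (\<lambda>t::real. indicator {0..1} t * (\<bar>\<mu>\<bar> * rate c d \<bar>\<mu>\<bar> n))"
      by (intro integrable_mult_left integrable_real_indicator) auto
  qed
  also have "\<dots> = \<bar>\<mu>\<bar> * rate c d \<bar>\<mu>\<bar> n" by (simp add: content_real)
  finally have "norm (expectation (\<Phi> 1) - expectation (\<Phi> 0)) \<le> \<bar>\<mu>\<bar> * rate c d \<bar>\<mu>\<bar> n" .
  moreover have "\<Phi> 1 = (\<lambda>\<omega>. iexp (\<mu> * qq \<omega>))" "\<Phi> 0 = (\<lambda>\<omega>. exp (Complex (- (\<mu>\<^sup>2 / 2 * v \<omega>)) (\<mu> * a \<omega>)))"
    unfolding \<Phi>_def by (auto simp: Complex_eq)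
  ultimately show ?thesis unfolding qq_def by simp
qed

text \<open>After \<open>interpolation_step\<close> only the Riemann sums depend on
  \<open>n\<close>. They converge on every path, and the exponential is bounded by 1, so dominated
  convergence identifies the limit.\<close>

theorem bounded_limit:
  fixes f f1 f2 f3 f4 :: "real \<Rightarrow> real"
  assumes df: "\<And>x. (f has_real_derivative f1 x) (at x)" "\<And>x. (f1 has_real_derivative f2 x) (at x)"
      "\<And>x. (f2 has_real_derivative f3 x) (at x)" "\<And>x. (f3 has_real_derivative f4 x) (at x)"
    and cf4: "continuous_on UNIV f4"
    and bf: "\<And>x. \<bar>f x\<bar> \<le> c" "\<And>x. \<bar>f1 x\<bar> \<le> c" "\<And>x. \<bar>f2 x\<bar> \<le> c" "\<And>x. \<bar>f3 x\<bar> \<le> c" "\<And>x. \<bar>f4 x\<bar> \<le> c"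
  shows "(\<lambda>n. expectation (\<lambda>\<omega>. iexp (\<mu> * weighted_quadratic_variation f B n \<omega>))) \<longlonglongrightarrow>
    expectation (\<lambda>\<omega>. exp (Complex (- (\<mu>\<^sup>2 / 2 * (C_quarter\<^sup>2 * (LINT s:{0..1}|lborel. (f (B s \<omega>))\<^sup>2))))
      (\<mu> * ((LINT s:{0..1}|lborel. f2 (B s \<omega>)) / 4))))"
proof -
  define a where "a n \<omega> = (\<Sum>k<n. f2 (B (real k / n) \<omega>)) / n / 4" for n \<omega>
  define v where "v n \<omega> = C_quarter\<^sup>2 * ((\<Sum>k<n. (f (B (real k / n) \<omega>))\<^sup>2) / n)" for n \<omega>
  let ?d = "\<bar>\<mu>\<bar> * c + 2 * \<mu>\<^sup>2 * C_quarter\<^sup>2 * c\<^sup>2"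
  have cf: "continuous_on UNIV f" "continuous_on UNIV f2" by (rule DERIV_continuous_on_UNIV, rule df)+
  have cf2: "continuous_on UNIV (\<lambda>x. (f x)\<^sup>2)" by (intro continuous_intros cf)
  have v0: "0 \<le> v n \<omega>" for n \<omega> unfolding v_def by (simp add: sum_nonneg)
  have [measurable]: "a n \<in> borel_measurable M" "v n \<in> borel_measurable M" for n
    unfolding a_def[abs_def] v_def[abs_def]
    by (intro borel_measurable_divide borel_measurable_times borel_measurable_const measurable_mean_B cf(2) measurable_mean_B[OF cf2])+
  note [measurable] = measurable_integral_B[OF cf(2)] measurable_integral_B[OF cf2]
  have lim: "(\<lambda>n. expectation (\<lambda>\<omega>. exp (Complex (- (\<mu>\<^sup>2 / 2 * v n \<omega>)) (\<mu> * a n \<omega>)))) \<longlonglongrightarrow>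
    expectation (\<lambda>\<omega>. exp (Complex (- (\<mu>\<^sup>2 / 2 * (C_quarter\<^sup>2 * (LINT s:{0..1}|lborel. (f (B s \<omega>))\<^sup>2))))
      (\<mu> * ((LINT s:{0..1}|lborel. f2 (B s \<omega>)) / 4))))"
  proof (rule integral_dominated_convergence[where w="\<lambda>_. 1"])
    show "AE \<omega> in M. norm (exp (Complex (- (\<mu>\<^sup>2 / 2 * v n \<omega>)) (\<mu> * a n \<omega>))) \<le> 1" for n
      by (intro AE_I2 real_norm_cmod_exp mult_nonneg_nonneg v0) auto
    show "AE \<omega> in M. (\<lambda>n. exp (Complex (- (\<mu>\<^sup>2 / 2 * v n \<omega>)) (\<mu> * a n \<omega>))) \<longlonglongrightarrow>
      exp (Complex (- (\<mu>\<^sup>2 / 2 * (C_quarter\<^sup>2 * (LINT s:{0..1}|lborel. (f (B s \<omega>))\<^sup>2)))) (\<mu> * ((LINT s:{0..1}|lborel. f2 (B s \<omega>)) / 4)))"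
      unfolding a_def v_def by (intro AE_I2 tendsto_exp tendsto_Complex tendsto_minus tendsto_mult tendsto_divide tendsto_const riemann_B cf cf2) simp_all
    show "(\<lambda>\<omega>. exp (Complex (- (\<mu>\<^sup>2 / 2 * v n \<omega>)) (\<mu> * a n \<omega>))) \<in> borel_measurable M" for n
      unfolding Complex_eq by measurable
    show "(\<lambda>\<omega>. exp (Complex (- (\<mu>\<^sup>2 / 2 * (C_quarter\<^sup>2 * (LINT s:{0..1}|lborel. (f (B s \<omega>))\<^sup>2)))) (\<mu> * ((LINT s:{0..1}|lborel. f2 (B s \<omega>)) / 4)))) \<in> borel_measurable M"
      unfolding Complex_eq by measurable
  qed simp
  have "(\<lambda>n. expectation (\<lambda>\<omega>. iexp (\<mu> * weighted_quadratic_variation f B n \<omega>)) - expectation (\<lambda>\<omega>. exp (Complex (- (\<mu>\<^sup>2 / 2 * v n \<omega>)) (\<mu> * a n \<omega>)))) \<longlonglongrightarrow> 0"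
  proof (rule Lim_null_comparison)
    show "\<forall>\<^sub>F n in sequentially. norm (expectation (\<lambda>\<omega>. iexp (\<mu> * weighted_quadratic_variation f B n \<omega>)) - expectation (\<lambda>\<omega>. exp (Complex (- (\<mu>\<^sup>2 / 2 * v n \<omega>)) (\<mu> * a n \<omega>))))
       \<le> \<bar>\<mu>\<bar> * rate c ?d \<bar>\<mu>\<bar> n"
      using eventually_gt_at_top[of 0] unfolding a_def v_def
      by eventually_elim (rule interpolation_step[OF df cf4 bf])
    show "(\<lambda>n. \<bar>\<mu>\<bar> * rate c ?d \<bar>\<mu>\<bar> n) \<longlonglongrightarrow> 0"
      using tendsto_mult_left[OF rate_tendsto, of "\<bar>\<mu>\<bar>"] by simp
  qed
  from tendsto_add[OF this lim] show ?thesis by simp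
qed

end

section \<open>The stochastic integral\<close>

locale independent_brownian_motion = prob_space M for M :: "'a measure" +
  fixes B W :: "real \<Rightarrow> 'a \<Rightarrow> real"
  assumes measurable_B: "\<And>t. t \<in> {0..1} \<Longrightarrow> B t \<in> borel_measurable M"
    and brownian: "standard_brownian_motion M W"
    and indep: "indep_processes M B W"
begin

abbreviation "F \<equiv> initially_enlarged_filtration M B W"

lemma measurable_W: "t \<in> {0..1} \<Longrightarrow> W t \<in> borel_measurable M"
  using brownian by (simp add: standard_brownian_motion_def)

lemma W_zero: "AE \<omega> in M. W 0 \<omega> = 0"
  using brownian by (simp add: standard_brownian_motion_def)

lemma law_W: "0 \<le> s \<Longrightarrow> s < t \<Longrightarrow> t \<le> 1 \<Longrightarrow>
    distr M borel (\<lambda>\<omega>. W t \<omega> - W s \<omega>) = gaussian_law 0 (sqrt (t - s))"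
  using brownian by (simp add: standard_brownian_motion_def)

lemma indep_increments_W:
  "(\<And>i. i \<le> m \<Longrightarrow> \<tau> i \<in> {0..1}) \<Longrightarrow> (\<And>i. i < m \<Longrightarrow> \<tau> i \<le> \<tau> (Suc i)) \<Longrightarrow>
    indep_vars (\<lambda>_. borel) (\<lambda>i \<omega>. W (\<tau> (Suc i)) \<omega> - W (\<tau> i) \<omega>) {..<m}"
  using brownian by (simp add: standard_brownian_motion_def)

lemma indep_paths: "indep_var (Pi\<^sub>M {0..1} (\<lambda>_. borel)) (\<lambda>\<omega>. \<lambda>t\<in>{0..1}. B t \<omega>)
    (Pi\<^sub>M {0..1} (\<lambda>_. borel)) (\<lambda>\<omega>. \<lambda>t\<in>{0..1}. W t \<omega>)"
  using indep by (simp add: indep_processes_def)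

lemma space_F: "space (F t) = space M"
  by (simp add: initially_enlarged_filtration_def space_measure_of_conv)

lemma sets_F: "sets (F t) = sigma_sets (space M)
       ({B s -` A \<inter> space M | s A. s \<in> {0..1} \<and> A \<in> sets borel} \<union>
        {W u -` A \<inter> space M | u A. u \<in> {0..t} \<and> A \<in> sets borel})"
  unfolding initially_enlarged_filtration_def by (rule sets_measure_of) auto

lemma sets_F_subset: "t \<le> 1 \<Longrightarrow> sets (F t) \<subseteq> sets M"
  unfolding sets_F by (rule sets.sigma_sets_subset) (auto intro!: measurable_sets measurable_B measurable_W)

lemma sets_F_mono:
  assumes "s \<le> t"
  shows "sets (F s) \<subseteq> sets (F t)"
  unfolding sets_F
proof (rule sigma_sets_mono', intro Un_mono subset_refl subsetI)
  fix x assume "x \<in> {W u -` A \<inter> space M | u A. u \<in> {0..s} \<and> A \<in> sets borel}"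
  then obtain u A where "x = W u -` A \<inter> space M" "u \<in> {0..s}" "A \<in> sets borel" by blast
  with assms show "x \<in> {W u -` A \<inter> space M | u A. u \<in> {0..t} \<and> A \<in> sets borel}"
    by (intro CollectI exI[of _ u] exI[of _ A]) simp
qed

lemma measurable_F_mono: "s \<le> t \<Longrightarrow> g \<in> measurable (F s) N \<Longrightarrow> g \<in> measurable (F t) N"
  using sets_F_mono[of s t] by (auto simp: measurable_def space_F)

lemma measurable_F_M: "t \<le> 1 \<Longrightarrow> g \<in> measurable (F t) N \<Longrightarrow> g \<in> measurable M N"
  using sets_F_subset[of t] by (auto simp: measurable_def space_F)

lemma measurable_B_F: "s \<in> {0..1} \<Longrightarrow> B s \<in> borel_measurable (F t)"
  by (rule measurableI) (auto simp: space_F sets_F intro!: sigma_sets.Basic)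

lemma measurable_W_F: "u \<in> {0..t} \<Longrightarrow> W u \<in> borel_measurable (F t)"
  by (rule measurableI) (auto simp: space_F sets_F intro!: sigma_sets.Basic)

section \<open>Independence of future increments\<close>

text \<open>Since \<open>W 0 = 0\<close> almost surely, the values at finitely many times are
  partial sums of increments over the sorted times. Independence of successive increments then
  separates the last one from the rest.\<close>

lemma prob_W_cylinder_increment:
  assumes st: "0 \<le> s" "s < t" "t \<le> 1" and J: "finite J" "J \<subseteq> {0..s}"
    and C: "\<And>u. C u \<in> sets borel" and D: "D \<in> sets borel"
  shows "prob {\<omega>\<in>space M. (\<forall>u\<in>J. W u \<omega> \<in> C u) \<and> W t \<omega> - W s \<omega> \<in> D} =
    prob {\<omega>\<in>space M. \<forall>u\<in>J. W u \<omega> \<in> C u} * prob {\<omega>\<in>space M. W t \<omega> - W s \<omega> \<in> D}"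
proof -
  \<comment> \<open>Adding 0 lets the partial sums start from \<open>W 0\<close>; adding
    \<open>s\<close> makes the last step run exactly from \<open>s\<close> to
    \<open>t\<close>.\<close>
  define K where "K = insert 0 (insert s J)"
  define L where "L = sorted_list_of_set K"
  define m where "m = length L - 1"
  \<comment> \<open>The indices \<open>0\<close> to \<open>m\<close> list the sorted times; the
    default value \<open>t\<close> supplies the time of index \<open>m + 1\<close>.\<close>
  define \<tau> where "\<tau> i = (if i \<le> m then L ! i else t)" for i
  let ?D = "\<lambda>i \<omega>. W (\<tau> (Suc i)) \<omega> - W (\<tau> i) \<omega>"
  have K: "finite K" "K \<subseteq> {0..s}" "0 \<in> K" "s \<in> K" using J st by (auto simp: K_def)
  have L: "set L = K" "sorted L" using K by (simp_all add: L_def)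
  have lenL: "length L = Suc m" using L K(3) unfolding m_def by (cases L) auto
  have \<tau>K: "\<tau> i \<in> K" if "i \<le> m" for i using that L(1) lenL by (auto simp: \<tau>_def)
  have \<tau>mono: "\<tau> i \<le> \<tau> j" if "i \<le> j" "j \<le> m" for i j
    using that L(2) lenL by (auto simp: \<tau>_def intro!: sorted_nth_mono)
  have ex: "\<exists>k\<le>m. \<tau> k = u" if "u \<in> K" for u
    using that L(1) lenL by (metis \<tau>_def in_set_conv_nth less_Suc_eq_le)
  have \<tau>0: "\<tau> 0 = 0"
  proof -
    obtain k where "k \<le> m" "\<tau> k = 0" using ex[OF K(3)] by blast
    with \<tau>mono[of 0 k] \<tau>K[of 0] K(2) show ?thesis by auto
  qed
  have \<tau>m: "\<tau> m = s"
  proof -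
    obtain k where "k \<le> m" "\<tau> k = s" using ex[OF K(4)] by blast
    with \<tau>mono[of k m] \<tau>K[of m] K(2) show ?thesis by auto
  qed
  have \<tau>t: "\<tau> (Suc m) = t" by (simp add: \<tau>_def)
  have ind: "indep_vars (\<lambda>_. borel) ?D {..<Suc m}"
  proof (rule indep_increments_W)
    show "\<tau> i \<in> {0..1}" if "i \<le> Suc m" for i
      using that \<tau>K[of i] K(2) st \<tau>t by (cases "i \<le> m") (auto simp: le_Suc_eq)
    show "\<tau> i \<le> \<tau> (Suc i)" if "i < Suc m" for i
      using that \<tau>mono[of i "Suc i"] \<tau>m \<tau>t st by (cases "i = m") auto
  qed
  have iv: "indep_var (Pi\<^sub>M {..<m} (\<lambda>_. borel)) (\<lambda>\<omega>. restrict (\<lambda>i. ?D i \<omega>) {..<m})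
      (Pi\<^sub>M {m} (\<lambda>_. borel)) (\<lambda>\<omega>. restrict (\<lambda>i. ?D i \<omega>) {m})"
    by (rule indep_var_restrict[OF ind]) auto
  have "\<forall>u\<in>J. \<exists>k. k \<le> m \<and> \<tau> k = u" using ex by (auto simp: K_def)
  then obtain k where k: "\<And>u. u \<in> J \<Longrightarrow> k u \<le> m" "\<And>u. u \<in> J \<Longrightarrow> \<tau> (k u) = u" by metis
  let ?E1 = "{x\<in>space (Pi\<^sub>M {..<m} (\<lambda>_. borel)). \<forall>u\<in>J. (\<Sum>i<k u. x i) \<in> C u}"
  let ?E2 = "{x\<in>space (Pi\<^sub>M {m} (\<lambda>_. borel)). x m \<in> D}"
  have mW: "W u \<in> borel_measurable M" if "u \<in> J" for u using that J st by (intro measurable_W) auto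
  have mst: "W s \<in> borel_measurable M" "W t \<in> borel_measurable M" using st by (intro measurable_W; auto)+
  have m1: "?E1 \<in> sets (Pi\<^sub>M {..<m} (\<lambda>_. borel :: real measure))"
  proof (rule sets.sets_Collect_finite_All[OF _ J(1)])
    fix u assume u: "u \<in> J"
    have "(\<lambda>x. \<Sum>i<k u. x i) \<in> measurable (Pi\<^sub>M {..<m} (\<lambda>_. borel :: real measure)) borel"
      using k(1)[OF u] by (intro borel_measurable_sum measurable_component_singleton) auto
    from measurable_sets[OF this C[of u]]
    show "{x \<in> space (Pi\<^sub>M {..<m} (\<lambda>_. borel)). (\<Sum>i<k u. x i) \<in> C u} \<in> sets (Pi\<^sub>M {..<m} (\<lambda>_. borel))"
      by (rule back_subst[where P="\<lambda>S. S \<in> _"]) auto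
  qed
  have m2: "?E2 \<in> sets (Pi\<^sub>M {m} (\<lambda>_. borel :: real measure))"
    using D by measurable
  have eq: "AE \<omega> in M. (\<forall>u\<in>J. W u \<omega> \<in> C u) \<longleftrightarrow> restrict (\<lambda>i. ?D i \<omega>) {..<m} \<in> ?E1"
  proof (use W_zero in eventually_elim)
    fix \<omega> assume 0: "W 0 \<omega> = 0"
    have "W u \<omega> = (\<Sum>i<k u. restrict (\<lambda>i. ?D i \<omega>) {..<m} i)" if u: "u \<in> J" for u
    proof -
      have "(\<Sum>i<k u. restrict (\<lambda>i. ?D i \<omega>) {..<m} i) = (\<Sum>i<k u. ?D i \<omega>)"
        using k(1)[OF u] by (intro sum.cong) auto
      also have "\<dots> = W (\<tau> (k u)) \<omega> - W (\<tau> 0) \<omega>" by (rule sum_lessThan_telescope)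
      finally show ?thesis using 0 k(2)[OF u] by (simp add: \<tau>0)
    qed
    then show "(\<forall>u\<in>J. W u \<omega> \<in> C u) \<longleftrightarrow> restrict (\<lambda>i. ?D i \<omega>) {..<m} \<in> ?E1"
      by (auto simp: space_PiM)
  qed
  have eq2: "restrict (\<lambda>i. ?D i \<omega>) {m} \<in> ?E2 \<longleftrightarrow> W t \<omega> - W s \<omega> \<in> D" for \<omega>
    by (simp add: space_PiM \<tau>t \<tau>m)
  have mJ: "{\<omega>\<in>space M. \<forall>u\<in>J. W u \<omega> \<in> C u} \<in> events"
  proof (rule sets.sets_Collect_finite_All[OF _ J(1)])
    fix u assume u: "u \<in> J"
    show "{\<omega>\<in>space M. W u \<omega> \<in> C u} \<in> events"
      using measurable_sets[OF mW[OF u] C[of u]] by (rule back_subst[where P="\<lambda>S. S \<in> _"]) auto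
  qed
  have mD: "{\<omega>\<in>space M. W t \<omega> - W s \<omega> \<in> D} \<in> events" using mst D by measurable
  note rv1 = indep_var_rv1[OF iv] and rv2 = indep_var_rv2[OF iv]
  let ?V1 = "(\<lambda>\<omega>. restrict (\<lambda>i. ?D i \<omega>) {..<m}) -` ?E1 \<inter> space M"
  let ?V2 = "(\<lambda>\<omega>. restrict (\<lambda>i. ?D i \<omega>) {m}) -` ?E2 \<inter> space M"
  have V2: "?V2 = {\<omega>\<in>space M. W t \<omega> - W s \<omega> \<in> D}" using eq2 by blast
  have ev: "?V1 \<in> events" by (rule measurable_sets[OF rv1 m1])
  have "prob {\<omega>\<in>space M. (\<forall>u\<in>J. W u \<omega> \<in> C u) \<and> W t \<omega> - W s \<omega> \<in> D} = prob (?V1 \<inter> ?V2)"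
  proof (rule finite_measure_eq_AE)
    show "AE \<omega> in M. \<omega> \<in> {\<omega>\<in>space M. (\<forall>u\<in>J. W u \<omega> \<in> C u) \<and> W t \<omega> - W s \<omega> \<in> D} \<longleftrightarrow> \<omega> \<in> ?V1 \<inter> ?V2"
      unfolding V2 using eq by eventually_elim blast
    have "{\<omega>\<in>space M. (\<forall>u\<in>J. W u \<omega> \<in> C u) \<and> W t \<omega> - W s \<omega> \<in> D} =
        {\<omega>\<in>space M. \<forall>u\<in>J. W u \<omega> \<in> C u} \<inter> {\<omega>\<in>space M. W t \<omega> - W s \<omega> \<in> D}" by blast
    then show "{\<omega>\<in>space M. (\<forall>u\<in>J. W u \<omega> \<in> C u) \<and> W t \<omega> - W s \<omega> \<in> D} \<in> events"
      using sets.Int[OF mJ mD] by simp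
    show "?V1 \<inter> ?V2 \<in> events" using ev mD unfolding V2 by (rule sets.Int)
  qed
  also have "?V1 \<inter> ?V2 = (\<lambda>\<omega>. (restrict (\<lambda>i. ?D i \<omega>) {..<m}, restrict (\<lambda>i. ?D i \<omega>) {m})) -` (?E1 \<times> ?E2) \<inter> space M"
    by blast
  also have "prob \<dots> = prob ?V1 * prob ?V2"
    by (rule indep_varD[OF iv m1 m2])
  also have "prob ?V1 = prob {\<omega>\<in>space M. \<forall>u\<in>J. W u \<omega> \<in> C u}"
  proof (rule finite_measure_eq_AE[OF _ ev mJ])
    show "AE \<omega> in M. \<omega> \<in> ?V1 \<longleftrightarrow> \<omega> \<in> {\<omega>\<in>space M. \<forall>u\<in>J. W u \<omega> \<in> C u}"
      using eq AE_space by eventually_elim blast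
  qed
  finally show ?thesis unfolding V2 .
qed

text \<open>Independence of the increment from \<open>F s\<close>, stated as a product law so that
  Fubini can be used. The events of \<open>G\<close>, which combine the whole path of
  \<open>B\<close> with finitely many values of \<open>W\<close> up to \<open>s\<close>, are stable
  under intersection and generate a sigma-algebra containing \<open>F s\<close>; so independence
  need be verified on \<open>G\<close> only.\<close>

lemma joint_law_increment_F:
  assumes st: "0 \<le> s" "s < t" "t \<le> 1"
  shows "distr M (F s \<Otimes>\<^sub>M borel) (\<lambda>\<omega>. (\<omega>, W t \<omega> - W s \<omega>)) =
    distr M (F s) (\<lambda>\<omega>. \<omega>) \<Otimes>\<^sub>M distr M borel (\<lambda>\<omega>. W t \<omega> - W s \<omega>)"
proof -
  let ?P = "Pi\<^sub>M {0..1} (\<lambda>_. borel :: real measure)" and ?B = "\<lambda>\<omega>. \<lambda>t\<in>{0..1}. B t \<omega>" and ?W = "\<lambda>\<omega>. \<lambda>t\<in>{0..1}. W t \<omega>"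
  let ?S = "\<lambda>A J C. {\<omega>\<in>space M. ?B \<omega> \<in> A \<and> (\<forall>u\<in>J. W u \<omega> \<in> C u)}"
  define G where "G = {?S A J C | A J C. A \<in> sets ?P \<and> finite J \<and> J \<subseteq> {0..s} \<and> (\<forall>u. C u \<in> sets borel)}"
  define H where "H = {(\<lambda>\<omega>. W t \<omega> - W s \<omega>) -` D \<inter> space M | D. D \<in> sets borel}"
  have mst[measurable]: "W s \<in> borel_measurable M" "W t \<in> borel_measurable M" using st by (intro measurable_W; auto)+
  have mB: "?B \<in> measurable M ?P" by (rule indep_var_rv1[OF indep_paths])
  have mc: "{y\<in>space ?P. y u \<in> A} \<in> sets ?P" if "u \<in> {0..1}" "A \<in> sets borel" for u A
    using that by measurable
  have mJ: "{y\<in>space ?P. \<forall>u\<in>J. y u \<in> C u} \<in> sets ?P" if "finite J" "J \<subseteq> {0..s}" "\<And>u. C u \<in> sets borel" for J C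
    using that st by (intro sets.sets_Collect_finite_All mc) auto
  have mD: "{y\<in>space ?P. y t - y s \<in> D} \<in> sets ?P" if "D \<in> sets borel" for D
  proof -
    have "(\<lambda>y. y t - y s) \<in> borel_measurable ?P"
      using st by (intro borel_measurable_diff measurable_component_singleton) auto
    from measurable_sets[OF this that] show ?thesis by (rule back_subst[where P="\<lambda>S. S \<in> _"]) auto
  qed
  \<comment> \<open>Independence of the two paths splits off the event for \<open>B\<close>; what
    remains concerns \<open>W\<close> alone and is left to
    \<open>prob_W_cylinder_increment\<close>.\<close>
  have split: "prob (?S A J C \<inter> {\<omega>\<in>space M. W t \<omega> - W s \<omega> \<in> D}) =
      prob {\<omega>\<in>space M. ?B \<omega> \<in> A} * prob {\<omega>\<in>space M. (\<forall>u\<in>J. W u \<omega> \<in> C u) \<and> W t \<omega> - W s \<omega> \<in> D}"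
    if "A \<in> sets ?P" "finite J" "J \<subseteq> {0..s}" "\<And>u. C u \<in> sets borel" "D \<in> sets borel" for A J C D
  proof -
    let ?E = "{y\<in>space ?P. \<forall>u\<in>J. y u \<in> C u} \<inter> {y\<in>space ?P. y t - y s \<in> D}"
    have "?E \<in> sets ?P" using mJ[OF that(2-4)] mD[OF that(5)] by (rule sets.Int)
    from indep_varD[OF indep_paths that(1) this]
    have *: "prob ((\<lambda>\<omega>. (?B \<omega>, ?W \<omega>)) -` (A \<times> ?E) \<inter> space M) = prob (?B -` A \<inter> space M) * prob (?W -` ?E \<inter> space M)" .
    have W: "?W \<omega> \<in> ?E \<longleftrightarrow> (\<forall>u\<in>J. W u \<omega> \<in> C u) \<and> W t \<omega> - W s \<omega> \<in> D" for \<omega>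
      using that(3) st by (auto simp: space_PiM)
    have "(\<lambda>\<omega>. (?B \<omega>, ?W \<omega>)) -` (A \<times> ?E) \<inter> space M = ?S A J C \<inter> {\<omega>\<in>space M. W t \<omega> - W s \<omega> \<in> D}"
      using W by blast
    moreover have "?W -` ?E \<inter> space M = {\<omega>\<in>space M. (\<forall>u\<in>J. W u \<omega> \<in> C u) \<and> W t \<omega> - W s \<omega> \<in> D}"
      using W by blast
    moreover have "?B -` A \<inter> space M = {\<omega>\<in>space M. ?B \<omega> \<in> A}" by blast
    ultimately show ?thesis using * by presburger
  qed
  have "indep_set G H"
    unfolding indep_sets2_eq
  proof (intro conjI ballI)
    show "G \<subseteq> events"
    proof
      fix x assume "x \<in> G"
      then obtain A J C where x: "x = ?S A J C" and A: "A \<in> sets ?P" "finite J" "J \<subseteq> {0..s}" "\<And>u. C u \<in> sets borel"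
        unfolding G_def by blast
      have "{\<omega>\<in>space M. \<forall>u\<in>J. W u \<omega> \<in> C u} \<in> events"
      proof (rule sets.sets_Collect_finite_All[OF _ A(2)])
        fix u assume "u \<in> J"
        then have "W u \<in> borel_measurable M" using A st by (intro measurable_W) auto
        from measurable_sets[OF this A(4)] show "{\<omega>\<in>space M. W u \<omega> \<in> C u} \<in> events"
          by (rule back_subst[where P="\<lambda>S. S \<in> _"]) auto
      qed
      from sets.Int[OF measurable_sets[OF mB A(1)] this] show "x \<in> events"
        unfolding x by (rule back_subst[where P="\<lambda>S. S \<in> _"]) blast
    qed
    show "H \<subseteq> events" unfolding H_def by (auto intro!: measurable_sets)
    fix x y assume "x \<in> G" "y \<in> H"
    then obtain A J C D where x: "x = ?S A J C" and A: "A \<in> sets ?P" "finite J" "J \<subseteq> {0..s}" "\<And>u. C u \<in> sets borel"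
      and y: "y = {\<omega>\<in>space M. W t \<omega> - W s \<omega> \<in> D}" and D: "D \<in> sets borel"
      unfolding G_def H_def by blast
    \<comment> \<open>Taking \<open>D = UNIV\<close> in \<open>split\<close> yields the probability
      of the cylinder event by itself.\<close>
    have "prob (?S A J C) = prob (?S A J C \<inter> {\<omega>\<in>space M. W t \<omega> - W s \<omega> \<in> UNIV})"
      by (rule arg_cong[where f=prob]) blast
    also have "\<dots> = prob {\<omega>\<in>space M. ?B \<omega> \<in> A} * prob {\<omega>\<in>space M. \<forall>u\<in>J. W u \<omega> \<in> C u}"
      by (subst split[OF A]) auto
    finally have "prob x = prob {\<omega>\<in>space M. ?B \<omega> \<in> A} * prob {\<omega>\<in>space M. \<forall>u\<in>J. W u \<omega> \<in> C u}"
      unfolding x .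
    then show "prob (x \<inter> y) = prob x * prob y"
      unfolding x y split[OF A D] prob_W_cylinder_increment[OF st A(2,3,4) D] by simp
  qed
  moreover have "Int_stable G"
  proof (rule Int_stableI)
    fix x y assume "x \<in> G" "y \<in> G"
    then obtain A J C A' J' C' where x: "x = ?S A J C" "A \<in> sets ?P" "finite J" "J \<subseteq> {0..s}" "\<And>u. C u \<in> sets borel"
      and y: "y = ?S A' J' C'" "A' \<in> sets ?P" "finite J'" "J' \<subseteq> {0..s}" "\<And>u. C' u \<in> sets borel"
      unfolding G_def by blast
    let ?C = "\<lambda>u. (if u \<in> J then C u else UNIV) \<inter> (if u \<in> J' then C' u else UNIV)"
    have "(\<forall>u\<in>J \<union> J'. W u \<omega> \<in> ?C u) \<longleftrightarrow> (\<forall>u\<in>J. W u \<omega> \<in> C u) \<and> (\<forall>u\<in>J'. W u \<omega> \<in> C' u)" for \<omega>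
      by (simp add: if_split_mem2) blast
    then have "x \<inter> y = ?S (A \<inter> A') (J \<union> J') ?C"
      unfolding x(1) y(1) by blast
    moreover have "A \<inter> A' \<in> sets ?P" "finite (J \<union> J')" "J \<union> J' \<subseteq> {0..s}" "\<And>u. ?C u \<in> sets borel"
      using x y by auto
    ultimately show "x \<inter> y \<in> G"
      unfolding G_def by (intro CollectI exI[of _ "A \<inter> A'"] exI[of _ "J \<union> J'"] exI[of _ ?C]) simp
  qed
  moreover have "Int_stable H"
  proof (rule Int_stableI)
    fix x y assume "x \<in> H" "y \<in> H"
    then obtain D D' where *: "x = (\<lambda>\<omega>. W t \<omega> - W s \<omega>) -` D \<inter> space M" "D \<in> sets borel"
      "y = (\<lambda>\<omega>. W t \<omega> - W s \<omega>) -` D' \<inter> space M" "D' \<in> sets borel" unfolding H_def by blast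
    then have "x \<inter> y = (\<lambda>\<omega>. W t \<omega> - W s \<omega>) -` (D \<inter> D') \<inter> space M" by blast
    moreover have "D \<inter> D' \<in> sets borel" using * by auto
    ultimately show "x \<inter> y \<in> H" unfolding H_def by blast
  qed
  ultimately have iGH: "indep_set (sigma_sets (space M) G) (sigma_sets (space M) H)"
    by (rule indep_set_sigma_sets)
  have "sets (F s) \<subseteq> sigma_sets (space M) G"
    unfolding sets_F
  proof (rule sigma_sets_mono, safe)
    fix u A assume "u \<in> {0..1::real}" "A \<in> sets (borel :: real measure)"
    then have "B u -` A \<inter> space M = ?S {y\<in>space ?P. y u \<in> A} {} (\<lambda>_. UNIV)"
      by (auto simp: space_PiM)
    moreover have "\<dots> \<in> G" unfolding G_def using mc[OF \<open>u \<in> _\<close> \<open>A \<in> _\<close>]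
      by (intro CollectI exI conjI) (rule refl, auto)
    ultimately show "B u -` A \<inter> space M \<in> sigma_sets (space M) G"
      using sigma_sets.Basic by metis
  next
    fix u A assume "u \<in> {0..s}" "A \<in> sets (borel :: real measure)"
    have "W u -` A \<inter> space M = ?S (space ?P) {u} (\<lambda>_. A)"
      by (auto simp: space_PiM)
    moreover have "\<dots> \<in> G" unfolding G_def using \<open>u \<in> _\<close> \<open>A \<in> _\<close>
      by (intro CollectI exI conjI) (rule refl, auto)
    ultimately show "W u -` A \<inter> space M \<in> sigma_sets (space M) G"
      using sigma_sets.Basic by metis
  qed
  then have prod: "prob (A \<inter> ((\<lambda>\<omega>. W t \<omega> - W s \<omega>) -` D \<inter> space M)) = prob A * prob ((\<lambda>\<omega>. W t \<omega> - W s \<omega>) -` D \<inter> space M)"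
    if "A \<in> sets (F s)" "D \<in> sets borel" for A D
    using iGH that unfolding indep_sets2_eq H_def by blast
  have id: "(\<lambda>\<omega>. \<omega>) \<in> measurable M (F s)"
    using st by (intro measurable_F_M[of s]) auto
  have pair: "(\<lambda>\<omega>. (\<omega>, W t \<omega> - W s \<omega>)) \<in> measurable M (F s \<Otimes>\<^sub>M borel)"
    by (intro measurable_Pair id) simp
  define Q where "Q = distr M (F s) (\<lambda>\<omega>. \<omega>)"
  have pQ: "prob_space Q" unfolding Q_def by (rule prob_space_distr[OF id])
  interpret Q: prob_space Q by (rule pQ)
  have pg: "prob_space (distr M borel (\<lambda>\<omega>. W t \<omega> - W s \<omega>))" by (rule prob_space_distr) simp
  interpret g: prob_space "distr M borel (\<lambda>\<omega>. W t \<omega> - W s \<omega>)" by (rule pg)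
  have sQ: "sets Q = sets (F s)" by (simp add: Q_def)
  show ?thesis
    unfolding Q_def[symmetric]
  proof (rule pair_measure_eqI[symmetric])
    show "sigma_finite_measure Q" "sigma_finite_measure (distr M borel (\<lambda>\<omega>. W t \<omega> - W s \<omega>))" by unfold_locales
    show "sets (Q \<Otimes>\<^sub>M distr M borel (\<lambda>\<omega>. W t \<omega> - W s \<omega>)) = sets (distr M (F s \<Otimes>\<^sub>M borel) (\<lambda>\<omega>. (\<omega>, W t \<omega> - W s \<omega>)))"
      using sets_pair_measure_cong[OF sQ, of "distr M borel (\<lambda>\<omega>. W t \<omega> - W s \<omega>)" borel] by simp
    fix A D assume A: "A \<in> sets Q" and D: "D \<in> sets (distr M borel (\<lambda>\<omega>. W t \<omega> - W s \<omega>))"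
    have AF: "A \<in> sets (F s)" and D': "D \<in> sets borel" using A D sQ by auto
    have AM: "A \<in> events" using AF sets_F_subset[of s] st by auto
    have AI: "A \<inter> space M = A" using sets.sets_into_space[OF AM] by blast
    have QA: "emeasure Q A = emeasure M A"
      unfolding Q_def by (subst emeasure_distr[OF id AF]) (simp add: AI)
    have "emeasure (distr M (F s \<Otimes>\<^sub>M borel) (\<lambda>\<omega>. (\<omega>, W t \<omega> - W s \<omega>))) (A \<times> D) = emeasure M ((\<lambda>\<omega>. (\<omega>, W t \<omega> - W s \<omega>)) -` (A \<times> D) \<inter> space M)"
      by (rule emeasure_distr[OF pair pair_measureI[OF AF D']])
    also have "(\<lambda>\<omega>. (\<omega>, W t \<omega> - W s \<omega>)) -` (A \<times> D) \<inter> space M = A \<inter> ((\<lambda>\<omega>. W t \<omega> - W s \<omega>) -` D \<inter> space M)"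
      using AI by blast
    also have "emeasure M \<dots> = emeasure M A * emeasure M ((\<lambda>\<omega>. W t \<omega> - W s \<omega>) -` D \<inter> space M)"
      using prod[OF AF D'] by (simp add: emeasure_eq_measure ennreal_mult)
    finally show "emeasure Q A * emeasure (distr M borel (\<lambda>\<omega>. W t \<omega> - W s \<omega>)) D =
        emeasure (distr M (F s \<Otimes>\<^sub>M borel) (\<lambda>\<omega>. (\<omega>, W t \<omega> - W s \<omega>))) (A \<times> D)"
      unfolding QA using D' by (simp add: emeasure_distr)
  qed
qed

text \<open>One step of the exponential martingale. Given \<open>F s\<close>, the coefficient
  \<open>\<xi>\<close> is a constant and the increment is Gaussian with variance
  \<open>t - s\<close>; the real growth factor is the reciprocal of the resulting characteristic
  function.\<close>

lemma expectation_exp_step: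
  fixes Z :: "'a \<Rightarrow> complex"
  assumes st: "0 \<le> s" "s \<le> t" "t \<le> 1" and Z: "Z \<in> borel_measurable (F s)" "\<And>\<omega>. \<omega> \<in> space M \<Longrightarrow> norm (Z \<omega>) \<le> K"
    and \<xi>: "\<xi> \<in> borel_measurable (F s)" "\<And>\<omega>. \<omega> \<in> space M \<Longrightarrow> \<bar>\<xi> \<omega>\<bar> \<le> L"
  shows "expectation (\<lambda>\<omega>. Z \<omega> * exp (Complex (\<mu>\<^sup>2 / 2 * ((\<xi> \<omega>)\<^sup>2 * (t - s))) (\<mu> * (\<xi> \<omega> * (W t \<omega> - W s \<omega>))))) = expectation Z"
proof (cases "s = t")
  case True
  then show ?thesis by (simp add: Complex_eq)
next
  case False
  with st have st': "s < t" by simp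
  let ?D = "\<lambda>\<omega>. W t \<omega> - W s \<omega>"
  let ?g = "distr M borel ?D"
  define Q where "Q = distr M (F s) (\<lambda>\<omega>. \<omega>)"
  define h where "h = (\<lambda>(\<omega>, x). Z \<omega> * exp (Complex (\<mu>\<^sup>2 / 2 * ((\<xi> \<omega>)\<^sup>2 * (t - s))) (\<mu> * (\<xi> \<omega> * x))))"
  have [measurable]: "W s \<in> borel_measurable M" "W t \<in> borel_measurable M" using st by (intro measurable_W; auto)+
  have id: "(\<lambda>\<omega>. \<omega>) \<in> measurable M (F s)"
    using st by (intro measurable_F_M[of s]) auto
  have pair: "(\<lambda>\<omega>. (\<omega>, ?D \<omega>)) \<in> measurable M (F s \<Otimes>\<^sub>M borel)"
    by (intro measurable_Pair id) simp
  have hm: "h \<in> borel_measurable (F s \<Otimes>\<^sub>M borel)"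
    unfolding h_def Complex_eq using Z(1) \<xi>(1) by measurable
  have pQ: "prob_space Q" unfolding Q_def by (rule prob_space_distr[OF id])
  interpret Q: prob_space Q by (rule pQ)
  have pg: "prob_space ?g" by (rule prob_space_distr) simp
  interpret g: prob_space ?g by (rule pg)
  interpret P: pair_prob_space Q ?g ..
  have sQ: "sets Q = sets (F s)" and spQ: "space Q = space M" by (simp_all add: Q_def space_F)
  note joint = joint_law_increment_F[OF st(1) st' st(3), folded Q_def]
  have "expectation (\<lambda>\<omega>. h (\<omega>, ?D \<omega>)) = integral\<^sup>L (distr M (F s \<Otimes>\<^sub>M borel) (\<lambda>\<omega>. (\<omega>, ?D \<omega>))) h"
    by (rule integral_distr[OF pair hm, symmetric])
  also have "\<dots> = (\<integral>\<omega>. (\<integral>x. h (\<omega>, x) \<partial>?g) \<partial>Q)"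
    unfolding joint
  proof (rule P.integral_fst'[symmetric], rule P.P.integrable_const_bound)
    show "AE z in Q \<Otimes>\<^sub>M ?g. norm (h z) \<le> K * exp (\<mu>\<^sup>2 / 2 * (L\<^sup>2 * (t - s)))"
    proof (rule AE_I2)
      fix z assume "z \<in> space (Q \<Otimes>\<^sub>M ?g)"
      then obtain \<omega> x where z: "z = (\<omega>, x)" and w: "\<omega> \<in> space M" by (cases z) (auto simp: space_pair_measure spQ)
      have "(\<xi> \<omega>)\<^sup>2 \<le> L\<^sup>2" using \<xi>(2)[OF w] by (metis abs_ge_zero power2_abs power_mono)
      then have "norm (exp (Complex (\<mu>\<^sup>2 / 2 * ((\<xi> \<omega>)\<^sup>2 * (t - s))) (\<mu> * (\<xi> \<omega> * x)))) \<le> exp (\<mu>\<^sup>2 / 2 * (L\<^sup>2 * (t - s)))"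
        using st by (simp add: mult_mono mult_left_mono)
      with Z(2)[OF w] show "norm (h z) \<le> K * exp (\<mu>\<^sup>2 / 2 * (L\<^sup>2 * (t - s)))"
        unfolding z h_def by (simp add: norm_mult mult_mono order_trans[OF norm_ge_zero Z(2)[OF w]])
    qed
    show "h \<in> borel_measurable (Q \<Otimes>\<^sub>M ?g)" 
      using hm by (subst measurable_cong_sets[OF sets_pair_measure_cong[OF sQ, of ?g borel] refl]) simp_all
  qed
  also have "\<dots> = (\<integral>\<omega>. Z \<omega> \<partial>Q)"
  proof (intro Bochner_Integration.integral_cong refl)
    fix \<omega>
    have "(\<integral>x. h (\<omega>, x) \<partial>?g) = (\<integral>x. Z \<omega> * exp (Complex (\<mu>\<^sup>2 / 2 * ((\<xi> \<omega>)\<^sup>2 * (t - s))) 0) * iexp ((\<mu> * \<xi> \<omega> * sqrt (t - s)) * x) \<partial>std_normal_distribution)"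
      unfolding law_W[OF st(1) st' st(3)] gaussian_law_conv_std[OF real_sqrt_ge_zero[OF diff_ge_0_iff_ge[THEN iffD2, OF st(2)]]] h_def
      by (subst integral_distr) (auto intro!: Bochner_Integration.integral_cong simp: Complex_eq exp_add[symmetric] algebra_simps)
    also have "\<dots> = Z \<omega> * exp (Complex (\<mu>\<^sup>2 / 2 * ((\<xi> \<omega>)\<^sup>2 * (t - s))) 0) * char std_normal_distribution (\<mu> * \<xi> \<omega> * sqrt (t - s))"
      unfolding char_def by simp
    also have "\<dots> = Z \<omega>"
    proof -
      have "(\<mu> * \<xi> \<omega> * sqrt (t - s))\<^sup>2 / 2 = \<mu>\<^sup>2 / 2 * ((\<xi> \<omega>)\<^sup>2 * (t - s))"
        using st by (simp add: power_mult_distrib)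
      then have "char std_normal_distribution (\<mu> * \<xi> \<omega> * sqrt (t - s)) = of_real (exp (- (\<mu>\<^sup>2 / 2 * ((\<xi> \<omega>)\<^sup>2 * (t - s)))))"
        unfolding char_std_normal_distribution by (metis minus_divide_left)
      moreover have "exp (Complex x 0) = of_real (exp x)" for x
        by (simp add: Complex_eq exp_of_real)
      ultimately show ?thesis by (simp add: of_real_mult[symmetric] exp_minus del: of_real_mult)
    qed
    finally show "(\<integral>x. h (\<omega>, x) \<partial>?g) = Z \<omega>" .
  qed
  also have "\<dots> = expectation Z" unfolding Q_def by (rule integral_distr[OF id Z(1)])
  finally show ?thesis by (simp add: h_def)
qed

end

section \<open>Quadratic variation of simple processes\<close>

lemma simple_process_square:
  assumes "\<And>i. i < m \<Longrightarrow> \<tau> i \<le> \<tau> (Suc i)"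
  shows "(simple_process m \<tau> \<xi> s \<omega>)\<^sup>2 = (\<Sum>i<m. (\<xi> i \<omega>)\<^sup>2 * indicator {\<tau> i<..\<tau> (Suc i)} s)"
proof -
  have mono: "\<tau> i \<le> \<tau> j" if "i \<le> j" "j \<le> m" for i j
    using that by (induction j rule: dec_induct) (auto intro: order_trans[OF _ assms])
  have lt: "indicator {\<tau> i<..\<tau> (Suc i)} s * indicator {\<tau> j<..\<tau> (Suc j)} s = (0::real)" if "i < j" "j < m" for i j
    using that mono[of "Suc i" j] by (auto simp: indicator_def)
  have dis: "indicator {\<tau> i<..\<tau> (Suc i)} s * indicator {\<tau> j<..\<tau> (Suc j)} s =
      (if i = j then indicator {\<tau> i<..\<tau> (Suc i)} s else (0::real))" if "i < m" "j < m" for i j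
    using lt[of i j] lt[of j i] that by (cases i j rule: linorder_cases) (auto simp: mult.commute indicator_def)
  have "(simple_process m \<tau> \<xi> s \<omega>)\<^sup>2 = (\<Sum>i<m. \<Sum>j<m. \<xi> i \<omega> * \<xi> j \<omega> *
      (indicator {\<tau> i<..\<tau> (Suc i)} s * indicator {\<tau> j<..\<tau> (Suc j)} s))"
    unfolding simple_process_def power2_eq_square sum_product by (simp add: mult_ac)
  also have "\<dots> = (\<Sum>i<m. \<Sum>j<m. if i = j then (\<xi> i \<omega>)\<^sup>2 * indicator {\<tau> i<..\<tau> (Suc i)} s else 0)"
    using dis by (intro sum.cong refl) (auto simp: power2_eq_square)
  also have "\<dots> = (\<Sum>i<m. (\<xi> i \<omega>)\<^sup>2 * indicator {\<tau> i<..\<tau> (Suc i)} s)"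
    by (intro sum.cong refl) (simp add: sum.delta)
  finally show ?thesis .
qed

text \<open>Identifies the quadratic variation that enters the exponential martingale with the
  squared L2 norm of the simple process on the path. Through this identity convergence of the
  processes becomes convergence of the variations.\<close>

lemma nn_integral_simple_process_square:
  assumes \<tau>: "\<And>i. i \<le> m \<Longrightarrow> \<tau> i \<in> {0..1}" "\<And>i. i < m \<Longrightarrow> \<tau> i \<le> \<tau> (Suc i)"
  shows "(\<integral>\<^sup>+s\<in>{0..1}. ennreal ((simple_process m \<tau> \<xi> s \<omega>)\<^sup>2) \<partial>lborel) =
    ennreal (\<Sum>i<m. (\<xi> i \<omega>)\<^sup>2 * (\<tau> (Suc i) - \<tau> i))"
proof -
  have "(\<integral>\<^sup>+s\<in>{0..1}. ennreal ((simple_process m \<tau> \<xi> s \<omega>)\<^sup>2) \<partial>lborel) =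
      (\<integral>\<^sup>+s. (\<Sum>i<m. ennreal ((\<xi> i \<omega>)\<^sup>2) * indicator {\<tau> i<..\<tau> (Suc i)} s) \<partial>lborel)"
  proof (intro nn_integral_cong)
    fix s
    have "ennreal ((simple_process m \<tau> \<xi> s \<omega>)\<^sup>2) = ennreal (\<Sum>i<m. (\<xi> i \<omega>)\<^sup>2 * indicator {\<tau> i<..\<tau> (Suc i)} s)"
      using simple_process_square[of m \<tau> \<xi> s \<omega>] \<tau>(2) by simp
    also have "\<dots> = (\<Sum>i<m. ennreal ((\<xi> i \<omega>)\<^sup>2 * indicator {\<tau> i<..\<tau> (Suc i)} s))"
      by (rule sum_ennreal[symmetric]) auto
    also have "\<dots> = (\<Sum>i<m. ennreal ((\<xi> i \<omega>)\<^sup>2) * indicator {\<tau> i<..\<tau> (Suc i)} s)"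
      by (intro sum.cong refl) (auto simp: indicator_def)
    finally have "ennreal ((simple_process m \<tau> \<xi> s \<omega>)\<^sup>2) = (\<Sum>i<m. ennreal ((\<xi> i \<omega>)\<^sup>2) * indicator {\<tau> i<..\<tau> (Suc i)} s)" .
    then have "ennreal ((simple_process m \<tau> \<xi> s \<omega>)\<^sup>2) * indicator {0..1} s = (\<Sum>i<m. ennreal ((\<xi> i \<omega>)\<^sup>2) * indicator {\<tau> i<..\<tau> (Suc i)} s) * indicator {0..1} s" by (rule arg_cong)
    moreover have "indicator {\<tau> i<..\<tau> (Suc i)} s * indicator {0..1} s = (indicator {\<tau> i<..\<tau> (Suc i)} s :: ennreal)" if "i < m" for i
      using \<tau>(1)[of i] \<tau>(1)[of "Suc i"] that by (auto simp: indicator_def)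
    ultimately show "ennreal ((simple_process m \<tau> \<xi> s \<omega>)\<^sup>2) * indicator {0..1} s = (\<Sum>i<m. ennreal ((\<xi> i \<omega>)\<^sup>2) * indicator {\<tau> i<..\<tau> (Suc i)} s)"
      by (simp only: sum_distrib_right mult.assoc) (intro sum.cong refl, simp only: lessThan_iff)
  qed
  also have "\<dots> = (\<Sum>i<m. ennreal ((\<xi> i \<omega>)\<^sup>2) * ennreal (\<tau> (Suc i) - \<tau> i))"
    using \<tau>(2) by (subst nn_integral_sum) (auto simp: nn_integral_cmult_indicator)
  also have "\<dots> = ennreal (\<Sum>i<m. (\<xi> i \<omega>)\<^sup>2 * (\<tau> (Suc i) - \<tau> i))"
    using \<tau>(2) by (subst sum_ennreal[symmetric]) (auto simp: ennreal_mult')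
  finally show ?thesis .
qed

text \<open>Young's inequality with a free \<open>\<delta>\<close>: a form of the triangle
  inequality for the L2 norm that remains meaningful when an integral is infinite.\<close>

lemma nn_integral_square_perturb:
  fixes f g :: "real \<Rightarrow> real"
  assumes [measurable]: "f \<in> borel_measurable N" "g \<in> borel_measurable N" and "0 < \<delta>"
  shows "(\<integral>\<^sup>+s. ennreal ((g s)\<^sup>2) \<partial>N) \<le> ennreal (1 + \<delta>) * (\<integral>\<^sup>+s. ennreal ((f s)\<^sup>2) \<partial>N) + ennreal (1 + 1 / \<delta>) * (\<integral>\<^sup>+s. ennreal ((f s - g s)\<^sup>2) \<partial>N)"
proof -
  have *: "y\<^sup>2 \<le> (1 + \<delta>) * x\<^sup>2 + (1 + 1 / \<delta>) * (x - y)\<^sup>2" for x y :: real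
  proof -
    have "0 \<le> (\<delta> * x + (x - y))\<^sup>2 / \<delta>" using assms(3) by simp
    also have "\<dots> = (1 + \<delta>) * x\<^sup>2 + (1 + 1 / \<delta>) * (x - y)\<^sup>2 - y\<^sup>2"
      using assms(3) by (simp add: field_simps power2_eq_square)
    finally show ?thesis by simp
  qed
  have "(\<integral>\<^sup>+s. ennreal ((g s)\<^sup>2) \<partial>N) \<le> (\<integral>\<^sup>+s. ennreal (1 + \<delta>) * ennreal ((f s)\<^sup>2) + ennreal (1 + 1 / \<delta>) * ennreal ((f s - g s)\<^sup>2) \<partial>N)"
    using assms(3) *[of "g _" "f _"]
    by (intro nn_integral_mono) (simp add: ennreal_mult[symmetric] ennreal_plus[symmetric] ennreal_leI del: ennreal_plus)
  also have "\<dots> = ennreal (1 + \<delta>) * (\<integral>\<^sup>+s. ennreal ((f s)\<^sup>2) \<partial>N) + ennreal (1 + 1 / \<delta>) * (\<integral>\<^sup>+s. ennreal ((f s - g s)\<^sup>2) \<partial>N)"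
    by (subst nn_integral_add) (auto simp: nn_integral_cmult)
  finally show ?thesis .
qed

lemma tendsto_nn_integral_square:
  fixes f :: "real \<Rightarrow> real" and g :: "nat \<Rightarrow> real \<Rightarrow> real"
  assumes [measurable]: "f \<in> borel_measurable N" "\<And>n. g n \<in> borel_measurable N"
    and v: "(\<integral>\<^sup>+s. ennreal ((f s)\<^sup>2) \<partial>N) = ennreal v" "0 \<le> v"
    and w: "\<And>n. (\<integral>\<^sup>+s. ennreal ((g n s)\<^sup>2) \<partial>N) = ennreal (w n)" "\<And>n. 0 \<le> w n"
    and lim: "(\<lambda>n. \<integral>\<^sup>+s. ennreal ((f s - g n s)\<^sup>2) \<partial>N) \<longlonglongrightarrow> 0"
  shows "w \<longlonglongrightarrow> v"
proof -
  define d where "d n = enn2real (\<integral>\<^sup>+s. ennreal ((f s - g n s)\<^sup>2) \<partial>N)" for n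
  \<comment> \<open>At least the root of the squared distance \<open>d n\<close>, so that
    \<open>d n / \<delta> n\<close> tends to 0 along with \<open>\<delta> n\<close>; the summand
    \<open>1 / (n + 1)\<close> keeps it positive when \<open>d n = 0\<close>.\<close>
  define \<delta> where "\<delta> n = sqrt (d n) + 1 / (real n + 1)" for n
  have fin: "\<forall>\<^sub>F n in sequentially. (\<integral>\<^sup>+s. ennreal ((f s - g n s)\<^sup>2) \<partial>N) < top"
    using order_tendstoD(2)[OF lim, of top] by simp
  have d0: "d \<longlonglongrightarrow> 0"
    unfolding d_def using tendsto_enn2real[of _ 0 sequentially] lim by simp
  have dn: "0 \<le> d n" for n by (simp add: d_def)
  have \<delta>p: "0 < \<delta> n" for n using dn[of n] by (simp add: \<delta>_def add_nonneg_pos)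
  have s0: "(\<lambda>n. sqrt (d n)) \<longlonglongrightarrow> 0" using tendsto_real_sqrt[OF d0] by simp
  have "(\<lambda>n. 1 / (real n + 1)) \<longlonglongrightarrow> 0" using LIMSEQ_inverse_real_of_nat by (simp add: inverse_eq_divide add.commute)
  from tendsto_add[OF s0 this] have \<delta>0: "\<delta> \<longlonglongrightarrow> 0" unfolding \<delta>_def by simp
  have small: "(1 + 1 / \<delta> n) * d n \<le> d n + sqrt (d n)" for n
  proof -
    have "d n / \<delta> n \<le> sqrt (d n)"
    proof (cases "d n = 0")
      case False
      have "sqrt (d n) \<le> \<delta> n" by (simp add: \<delta>_def)
      then have "sqrt (d n) * sqrt (d n) \<le> sqrt (d n) * \<delta> n" by (rule mult_left_mono) (simp add: dn)
      then show ?thesis using \<delta>p[of n] dn[of n] by (simp add: divide_le_eq)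
    qed simp
    then show ?thesis by (simp add: algebra_simps)
  qed
  have up: "w n \<le> (1 + \<delta> n) * v + (d n + sqrt (d n))"
    and lo: "v \<le> (1 + \<delta> n) * w n + (d n + sqrt (d n))"
    if "(\<integral>\<^sup>+s. ennreal ((f s - g n s)\<^sup>2) \<partial>N) < top" for n
  proof -
    have D: "(\<integral>\<^sup>+s. ennreal ((f s - g n s)\<^sup>2) \<partial>N) = ennreal (d n)" using that by (simp add: d_def)
    have D': "(\<integral>\<^sup>+s. ennreal ((g n s - f s)\<^sup>2) \<partial>N) = ennreal (d n)" unfolding D[symmetric] by (simp add: power2_commute)
    have "ennreal (w n) \<le> ennreal ((1 + \<delta> n) * v + (1 + 1 / \<delta> n) * d n)"
      using nn_integral_square_perturb[of f N "g n" "\<delta> n"] \<delta>p[of n] dn[of n] v w(2)[of n]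
      by (simp add: D w ennreal_mult ennreal_plus)
    then have "w n \<le> (1 + \<delta> n) * v + (1 + 1 / \<delta> n) * d n"
      using \<delta>p[of n] dn[of n] v by (subst (asm) ennreal_le_iff) auto
    with small[of n] show "w n \<le> (1 + \<delta> n) * v + (d n + sqrt (d n))" by linarith
    have "ennreal v \<le> ennreal ((1 + \<delta> n) * w n + (1 + 1 / \<delta> n) * d n)"
      using nn_integral_square_perturb[of "g n" N f "\<delta> n"] \<delta>p[of n] dn[of n] v w(2)[of n]
      by (simp add: D' w ennreal_mult ennreal_plus)
    then have "v \<le> (1 + \<delta> n) * w n + (1 + 1 / \<delta> n) * d n"
      using \<delta>p[of n] dn[of n] w(2)[of n] by (subst (asm) ennreal_le_iff) auto
    with small[of n] show "v \<le> (1 + \<delta> n) * w n + (d n + sqrt (d n))" by linarith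
  qed
  show ?thesis
  proof (rule tendsto_sandwich)
    show "\<forall>\<^sub>F n in sequentially. (v - (d n + sqrt (d n))) / (1 + \<delta> n) \<le> w n"
      using fin
    proof eventually_elim
      case (elim n)
      have "0 < 1 + \<delta> n" using \<delta>p[of n] by simp
      with lo[OF elim] show ?case by (simp add: divide_le_eq mult.commute algebra_simps)
    qed
    show "\<forall>\<^sub>F n in sequentially. w n \<le> (1 + \<delta> n) * v + (d n + sqrt (d n))"
      using fin by eventually_elim (rule up)
    have "(\<lambda>n. (v - (d n + sqrt (d n))) / (1 + \<delta> n)) \<longlonglongrightarrow> (v - (0 + 0)) / (1 + 0)"
      by (intro tendsto_intros d0 s0 \<delta>0) simp
    then show "(\<lambda>n. (v - (d n + sqrt (d n))) / (1 + \<delta> n)) \<longlonglongrightarrow> v" by simp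
    have "(\<lambda>n. (1 + \<delta> n) * v + (d n + sqrt (d n))) \<longlonglongrightarrow> (1 + 0) * v + (0 + 0)"
      by (intro tendsto_intros d0 s0 \<delta>0)
    then show "(\<lambda>n. (1 + \<delta> n) * v + (d n + sqrt (d n))) \<longlonglongrightarrow> v" by simp
  qed
qed

section \<open>The exponential martingale and its stopping\<close>

context independent_brownian_motion
begin

text \<open>Iterates \<open>expectation_exp_step\<close> over the partition. \<open>Z\<close> is
  known at time 0 and may depend on the whole path of \<open>B\<close>; it is the device that
  replaces conditioning on \<open>B\<close>.\<close>

lemma expectation_exp_simple:
  fixes Z :: "'a \<Rightarrow> complex"
  assumes sa: "simple_adapted M F m \<tau> \<xi>"
    and Z: "Z \<in> borel_measurable (F 0)" "\<And>\<omega>. \<omega> \<in> space M \<Longrightarrow> norm (Z \<omega>) \<le> K"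
  shows "expectation (\<lambda>\<omega>. Z \<omega> * exp (Complex (\<mu>\<^sup>2 / 2 * (\<Sum>i<m. (\<xi> i \<omega>)\<^sup>2 * (\<tau> (Suc i) - \<tau> i))) (\<mu> * simple_ito_integral W m \<tau> \<xi> \<omega>))) = expectation Z"
proof -
  define A where "A k \<omega> = Z \<omega> * exp (Complex (\<mu>\<^sup>2 / 2 * (\<Sum>i<k. (\<xi> i \<omega>)\<^sup>2 * (\<tau> (Suc i) - \<tau> i))) (\<mu> * simple_ito_integral W k \<tau> \<xi> \<omega>))" for k \<omega>
  have \<tau>: "\<tau> i \<in> {0..1}" if "i \<le> m" for i using sa that by (simp add: simple_adapted_def)
  have \<tau>s: "\<tau> i \<le> \<tau> (Suc i)" if "i < m" for i using sa that by (simp add: simple_adapted_def)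
  have "A k \<in> borel_measurable (F (\<tau> k)) \<and> (\<exists>K. \<forall>\<omega>\<in>space M. norm (A k \<omega>) \<le> K) \<and> expectation (A k) = expectation Z" if "k \<le> m" for k
    using that
  proof (induction k)
    case 0
    have "A 0 = Z" unfolding A_def by (auto simp: simple_ito_integral_def Complex_eq)
    with Z \<tau>[of 0] show ?case by (auto intro!: measurable_F_mono[of 0 "\<tau> 0"])
  next
    case (Suc k)
    then obtain K where IH: "A k \<in> borel_measurable (F (\<tau> k))" "\<And>\<omega>. \<omega> \<in> space M \<Longrightarrow> norm (A k \<omega>) \<le> K" "expectation (A k) = expectation Z" by auto
    from sa Suc.prems obtain L where \<xi>: "\<xi> k \<in> borel_measurable (F (\<tau> k))" "\<And>\<omega>. \<omega> \<in> space M \<Longrightarrow> \<bar>\<xi> k \<omega>\<bar> \<le> L"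
      unfolding simple_adapted_def by (metis Suc_le_lessD)
    have t: "0 \<le> \<tau> k" "\<tau> k \<le> \<tau> (Suc k)" "\<tau> (Suc k) \<le> 1" using \<tau>[of k] \<tau>[of "Suc k"] \<tau>s[of k] Suc.prems by auto
    have A: "A (Suc k) = (\<lambda>\<omega>. A k \<omega> * exp (Complex (\<mu>\<^sup>2 / 2 * ((\<xi> k \<omega>)\<^sup>2 * (\<tau> (Suc k) - \<tau> k))) (\<mu> * (\<xi> k \<omega> * (W (\<tau> (Suc k)) \<omega> - W (\<tau> k) \<omega>)))))"
    proof
      fix \<omega>
      have "exp (Complex (a + b) (c + d)) = exp (Complex a c) * exp (Complex b d)" for a b c d
        by (simp add: exp_add[symmetric] complex_add)
      then show "A (Suc k) \<omega> = A k \<omega> * exp (Complex (\<mu>\<^sup>2 / 2 * ((\<xi> k \<omega>)\<^sup>2 * (\<tau> (Suc k) - \<tau> k))) (\<mu> * (\<xi> k \<omega> * (W (\<tau> (Suc k)) \<omega> - W (\<tau> k) \<omega>))))"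
        unfolding A_def simple_ito_integral_def by (simp only: sum.lessThan_Suc distrib_left mult.assoc)
    qed
    have m: "A (Suc k) \<in> borel_measurable (F (\<tau> (Suc k)))"
    proof -
      have [measurable]: "A k \<in> borel_measurable (F (\<tau> (Suc k)))" "\<xi> k \<in> borel_measurable (F (\<tau> (Suc k)))"
        "W (\<tau> k) \<in> borel_measurable (F (\<tau> (Suc k)))" "W (\<tau> (Suc k)) \<in> borel_measurable (F (\<tau> (Suc k)))"
        using t by (auto intro!: measurable_F_mono[OF t(2)] IH \<xi> measurable_W_F)
      show ?thesis unfolding A Complex_eq by measurable
    qed
    moreover have "norm (A (Suc k) \<omega>) \<le> K * exp (\<mu>\<^sup>2 / 2 * (L\<^sup>2 * (\<tau> (Suc k) - \<tau> k)))" if \<omega>: "\<omega> \<in> space M" for \<omega>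
    proof -
      have "(\<xi> k \<omega>)\<^sup>2 \<le> L\<^sup>2" using \<xi>(2)[OF \<omega>] by (metis abs_ge_zero power2_abs power_mono)
      then have "exp (\<mu>\<^sup>2 / 2 * ((\<xi> k \<omega>)\<^sup>2 * (\<tau> (Suc k) - \<tau> k))) \<le> exp (\<mu>\<^sup>2 / 2 * (L\<^sup>2 * (\<tau> (Suc k) - \<tau> k)))"
        using t by (simp add: mult_mono mult_left_mono)
      then show ?thesis
        unfolding A norm_mult norm_exp_eq_Re complex.sel
        by (rule mult_mono[OF IH(2)[OF \<omega>]]) (auto intro: order_trans[OF norm_ge_zero IH(2)[OF \<omega>]])
    qed
    moreover have "expectation (A (Suc k)) = expectation Z"
      unfolding A IH(3)[symmetric] by (rule expectation_exp_step[OF t IH(1,2) \<xi>]) auto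
    ultimately show ?case by blast
  qed
  from this[of m] show ?thesis unfolding A_def[abs_def] by simp
qed

text \<open>Sets the process to 0 from the first interval on which its quadratic variation would
  exceed \<open>K\<close>. The sum includes interval \<open>i\<close> itself: as the partition is
  deterministic, this is already known at its left endpoint. So the stopped process stays adapted
  while its variation never overshoots.\<close>

definition stopped :: "real \<Rightarrow> (nat \<Rightarrow> real) \<Rightarrow> (nat \<Rightarrow> 'a \<Rightarrow> real) \<Rightarrow> nat \<Rightarrow> 'a \<Rightarrow> real" where
  "stopped K \<tau> \<xi> i \<omega> = (if (\<Sum>j<Suc i. (\<xi> j \<omega>)\<^sup>2 * (\<tau> (Suc j) - \<tau> j)) \<le> K then \<xi> i \<omega> else 0)"

lemma simple_adapted_stopped:
  assumes sa: "simple_adapted M F m \<tau> \<xi>"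
  shows "simple_adapted M F m \<tau> (stopped K \<tau> \<xi>)"
  unfolding simple_adapted_def
proof (intro conjI allI impI)
  show "\<tau> i \<in> {0..1}" if "i \<le> m" for i using sa that by (simp add: simple_adapted_def)
  have \<tau>s: "\<tau> i \<le> \<tau> (Suc i)" if "i < m" for i using sa that by (simp add: simple_adapted_def)
  then show "\<tau> i \<le> \<tau> (Suc i)" if "i < m" for i using that .
  have mono: "\<tau> i \<le> \<tau> j" if "i \<le> j" "j \<le> m" for i j
    using that by (induction j rule: dec_induct) (auto intro: order_trans[OF _ \<tau>s])
  show "stopped K \<tau> \<xi> i \<in> borel_measurable (F (\<tau> i))" if i: "i < m" for i
  proof -
    have "\<xi> j \<in> borel_measurable (F (\<tau> i))" if "j \<le> i" for j
      using sa that i mono[of j i] unfolding simple_adapted_def by (intro measurable_F_mono[of "\<tau> j" "\<tau> i"]) auto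
    then have "(\<lambda>\<omega>. \<Sum>j<Suc i. (\<xi> j \<omega>)\<^sup>2 * (\<tau> (Suc j) - \<tau> j)) \<in> borel_measurable (F (\<tau> i))" "\<xi> i \<in> borel_measurable (F (\<tau> i))"
      by (auto intro!: borel_measurable_sum borel_measurable_times borel_measurable_power)
    then show ?thesis unfolding stopped_def[abs_def] by measurable
  qed
  show "\<exists>L. \<forall>\<omega>\<in>space M. \<bar>stopped K \<tau> \<xi> i \<omega>\<bar> \<le> L" if i: "i < m" for i
  proof -
    from sa i obtain L where "\<forall>\<omega>\<in>space M. \<bar>\<xi> i \<omega>\<bar> \<le> L" unfolding simple_adapted_def by blast
    then have "\<forall>\<omega>\<in>space M. \<bar>stopped K \<tau> \<xi> i \<omega>\<bar> \<le> max L 0" by (auto simp: stopped_def)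
    then show ?thesis by blast
  qed
qed

lemma stopped_variation_le:
  assumes "\<And>i. i < m \<Longrightarrow> \<tau> i \<le> \<tau> (Suc i)" "0 \<le> K"
  shows "(\<Sum>i<m. (stopped K \<tau> \<xi> i \<omega>)\<^sup>2 * (\<tau> (Suc i) - \<tau> i)) \<le> K"
proof -
  \<comment> \<open>The comparison with the unstopped sum is what the induction needs in the case
    where the next term is kept.\<close>
  have "(\<Sum>i<k. (stopped K \<tau> \<xi> i \<omega>)\<^sup>2 * (\<tau> (Suc i) - \<tau> i)) \<le> min K (\<Sum>i<k. (\<xi> i \<omega>)\<^sup>2 * (\<tau> (Suc i) - \<tau> i))" if "k \<le> m" for k
    using that
  proof (induction k)
    case 0
    then show ?case using assms(2) by simp
  next
    case (Suc k)
    then have "0 \<le> (\<xi> k \<omega>)\<^sup>2 * (\<tau> (Suc k) - \<tau> k)" using assms(1)[of k] by simp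
    with Suc show ?case by (simp add: stopped_def)
  qed
  from this[of m] show ?thesis by simp
qed

lemma stopped_eq:
  assumes "\<And>i. i < m \<Longrightarrow> \<tau> i \<le> \<tau> (Suc i)" "(\<Sum>i<m. (\<xi> i \<omega>)\<^sup>2 * (\<tau> (Suc i) - \<tau> i)) \<le> K" "i < m"
  shows "stopped K \<tau> \<xi> i \<omega> = \<xi> i \<omega>"
proof -
  have "(\<Sum>j<Suc i. (\<xi> j \<omega>)\<^sup>2 * (\<tau> (Suc j) - \<tau> j)) \<le> (\<Sum>i<m. (\<xi> i \<omega>)\<^sup>2 * (\<tau> (Suc i) - \<tau> i))"
    using assms(1,3) by (intro sum_mono2) auto
  with assms(2) show ?thesis by (simp add: stopped_def)
qed

end

context independent_brownian_motion
begin

text \<open>States that given the path of \<open>B\<close> the integral is centred Gaussian with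
  variance \<open>V\<close>; \<open>A\<close> is an arbitrary phase known at time 0. The identity
  for simple processes is passed to the limit along an almost surely convergent subsequence, with
  stopping for domination, and the restriction to \<open>V \<omega> < real K\<close> is removed at
  the end.\<close>

lemma characteristic_function_ito:
  assumes I: "has_ito_integral M F W X I"
    and X: "(\<lambda>(s, \<omega>). indicator {0..1} s * X s \<omega>) \<in> borel_measurable (borel \<Otimes>\<^sub>M M)"
    and V: "V \<in> borel_measurable (F 0)" "\<And>\<omega>. \<omega> \<in> space M \<Longrightarrow> 0 \<le> V \<omega>"
      "\<And>\<omega>. \<omega> \<in> space M \<Longrightarrow> (\<integral>\<^sup>+s\<in>{0..1}. ennreal ((X s \<omega>)\<^sup>2) \<partial>lborel) = ennreal (V \<omega>)"
    and A: "A \<in> borel_measurable (F 0)"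
  shows "expectation (\<lambda>\<omega>. iexp (A \<omega> + \<mu> * I \<omega>)) = expectation (\<lambda>\<omega>. exp (Complex (- (\<mu>\<^sup>2 / 2 * V \<omega>)) (A \<omega>)))"
proof -
  from I obtain m \<tau> \<xi> where Im[measurable]: "I \<in> borel_measurable M"
    and sa: "\<And>n. simple_adapted M F (m n) (\<tau> n) (\<xi> n)"
    and l1: "(\<lambda>n. \<integral>\<^sup>+ \<omega>. (\<integral>\<^sup>+ s\<in>{0..1}. ennreal ((X s \<omega> - simple_process (m n) (\<tau> n) (\<xi> n) s \<omega>)\<^sup>2) \<partial>lborel) \<partial>M) \<longlonglongrightarrow> 0"
    and l2: "(\<lambda>n. \<integral>\<^sup>+ \<omega>. ennreal ((I \<omega> - simple_ito_integral W (m n) (\<tau> n) (\<xi> n) \<omega>)\<^sup>2) \<partial>M) \<longlonglongrightarrow> 0"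
    unfolding has_ito_integral_def by blast
  define J where "J n = simple_ito_integral W (m n) (\<tau> n) (\<xi> n)" for n
  define D where "D n \<omega> = (\<integral>\<^sup>+ s\<in>{0..1}. ennreal ((X s \<omega> - simple_process (m n) (\<tau> n) (\<xi> n) s \<omega>)\<^sup>2) \<partial>lborel)" for n \<omega>
  define E where "E n \<omega> = ennreal ((I \<omega> - J n \<omega>)\<^sup>2)" for n \<omega>
  define Vn where "Vn n \<omega> = (\<Sum>i<m n. (\<xi> n i \<omega>)\<^sup>2 * (\<tau> n (Suc i) - \<tau> n i))" for n \<omega>
  have \<tau>: "\<tau> n i \<in> {0..1}" if "i \<le> m n" for n i using sa[of n] that by (simp add: simple_adapted_def)
  have \<tau>s: "\<tau> n i \<le> \<tau> n (Suc i)" if "i < m n" for n i using sa[of n] that by (simp add: simple_adapted_def)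
  have \<xi>m: "\<xi> n i \<in> borel_measurable M" if "i < m n" for n i
    using sa[of n] \<tau>[of i n] that by (intro measurable_F_M[of "\<tau> n i"]) (auto simp: simple_adapted_def)
  have Jm: "simple_ito_integral W (m n) (\<tau> n) x \<in> borel_measurable M" if "\<And>i. i < m n \<Longrightarrow> x i \<in> borel_measurable M" for n x
    unfolding simple_ito_integral_def[abs_def] using that \<tau>[of _ n]
    by (intro borel_measurable_sum borel_measurable_times borel_measurable_diff measurable_W) auto
  have [measurable]: "J n \<in> borel_measurable M" for n unfolding J_def by (intro Jm \<xi>m)
  have Sm: "(\<lambda>p. simple_process (m n) (\<tau> n) (\<xi> n) (fst p) (snd p)) \<in> borel_measurable (borel \<Otimes>\<^sub>M M)" for n
    unfolding simple_process_def
  proof (intro borel_measurable_sum borel_measurable_times)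
    fix i assume "i \<in> {..<m n}"
    then show "(\<lambda>p. \<xi> n i (snd p)) \<in> borel_measurable (borel \<Otimes>\<^sub>M M)"
      by (intro measurable_compose[OF measurable_snd \<xi>m]) simp
    show "(\<lambda>p. indicator {\<tau> n i<..\<tau> n (Suc i)} (fst p) :: real) \<in> borel_measurable (borel \<Otimes>\<^sub>M M)" by measurable
  qed
  have [measurable]: "D n \<in> borel_measurable M" for n
  proof -
    define q where "q p = ennreal ((indicator {0..1} (fst p) * X (fst p) (snd p) - indicator {0..1} (fst p) * simple_process (m n) (\<tau> n) (\<xi> n) (fst p) (snd p))\<^sup>2)" for p
    have [measurable]: "q \<in> borel_measurable (borel \<Otimes>\<^sub>M M)"
      unfolding q_def[abs_def] using X Sm[of n] by (simp add: case_prod_beta')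
    have "D n = (\<lambda>\<omega>. \<integral>\<^sup>+s. q (s, \<omega>) \<partial>lborel)"
      unfolding D_def[abs_def] q_def by (intro ext nn_integral_cong) (auto simp: indicator_def)
    then show ?thesis by simp
  qed
  have [measurable]: "E n \<in> borel_measurable M" for n unfolding E_def[abs_def] by measurable
  \<comment> \<open>Adding the two errors and truncating at 1 gives one sequence that is integrable
    and converges in mean to 0, so a single subsequence makes both the variations and the integrals
    converge almost surely.\<close>
  define u where "u n \<omega> = enn2real (min 1 (D n \<omega> + E n \<omega>))" for n \<omega>
  have eu: "ennreal (u n \<omega>) = min 1 (D n \<omega> + E n \<omega>)" for n \<omega>
    unfolding u_def by (rule ennreal_enn2real) (simp add: min_less_iff_disj)
  have u0: "0 \<le> u n \<omega>" for n \<omega> by (simp add: u_def)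
  have u1: "u n \<omega> \<le> 1" for n \<omega>
    using eu[of n \<omega>] u0[of n \<omega>] by (metis ennreal_le_1 min.cobounded1)
  have um[measurable]: "u n \<in> borel_measurable M" for n unfolding u_def[abs_def] by measurable
  have "(\<lambda>n. (\<integral>\<^sup>+\<omega>. D n \<omega> \<partial>M) + (\<integral>\<^sup>+\<omega>. E n \<omega> \<partial>M)) \<longlonglongrightarrow> 0 + 0"
    using l1 l2 unfolding D_def[symmetric] J_def[symmetric] E_def[symmetric] by (rule tendsto_add)
  then have DE: "(\<lambda>n. \<integral>\<^sup>+\<omega>. D n \<omega> + E n \<omega> \<partial>M) \<longlonglongrightarrow> 0" by (simp add: nn_integral_add)
  have "(\<lambda>n. \<integral>\<^sup>+\<omega>. min 1 (D n \<omega> + E n \<omega>) \<partial>M) \<longlonglongrightarrow> 0"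
    by (rule tendsto_sandwich[OF _ _ tendsto_const DE]) (auto intro!: always_eventually nn_integral_mono)
  then have "(\<lambda>n. enn2real (\<integral>\<^sup>+\<omega>. min 1 (D n \<omega> + E n \<omega>) \<partial>M)) \<longlonglongrightarrow> 0"
    using tendsto_enn2real[of _ 0 sequentially] by simp
  moreover have "(\<integral>\<omega>. norm (u n \<omega>) \<partial>M) = enn2real (\<integral>\<^sup>+\<omega>. min 1 (D n \<omega> + E n \<omega>) \<partial>M)" for n
    by (subst integral_eq_nn_integral) (auto simp: u0 eu)
  moreover have "integrable M (u n)" for n
    by (rule integrable_const_bound[of _ 1]) (auto simp: u0 u1)
  ultimately obtain r where r: "strict_mono r" and ae: "AE \<omega> in M. (\<lambda>n. u (r n) \<omega>) \<longlonglongrightarrow> 0"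
    using tendsto_L1_AE_subseq[of M u] by auto
  have conv: "(\<lambda>n. Vn (r n) \<omega>) \<longlonglongrightarrow> V \<omega> \<and> (\<lambda>n. J (r n) \<omega>) \<longlonglongrightarrow> I \<omega>"
    if w: "\<omega> \<in> space M" and u: "(\<lambda>n. u (r n) \<omega>) \<longlonglongrightarrow> 0" for \<omega>
  proof
    have m0: "(\<lambda>n. min 1 (D (r n) \<omega> + E (r n) \<omega>)) \<longlonglongrightarrow> 0"
      using tendsto_ennrealI[OF u] by (simp add: eu)
    then have "\<forall>\<^sub>F n in sequentially. min 1 (D (r n) \<omega> + E (r n) \<omega>) < 1"
      by (rule order_tendstoD(2)) simp
    then have ev: "\<forall>\<^sub>F n in sequentially. min 1 (D (r n) \<omega> + E (r n) \<omega>) = D (r n) \<omega> + E (r n) \<omega>"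
      by eventually_elim (auto simp: min_def split: if_splits)
    have D0: "(\<lambda>n. D (r n) \<omega>) \<longlonglongrightarrow> 0"
      by (rule tendsto_sandwich[OF _ _ tendsto_const m0]) (simp, rule eventually_mono[OF ev], simp only:, simp)
    have "(\<lambda>n. E (r n) \<omega>) \<longlonglongrightarrow> 0"
      by (rule tendsto_sandwich[OF _ _ tendsto_const m0]) (simp, rule eventually_mono[OF ev], simp only:, simp)
    then have "(\<lambda>n. (I \<omega> - J (r n) \<omega>)\<^sup>2) \<longlonglongrightarrow> 0"
      using tendsto_enn2real[of "\<lambda>n. E (r n) \<omega>" 0 sequentially] by (simp add: E_def)
    then have "(\<lambda>n. \<bar>I \<omega> - J (r n) \<omega>\<bar>) \<longlonglongrightarrow> 0"
      using tendsto_real_sqrt[of _ 0] by fastforce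
    then have "(\<lambda>n. I \<omega> - J (r n) \<omega>) \<longlonglongrightarrow> 0" by (simp add: tendsto_rabs_zero_iff)
    from tendsto_diff[OF tendsto_const[of "I \<omega>"] this] show "(\<lambda>n. J (r n) \<omega>) \<longlonglongrightarrow> I \<omega>" by simp
    show "(\<lambda>n. Vn (r n) \<omega>) \<longlonglongrightarrow> V \<omega>"
    proof (rule tendsto_nn_integral_square[where N=lborel and f="\<lambda>s. indicator {0..1} s * X s \<omega>"
        and g="\<lambda>n s. indicator {0..1} s * simple_process (m (r n)) (\<tau> (r n)) (\<xi> (r n)) s \<omega>"])
      show "(\<lambda>s. indicator {0..1} s * X s \<omega>) \<in> borel_measurable lborel"
        using measurable_compose[OF measurable_Pair2'[OF w] X] by simp
      show "(\<lambda>s. indicator {0..1} s * simple_process (m (r n)) (\<tau> (r n)) (\<xi> (r n)) s \<omega>) \<in> borel_measurable lborel" for n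
        unfolding simple_process_def by measurable
      have "(\<integral>\<^sup>+s. ennreal ((indicator {0..1} s * X s \<omega>)\<^sup>2) \<partial>lborel) = (\<integral>\<^sup>+s\<in>{0..1}. ennreal ((X s \<omega>)\<^sup>2) \<partial>lborel)"
        by (intro nn_integral_cong) (auto simp: indicator_def)
      then show "(\<integral>\<^sup>+s. ennreal ((indicator {0..1} s * X s \<omega>)\<^sup>2) \<partial>lborel) = ennreal (V \<omega>)" using V(3)[OF w] by simp
      show "0 \<le> V \<omega>" by (rule V(2)[OF w])
      show "0 \<le> Vn (r n) \<omega>" for n unfolding Vn_def by (intro sum_nonneg mult_nonneg_nonneg) (auto simp: \<tau>s)
      have "(\<integral>\<^sup>+s. ennreal ((indicator {0..1} s * simple_process (m (r n)) (\<tau> (r n)) (\<xi> (r n)) s \<omega>)\<^sup>2) \<partial>lborel) =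
          (\<integral>\<^sup>+s\<in>{0..1}. ennreal ((simple_process (m (r n)) (\<tau> (r n)) (\<xi> (r n)) s \<omega>)\<^sup>2) \<partial>lborel)" for n
        by (intro nn_integral_cong) (auto simp: indicator_def)
      then show "(\<integral>\<^sup>+s. ennreal ((indicator {0..1} s * simple_process (m (r n)) (\<tau> (r n)) (\<xi> (r n)) s \<omega>)\<^sup>2) \<partial>lborel) = ennreal (Vn (r n) \<omega>)" for n
        unfolding Vn_def using nn_integral_simple_process_square[of "m (r n)" "\<tau> (r n)", OF \<tau> \<tau>s] by simp
      have "(\<integral>\<^sup>+s. ennreal ((indicator {0..1} s * X s \<omega> - indicator {0..1} s * simple_process (m (r n)) (\<tau> (r n)) (\<xi> (r n)) s \<omega>)\<^sup>2) \<partial>lborel) = D (r n) \<omega>" for n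
        unfolding D_def by (intro nn_integral_cong) (auto simp: indicator_def)
      then show "(\<lambda>n. \<integral>\<^sup>+s. ennreal ((indicator {0..1} s * X s \<omega> - indicator {0..1} s * simple_process (m (r n)) (\<tau> (r n)) (\<xi> (r n)) s \<omega>)\<^sup>2) \<partial>lborel) \<longlonglongrightarrow> 0"
        using D0 by simp
    qed
  qed
  note [measurable] = measurable_F_M[OF zero_le_one V(1)] measurable_F_M[OF zero_le_one A]
  \<comment> \<open>Where \<open>V\<close> is strictly below \<open>K\<close>, the approximating
    variations are eventually below \<open>K\<close> too, so that stopping has no effect in the
    limit; where it is not, both sides vanish.\<close>
  have trunc: "expectation (\<lambda>\<omega>. if V \<omega> < real K then iexp (A \<omega> + \<mu> * I \<omega>) else 0) =
      expectation (\<lambda>\<omega>. if V \<omega> < real K then exp (Complex (- (\<mu>\<^sup>2 / 2 * V \<omega>)) (A \<omega>)) else 0)" for K :: nat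
  proof -
    \<comment> \<open>\<open>Z\<close> contains the Gaussian damping in advance; in the limit it
      cancels the growth factor of the exponential martingale and leaves the plain characteristic
      function.\<close>
    define Z where "Z \<omega> = (if V \<omega> < real K then exp (Complex (- (\<mu>\<^sup>2 / 2 * V \<omega>)) (A \<omega>)) else 0)" for \<omega>
    have Zm: "Z \<in> borel_measurable (F 0)"
      unfolding Z_def[abs_def] Complex_eq using V(1) A by measurable
    note [measurable] = measurable_F_M[OF zero_le_one Zm]
    have Z1: "norm (Z \<omega>) \<le> 1" if "\<omega> \<in> space M" for \<omega>
      using V(2)[OF that] by (simp add: Z_def)
    define x where "x n = stopped (real K) (\<tau> n) (\<xi> n)" for n
    have xa: "simple_adapted M F (m n) (\<tau> n) (x n)" for n
      unfolding x_def by (rule simple_adapted_stopped[OF sa])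
    have xm: "x n i \<in> borel_measurable M" if "i < m n" for n i
      using xa[of n] \<tau>[of i n] that by (intro measurable_F_M[of "\<tau> n i"]) (auto simp: simple_adapted_def)
    define h where "h n \<omega> = Z \<omega> * exp (Complex (\<mu>\<^sup>2 / 2 * (\<Sum>i<m n. (x n i \<omega>)\<^sup>2 * (\<tau> n (Suc i) - \<tau> n i))) (\<mu> * simple_ito_integral W (m n) (\<tau> n) (x n) \<omega>))" for n \<omega>
    have Eh: "expectation (h n) = expectation Z" for n
      unfolding h_def[abs_def] by (rule expectation_exp_simple[OF xa Zm Z1])
    have "(\<lambda>n. expectation (h (r n))) \<longlonglongrightarrow> expectation (\<lambda>\<omega>. if V \<omega> < real K then iexp (A \<omega> + \<mu> * I \<omega>) else 0)"
    proof (rule integral_dominated_convergence[where w="\<lambda>_. exp (\<mu>\<^sup>2 / 2 * real K)"])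
      show "(\<lambda>\<omega>. if V \<omega> < real K then iexp (A \<omega> + \<mu> * I \<omega>) else 0) \<in> borel_measurable M" by measurable
      show "h (r n) \<in> borel_measurable M" for n
      proof -
        have [measurable]: "simple_ito_integral W (m (r n)) (\<tau> (r n)) (x (r n)) \<in> borel_measurable M" by (intro Jm xm)
        have [measurable]: "(\<lambda>\<omega>. \<Sum>i<m (r n). (x (r n) i \<omega>)\<^sup>2 * (\<tau> (r n) (Suc i) - \<tau> (r n) i)) \<in> borel_measurable M"
          by (intro borel_measurable_sum borel_measurable_times borel_measurable_power xm) auto
        show ?thesis unfolding h_def[abs_def] Complex_eq by measurable
      qed
      show "AE \<omega> in M. norm (h (r n) \<omega>) \<le> exp (\<mu>\<^sup>2 / 2 * real K)" for n
      proof (rule AE_I2)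
        fix \<omega> assume w: "\<omega> \<in> space M"
        have "(\<Sum>i<m (r n). (x (r n) i \<omega>)\<^sup>2 * (\<tau> (r n) (Suc i) - \<tau> (r n) i)) \<le> real K"
          unfolding x_def by (intro stopped_variation_le \<tau>s) auto
        then have "exp (\<mu>\<^sup>2 / 2 * (\<Sum>i<m (r n). (x (r n) i \<omega>)\<^sup>2 * (\<tau> (r n) (Suc i) - \<tau> (r n) i))) \<le> exp (\<mu>\<^sup>2 / 2 * real K)"
          unfolding exp_le_cancel_iff by (rule mult_left_mono) simp
        with Z1[OF w] show "norm (h (r n) \<omega>) \<le> exp (\<mu>\<^sup>2 / 2 * real K)"
          unfolding h_def norm_mult norm_exp_eq_Re complex.sel
          using mult_mono[of "norm (Z \<omega>)" 1 _ "exp (\<mu>\<^sup>2 / 2 * real K)"] by fastforce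
      qed
      show "AE \<omega> in M. (\<lambda>n. h (r n) \<omega>) \<longlonglongrightarrow> (if V \<omega> < real K then iexp (A \<omega> + \<mu> * I \<omega>) else 0)"
        using ae AE_space
      proof eventually_elim
        case (elim \<omega>)
        note c = conv[OF elim(2,1)]
        show ?case
        proof (cases "V \<omega> < real K")
          case True
          have lim: "(\<lambda>n. Z \<omega> * exp (Complex (\<mu>\<^sup>2 / 2 * Vn (r n) \<omega>) (\<mu> * J (r n) \<omega>))) \<longlonglongrightarrow> Z \<omega> * exp (Complex (\<mu>\<^sup>2 / 2 * V \<omega>) (\<mu> * I \<omega>))"
            by (intro tendsto_mult tendsto_const tendsto_exp tendsto_Complex c[THEN conjunct1] c[THEN conjunct2])
          have "Z \<omega> * exp (Complex (\<mu>\<^sup>2 / 2 * V \<omega>) (\<mu> * I \<omega>)) = iexp (A \<omega> + \<mu> * I \<omega>)"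
            using True by (simp add: Z_def exp_add[symmetric] complex_add) (simp add: Complex_eq)
          moreover have "\<forall>\<^sub>F n in sequentially. Z \<omega> * exp (Complex (\<mu>\<^sup>2 / 2 * Vn (r n) \<omega>) (\<mu> * J (r n) \<omega>)) = h (r n) \<omega>"
            using order_tendstoD(2)[OF c[THEN conjunct1] True]
          proof eventually_elim
            case (elim n)
            have "x (r n) i \<omega> = \<xi> (r n) i \<omega>" if "i < m (r n)" for i
              unfolding x_def using elim that by (intro stopped_eq[where m="m (r n)"] \<tau>s) (auto simp: Vn_def)
            then show ?case unfolding h_def Vn_def J_def simple_ito_integral_def by simp
          qed
          ultimately show ?thesis using Lim_transform_eventually[OF lim] True by simp
        qed (simp add: h_def Z_def)
      qed
    qed simp
    then have "expectation (\<lambda>\<omega>. if V \<omega> < real K then iexp (A \<omega> + \<mu> * I \<omega>) else 0) = expectation Z"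
      unfolding Eh by (simp add: LIMSEQ_const_iff)
    then show ?thesis unfolding Z_def[abs_def] .
  qed
  have lim: "(\<lambda>K. expectation (\<lambda>\<omega>. if V \<omega> < real K then g \<omega> else 0)) \<longlonglongrightarrow> expectation g"
    if [measurable]: "g \<in> borel_measurable M" and "\<And>\<omega>. \<omega> \<in> space M \<Longrightarrow> norm (g \<omega>) \<le> 1" for g :: "'a \<Rightarrow> complex"
  proof (rule integral_dominated_convergence[where w="\<lambda>_. 1"])
    show "AE \<omega> in M. (\<lambda>K. if V \<omega> < real K then g \<omega> else 0) \<longlonglongrightarrow> g \<omega>"
    proof (rule AE_I2)
      fix \<omega>
      have "\<forall>\<^sub>F K in sequentially. V \<omega> < real K"
        using filterlim_real_sequentially by (simp add: filterlim_at_top_dense)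
      then have "\<forall>\<^sub>F K in sequentially. (if V \<omega> < real K then g \<omega> else 0) = g \<omega>"
        by eventually_elim simp
      then show "(\<lambda>K. if V \<omega> < real K then g \<omega> else 0) \<longlonglongrightarrow> g \<omega>" by (rule tendsto_eventually)
    qed
    show "AE \<omega> in M. norm (if V \<omega> < real K then g \<omega> else 0) \<le> 1" for K
      using that(2) by (intro AE_I2) auto
  qed auto
  show ?thesis
  proof (rule LIMSEQ_unique)
    show "(\<lambda>K. expectation (\<lambda>\<omega>. if V \<omega> < real K then iexp (A \<omega> + \<mu> * I \<omega>) else 0)) \<longlonglongrightarrow> expectation (\<lambda>\<omega>. iexp (A \<omega> + \<mu> * I \<omega>))"
      by (rule lim) auto
    have "(\<lambda>\<omega>. exp (Complex (- (\<mu>\<^sup>2 / 2 * V \<omega>)) (A \<omega>))) \<in> borel_measurable M"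
      unfolding Complex_eq by measurable
    then show "(\<lambda>K. expectation (\<lambda>\<omega>. if V \<omega> < real K then iexp (A \<omega> + \<mu> * I \<omega>) else 0)) \<longlonglongrightarrow> expectation (\<lambda>\<omega>. exp (Complex (- (\<mu>\<^sup>2 / 2 * V \<omega>)) (A \<omega>)))"
      unfolding trunc using V(2) by (intro lim) auto
  qed
qed

end

lemma measurable_path_process:
  fixes X :: "real \<Rightarrow> 'a \<Rightarrow> real"
  assumes X: "\<And>t. t \<in> {0..1} \<Longrightarrow> X t \<in> borel_measurable M"
    and cont: "\<And>\<omega>. \<omega> \<in> space M \<Longrightarrow> continuous_on {0..1} (\<lambda>t. X t \<omega>)"
  shows "(\<lambda>(s, \<omega>). indicator {0..1} s * X s \<omega>) \<in> borel_measurable (borel \<Otimes>\<^sub>M M)"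
proof (rule borel_measurable_LIMSEQ_real)
  let ?t = "\<lambda>i n. min 1 (real i / real (Suc n))"
  let ?Y = "\<lambda>n p. indicator {0..1} (fst p) * X (?t (nat \<lfloor>real (Suc n) * fst p\<rfloor>) n) (snd p)"
  show "?Y n \<in> borel_measurable (borel \<Otimes>\<^sub>M M)" for n
  proof (intro borel_measurable_times)
    show "(\<lambda>p. indicator {0..1::real} (fst p) :: real) \<in> borel_measurable (borel \<Otimes>\<^sub>M M)"
      by (rule measurable_compose[OF measurable_fst borel_measurable_indicator]) simp
    show "(\<lambda>p. X (?t (nat \<lfloor>real (Suc n) * fst p\<rfloor>) n) (snd p)) \<in> borel_measurable (borel \<Otimes>\<^sub>M M)"
    proof (rule measurable_compose_countable[where f="\<lambda>i p. X (?t i n) (snd p)"])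
      show "(\<lambda>p. X (?t i n) (snd p)) \<in> borel_measurable (borel \<Otimes>\<^sub>M M)" for i
        by (intro measurable_compose[OF measurable_snd X]) (simp add: min_le_iff_disj)
      show "(\<lambda>p. nat \<lfloor>real (Suc n) * fst p\<rfloor>) \<in> (borel :: real measure) \<Otimes>\<^sub>M M \<rightarrow>\<^sub>M count_space UNIV" by measurable
    qed
  qed
  fix p assume "p \<in> space ((borel :: real measure) \<Otimes>\<^sub>M M)"
  then obtain s \<omega> where p: "p = (s, \<omega>)" and w: "\<omega> \<in> space M" by (cases p) (auto simp: space_pair_measure)
  show "(\<lambda>n. ?Y n p) \<longlonglongrightarrow> (case p of (s, \<omega>) \<Rightarrow> indicator {0..1} s * X s \<omega>)"
  proof (cases "s \<in> {0..1}")
    case s: True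
    let ?u = "\<lambda>n. ?t (nat \<lfloor>real (Suc n) * s\<rfloor>) n"
    have u: "\<bar>?u n - s\<bar> \<le> 1 / real (Suc n)" "?u n \<in> {0..1}" for n
    proof -
      let ?k = "nat \<lfloor>real (Suc n) * s\<rfloor>"
      have k: "real ?k \<le> real (Suc n) * s" "real (Suc n) * s < real ?k + 1"
        using s by (auto simp: of_nat_nat)
      then have "real ?k / real (Suc n) \<le> s" "s \<le> (real ?k + 1) / real (Suc n)"
        by (auto simp: divide_le_eq le_divide_eq mult.commute)
      then show "\<bar>?u n - s\<bar> \<le> 1 / real (Suc n)" "?u n \<in> {0..1}" using s by (auto simp: add_divide_distrib min_absorb2)
    qed
    have "?u \<longlonglongrightarrow> s"
    proof (rule LIM_zero_cancel, rule Lim_null_comparison)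
      show "\<forall>\<^sub>F n in sequentially. norm (?u n - s) \<le> inverse (real (Suc n))"
        using u(1) by (intro always_eventually allI) (simp only: real_norm_def inverse_eq_divide)
    qed (rule LIMSEQ_inverse_real_of_nat)
    then have "(\<lambda>n. X (?u n) \<omega>) \<longlonglongrightarrow> X s \<omega>"
      using continuous_on_tendsto_compose[OF cont[OF w], of ?u s sequentially] u(2) s by simp
    with s show ?thesis by (simp add: p)
  qed (simp add: p)
qed

lemma simple_process_eq:
  assumes mono: "\<And>i. i < m \<Longrightarrow> \<tau> i \<le> \<tau> (Suc i)" and k: "k < m" "s \<in> {\<tau> k<..\<tau> (Suc k)}"
  shows "simple_process m \<tau> \<xi> s \<omega> = \<xi> k \<omega>"
proof -
  have mono': "\<tau> i \<le> \<tau> j" if "i \<le> j" "j \<le> m" for i j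
    using that by (induction j rule: dec_induct) (auto intro: order_trans[OF _ mono])
  have "indicator {\<tau> i<..\<tau> (Suc i)} s = (if i = k then 1 else 0 :: real)" if "i < m" for i
    using that k mono'[of "Suc i" k] mono'[of "Suc k" i] by (cases i k rule: linorder_cases) (auto simp: indicator_def)
  then have "simple_process m \<tau> \<xi> s \<omega> = (\<Sum>i<m. if i = k then \<xi> i \<omega> else 0)"
    unfolding simple_process_def by (intro sum.cong refl) auto
  then show ?thesis using k by simp
qed

section \<open>Covariances of Brownian increments and the isometry\<close>

text \<open>The length of the overlap, written in the form that polarisation produces for the
  covariance of two Brownian increments in \<open>covariance_increments_W\<close>. The coincidence
  of the two expressions is the isometry.\<close>

lemma integral_indicator_intervals:
  fixes a b c d :: real
  assumes "a \<le> b" "c \<le> d"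
  shows "integrable lborel (\<lambda>s. indicator {a<..b} s * indicator {c<..d} s :: real)"
    and "(LINT s|lborel. indicator {a<..b} s * indicator {c<..d} s) = (\<bar>b - c\<bar> - \<bar>b - d\<bar> + \<bar>a - d\<bar> - \<bar>a - c\<bar>) / 2"
proof -
  have eq: "indicator {a<..b} s * indicator {c<..d} s = (indicator {max a c<..min b d} s :: real)" for s
    by (auto simp: indicator_def)
  have fin: "emeasure lborel {x<..y} < \<infinity>" for x y :: real
    by (cases "x \<le> y") simp_all
  show "integrable lborel (\<lambda>s. indicator {a<..b} s * indicator {c<..d} s :: real)"
    unfolding eq using fin by (intro integrable_real_indicator) auto
  have "(LINT s|lborel. indicator {a<..b} s * indicator {c<..d} s) = measure lborel {max a c<..min b d}"
    unfolding eq by simp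
  also have "\<dots> = max 0 (min b d - max a c)"
    by (cases "max a c \<le> min b d") (auto simp: measure_def)
  also have "\<dots> = (\<bar>b - c\<bar> - \<bar>b - d\<bar> + \<bar>a - d\<bar> - \<bar>a - c\<bar>) / 2"
    using assms by (auto simp: max_def min_def abs_if split: if_splits)
  finally show "(LINT s|lborel. indicator {a<..b} s * indicator {c<..d} s) = (\<bar>b - c\<bar> - \<bar>b - d\<bar> + \<bar>a - d\<bar> - \<bar>a - c\<bar>) / 2" .
qed

context independent_brownian_motion
begin

lemma second_moment_W:
  assumes "s \<in> {0..1}" "t \<in> {0..1}"
  shows "integrable M (\<lambda>\<omega>. (W t \<omega> - W s \<omega>)\<^sup>2)" "expectation (\<lambda>\<omega>. (W t \<omega> - W s \<omega>)\<^sup>2) = \<bar>t - s\<bar>"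
proof -
  have *: "integrable M (\<lambda>\<omega>. (W v \<omega> - W u \<omega>)\<^sup>2) \<and> expectation (\<lambda>\<omega>. (W v \<omega> - W u \<omega>)\<^sup>2) = v - u"
    if uv: "0 \<le> u" "u < v" "v \<le> 1" for u v
  proof -
    have [measurable]: "W u \<in> borel_measurable M" "W v \<in> borel_measurable M" using uv by (intro measurable_W; auto)+
    have "distr M borel (\<lambda>\<omega>. W v \<omega> - W u \<omega>) = distr std_normal_distribution borel (\<lambda>x. sqrt (v - u) * x)"
      unfolding law_W[OF uv] using gaussian_law_conv_std[of "sqrt (v - u)" 0] uv by simp
    note law = this
    have i2: "integrable std_normal_distribution (\<lambda>x. x\<^sup>2)" "(LINT x|std_normal_distribution. x\<^sup>2) = 1"
      using std_normal_distribution_even_moments[of 1] by simp_all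
    have "integrable (distr M borel (\<lambda>\<omega>. W v \<omega> - W u \<omega>)) (\<lambda>x. x\<^sup>2)"
      unfolding law using i2(1) by (subst integrable_distr_eq) (auto simp: power_mult_distrib)
    then have "integrable M (\<lambda>\<omega>. (W v \<omega> - W u \<omega>)\<^sup>2)" by (subst (asm) integrable_distr_eq) auto
    moreover have "expectation (\<lambda>\<omega>. (W v \<omega> - W u \<omega>)\<^sup>2) = integral\<^sup>L (distr M borel (\<lambda>\<omega>. W v \<omega> - W u \<omega>)) (\<lambda>x. x\<^sup>2)"
      by (subst integral_distr) auto
    moreover have "\<dots> = v - u"
      unfolding law using i2(2) uv by (subst integral_distr) (auto simp: power_mult_distrib)
    ultimately show ?thesis by simp
  qed
  show "integrable M (\<lambda>\<omega>. (W t \<omega> - W s \<omega>)\<^sup>2)" "expectation (\<lambda>\<omega>. (W t \<omega> - W s \<omega>)\<^sup>2) = \<bar>t - s\<bar>"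
    using *[of s t] *[of t s] assms by (cases s t rule: linorder_cases; simp add: power2_commute[of "W t _"])+
qed

text \<open>Polarisation expresses the product through squares of four single increments, so no case
  distinction on the relative position of the intervals arises.\<close>

lemma covariance_increments_W:
  assumes "a \<in> {0..1}" "b \<in> {0..1}" "c \<in> {0..1}" "d \<in> {0..1}"
  shows "integrable M (\<lambda>\<omega>. (W b \<omega> - W a \<omega>) * (W d \<omega> - W c \<omega>))"
    and "expectation (\<lambda>\<omega>. (W b \<omega> - W a \<omega>) * (W d \<omega> - W c \<omega>)) = (\<bar>b - c\<bar> - \<bar>b - d\<bar> + \<bar>a - d\<bar> - \<bar>a - c\<bar>) / 2"
proof -
  have eq: "(W b \<omega> - W a \<omega>) * (W d \<omega> - W c \<omega>) =
      ((W b \<omega> - W c \<omega>)\<^sup>2 - (W b \<omega> - W d \<omega>)\<^sup>2 + (W a \<omega> - W d \<omega>)\<^sup>2 - (W a \<omega> - W c \<omega>)\<^sup>2) / 2" for \<omega>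
    by (simp add: power2_eq_square field_simps)
  show "integrable M (\<lambda>\<omega>. (W b \<omega> - W a \<omega>) * (W d \<omega> - W c \<omega>))"
    unfolding eq using assms
    by (intro integrable_divide Bochner_Integration.integrable_diff Bochner_Integration.integrable_add second_moment_W)
  show "expectation (\<lambda>\<omega>. (W b \<omega> - W a \<omega>) * (W d \<omega> - W c \<omega>)) = (\<bar>b - c\<bar> - \<bar>b - d\<bar> + \<bar>a - d\<bar> - \<bar>a - c\<bar>) / 2"
    unfolding eq using assms second_moment_W
    by (simp add: Bochner_Integration.integral_diff Bochner_Integration.integral_add)
qed

text \<open>The coefficients are functions of the path of \<open>B\<close>, so independence of the
  paths factors every mixed moment. \<open>P\<close> may index overlapping intervals in any order;
  this covers the difference of simple integrals on two grids without a common refinement.\<close>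

lemma ito_isometry:
  fixes a b :: "'i \<Rightarrow> real" and h :: "'i \<Rightarrow> (real \<Rightarrow> real) \<Rightarrow> real"
  assumes P: "finite P" and ab: "\<And>p. p \<in> P \<Longrightarrow> 0 \<le> a p" "\<And>p. p \<in> P \<Longrightarrow> a p \<le> b p" "\<And>p. p \<in> P \<Longrightarrow> b p \<le> 1"
    and h: "\<And>p. p \<in> P \<Longrightarrow> h p \<in> borel_measurable (Pi\<^sub>M {0..1} (\<lambda>_. borel))" "\<And>p x. p \<in> P \<Longrightarrow> \<bar>h p x\<bar> \<le> L"
    and c: "\<And>p \<omega>. p \<in> P \<Longrightarrow> c p \<omega> = h p (\<lambda>t\<in>{0..1}. B t \<omega>)"
  shows "(\<integral>\<^sup>+\<omega>. ennreal ((\<Sum>p\<in>P. c p \<omega> * (W (b p) \<omega> - W (a p) \<omega>))\<^sup>2) \<partial>M) =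
    (\<integral>\<^sup>+\<omega>. (\<integral>\<^sup>+s. ennreal ((\<Sum>p\<in>P. c p \<omega> * indicator {a p<..b p} s)\<^sup>2) \<partial>lborel) \<partial>M)"
proof -
  define g where "g p q = (\<bar>b p - a q\<bar> - \<bar>b p - b q\<bar> + \<bar>a p - b q\<bar> - \<bar>a p - a q\<bar>) / 2" for p q
  let ?D = "\<lambda>p \<omega>. W (b p) \<omega> - W (a p) \<omega>"
  have ab01: "a p \<in> {0..1}" "b p \<in> {0..1}" if "p \<in> P" for p using ab[OF that] by auto
  have cm: "c p \<in> borel_measurable M" if "p \<in> P" for p
  proof -
    have "c p = (\<lambda>\<omega>. h p (\<lambda>t\<in>{0..1}. B t \<omega>))" using c[OF that] by auto
    then show ?thesis using measurable_compose[OF indep_var_rv1[OF indep_paths] h(1)[OF that]] by simp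
  qed
  have cL: "\<bar>c p \<omega>\<bar> \<le> L" if "p \<in> P" for p \<omega> using h(2)[OF that] c[OF that] by simp
  have icc: "integrable M (\<lambda>\<omega>. c p \<omega> * c q \<omega>)" if pq: "p \<in> P" "q \<in> P" for p q
  proof (rule integrable_const_bound[of _ "L * L"])
    show "AE \<omega> in M. norm (c p \<omega> * c q \<omega>) \<le> L * L"
      using cL[OF pq(1)] cL[OF pq(2)] by (intro AE_I2) (simp add: abs_mult mult_mono order_trans[OF abs_ge_zero cL[OF pq(1)]])
    show "(\<lambda>\<omega>. c p \<omega> * c q \<omega>) \<in> borel_measurable M" using cm pq by (intro borel_measurable_times)
  qed
  have prod: "integrable M (\<lambda>\<omega>. (c p \<omega> * c q \<omega>) * (?D p \<omega> * ?D q \<omega>)) \<and>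
      expectation (\<lambda>\<omega>. (c p \<omega> * c q \<omega>) * (?D p \<omega> * ?D q \<omega>)) = expectation (\<lambda>\<omega>. c p \<omega> * c q \<omega>) * g p q"
    if pq: "p \<in> P" "q \<in> P" for p q
  proof -
    have "indep_var borel ((\<lambda>x. h p x * h q x) \<circ> (\<lambda>\<omega>. \<lambda>t\<in>{0..1}. B t \<omega>))
        borel ((\<lambda>y. (y (b p) - y (a p)) * (y (b q) - y (a q))) \<circ> (\<lambda>\<omega>. \<lambda>t\<in>{0..1}. W t \<omega>))"
      using pq ab01
      by (intro indep_var_compose[OF indep_paths] borel_measurable_times borel_measurable_diff h measurable_component_singleton)
    also have "(\<lambda>x. h p x * h q x) \<circ> (\<lambda>\<omega>. \<lambda>t\<in>{0..1}. B t \<omega>) = (\<lambda>\<omega>. c p \<omega> * c q \<omega>)"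
      using pq c by auto
    also have "(\<lambda>y. (y (b p) - y (a p)) * (y (b q) - y (a q))) \<circ> (\<lambda>\<omega>. \<lambda>t\<in>{0..1}. W t \<omega>) = (\<lambda>\<omega>. ?D p \<omega> * ?D q \<omega>)"
      using ab01[OF pq(1)] ab01[OF pq(2)] by auto
    finally have iv: "indep_var borel (\<lambda>\<omega>. c p \<omega> * c q \<omega>) borel (\<lambda>\<omega>. ?D p \<omega> * ?D q \<omega>)" .
    have iD: "integrable M (\<lambda>\<omega>. ?D p \<omega> * ?D q \<omega>)" using pq by (intro covariance_increments_W ab01)
    show ?thesis
      using indep_var_integrable[OF iv icc[OF pq] iD] indep_var_lebesgue_integral[OF iv icc[OF pq] iD]
        covariance_increments_W(2)[OF ab01(1)[OF pq(1)] ab01(2)[OF pq(1)] ab01(1)[OF pq(2)] ab01(2)[OF pq(2)]]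
      by (simp add: g_def)
  qed
  have sq: "(\<Sum>p\<in>P. c p \<omega> * x p)\<^sup>2 = (\<Sum>p\<in>P. \<Sum>q\<in>P. (c p \<omega> * c q \<omega>) * (x p * x q))" for x \<omega>
    unfolding power2_eq_square sum_product by (intro sum.cong refl) (simp add: mult_ac)
  have ind: "integrable lborel (\<lambda>s. indicator {a p<..b p} s * indicator {a q<..b q} s :: real)"
      "(LINT s|lborel. indicator {a p<..b p} s * indicator {a q<..b q} s) = g p q" if "p \<in> P" "q \<in> P" for p q
    unfolding g_def by (rule integral_indicator_intervals[OF ab(2)[OF that(1)] ab(2)[OF that(2)]])+
  have LINT: "(LINT s|lborel. (\<Sum>p\<in>P. c p \<omega> * indicator {a p<..b p} s)\<^sup>2) = (\<Sum>p\<in>P. \<Sum>q\<in>P. (c p \<omega> * c q \<omega>) * g p q)" for \<omega>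
    unfolding sq using ind by (simp add: Bochner_Integration.integral_sum Bochner_Integration.integrable_sum)
  have "(\<integral>\<^sup>+\<omega>. ennreal ((\<Sum>p\<in>P. c p \<omega> * ?D p \<omega>)\<^sup>2) \<partial>M) = ennreal (expectation (\<lambda>\<omega>. (\<Sum>p\<in>P. c p \<omega> * ?D p \<omega>)\<^sup>2))"
  proof (rule nn_integral_eq_integral)
    show "integrable M (\<lambda>\<omega>. (\<Sum>p\<in>P. c p \<omega> * ?D p \<omega>)\<^sup>2)"
      unfolding sq using prod by (intro Bochner_Integration.integrable_sum) blast
  qed simp
  also have "expectation (\<lambda>\<omega>. (\<Sum>p\<in>P. c p \<omega> * ?D p \<omega>)\<^sup>2) = (\<Sum>p\<in>P. \<Sum>q\<in>P. expectation (\<lambda>\<omega>. c p \<omega> * c q \<omega>) * g p q)"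
    unfolding sq using prod by (simp add: Bochner_Integration.integral_sum Bochner_Integration.integrable_sum)
  also have "\<dots> = expectation (\<lambda>\<omega>. \<Sum>p\<in>P. \<Sum>q\<in>P. (c p \<omega> * c q \<omega>) * g p q)"
    using icc by (simp add: Bochner_Integration.integral_sum Bochner_Integration.integrable_sum)
  also have "ennreal \<dots> = (\<integral>\<^sup>+\<omega>. ennreal (\<Sum>p\<in>P. \<Sum>q\<in>P. (c p \<omega> * c q \<omega>) * g p q) \<partial>M)"
  proof (rule nn_integral_eq_integral[symmetric])
    show "integrable M (\<lambda>\<omega>. \<Sum>p\<in>P. \<Sum>q\<in>P. (c p \<omega> * c q \<omega>) * g p q)"
      using icc by (intro Bochner_Integration.integrable_sum integrable_mult_left) 
    have "0 \<le> (\<Sum>p\<in>P. \<Sum>q\<in>P. (c p \<omega> * c q \<omega>) * g p q)" for \<omega>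
    proof -
      have "(\<Sum>p\<in>P. \<Sum>q\<in>P. (c p \<omega> * c q \<omega>) * g p q) = (LINT s|lborel. (\<Sum>p\<in>P. c p \<omega> * indicator {a p<..b p} s)\<^sup>2)"
        by (rule LINT[symmetric])
      then show ?thesis by simp
    qed
    then show "AE \<omega> in M. 0 \<le> (\<Sum>p\<in>P. \<Sum>q\<in>P. (c p \<omega> * c q \<omega>) * g p q)" by simp
  qed
  also have "\<dots> = (\<integral>\<^sup>+\<omega>. (\<integral>\<^sup>+s. ennreal ((\<Sum>p\<in>P. c p \<omega> * indicator {a p<..b p} s)\<^sup>2) \<partial>lborel) \<partial>M)"
  proof (intro nn_integral_cong)
    fix \<omega>
    have i: "integrable lborel (\<lambda>s. (\<Sum>p\<in>P. c p \<omega> * indicator {a p<..b p} s)\<^sup>2)"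
      unfolding sq using integral_indicator_intervals(1) ab
      by (intro Bochner_Integration.integrable_sum integrable_mult_right) auto
    have "(\<integral>\<^sup>+s. ennreal ((\<Sum>p\<in>P. c p \<omega> * indicator {a p<..b p} s)\<^sup>2) \<partial>lborel) = ennreal (LINT s|lborel. (\<Sum>p\<in>P. c p \<omega> * indicator {a p<..b p} s)\<^sup>2)"
      by (rule nn_integral_eq_integral[OF i]) simp
    also have "(LINT s|lborel. (\<Sum>p\<in>P. c p \<omega> * indicator {a p<..b p} s)\<^sup>2) = (\<Sum>p\<in>P. \<Sum>q\<in>P. (c p \<omega> * c q \<omega>) * g p q)"
      by (rule LINT)
    finally show "ennreal (\<Sum>p\<in>P. \<Sum>q\<in>P. (c p \<omega> * c q \<omega>) * g p q) = (\<integral>\<^sup>+s. ennreal ((\<Sum>p\<in>P. c p \<omega> * indicator {a p<..b p} s)\<^sup>2) \<partial>lborel)" ..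
  qed
  finally show ?thesis .
qed

end

section \<open>Existence of the stochastic integral\<close>

text \<open>Bounded second moments give uniform integrability: dominated convergence handles the
  part truncated at \<open>L\<close>, and the excess is at most
  \<open>(u n \<omega>)\<^sup>2 / L\<close>.\<close>

lemma nn_integral_tendsto_0_if_bounded_square:
  fixes u :: "nat \<Rightarrow> 'a \<Rightarrow> real"
  assumes M: "finite_measure M" and [measurable]: "\<And>n. u n \<in> borel_measurable M" and u0: "\<And>n \<omega>. 0 \<le> u n \<omega>"
    and lim: "\<And>\<omega>. \<omega> \<in> space M \<Longrightarrow> (\<lambda>n. u n \<omega>) \<longlonglongrightarrow> 0"
    and bnd: "\<And>n. (\<integral>\<^sup>+\<omega>. ennreal ((u n \<omega>)\<^sup>2) \<partial>M) \<le> ennreal K"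
  shows "(\<lambda>n. \<integral>\<^sup>+\<omega>. ennreal (u n \<omega>) \<partial>M) \<longlonglongrightarrow> 0"
proof (rule order_tendstoI)
  interpret finite_measure M by fact
  fix a :: ennreal assume "0 < a"
  then obtain b where b: "0 < b" "b < a" using dense by blast
  then obtain \<epsilon> where \<epsilon>: "b = ennreal \<epsilon>" "0 < \<epsilon>" by (cases b) auto
  define L where "L = 2 * (\<bar>K\<bar> + 1) / \<epsilon>"
  have L: "0 < L" using \<epsilon> by (simp add: L_def)
  have KL: "\<bar>K\<bar> / L \<le> \<epsilon> / 2" using \<epsilon> by (simp add: L_def field_simps)
  have "(\<lambda>n. \<integral>\<^sup>+\<omega>. ennreal (min (u n \<omega>) L) \<partial>M) \<longlonglongrightarrow> (\<integral>\<^sup>+\<omega>. ennreal 0 \<partial>M)"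
  proof (rule nn_integral_dominated_convergence[where w="\<lambda>_. ennreal L"])
    show "AE \<omega> in M. (\<lambda>n. ennreal (min (u n \<omega>) L)) \<longlonglongrightarrow> ennreal 0"
    proof (rule AE_I2, rule tendsto_ennrealI)
      fix \<omega> assume "\<omega> \<in> space M"
      from tendsto_min[OF lim[OF this] tendsto_const[of L]] show "(\<lambda>n. min (u n \<omega>) L) \<longlonglongrightarrow> 0"
        using L by simp
    qed
  qed (auto simp: ennreal_mult_less_top emeasure_eq_measure ennreal_leI)
  then have "(\<lambda>n. \<integral>\<^sup>+\<omega>. ennreal (min (u n \<omega>) L) \<partial>M) \<longlonglongrightarrow> 0" by simp
  then have "\<forall>\<^sub>F n in sequentially. (\<integral>\<^sup>+\<omega>. ennreal (min (u n \<omega>) L) \<partial>M) < ennreal (\<epsilon> / 2)"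
    by (rule order_tendstoD(2)) (use \<epsilon> in simp)
  then show "\<forall>\<^sub>F n in sequentially. (\<integral>\<^sup>+\<omega>. ennreal (u n \<omega>) \<partial>M) < a"
  proof eventually_elim
    case (elim n)
    have "u n \<omega> \<le> min (u n \<omega>) L + (1 / L) * (u n \<omega>)\<^sup>2" for \<omega>
    proof (cases "u n \<omega> \<le> L")
      case False
      then have "L * u n \<omega> \<le> u n \<omega> * u n \<omega>" using u0[of n \<omega>] by (intro mult_right_mono) auto
      then have "u n \<omega> \<le> (1 / L) * (u n \<omega>)\<^sup>2" using L by (simp add: field_simps power2_eq_square)
      with False L show ?thesis by (simp add: min_def)
    qed (use L in simp)
    then have "(\<integral>\<^sup>+\<omega>. ennreal (u n \<omega>) \<partial>M) \<le> (\<integral>\<^sup>+\<omega>. ennreal (min (u n \<omega>) L) + ennreal (1 / L) * ennreal ((u n \<omega>)\<^sup>2) \<partial>M)"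
      using L u0 by (intro nn_integral_mono) (simp add: ennreal_mult[symmetric] ennreal_plus[symmetric] ennreal_leI del: ennreal_plus)
    also have "\<dots> = (\<integral>\<^sup>+\<omega>. ennreal (min (u n \<omega>) L) \<partial>M) + ennreal (1 / L) * (\<integral>\<^sup>+\<omega>. ennreal ((u n \<omega>)\<^sup>2) \<partial>M)"
      by (subst nn_integral_add) (auto simp: nn_integral_cmult)
    also have "\<dots> \<le> ennreal (\<epsilon> / 2) + ennreal (1 / L) * ennreal \<bar>K\<bar>"
      using elim by (intro add_mono mult_left_mono order_trans[OF bnd] ennreal_leI) auto
    also have "\<dots> \<le> ennreal (\<epsilon> / 2) + ennreal (\<epsilon> / 2)"
      using L KL by (intro add_left_mono) (simp add: ennreal_mult[symmetric] ennreal_leI)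
    also have "\<dots> = b" using \<epsilon> by (simp add: ennreal_plus[symmetric] del: ennreal_plus)
    finally show ?case using b by simp
  qed
qed simp

lemma fourth_power_diff_le: "(x - y) ^ 4 \<le> 8 * (x ^ 4 + y ^ 4)" for x y :: real
proof -
  have "(x - y)\<^sup>2 \<le> 2 * (x\<^sup>2 + y\<^sup>2)" using sum_squares_bound[of x "-y"] by (simp add: power2_diff)
  then have "((x - y)\<^sup>2)\<^sup>2 \<le> (2 * (x\<^sup>2 + y\<^sup>2))\<^sup>2" by (rule power_mono) simp
  also have "\<dots> \<le> 8 * ((x\<^sup>2)\<^sup>2 + (y\<^sup>2)\<^sup>2)"
    using sum_squares_bound[of "x\<^sup>2" "y\<^sup>2"] by (simp add: power2_sum power_mult_distrib)
  finally show ?thesis by simp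
qed

lemma clamp_tendsto:
  fixes y :: real
  assumes "x \<longlonglongrightarrow> y"
  shows "(\<lambda>n. max (- real (Suc n)) (min (real (Suc n)) (x n))) \<longlonglongrightarrow> y"
proof (rule Lim_transform_eventually[OF assms])
  have "filterlim (\<lambda>n. real (Suc n)) at_top sequentially"
    using filterlim_real_sequentially filterlim_Suc by (rule filterlim_compose)
  then have "\<forall>\<^sub>F n in sequentially. \<bar>y\<bar> + 1 \<le> real (Suc n)" unfolding filterlim_at_top by blast
  moreover have "\<forall>\<^sub>F n in sequentially. \<bar>x n\<bar> < \<bar>y\<bar> + 1"
    using tendsto_rabs[OF assms] by (rule order_tendstoD(2)) simp
  ultimately show "\<forall>\<^sub>F n in sequentially. x n = max (- real (Suc n)) (min (real (Suc n)) (x n))"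
    by eventually_elim auto
qed

context independent_brownian_motion
begin

text \<open>The two simple processes form one family over the disjoint union of their index sets,
  the second with opposite sign, to which \<open>ito_isometry\<close> applies.\<close>

lemma nn_integral_ito_difference:
  fixes h h' :: "nat \<Rightarrow> (real \<Rightarrow> real) \<Rightarrow> real"
  assumes \<tau>: "\<And>i. i \<le> m \<Longrightarrow> \<tau> i \<in> {0..1}" "\<And>i. i < m \<Longrightarrow> \<tau> i \<le> \<tau> (Suc i)"
    and \<tau>': "\<And>i. i \<le> m' \<Longrightarrow> \<tau>' i \<in> {0..1}" "\<And>i. i < m' \<Longrightarrow> \<tau>' i \<le> \<tau>' (Suc i)"
    and h: "\<And>i. i < m \<Longrightarrow> h i \<in> borel_measurable (Pi\<^sub>M {0..1} (\<lambda>_. borel))" "\<And>i x. \<bar>h i x\<bar> \<le> L"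
    and h': "\<And>i. i < m' \<Longrightarrow> h' i \<in> borel_measurable (Pi\<^sub>M {0..1} (\<lambda>_. borel))" "\<And>i x. \<bar>h' i x\<bar> \<le> L'"
    and \<xi>: "\<And>i \<omega>. i < m \<Longrightarrow> \<xi> i \<omega> = h i (\<lambda>t\<in>{0..1}. B t \<omega>)"
    and \<xi>': "\<And>i \<omega>. i < m' \<Longrightarrow> \<xi>' i \<omega> = h' i (\<lambda>t\<in>{0..1}. B t \<omega>)"
  shows "(\<integral>\<^sup>+\<omega>. ennreal ((simple_ito_integral W m \<tau> \<xi> \<omega> - simple_ito_integral W m' \<tau>' \<xi>' \<omega>)\<^sup>2) \<partial>M) =
    (\<integral>\<^sup>+\<omega>. (\<integral>\<^sup>+s. ennreal ((simple_process m \<tau> \<xi> s \<omega> - simple_process m' \<tau>' \<xi>' s \<omega>)\<^sup>2) \<partial>lborel) \<partial>M)"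
proof -
  let ?P = "{..<m} <+> {..<m'}"
  let ?a = "case_sum \<tau> \<tau>'" and ?b = "case_sum (\<lambda>i. \<tau> (Suc i)) (\<lambda>i. \<tau>' (Suc i))"
  let ?c = "\<lambda>p \<omega>. case_sum (\<lambda>i. \<xi> i \<omega>) (\<lambda>i. - \<xi>' i \<omega>) p"
  let ?h = "\<lambda>p x. case_sum (\<lambda>i. h i x) (\<lambda>i. - h' i x) p"
  have ito: "simple_ito_integral W m \<tau> \<xi> \<omega> - simple_ito_integral W m' \<tau>' \<xi>' \<omega> = (\<Sum>p\<in>?P. ?c p \<omega> * (W (?b p) \<omega> - W (?a p) \<omega>))" for \<omega>
    unfolding simple_ito_integral_def by (simp add: sum.Plus sum_negf)
  have proc: "simple_process m \<tau> \<xi> s \<omega> - simple_process m' \<tau>' \<xi>' s \<omega> = (\<Sum>p\<in>?P. ?c p \<omega> * indicator {?a p<..?b p} s)" for s \<omega>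
    unfolding simple_process_def
    by (subst sum.Plus) (simp_all only: finite_lessThan o_def sum.case mult_minus_left sum_negf diff_conv_add_uminus)
  show ?thesis
    unfolding ito proc
  proof (rule ito_isometry[where h="?h" and L="max L L'"])
    fix p assume p: "p \<in> ?P"
    show "0 \<le> ?a p" using p \<tau>(1) \<tau>'(1) by (auto simp: less_imp_le)
    show "?a p \<le> ?b p" using p \<tau>(2) \<tau>'(2) by auto
    show "?b p \<le> 1" using p \<tau>(1)[of "Suc _"] \<tau>'(1)[of "Suc _"] by (auto simp: Suc_le_eq)
    show "?h p \<in> borel_measurable (Pi\<^sub>M {0..1} (\<lambda>_. borel))" using p h(1) h'(1) by auto
    show "\<bar>?h p x\<bar> \<le> max L L'" for x
      using h(2)[of _ x] h'(2)[of _ x] by (cases p) (auto simp: le_max_iff_disj)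
    show "?c p \<omega> = ?h p (\<lambda>t\<in>{0..1}. B t \<omega>)" for \<omega> using p \<xi> \<xi>' by auto
  qed auto
qed

text \<open>\<open>ito_integral\<close> is a choice and has meaning only once some integral exists.
  Left-endpoint approximations converge in the L2 norm, since fourth moments make the squared errors
  uniformly integrable; by the isometry their integrals are Cauchy.\<close>

lemma ito_integral_exists:
  fixes f :: "real \<Rightarrow> real"
  assumes cB: "\<And>\<omega>. \<omega> \<in> space M \<Longrightarrow> continuous_on {0..1} (\<lambda>t. B t \<omega>)"
    and f: "continuous_on UNIV f"
    and K: "\<And>t. t \<in> {0..1} \<Longrightarrow> (\<integral>\<^sup>+\<omega>. ennreal ((f (B t \<omega>)) ^ 4) \<partial>M) \<le> ennreal K" "0 \<le> K"
  shows "\<exists>I. has_ito_integral M F W (\<lambda>s \<omega>. f (B s \<omega>)) I"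
proof -
  have [measurable]: "f \<in> borel_measurable borel" by (rule borel_measurable_continuous_onI[OF f])
  \<comment> \<open>Simple adapted processes have to be bounded whereas \<open>f\<close> need not
    be, so values are clamped at a level that grows with \<open>n\<close>.\<close>
  define q where "q n y = max (- real (Suc n)) (min (real (Suc n)) (f y))" for n y
  have [measurable]: "q n \<in> borel_measurable borel" for n unfolding q_def[abs_def] by measurable
  have qL: "\<bar>q n y\<bar> \<le> real (Suc n)" for n y unfolding q_def by auto
  have qf: "\<bar>q n y\<bar> \<le> \<bar>f y\<bar>" for n y unfolding q_def by auto
  define \<tau> where "\<tau> n i = real i / real (Suc n)" for n i
  define \<xi> where "\<xi> n i \<omega> = q n (B (\<tau> n i) \<omega>)" for n i \<omega>
  define S where "S n = simple_process (Suc n) (\<tau> n) (\<xi> n)" for n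
  define J where "J n = simple_ito_integral W (Suc n) (\<tau> n) (\<xi> n)" for n
  define X where "X s \<omega> = f (B s \<omega>)" for s \<omega>
  have \<tau>: "\<tau> n i \<in> {0..1}" if "i \<le> Suc n" for n i using that by (simp add: \<tau>_def divide_le_eq)
  have \<tau>s: "\<tau> n i \<le> \<tau> n (Suc i)" for n i by (simp add: \<tau>_def divide_right_mono)
  have XM[measurable]: "(\<lambda>(s, \<omega>). indicator {0..1} s * X s \<omega>) \<in> borel_measurable (borel \<Otimes>\<^sub>M M)"
    unfolding X_def
    by (intro measurable_path_process measurable_compose[OF measurable_B] continuous_on_compose2[OF f cB]) auto
  have Xt: "X t \<in> borel_measurable M" if "t \<in> {0..1}" for t
    unfolding X_def[abs_def] using measurable_B[OF that] by measurable
  have \<xi>M: "\<xi> n i \<in> borel_measurable M" if "i \<le> n" for n i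
    unfolding \<xi>_def[abs_def] using \<tau>[of i n] that by (intro measurable_compose[OF measurable_B]) auto
  have SM: "(\<lambda>p. S n (fst p) (snd p)) \<in> borel_measurable (borel \<Otimes>\<^sub>M M)" for n
    unfolding S_def simple_process_def
  proof (intro borel_measurable_sum borel_measurable_times)
    fix i assume "i \<in> {..<Suc n}"
    then show "(\<lambda>p. \<xi> n i (snd p)) \<in> borel_measurable (borel \<Otimes>\<^sub>M M)"
      by (intro measurable_compose[OF measurable_snd \<xi>M]) simp
    show "(\<lambda>p. indicator {\<tau> n i<..\<tau> n (Suc i)} (fst p) :: real) \<in> borel_measurable (borel \<Otimes>\<^sub>M M)" by measurable
  qed
  have sa: "simple_adapted M F (Suc n) (\<tau> n) (\<xi> n)" for n
    unfolding simple_adapted_def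
  proof (intro conjI allI impI)
    fix i assume i: "i < Suc n"
    show "\<xi> n i \<in> borel_measurable (F (\<tau> n i))"
      unfolding \<xi>_def[abs_def] using \<tau>[of i n] i by (intro measurable_compose[OF measurable_B_F]) auto
    show "\<exists>L. \<forall>\<omega>\<in>space M. \<bar>\<xi> n i \<omega>\<bar> \<le> L" unfolding \<xi>_def using qL by blast
  qed (use \<tau> \<tau>s in auto)
  define u where "u n s \<omega> = (indicator {0..1} s * X s \<omega> - indicator {0..1} s * S n s \<omega>)\<^sup>2" for n s \<omega>
  have uM: "(\<lambda>p. u n (fst p) (snd p)) \<in> borel_measurable (borel \<Otimes>\<^sub>M M)" for n
    unfolding u_def using XM SM[of n] by (simp add: case_prod_beta')
  define e where "e n = (\<integral>\<^sup>+\<omega>. (\<integral>\<^sup>+s\<in>{0..1}. ennreal ((X s \<omega> - S n s \<omega>)\<^sup>2) \<partial>lborel) \<partial>M)" for n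
  have eu: "(\<integral>\<^sup>+s\<in>{0..1}. ennreal ((X s \<omega> - S n s \<omega>)\<^sup>2) \<partial>lborel) = (\<integral>\<^sup>+s. ennreal (u n s \<omega>) \<partial>lborel)" for n \<omega>
    unfolding u_def by (intro nn_integral_cong) (auto simp: indicator_def)
  interpret P: pair_sigma_finite lborel M ..
  have e: "e n = (\<integral>\<^sup>+s. (\<integral>\<^sup>+\<omega>. ennreal (u n s \<omega>) \<partial>M) \<partial>lborel)" for n
    unfolding e_def eu using uM[of n] by (intro P.Fubini') (simp add: case_prod_beta')
  have us: "(\<lambda>n. \<integral>\<^sup>+\<omega>. ennreal (u n s \<omega>) \<partial>M) \<longlonglongrightarrow> 0 \<and> (\<forall>n. (\<integral>\<^sup>+\<omega>. ennreal ((u n s \<omega>)\<^sup>2) \<partial>M) \<le> ennreal (16 * K))"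
    if s: "0 < s" "s \<le> 1" for s
  proof -
    \<comment> \<open>The cells are open on the left and closed on the right; hence the ceiling
      minus one instead of the floor.\<close>
    define k where "k n = nat (\<lceil>s * real (Suc n)\<rceil> - 1)" for n
    have k: "real (k n) < s * real (Suc n)" "s * real (Suc n) \<le> real (k n) + 1" for n
    proof -
      have "0 < s * real (Suc n)" using s by simp
      then have "1 \<le> \<lceil>s * real (Suc n)\<rceil>" by linarith
      then have "real (k n) = real_of_int \<lceil>s * real (Suc n)\<rceil> - 1" by (simp add: k_def)
      then show "real (k n) < s * real (Suc n)" "s * real (Suc n) \<le> real (k n) + 1" by linarith+
    qed
    have kn: "k n < Suc n" for n
    proof -
      have "s * real (Suc n) \<le> 1 * real (Suc n)" using s by (intro mult_right_mono) auto
      with k(1)[of n] have "real (k n) < 1 * real (Suc n)" by (rule order_less_le_trans)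
      then have "real (k n) < real (Suc n)" by simp
      then show ?thesis by (simp only: of_nat_less_iff)
    qed
    have mem: "s \<in> {\<tau> n (k n)<..\<tau> n (Suc (k n))}" for n
      using k[of n] by (simp add: \<tau>_def divide_less_eq le_divide_eq add.commute)
    have S: "S n s \<omega> = q n (B (\<tau> n (k n)) \<omega>)" for n \<omega>
      unfolding S_def by (subst simple_process_eq[where m="Suc n" and \<tau>="\<tau> n", OF \<tau>s kn mem]) (simp add: \<xi>_def)
    have tn: "\<tau> n (k n) \<in> {0..1}" for n using \<tau>[of "k n" n] kn[of n] by simp
    have tlim: "(\<lambda>n. \<tau> n (k n)) \<longlonglongrightarrow> s"
    proof (rule LIM_zero_cancel, rule Lim_null_comparison)
      have "\<bar>\<tau> n (k n) - s\<bar> \<le> inverse (real (Suc n))" for n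
      proof -
        have "\<tau> n (Suc (k n)) = \<tau> n (k n) + inverse (real (Suc n))"
          by (simp add: \<tau>_def add_divide_distrib inverse_eq_divide)
        with mem[of n] show ?thesis by auto
      qed
      then show "\<forall>\<^sub>F n in sequentially. norm (\<tau> n (k n) - s) \<le> inverse (real (Suc n))" by simp
    qed (rule LIMSEQ_inverse_real_of_nat)
    have u: "u n s \<omega> = (X s \<omega> - S n s \<omega>)\<^sup>2" for n \<omega> using s by (simp add: u_def)
    have u4: "(u n s \<omega>)\<^sup>2 \<le> 8 * ((X s \<omega>) ^ 4 + (X (\<tau> n (k n)) \<omega>) ^ 4)" for n \<omega>
    proof -
      have "(u n s \<omega>)\<^sup>2 = (X s \<omega> - S n s \<omega>) ^ 4" unfolding u by simp
      also have "\<dots> \<le> 8 * ((X s \<omega>) ^ 4 + (S n s \<omega>) ^ 4)" by (rule fourth_power_diff_le)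
      also have "(S n s \<omega>) ^ 4 \<le> (X (\<tau> n (k n)) \<omega>) ^ 4"
        using power_mono[OF qf[of n "B (\<tau> n (k n)) \<omega>"], of 4] unfolding S X_def by simp
      finally show ?thesis by simp
    qed
    have Ss: "S n s \<in> borel_measurable M" for n
      unfolding S[abs_def] using measurable_B[OF tn[of n]] by measurable
    have Xs: "X s \<in> borel_measurable M" using s by (intro Xt) auto
    have um: "(\<lambda>\<omega>. u n s \<omega>) \<in> borel_measurable M" for n unfolding u using Ss[of n] Xs by measurable
    have b: "(\<integral>\<^sup>+\<omega>. ennreal ((u n s \<omega>)\<^sup>2) \<partial>M) \<le> ennreal (16 * K)" for n
    proof -
      note [measurable] = Xs Xt[OF tn[of n]]
      have "(\<integral>\<^sup>+\<omega>. ennreal ((u n s \<omega>)\<^sup>2) \<partial>M) \<le> (\<integral>\<^sup>+\<omega>. ennreal 8 * (ennreal ((X s \<omega>) ^ 4) + ennreal ((X (\<tau> n (k n)) \<omega>) ^ 4)) \<partial>M)"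
        using u4[of n] by (intro nn_integral_mono)
          (simp only: ennreal_plus[symmetric] ennreal_mult[symmetric] ennreal_leI zero_le_even_power even_numeral add_nonneg_nonneg zero_le_numeral)
      also have "\<dots> = ennreal 8 * ((\<integral>\<^sup>+\<omega>. ennreal ((X s \<omega>) ^ 4) \<partial>M) + (\<integral>\<^sup>+\<omega>. ennreal ((X (\<tau> n (k n)) \<omega>) ^ 4) \<partial>M))"
        by (subst nn_integral_cmult, measurable, subst nn_integral_add) auto
      also have "\<dots> \<le> ennreal 8 * (ennreal K + ennreal K)"
        unfolding X_def using s tn[of n] by (intro mult_left_mono add_mono K(1)) auto
      also have "\<dots> = ennreal (16 * K)"
        using K(2) by (simp only: ennreal_plus[symmetric] ennreal_mult[symmetric] zero_le_numeral add_nonneg_nonneg) simp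
      finally show ?thesis .
    qed
    moreover have "(\<lambda>n. \<integral>\<^sup>+\<omega>. ennreal (u n s \<omega>) \<partial>M) \<longlonglongrightarrow> 0"
    proof (rule nn_integral_tendsto_0_if_bounded_square[OF _ um _ _ b])
      show "finite_measure M" by (rule finite_measure_axioms)
      show "0 \<le> u n s \<omega>" for n \<omega> by (simp add: u_def)
      fix \<omega> assume w: "\<omega> \<in> space M"
      have "(\<lambda>n. f (B (\<tau> n (k n)) \<omega>)) \<longlonglongrightarrow> f (B s \<omega>)"
        by (rule continuous_on_tendsto_compose[OF continuous_on_compose2[OF f cB[OF w]] tlim]) (use tn s in auto)
      from clamp_tendsto[OF this] have "(\<lambda>n. S n s \<omega>) \<longlonglongrightarrow> X s \<omega>" unfolding S q_def X_def .
      from tendsto_power[OF tendsto_diff[OF tendsto_const[of "X s \<omega>"] this], of 2] show "(\<lambda>n. u n s \<omega>) \<longlonglongrightarrow> 0" unfolding u by simp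
    qed
    ultimately show ?thesis by blast
  qed
  have e0: "e \<longlonglongrightarrow> 0"
  proof -
    have "(\<lambda>n. \<integral>\<^sup>+s. (\<integral>\<^sup>+\<omega>. ennreal (u n s \<omega>) \<partial>M) \<partial>lborel) \<longlonglongrightarrow> (\<integral>\<^sup>+s. 0 \<partial>(lborel :: real measure))"
    proof (rule nn_integral_dominated_convergence[where w="\<lambda>s. ennreal (1 + 16 * K) * indicator {0..1} s"])
      show "(\<lambda>s. \<integral>\<^sup>+\<omega>. ennreal (u n s \<omega>) \<partial>M) \<in> borel_measurable lborel" for n
        using uM[of n] by (intro borel_measurable_nn_integral) (simp add: case_prod_beta')
      \<comment> \<open>The point 0 belongs to no cell of any partition, so the approximations fail
        there, on a null set.\<close>
      have ae: "AE s in lborel. s \<noteq> (0::real)" by (rule AE_lborel_singleton)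
      show "AE s in lborel. (\<integral>\<^sup>+\<omega>. ennreal (u n s \<omega>) \<partial>M) \<le> ennreal (1 + 16 * K) * indicator {0..1} s" for n
        using ae
      proof eventually_elim
        case (elim s)
        show ?case
        proof (cases "s \<in> {0..1}")
          case True
          with elim have s: "0 < s" "s \<le> 1" by auto
          have le1: "y \<le> 1 + y\<^sup>2" if "0 \<le> y" for y :: real
          proof -
            have "2 * y \<le> y\<^sup>2 + 1" using sum_squares_bound[of y 1] by simp
            with that show ?thesis by linarith
          qed
          have "u n s \<omega> \<le> 1 + (u n s \<omega>)\<^sup>2" for \<omega>
            by (rule le1) (simp add: u_def)
          then have "(\<integral>\<^sup>+\<omega>. ennreal (u n s \<omega>) \<partial>M) \<le> (\<integral>\<^sup>+\<omega>. 1 + ennreal ((u n s \<omega>)\<^sup>2) \<partial>M)"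
            by (intro nn_integral_mono) (simp only: ennreal_1[symmetric] ennreal_plus[symmetric] zero_le_one zero_le_power2 ennreal_leI)
          also have "\<dots> = 1 + (\<integral>\<^sup>+\<omega>. ennreal ((u n s \<omega>)\<^sup>2) \<partial>M)"
            using measurable_compose[OF measurable_Pair1'[of s borel] uM[of n]] by (subst nn_integral_add) (auto simp: emeasure_space_1)
          also have "\<dots> \<le> 1 + ennreal (16 * K)" using us[OF s] by (intro add_left_mono) blast
          finally show ?thesis using True K(2) by simp
        qed (simp add: u_def)
      qed
      show "AE s in lborel. (\<lambda>n. \<integral>\<^sup>+\<omega>. ennreal (u n s \<omega>) \<partial>M) \<longlonglongrightarrow> 0"
        using ae
      proof eventually_elim
        case (elim s)
        show ?case
        proof (cases "s \<in> {0..1}")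
          case True
          with elim have s: "0 < s" "s \<le> 1" by auto
          from us[OF s] show ?thesis by blast
        qed (simp add: u_def)
      qed
      show "(\<integral>\<^sup>+s. ennreal (1 + 16 * K) * indicator {0..1} s \<partial>(lborel :: real measure)) < \<infinity>"
        by (simp add: nn_integral_cmult_indicator ennreal_mult_less_top)
    qed auto
    then show ?thesis unfolding e[abs_def] by simp
  qed
  have S0: "S n s \<omega> = 0" if "s \<notin> {0..1}" for n s \<omega>
  proof -
    have "s \<notin> {\<tau> n i<..\<tau> n (Suc i)}" if "i < Suc n" for i
      using \<open>s \<notin> {0..1}\<close> \<tau>[of i n] \<tau>[of "Suc i" n] that by auto
    then show ?thesis unfolding S_def simple_process_def by (intro sum.neutral) auto
  qed
  have Jd: "(\<integral>\<^sup>+\<omega>. ennreal ((J n \<omega> - J k \<omega>)\<^sup>2) \<partial>M) \<le> 2 * e n + 2 * e k" for n k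
  proof -
    have hm: "(\<lambda>x. q n (x (\<tau> n i))) \<in> borel_measurable (Pi\<^sub>M {0..1} (\<lambda>_. borel))" if "i < Suc n" for n i
      using \<tau>[of i n] that by (intro measurable_compose[OF measurable_component_singleton]) auto
    have "(\<integral>\<^sup>+\<omega>. ennreal ((J n \<omega> - J k \<omega>)\<^sup>2) \<partial>M) = (\<integral>\<^sup>+\<omega>. (\<integral>\<^sup>+s. ennreal ((S n s \<omega> - S k s \<omega>)\<^sup>2) \<partial>lborel) \<partial>M)"
      unfolding J_def S_def
      by (rule nn_integral_ito_difference[where m="Suc n" and m'="Suc k" and \<tau>="\<tau> n" and \<tau>'="\<tau> k" and h="\<lambda>i x. q n (x (\<tau> n i))" and h'="\<lambda>i x. q k (x (\<tau> k i))", OF \<tau> \<tau>s \<tau> \<tau>s hm qL hm qL])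
        (use \<tau> in \<open>auto simp: \<xi>_def\<close>)
    also have "\<dots> \<le> (\<integral>\<^sup>+\<omega>. (\<integral>\<^sup>+s. 2 * ennreal (u n s \<omega>) + 2 * ennreal (u k s \<omega>) \<partial>lborel) \<partial>M)"
    proof (intro nn_integral_mono)
      fix s \<omega>
      have "(S n s \<omega> - S k s \<omega>)\<^sup>2 \<le> 2 * u n s \<omega> + 2 * u k s \<omega>"
      proof (cases "s \<in> {0..1}")
        case True
        \<comment> \<open>The right-hand side of the claim exceeds the left by exactly this square,
          the parallelogram law for the two errors.\<close>
        have "0 \<le> ((X s \<omega> - S n s \<omega>) + (X s \<omega> - S k s \<omega>))\<^sup>2" by simp
        with True show ?thesis by (simp add: u_def power2_eq_square algebra_simps)
      qed (simp add: S0 u_def)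
      then have "ennreal ((S n s \<omega> - S k s \<omega>)\<^sup>2) \<le> ennreal (2 * u n s \<omega> + 2 * u k s \<omega>)" by (rule ennreal_leI)
      also have "\<dots> = 2 * ennreal (u n s \<omega>) + 2 * ennreal (u k s \<omega>)"
        by (simp add: ennreal_mult u_def)
      finally show "ennreal ((S n s \<omega> - S k s \<omega>)\<^sup>2) \<le> 2 * ennreal (u n s \<omega>) + 2 * ennreal (u k s \<omega>)" .
    qed
    also have "\<dots> = 2 * e n + 2 * e k"
    proof -
      have m1: "(\<lambda>s. ennreal (u n s \<omega>)) \<in> borel_measurable lborel" if "\<omega> \<in> space M" for n \<omega>
        using measurable_compose[OF measurable_Pair2'[OF that] uM[of n]] by simp
      have m2: "(\<lambda>\<omega>. \<integral>\<^sup>+s. ennreal (u n s \<omega>) \<partial>lborel) \<in> borel_measurable M" for n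
      proof -
        have "(\<lambda>p. ennreal (u n (snd p) (fst p))) \<in> borel_measurable (M \<Otimes>\<^sub>M lborel)"
          using measurable_compose[OF measurable_pair_swap' uM[of n]] by (simp add: case_prod_beta')
        then show ?thesis by (intro lborel.borel_measurable_nn_integral) (simp add: case_prod_beta')
      qed
      have "(\<integral>\<^sup>+\<omega>. (\<integral>\<^sup>+s. 2 * ennreal (u n s \<omega>) + 2 * ennreal (u k s \<omega>) \<partial>lborel) \<partial>M) =
          (\<integral>\<^sup>+\<omega>. 2 * (\<integral>\<^sup>+s. ennreal (u n s \<omega>) \<partial>lborel) + 2 * (\<integral>\<^sup>+s. ennreal (u k s \<omega>) \<partial>lborel) \<partial>M)"
        using m1 by (intro nn_integral_cong) (simp add: nn_integral_add nn_integral_cmult)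
      also have "\<dots> = 2 * e n + 2 * e k"
        unfolding e_def eu using m2 by (simp add: nn_integral_add nn_integral_cmult)
      finally show ?thesis .
    qed
    finally show ?thesis .
  qed
  have JM[measurable]: "J n \<in> borel_measurable M" for n
    unfolding J_def simple_ito_integral_def[abs_def] using \<tau>[of _ n]
    by (intro borel_measurable_sum borel_measurable_times borel_measurable_diff measurable_W \<xi>M) auto
  have Ji: "integrable M (J n)" for n
    unfolding J_def simple_ito_integral_def[abs_def]
  proof (intro Bochner_Integration.integrable_sum)
    fix i assume i: "i \<in> {..<Suc n}"
    have t: "\<tau> n i \<in> {0..1}" "\<tau> n (Suc i) \<in> {0..1}" using i \<tau> by auto
    show "integrable M (\<lambda>\<omega>. \<xi> n i \<omega> * (W (\<tau> n (Suc i)) \<omega> - W (\<tau> n i) \<omega>))"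
    proof (rule Bochner_Integration.integrable_bound)
      show "integrable M (\<lambda>\<omega>. real (Suc n) * (1 + (W (\<tau> n (Suc i)) \<omega> - W (\<tau> n i) \<omega>)\<^sup>2))"
        by (intro integrable_mult_right Bochner_Integration.integrable_add integrable_const second_moment_W t)
      show "(\<lambda>\<omega>. \<xi> n i \<omega> * (W (\<tau> n (Suc i)) \<omega> - W (\<tau> n i) \<omega>)) \<in> borel_measurable M"
        using i by (intro borel_measurable_times borel_measurable_diff measurable_W t \<xi>M) auto
      have "\<bar>x\<bar> \<le> 1 + x\<^sup>2" for x :: real
        using sum_squares_bound[of "\<bar>x\<bar>" 1] by simp
      then show "AE \<omega> in M. norm (\<xi> n i \<omega> * (W (\<tau> n (Suc i)) \<omega> - W (\<tau> n i) \<omega>)) \<le> norm (real (Suc n) * (1 + (W (\<tau> n (Suc i)) \<omega> - W (\<tau> n i) \<omega>)\<^sup>2))"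
        using qL[of n] by (intro AE_I2) (simp add: \<xi>_def norm_mult abs_mult mult_mono)
    qed
  qed
  \<comment> \<open>The L2 estimate is weakened to an L1 estimate, from which an almost surely
    Cauchy subsequence can be extracted; the limit along it serves as the integral.\<close>
  have cauchy: "\<exists>N. \<forall>i\<ge>N. \<forall>j\<ge>N. (LINT \<omega>|M. norm (J i \<omega> - J j \<omega>)) < \<epsilon>" if \<epsilon>: "0 < \<epsilon>" for \<epsilon>
  proof -
    define \<delta> where "\<delta> = \<epsilon> / 4"
    have \<delta>: "0 < \<delta>" using \<epsilon> by (simp add: \<delta>_def)
    have "\<forall>\<^sub>F n in sequentially. e n < ennreal (\<delta>\<^sup>2 / 4)"
      using e0 by (rule order_tendstoD(2)) (use \<delta> in simp)
    then obtain N where N: "\<And>n. N \<le> n \<Longrightarrow> e n < ennreal (\<delta>\<^sup>2 / 4)" unfolding eventually_sequentially by blast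
    have "(LINT \<omega>|M. norm (J i \<omega> - J j \<omega>)) < \<epsilon>" if ij: "N \<le> i" "N \<le> j" for i j
    proof -
      have "\<bar>x\<bar> \<le> \<delta> + (1 / \<delta>) * x\<^sup>2" for x :: real
      proof -
        have "2 * \<delta> * \<bar>x\<bar> \<le> \<delta>\<^sup>2 + x\<^sup>2" using sum_squares_bound[of \<delta> "\<bar>x\<bar>"] by simp
        moreover have "0 \<le> \<delta> * \<bar>x\<bar>" using \<delta> by simp
        ultimately have "\<bar>x\<bar> * \<delta> \<le> \<delta>\<^sup>2 + x\<^sup>2" by (simp only: mult.assoc mult.commute[of "\<bar>x\<bar>"])
        then have "\<bar>x\<bar> \<le> (\<delta>\<^sup>2 + x\<^sup>2) / \<delta>" using \<delta> by (simp add: pos_le_divide_eq)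
        also have "\<dots> = \<delta> + (1 / \<delta>) * x\<^sup>2" using \<delta> by (simp add: add_divide_distrib power2_eq_square)
        finally show ?thesis .
      qed
      then have "(\<integral>\<^sup>+\<omega>. ennreal (norm (J i \<omega> - J j \<omega>)) \<partial>M) \<le> (\<integral>\<^sup>+\<omega>. ennreal \<delta> + ennreal (1 / \<delta>) * ennreal ((J i \<omega> - J j \<omega>)\<^sup>2) \<partial>M)"
        using \<delta> by (intro nn_integral_mono) (simp add: ennreal_mult[symmetric] ennreal_plus[symmetric] ennreal_leI del: ennreal_plus)
      also have "\<dots> = ennreal \<delta> + ennreal (1 / \<delta>) * (\<integral>\<^sup>+\<omega>. ennreal ((J i \<omega> - J j \<omega>)\<^sup>2) \<partial>M)"
        by (subst nn_integral_add) (auto simp: nn_integral_cmult emeasure_space_1)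
      also have "\<dots> \<le> ennreal \<delta> + ennreal (1 / \<delta>) * (2 * ennreal (\<delta>\<^sup>2 / 4) + 2 * ennreal (\<delta>\<^sup>2 / 4))"
        using N[OF ij(1)] N[OF ij(2)] by (intro add_left_mono mult_left_mono order_trans[OF Jd] add_mono) auto
      also have "2 * ennreal (\<delta>\<^sup>2 / 4) + 2 * ennreal (\<delta>\<^sup>2 / 4) = ennreal (2 * (\<delta>\<^sup>2 / 4) + 2 * (\<delta>\<^sup>2 / 4))"
        by (subst ennreal_plus) (simp_all only: ennreal_mult'' ennreal_numeral zero_le_numeral mult_nonneg_nonneg zero_le_divide_iff zero_le_power2 simp_thms)
      also have "ennreal \<delta> + ennreal (1 / \<delta>) * \<dots> = ennreal (\<delta> + (1 / \<delta>) * (2 * (\<delta>\<^sup>2 / 4) + 2 * (\<delta>\<^sup>2 / 4)))"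
        using \<delta> by (simp add: ennreal_mult[symmetric] ennreal_plus[symmetric] del: ennreal_plus)
      also have "\<delta> + (1 / \<delta>) * (2 * (\<delta>\<^sup>2 / 4) + 2 * (\<delta>\<^sup>2 / 4)) = \<epsilon> / 2"
        using \<delta> by (simp add: power2_eq_square) (simp add: \<delta>_def)
      finally have "(\<integral>\<^sup>+\<omega>. ennreal (norm (J i \<omega> - J j \<omega>)) \<partial>M) \<le> ennreal (\<epsilon> / 2)" .
      moreover have "(\<integral>\<^sup>+\<omega>. ennreal (norm (J i \<omega> - J j \<omega>)) \<partial>M) = ennreal (LINT \<omega>|M. norm (J i \<omega> - J j \<omega>))"
        by (intro nn_integral_eq_integral integrable_norm Bochner_Integration.integrable_diff Ji) auto
      ultimately have "(LINT \<omega>|M. norm (J i \<omega> - J j \<omega>)) \<le> \<epsilon> / 2" using \<epsilon> by (simp add: ennreal_le_iff)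
      then show ?thesis using \<epsilon> by linarith
    qed
    then show ?thesis by blast
  qed
  obtain r where r: "strict_mono r" and aeC: "AE \<omega> in M. Cauchy (\<lambda>i. J (r i) \<omega>)"
    using cauchy_L1_AE_cauchy_subseq[OF Ji cauchy] by blast
  define I where "I \<omega> = lim (\<lambda>i. J (r i) \<omega>)" for \<omega>
  have IM[measurable]: "I \<in> borel_measurable M" unfolding I_def[abs_def] by measurable
  have JI: "AE \<omega> in M. (\<lambda>i. J (r i) \<omega>) \<longlonglongrightarrow> I \<omega>"
    using aeC by eventually_elim (simp add: I_def Cauchy_convergent_iff convergent_LIMSEQ_iff)
  \<comment> \<open>Fatou's lemma along the subsequence carries the L2 bound over to the limit, and
    \<open>e (r i)\<close> tends to 0.\<close>
  have IJ: "(\<integral>\<^sup>+\<omega>. ennreal ((I \<omega> - J n \<omega>)\<^sup>2) \<partial>M) \<le> 2 * e n" for n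
  proof -
    have "(\<integral>\<^sup>+\<omega>. ennreal ((I \<omega> - J n \<omega>)\<^sup>2) \<partial>M) = (\<integral>\<^sup>+\<omega>. liminf (\<lambda>i. ennreal ((J (r i) \<omega> - J n \<omega>)\<^sup>2)) \<partial>M)"
    proof (rule nn_integral_cong_AE, use JI in eventually_elim)
      case (elim \<omega>)
      from tendsto_ennrealI[OF tendsto_power[OF tendsto_diff[OF elim tendsto_const[of "J n \<omega>"]], of 2]]
      show ?case by (intro lim_imp_Liminf[symmetric]) auto
    qed
    also have "\<dots> \<le> liminf (\<lambda>i. \<integral>\<^sup>+\<omega>. ennreal ((J (r i) \<omega> - J n \<omega>)\<^sup>2) \<partial>M)"
      by (rule nn_integral_liminf) measurable
    also have "\<dots> \<le> liminf (\<lambda>i. 2 * e (r i) + 2 * e n)"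
      by (intro Liminf_mono always_eventually allI Jd)
    also have "\<dots> = 2 * 0 + 2 * e n"
      using LIMSEQ_subseq_LIMSEQ[OF e0 r]
      by (intro lim_imp_Liminf tendsto_add tendsto_const ennreal_tendsto_cmult) (auto simp: o_def)
    finally show ?thesis by simp
  qed
  have "has_ito_integral M F W X I"
    unfolding has_ito_integral_def
  proof (intro conjI exI[of _ "\<lambda>n. Suc n"] exI[of _ \<tau>] exI[of _ \<xi>] allI)
    have "(\<lambda>(s, \<omega>). indicator {0..1} s * X s \<omega>) \<in> borel_measurable (restrict_space borel {0..1} \<Otimes>\<^sub>M M)"
    proof -
      have "(\<lambda>p. (fst p, snd p)) \<in> restrict_space borel {0..1::real} \<Otimes>\<^sub>M M \<rightarrow>\<^sub>M borel \<Otimes>\<^sub>M M"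
        by (intro measurable_Pair measurable_compose[OF measurable_fst measurable_restrict_space1[OF measurable_ident_sets[OF refl]], unfolded id_def] measurable_snd)
      from measurable_compose[OF this XM] show ?thesis by simp
    qed
    then show "(\<lambda>(s, \<omega>). X s \<omega>) \<in> borel_measurable (restrict_space borel {0..1} \<Otimes>\<^sub>M M)"
      by (rule measurable_cong[THEN iffD1, rotated]) (auto simp: space_pair_measure space_restrict_space)
    show "I \<in> borel_measurable M" by (rule IM)
    show "simple_adapted M F (Suc n) (\<tau> n) (\<xi> n)" for n by (rule sa)
    show "(\<lambda>n. \<integral>\<^sup>+\<omega>. (\<integral>\<^sup>+s\<in>{0..1}. ennreal ((X s \<omega> - simple_process (Suc n) (\<tau> n) (\<xi> n) s \<omega>)\<^sup>2) \<partial>lborel) \<partial>M) \<longlonglongrightarrow> 0"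
      using e0 unfolding e_def S_def .
    have "(\<lambda>n. 2 * e n) \<longlonglongrightarrow> 2 * 0" by (intro ennreal_tendsto_cmult e0) auto
    then have "(\<lambda>n. 2 * e n) \<longlonglongrightarrow> 0" by simp
    from tendsto_sandwich[OF _ _ tendsto_const this]
    show "(\<lambda>n. \<integral>\<^sup>+\<omega>. ennreal ((I \<omega> - simple_ito_integral W (Suc n) (\<tau> n) (\<xi> n) \<omega>)\<^sup>2) \<partial>M) \<longlonglongrightarrow> 0"
      using IJ unfolding J_def by (simp add: always_eventually)
  qed
  then show ?thesis unfolding X_def[abs_def] by blast
qed

end

section \<open>Localisation and conclusion\<close>

text \<open>An inductive form of continuous differentiability of order \<open>k\<close> that names
  no higher derivative, so closure under products and compositions follows by induction on the
  order.\<close>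

fun C_times :: "nat \<Rightarrow> (real \<Rightarrow> real) \<Rightarrow> bool" where
  "C_times 0 g = continuous_on UNIV g"
| "C_times (Suc k) g = (\<exists>g'. (\<forall>x. (g has_real_derivative g' x) (at x)) \<and> C_times k g')"

lemma C_times_SucI: "(\<And>x. (g has_real_derivative g' x) (at x)) \<Longrightarrow> C_times k g' \<Longrightarrow> C_times (Suc k) g"
  by auto

lemma C_times_SucE:
  assumes "C_times (Suc k) g"
  obtains g' where "\<And>x. (g has_real_derivative g' x) (at x)" "C_times k g'"
  using assms by auto

lemma C_times_Suc_D: "C_times (Suc k) g \<Longrightarrow> C_times k g"
  by (induction k arbitrary: g) (auto intro: DERIV_continuous_on_UNIV)

lemma C_times_const: "C_times k (\<lambda>_. c)"
proof (induction k arbitrary: c)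
  case (Suc k)
  show ?case by (rule C_times_SucI[OF DERIV_const Suc.IH])
qed simp

lemma C_times_ident: "C_times k (\<lambda>x. x)"
proof (cases k)
  case (Suc j)
  show ?thesis unfolding Suc by (rule C_times_SucI[OF DERIV_ident C_times_const])
qed simp

lemma C_times_add: "C_times k f \<Longrightarrow> C_times k g \<Longrightarrow> C_times k (\<lambda>x. f x + g x)"
proof (induction k arbitrary: f g)
  case (Suc k)
  obtain f' where f: "\<And>x. (f has_real_derivative f' x) (at x)" "C_times k f'" using C_times_SucE[OF Suc.prems(1)] by blast
  obtain g' where g: "\<And>x. (g has_real_derivative g' x) (at x)" "C_times k g'" using C_times_SucE[OF Suc.prems(2)] by blast
  show ?case by (rule C_times_SucI[OF DERIV_add[OF f(1) g(1)] Suc.IH[OF f(2) g(2)]])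
qed (auto intro: continuous_on_add)

lemma C_times_mult: "C_times k f \<Longrightarrow> C_times k g \<Longrightarrow> C_times k (\<lambda>x. f x * g x)"
proof (induction k arbitrary: f g)
  case (Suc k)
  obtain f' where f: "\<And>x. (f has_real_derivative f' x) (at x)" "C_times k f'" using C_times_SucE[OF Suc.prems(1)] by blast
  obtain g' where g: "\<And>x. (g has_real_derivative g' x) (at x)" "C_times k g'" using C_times_SucE[OF Suc.prems(2)] by blast
  have "C_times k (\<lambda>x. f' x * g x + g' x * f x)"
    using Suc.IH[OF f(2) C_times_Suc_D[OF Suc.prems(2)]] Suc.IH[OF g(2) C_times_Suc_D[OF Suc.prems(1)]] by (rule C_times_add)
  then show ?case by (rule C_times_SucI[OF DERIV_mult[OF f(1) g(1)]])
qed (auto intro: continuous_on_mult)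

lemma C_times_compose: "C_times k f \<Longrightarrow> C_times k g \<Longrightarrow> C_times k (\<lambda>x. f (g x))"
proof (induction k arbitrary: f g)
  case 0
  then show ?case by (auto intro: continuous_on_compose2)
next
  case (Suc k)
  obtain f' where f: "\<And>x. (f has_real_derivative f' x) (at x)" "C_times k f'" using C_times_SucE[OF Suc.prems(1)] by blast
  obtain g' where g: "\<And>x. (g has_real_derivative g' x) (at x)" "C_times k g'" using C_times_SucE[OF Suc.prems(2)] by blast
  have "C_times k (\<lambda>x. f' (g x) * g' x)"
    using Suc.IH[OF f(2) C_times_Suc_D[OF Suc.prems(2)]] g(2) by (rule C_times_mult)
  then show ?case by (rule C_times_SucI[OF DERIV_chain2[OF f(1) g(1)]])
qed

lemma DERIV_max_0_power: "((\<lambda>x. max 0 x ^ Suc (Suc n)) has_real_derivative real (Suc (Suc n)) * max 0 x ^ Suc n) (at x)" for x :: real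
proof (cases x "0 :: real" rule: linorder_cases)
  case less
  have "((\<lambda>_. 0) has_real_derivative 0) (at x)" by simp
  then show ?thesis
    using less by (subst has_field_derivative_cong_eventually[where g="\<lambda>_. 0"])
      (auto intro!: eventually_mono[OF eventually_at_in_open'[of "{..<0}" x]] simp: max_def)
next
  case greater
  have "((\<lambda>x. x ^ Suc (Suc n)) has_real_derivative real (Suc (Suc n)) * x ^ Suc n) (at x)"
    using DERIV_pow[of "Suc (Suc n)" x] by simp
  then show ?thesis
    using greater by (subst has_field_derivative_cong_eventually[where g="\<lambda>x. x ^ Suc (Suc n)"])
      (auto intro!: eventually_mono[OF eventually_at_in_open'[of "{0<..}" x]] simp: max_def)
next
  case equal
  have "(\<lambda>h. (max 0 h ^ Suc (Suc n)) / h) \<midarrow>0\<rightarrow> (0::real)"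
  proof (rule Lim_null_comparison)
    have "norm ((max 0 h ^ Suc (Suc n)) / h) \<le> \<bar>h\<bar> ^ Suc n" for h :: real
    proof (cases "h > 0")
      case False
      then have "max 0 h = 0" by simp
      then show ?thesis by (simp only: power_0_Suc div_0 norm_zero zero_le_power abs_ge_zero)
    qed simp
    then show "\<forall>\<^sub>F h in at 0. norm ((max 0 h ^ Suc (Suc n)) / h) \<le> \<bar>h\<bar> ^ Suc n" by simp
    have "((\<lambda>h::real. \<bar>h\<bar> ^ Suc n) \<longlongrightarrow> \<bar>0\<bar> ^ Suc n) (at 0)" by (intro tendsto_intros)
    then show "((\<lambda>h::real. \<bar>h\<bar> ^ Suc n) \<longlongrightarrow> 0) (at 0)" by simp
  qed
  with equal show ?thesis by (simp add: DERIV_def)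
qed

text \<open>The building block of the cut-off: a power glued to 0, smooth to the finite order that
  is required.\<close>

lemma C_times_max_0_power: "C_times k (\<lambda>x. max 0 x ^ Suc k)"
proof (induction k)
  case 0
  show ?case by (auto intro!: continuous_intros)
next
  case (Suc k)
  show ?case by (rule C_times_SucI[OF DERIV_max_0_power C_times_mult[OF C_times_const Suc]])
qed

text \<open>With \<open>p x = max 0 x ^ Suc k\<close>, the function
  \<open>p (1 - p (x\<^sup>2 / R\<^sup>2 - 1))\<close> works. For \<open>\<bar>x\<bar> < R\<close>
  the inner \<open>p\<close> vanishes and the value is 1; once
  \<open>x\<^sup>2 \<ge> 2 * R\<^sup>2\<close>, the inner \<open>p\<close> is at least 1 and the
  value is 0.\<close>

lemma cutoff_exists:
  assumes "0 < R"
  obtains cut where "C_times k cut" "\<And>x. \<bar>x\<bar> < R \<Longrightarrow> cut x = 1" "\<And>x. 2 * R < \<bar>x\<bar> \<Longrightarrow> cut x = 0"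
proof -
  let ?p = "\<lambda>x::real. max 0 x ^ Suc k"
  let ?cut = "\<lambda>x. ?p (1 + (-1) * ?p (1 / R\<^sup>2 * (x * x) + (-1)))"
  have lin: "C_times k (\<lambda>x. c * g x + d)" if "C_times k g" for c d g
    by (intro C_times_add C_times_mult C_times_const that)
  have "C_times k (\<lambda>x. (-1) * ?p (1 / R\<^sup>2 * (x * x) + (-1)) + 1)"
    by (intro lin C_times_compose[OF C_times_max_0_power] C_times_mult C_times_ident)
  then have "C_times k (\<lambda>x. 1 + (-1) * ?p (1 / R\<^sup>2 * (x * x) + (-1)))" by (simp only: add.commute)
  then have "C_times k ?cut" by (rule C_times_compose[OF C_times_max_0_power])
  moreover have "?cut x = 1" if "\<bar>x\<bar> < R" for x
  proof -
    have "\<bar>x\<bar>\<^sup>2 \<le> R\<^sup>2" using that by (intro power_mono) auto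
    then have "1 / R\<^sup>2 * (x * x) + (-1) \<le> 0" using assms by (simp add: power2_eq_square field_simps)
    then have "max 0 (1 / R\<^sup>2 * (x * x) + (-1)) = 0" by simp
    then show ?thesis by simp
  qed
  moreover have "?cut x = 0" if "2 * R < \<bar>x\<bar>" for x
  proof -
    have "(2 * R)\<^sup>2 \<le> \<bar>x\<bar>\<^sup>2" using that assms by (intro power_mono) auto
    then have "2 * R\<^sup>2 \<le> x * x"
      using zero_le_power2[of R] unfolding power2_abs power_mult_distrib power2_eq_square by linarith
    then have "1 \<le> 1 / R\<^sup>2 * (x * x) + (-1)" using assms by (simp add: field_simps)
    then have "1 \<le> ?p (1 / R\<^sup>2 * (x * x) + (-1))" by (intro one_le_power) auto
    then have "max 0 (1 + (-1) * ?p (1 / R\<^sup>2 * (x * x) + (-1))) = 0" by (simp del: power_Suc)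
    then show ?thesis by simp
  qed
  ultimately show ?thesis by (rule that)
qed

lemma DERIV_eq_on_open:
  fixes f g f' g' :: "real \<Rightarrow> real"
  assumes "open S" "x \<in> S" "\<And>y. y \<in> S \<Longrightarrow> f y = g y" "(f has_real_derivative a) (at x)" "(g has_real_derivative b) (at x)"
  shows "a = b"
  using has_field_derivative_transform_within_open[OF assms(4,1,2), of g] assms(3,5) DERIV_unique by blast

lemma bounded_if_zero_outside:
  fixes g :: "real \<Rightarrow> real"
  assumes "continuous_on UNIV g" "\<And>x. r < \<bar>x\<bar> \<Longrightarrow> g x = 0"
  obtains c where "\<And>x. \<bar>g x\<bar> \<le> c"
proof -
  have "compact (g ` {-r..r})" by (intro compact_continuous_image continuous_on_subset[OF assms(1)]) auto
  then obtain c where c: "\<And>x. x \<in> {-r..r} \<Longrightarrow> \<bar>g x\<bar> \<le> c"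
    using compact_imp_bounded bounded_iff by (metis image_eqI real_norm_def)
  have "\<bar>g x\<bar> \<le> max c 0" for x
  proof (cases "r < \<bar>x\<bar>")
    case False
    then have "x \<in> {-r..r}" by auto
    from c[OF this] show ?thesis by simp
  qed (simp add: assms(2))
  then show ?thesis by (rule that)
qed

lemma C_times_iff_derivatives:
  "C_times k g \<longleftrightarrow> (\<exists>G. G 0 = g \<and> (\<forall>i<k. \<forall>x. (G i has_real_derivative G (Suc i) x) (at x)) \<and> continuous_on UNIV (G k))"
proof (induction k arbitrary: g)
  case (Suc k)
  show ?case
  proof
    assume "C_times (Suc k) g"
    then obtain g' where g: "\<And>x. (g has_real_derivative g' x) (at x)" "C_times k g'" using C_times_SucE by blast
    from g(2) obtain G where G: "G 0 = g'" "\<And>i x. i < k \<Longrightarrow> (G i has_real_derivative G (Suc i) x) (at x)" "continuous_on UNIV (G k)"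
      unfolding Suc.IH by blast
    have "((case_nat g G) i has_real_derivative (case_nat g G) (Suc i) x) (at x)" if "i < Suc k" for i x
      using that g(1) G(1,2) by (cases i) auto
    with G(3) show "\<exists>G. G 0 = g \<and> (\<forall>i<Suc k. \<forall>x. (G i has_real_derivative G (Suc i) x) (at x)) \<and> continuous_on UNIV (G (Suc k))"
      by (intro exI[of _ "case_nat g G"]) simp
  next
    assume "\<exists>G. G 0 = g \<and> (\<forall>i<Suc k. \<forall>x. (G i has_real_derivative G (Suc i) x) (at x)) \<and> continuous_on UNIV (G (Suc k))"
    then obtain G where G: "G 0 = g" "\<And>i x. i < Suc k \<Longrightarrow> (G i has_real_derivative G (Suc i) x) (at x)" "continuous_on UNIV (G (Suc k))"
      by blast
    have "C_times k (G 1)"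
      unfolding Suc.IH using G(2,3) by (intro exI[of _ "\<lambda>i. G (Suc i)"]) simp
    with G(1) G(2)[of 0] show "C_times (Suc k) g" by (intro C_times_SucI[of g "G 1"]) simp_all
  qed
qed auto

text \<open>The derivatives of the product with the cut-off are never computed. On the open sets
  where the cut-off is constant they are identified by uniqueness of derivatives, and on the compact
  remainder continuity bounds them.\<close>

lemma bounded_modification:
  fixes D :: "nat \<Rightarrow> real \<Rightarrow> real"
  assumes D: "\<And>i x. i < k \<Longrightarrow> (D i has_real_derivative D (Suc i) x) (at x)" "continuous_on UNIV (D k)" and R: "0 < R"
  obtains G c where "\<And>i x. i < k \<Longrightarrow> (G i has_real_derivative G (Suc i) x) (at x)" "continuous_on UNIV (G k)"
      "\<And>i x. i \<le> k \<Longrightarrow> \<bar>G i x\<bar> \<le> c" "\<And>i x. i \<le> k \<Longrightarrow> \<bar>x\<bar> < R \<Longrightarrow> G i x = D i x"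
proof -
  obtain cut where cut: "C_times k cut" "\<And>x. \<bar>x\<bar> < R \<Longrightarrow> cut x = 1" "\<And>x. 2 * R < \<bar>x\<bar> \<Longrightarrow> cut x = 0"
    using cutoff_exists[OF R] by blast
  have "C_times k (D 0)" unfolding C_times_iff_derivatives using D by blast
  then have "C_times k (\<lambda>x. D 0 x * cut x)" using cut(1) by (rule C_times_mult)
  then obtain G where G: "G 0 = (\<lambda>x. D 0 x * cut x)" "\<And>i x. i < k \<Longrightarrow> (G i has_real_derivative G (Suc i) x) (at x)" "continuous_on UNIV (G k)"
    unfolding C_times_iff_derivatives by blast
  have "open {x::real. 2 * R < \<bar>x\<bar>}" and "open {x::real. \<bar>x\<bar> < R}" by (auto intro!: open_Collect_less continuous_intros)
  note opn = this
  have zero: "G i x = 0" if "i \<le> k" "2 * R < \<bar>x\<bar>" for i x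
    using that
  proof (induction i arbitrary: x)
    case (Suc i)
    then show ?case
      using DERIV_eq_on_open[OF opn(1), of x "G i" "\<lambda>_. 0" "G (Suc i) x" 0] G(2)[of i x] by auto
  qed (simp add: G(1) cut(3))
  have eq: "G i x = D i x" if "i \<le> k" "\<bar>x\<bar> < R" for i x
    using that
  proof (induction i arbitrary: x)
    case (Suc i)
    then show ?case
      using DERIV_eq_on_open[OF opn(2), of x "G i" "D i" "G (Suc i) x" "D (Suc i) x"] G(2)[of i x] D(1)[of i x] by auto
  qed (simp add: G(1) cut(2))
  have "continuous_on UNIV (G i)" if "i \<le> k" for i
    using that G(3) G(2)[of i] by (cases "i = k") (auto intro: DERIV_continuous_on_UNIV)
  then have "\<exists>c. \<forall>x. \<bar>G i x\<bar> \<le> c" if "i \<le> k" for i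
    using bounded_if_zero_outside[of "G i" "2 * R"] zero that by metis
  then obtain c where c: "\<And>i x. i \<le> k \<Longrightarrow> \<bar>G i x\<bar> \<le> c i" by metis
  have "\<bar>G i x\<bar> \<le> Max (c ` {..k})" if "i \<le> k" for i x
    using c[OF that, of x] that by (intro order_trans[OF c[OF that] Max_ge]) auto
  with G(2,3) show ?thesis using eq by (rule that)
qed

section \<open>Localisation to a bounded range\<close>

context quarter_fbm
begin

text \<open>Rational times make this event measurable and already contain the grid points \<open>k/n\<close>.\<close>

definition exceeds :: "real \<Rightarrow> 'a set" where
  "exceeds R = {\<omega>\<in>space M. \<exists>t\<in>{0..1} \<inter> \<rat>. R < \<bar>B t \<omega>\<bar>}"

lemma exceeds_events: "exceeds R \<in> events"
proof -
  have "exceeds R = (\<Union>t\<in>{0..1} \<inter> \<rat>. {\<omega>\<in>space M. R < \<bar>B t \<omega>\<bar>})" by (auto simp: exceeds_def)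
  also have "\<dots> \<in> events"
  proof (intro sets.countable_UN'')
    show "countable ({0..1} \<inter> \<rat> :: real set)" using countable_rat by (rule countable_subset[rotated]) auto
    fix t :: real assume "t \<in> {0..1} \<inter> \<rat>"
    then have [measurable]: "B t \<in> borel_measurable M" by (intro measurable_B) auto
    show "{\<omega>\<in>space M. R < \<bar>B t \<omega>\<bar>} \<in> events" by measurable
  qed
  finally show ?thesis .
qed

text \<open>Each path is continuous on a compact interval, hence bounded, so its indicator is
  eventually 0; dominated convergence does the rest.\<close>

lemma prob_exceeds_tendsto: "(\<lambda>R. prob (exceeds (real R))) \<longlonglongrightarrow> 0"
proof -
  have "(\<lambda>R. expectation (indicator (exceeds (real R)))) \<longlonglongrightarrow> expectation (\<lambda>_. 0 :: real)"
  proof (rule integral_dominated_convergence[where w="\<lambda>_. 1"])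
    show "AE \<omega> in M. (\<lambda>R. indicator (exceeds (real R)) \<omega>) \<longlonglongrightarrow> (0 :: real)"
    proof (rule AE_I2)
      fix \<omega> assume w: "\<omega> \<in> space M"
      have "compact ((\<lambda>t. B t \<omega>) ` {0..1})" by (intro compact_continuous_image continuous_B w) auto
      then obtain c where c: "\<And>t. t \<in> {0..1} \<Longrightarrow> \<bar>B t \<omega>\<bar> \<le> c"
        using compact_imp_bounded bounded_iff by (metis image_eqI real_norm_def)
      have "\<forall>\<^sub>F R in sequentially. c \<le> real R"
        using filterlim_real_sequentially unfolding filterlim_at_top by blast
      then have "\<forall>\<^sub>F R in sequentially. indicator (exceeds (real R)) \<omega> = (0 :: real)"
      proof eventually_elim
        case (elim R)
        then have "\<omega> \<notin> exceeds (real R)" using c by (force simp: exceeds_def)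
        then show ?case by simp
      qed
      then show "(\<lambda>R. indicator (exceeds (real R)) \<omega>) \<longlonglongrightarrow> (0 :: real)" by (rule tendsto_eventually)
    qed
    show "indicator (exceeds (real R)) \<in> borel_measurable M" for R
      using exceeds_events by (rule borel_measurable_indicator)
  qed (auto simp: indicator_def)
  moreover have "expectation (indicator (exceeds (real R))) = prob (exceeds (real R))" for R
    using exceeds_events[of "real R"] sets.sets_into_space[OF exceeds_events[of "real R"]] by (simp add: Int_absorb2)
  ultimately show ?thesis by simp
qed

lemma bounded_by_if_not_exceeds:
  assumes "\<omega> \<in> space M" "\<omega> \<notin> exceeds R" "t \<in> {0..1}"
  shows "\<bar>B t \<omega>\<bar> \<le> R"
proof -
  have "x \<in> closure \<rat>" for x :: real
    unfolding closure_approachable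
  proof (intro allI impI)
    fix e :: real assume "0 < e"
    then obtain q where "q \<in> \<rat>" "x < q" "q < x + e" using Rats_dense_in_real[of x "x + e"] by auto
    then show "\<exists>y\<in>\<rat>. dist y x < e" by (intro bexI[of _ q]) (auto simp: dist_real_def)
  qed
  then have "closure ({0<..<1} \<inter> \<rat>) = closure {0<..<1::real}"
    by (intro closure_open_Int_superset) auto
  then have "t \<in> closure ({0<..<1} \<inter> \<rat>)"
    using assms(3) by (simp add: closure_greaterThanLessThan)
  then obtain x where x: "\<And>n. x n \<in> {0<..<1} \<inter> \<rat>" "x \<longlonglongrightarrow> t"
    unfolding closure_sequential by blast
  have "(\<lambda>n. \<bar>B (x n) \<omega>\<bar>) \<longlonglongrightarrow> \<bar>B t \<omega>\<bar>"
    using x(1) by (intro tendsto_rabs continuous_on_tendsto_compose[OF continuous_B[OF assms(1)] x(2) assms(3)]) (auto simp: less_imp_le)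
  moreover have "\<bar>B (x n) \<omega>\<bar> \<le> R" for n
    using assms(1,2) x(1)[of n] by (force simp: exceeds_def not_less)
  ultimately show ?thesis by (intro LIMSEQ_le_const2) auto
qed

lemma norm_expectation_diff_le:
  fixes u v :: "'a \<Rightarrow> complex"
  assumes [measurable]: "u \<in> borel_measurable M" "v \<in> borel_measurable M" "A \<in> events"
    and "\<And>\<omega>. \<omega> \<in> space M \<Longrightarrow> norm (u \<omega>) \<le> 1" "\<And>\<omega>. \<omega> \<in> space M \<Longrightarrow> norm (v \<omega>) \<le> 1"
    and "\<And>\<omega>. \<omega> \<in> space M \<Longrightarrow> \<omega> \<notin> A \<Longrightarrow> u \<omega> = v \<omega>"
  shows "norm (expectation u - expectation v) \<le> 2 * prob A"
proof -
  have i: "integrable M u" "integrable M v"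
    using assms(4,5) by (auto intro!: integrable_const_bound[of _ 1])
  have "norm (expectation u - expectation v) = norm (expectation (\<lambda>\<omega>. u \<omega> - v \<omega>))" using i by simp
  also have "\<dots> \<le> expectation (\<lambda>\<omega>. norm (u \<omega> - v \<omega>))" by (rule integral_norm_bound)
  also have "\<dots> \<le> expectation (\<lambda>\<omega>. 2 * indicator A \<omega>)"
  proof (rule integral_mono)
    show "integrable M (\<lambda>\<omega>. norm (u \<omega> - v \<omega>))" using i by (intro integrable_norm Bochner_Integration.integrable_diff)
    show "integrable M (\<lambda>\<omega>. 2 * indicator A \<omega> :: real)"
      by (intro integrable_mult_right integrable_real_indicator) (auto simp: emeasure_eq_measure)
    fix \<omega> assume w: "\<omega> \<in> space M"
    show "norm (u \<omega> - v \<omega>) \<le> 2 * indicator A \<omega>"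
      using norm_triangle_ineq4[of "u \<omega>" "v \<omega>"] assms(4)[OF w] assms(5)[OF w] assms(6)[OF w] by (cases "\<omega> \<in> A") auto
  qed
  also have "\<dots> = 2 * prob A" using sets.sets_into_space[OF assms(3)] by (simp add: Int_absorb2)
  finally show ?thesis .
qed

lemma measurable_weighted_quadratic_variation:
  assumes "continuous_on UNIV f"
  shows "weighted_quadratic_variation f B n \<in> borel_measurable M"
  unfolding weighted_quadratic_variation_def[abs_def]
proof (intro borel_measurable_times borel_measurable_const borel_measurable_sum)
  fix k assume "k \<in> {..<n}"
  then have k: "real k / real n \<in> {0..1}" "real (k + 1) / real n \<in> {0..1}" by auto
  note [measurable] = borel_measurable_continuous_onI[OF assms] measurable_B[OF k(1)] measurable_B[OF k(2)]
  show "(\<lambda>\<omega>. f (B (real k / real n) \<omega>)) \<in> borel_measurable M" by measurable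
  show "(\<lambda>\<omega>. sqrt (real n) * (B (real (k + 1) / real n) \<omega> - B (real k / real n) \<omega>)\<^sup>2 - 1) \<in> borel_measurable M" by measurable
qed

text \<open>Exchanging the functions for bounded ones that agree with them on a large interval
  alters both the sequence and the limit by at most twice the probability of leaving the interval.
  This is uniform in \<open>n\<close>, so the bounded case suffices.\<close>

theorem characteristic_function_limit:
  fixes D :: "nat \<Rightarrow> real \<Rightarrow> real"
  assumes D: "\<And>i x. i < 4 \<Longrightarrow> (D i has_real_derivative D (Suc i) x) (at x)" "continuous_on UNIV (D 4)"
  shows "(\<lambda>n. expectation (\<lambda>\<omega>. iexp (\<mu> * weighted_quadratic_variation (D 0) B n \<omega>))) \<longlonglongrightarrow>
    expectation (\<lambda>\<omega>. exp (Complex (- (\<mu>\<^sup>2 / 2 * (C_quarter\<^sup>2 * (LINT s:{0..1}|lborel. (D 0 (B s \<omega>))\<^sup>2))))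
      (\<mu> * ((LINT s:{0..1}|lborel. D 2 (B s \<omega>)) / 4))))"
proof -
  define \<Lambda> where "\<Lambda> g g2 \<omega> = exp (Complex (- (\<mu>\<^sup>2 / 2 * (C_quarter\<^sup>2 * (LINT s:{0..1}|lborel. (g (B s \<omega>))\<^sup>2))))
      (\<mu> * ((LINT s:{0..1}|lborel. g2 (B s \<omega>)) / 4)))" for g g2 :: "real \<Rightarrow> real" and \<omega>
  define \<Gamma> where "\<Gamma> g n \<omega> = iexp (\<mu> * weighted_quadratic_variation g B n \<omega>)" for g n \<omega>
  have \<Lambda>m: "\<Lambda> g g2 \<in> borel_measurable M" if "continuous_on UNIV g" "continuous_on UNIV g2" for g g2
  proof -
    note [measurable] = measurable_integral_B[OF that(2)] measurable_integral_B[OF continuous_on_power[OF that(1), of 2]]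
    show ?thesis unfolding \<Lambda>_def[abs_def] Complex_eq by measurable
  qed
  have \<Lambda>1: "norm (\<Lambda> g g2 \<omega>) \<le> 1" for g g2 \<omega>
    unfolding \<Lambda>_def by (intro real_norm_cmod_exp mult_nonneg_nonneg integral_nonneg_AE) (auto simp: set_lebesgue_integral_def)
  have \<Gamma>m: "\<Gamma> g n \<in> borel_measurable M" if "continuous_on UNIV g" for g n
    unfolding \<Gamma>_def[abs_def] using measurable_weighted_quadratic_variation[OF that, of n] by measurable
  have \<Gamma>1: "norm (\<Gamma> g n \<omega>) \<le> 1" for g n \<omega> unfolding \<Gamma>_def by simp
  have cf: "continuous_on UNIV (D 0)" "continuous_on UNIV (D 2)"
    using D(1)[of 0] D(1)[of 2] by (auto intro: DERIV_continuous_on_UNIV)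
  have "(\<lambda>n. expectation (\<Gamma> (D 0) n)) \<longlonglongrightarrow> expectation (\<Lambda> (D 0) (D 2))"
  proof (rule LIMSEQ_I)
    fix r :: real assume r: "0 < r"
    \<comment> \<open>The two exchanges cost \<open>2 * prob\<close> each, that is, less than
      \<open>r / 3\<close> each; the last third is left for the bounded limit.\<close>
    have "\<forall>\<^sub>F R in sequentially. prob (exceeds (real R)) < r / 6"
      using prob_exceeds_tendsto by (rule order_tendstoD(2)) (use r in simp)
    then obtain R where R: "prob (exceeds (real R)) < r / 6" unfolding eventually_sequentially by blast
    \<comment> \<open>The modification agrees with the original on an open interval; radius
      \<open>R + 1\<close> makes room for the closed range of paths that do not exceed
      \<open>R\<close>.\<close>
    have R1: "0 < real R + 1" by simp
    obtain G c where G: "\<And>i x. i < 4 \<Longrightarrow> (G i has_real_derivative G (Suc i) x) (at x)" "continuous_on UNIV (G 4)"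
      and c: "\<And>i x. i \<le> 4 \<Longrightarrow> \<bar>G i x\<bar> \<le> c" and eq: "\<And>i x. i \<le> 4 \<Longrightarrow> \<bar>x\<bar> < real R + 1 \<Longrightarrow> G i x = D i x"
      using bounded_modification[OF D R1] by blast
    have cg: "continuous_on UNIV (G 0)" "continuous_on UNIV (G 2)"
      using G(1)[of 0] G(1)[of 2] by (auto intro: DERIV_continuous_on_UNIV)
    have Beq: "(G 0) (B t \<omega>) = (D 0) (B t \<omega>)" "(G 2) (B t \<omega>) = (D 2) (B t \<omega>)"
      if "\<omega> \<in> space M" "\<omega> \<notin> exceeds (real R)" "t \<in> {0..1}" for \<omega> t
      using bounded_by_if_not_exceeds[OF that] by (auto intro!: eq)
    have \<Gamma>d: "norm (expectation (\<Gamma> (D 0) n) - expectation (\<Gamma> (G 0) n)) \<le> 2 * prob (exceeds (real R))" for n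
    proof (rule norm_expectation_diff_le[OF \<Gamma>m[OF cf(1)] \<Gamma>m[OF cg(1)] exceeds_events])
      show "norm (\<Gamma> (D 0) n \<omega>) \<le> 1" "norm (\<Gamma> (G 0) n \<omega>) \<le> 1" for \<omega> by (rule \<Gamma>1)+
      fix \<omega> assume w: "\<omega> \<in> space M" "\<omega> \<notin> exceeds (real R)"
      have "weighted_quadratic_variation (D 0) B n \<omega> = weighted_quadratic_variation (G 0) B n \<omega>"
        unfolding weighted_quadratic_variation_def
        by (intro arg_cong2[where f=times] refl sum.cong) (auto intro!: Beq(1)[OF w, symmetric])
      then show "\<Gamma> (D 0) n \<omega> = \<Gamma> (G 0) n \<omega>" unfolding \<Gamma>_def by simp
    qed
    have \<Lambda>d: "norm (expectation (\<Lambda> (G 0) (G 2)) - expectation (\<Lambda> (D 0) (D 2))) \<le> 2 * prob (exceeds (real R))"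
    proof (rule norm_expectation_diff_le[OF \<Lambda>m[OF cg] \<Lambda>m[OF cf] exceeds_events])
      show "norm (\<Lambda> (G 0) (G 2) \<omega>) \<le> 1" "norm (\<Lambda> (D 0) (D 2) \<omega>) \<le> 1" for \<omega> by (rule \<Lambda>1)+
      fix \<omega> assume w: "\<omega> \<in> space M" "\<omega> \<notin> exceeds (real R)"
      have "(LINT s:{0..1}|lborel. ((G 0) (B s \<omega>))\<^sup>2) = (LINT s:{0..1}|lborel. ((D 0) (B s \<omega>))\<^sup>2)"
        "(LINT s:{0..1}|lborel. (G 2) (B s \<omega>)) = (LINT s:{0..1}|lborel. (D 2) (B s \<omega>))"
        by (rule set_lebesgue_integral_cong; simp add: Beq[OF w])+
      then show "\<Lambda> (G 0) (G 2) \<omega> = \<Lambda> (D 0) (D 2) \<omega>" unfolding \<Lambda>_def by simp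
    qed
    have "(\<lambda>n. expectation (\<Gamma> (G 0) n)) \<longlonglongrightarrow> expectation (\<Lambda> (G 0) (G 2))"
      unfolding \<Gamma>_def \<Lambda>_def
      by (rule bounded_limit[of "G 0" "G 1" "G 2" "G 3" "G 4" c])
        (use G c in \<open>auto simp: numeral_eq_Suc\<close>)
    from LIMSEQ_D[OF this, of "r / 3"] r obtain N where N: "\<And>n. N \<le> n \<Longrightarrow> norm (expectation (\<Gamma> (G 0) n) - expectation (\<Lambda> (G 0) (G 2))) < r / 3"
      by auto
    have "norm (expectation (\<Gamma> (D 0) n) - expectation (\<Lambda> (D 0) (D 2))) < r" if "N \<le> n" for n
    proof -
      have "norm (expectation (\<Gamma> (D 0) n) - expectation (\<Lambda> (D 0) (D 2))) \<le> norm (expectation (\<Gamma> (D 0) n) - expectation (\<Gamma> (G 0) n))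
          + norm (expectation (\<Gamma> (G 0) n) - expectation (\<Lambda> (G 0) (G 2))) + norm (expectation (\<Lambda> (G 0) (G 2)) - expectation (\<Lambda> (D 0) (D 2)))"
        by norm
      with N[OF that] \<Gamma>d[of n] \<Lambda>d R show ?thesis by linarith
    qed
    then show "\<exists>N. \<forall>n\<ge>N. norm (expectation (\<Gamma> (D 0) n) - expectation (\<Lambda> (D 0) (D 2))) < r" by blast
  qed
  then show ?thesis unfolding \<Gamma>_def[abs_def] \<Lambda>_def[abs_def] .
qed

text \<open>Intended for \<open>N = F 0\<close>: variance and drift must be known at time 0 to enter
  the conditional characteristic function.\<close>

lemma measurable_integral_B_subalgebra:
  fixes g :: "real \<Rightarrow> real"
  assumes N: "space N = space M" "\<And>t. t \<in> {0..1} \<Longrightarrow> B t \<in> borel_measurable N" and g: "continuous_on UNIV g"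
  shows "(\<lambda>\<omega>. LINT s:{0..1}|lborel. g (B s \<omega>)) \<in> borel_measurable N"
proof (rule borel_measurable_LIMSEQ_real)
  show "(\<lambda>n. (\<Sum>l<n. g (B (real l / n) \<omega>)) / n) \<longlonglongrightarrow> (LINT s:{0..1}|lborel. g (B s \<omega>))" if "\<omega> \<in> space N" for \<omega>
    using that by (intro riemann_B g) (simp add: N)
  show "(\<lambda>\<omega>. (\<Sum>l<n. g (B (real l / n) \<omega>)) / n) \<in> borel_measurable N" for n :: nat
    by (intro borel_measurable_divide borel_measurable_sum borel_measurable_const
      measurable_compose[OF N(2) borel_measurable_continuous_onI[OF g]]) auto
qed

end

text \<open>By Levy's continuity theorem it suffices to compare characteristic functions. That of
  the limit is obtained from \<open>characteristic_function_ito\<close> at frequency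
  \<open>\<mu> * C_quarter\<close> with the drift as phase, and coincides with the limit in
  \<open>characteristic_function_limit\<close>.\<close>

theorem theorem1p1:
  fixes M :: "'a measure"
    and B W :: "real \<Rightarrow> 'a \<Rightarrow> real"
    and f :: "real \<Rightarrow> real"
  assumes "prob_space M"
    and "fractional_brownian_motion M (1/4) B"
    and "standard_brownian_motion M W"
    and "indep_processes M B W"
    and "class_C 4 f"
    and "\<And>(p::real) (i::nat). p \<ge> 1 \<Longrightarrow> i \<le> 4 \<Longrightarrow>
           (SUP t\<in>{0..1}. \<integral>\<^sup>+ \<omega>. ennreal (\<bar>(deriv ^^ i) f (B t \<omega>)\<bar> powr p) \<partial>M) < \<infinity>"
  shows "weak_conv_m
           (\<lambda>n. distr M borel (weighted_quadratic_variation f B n))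
           (distr M borel (\<lambda>\<omega>.
              C_quarter *
                ito_integral M (initially_enlarged_filtration M B W) W (\<lambda>s \<omega>. f (B s \<omega>)) \<omega>
              + 1 / 4 * (LINT s:{0..1}|lborel. (deriv ^^ 2) f (B s \<omega>))))
         \<and> \<bar>C_quarter - 1.535\<bar> < 0.0005"
proof
  interpret prob_space M by fact
  interpret quarter_fbm M B by (rule quarter_fbm.intro[OF assms(1) quarter_fbm_axioms.intro[OF assms(2)]])
  note Bm = measurable_B
  interpret independent_brownian_motion M B W
    by (rule independent_brownian_motion.intro[OF assms(1) independent_brownian_motion_axioms.intro[OF Bm assms(3,4)]])
  define D where "D i = (deriv ^^ i) f" for i
  have dD: "(D i has_real_derivative D (Suc i) x) (at x)" if "i < 4" for i x
  proof -
    have "D i differentiable (at x)" using assms(5) that by (simp add: class_C_def D_def)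
    then show ?thesis by (simp add: D_def DERIV_deriv_iff_real_differentiable)
  qed
  have cD: "continuous_on UNIV (D 4)" using assms(5) by (simp add: class_C_def D_def)
  have D0: "D 0 = f" by (simp add: D_def)
  have cf: "continuous_on UNIV f" "continuous_on UNIV (D 2)"
    using dD[of 0] dD[of 2] by (auto intro: DERIV_continuous_on_UNIV simp: D0)
  have cf2: "continuous_on UNIV (\<lambda>x. (f x)\<^sup>2)" by (intro continuous_intros cf)
  \<comment> \<open>The moment assumption with \<open>p = 4\<close> and \<open>i = 0\<close>: the
    uniform fourth moments on which existence of the integral rests.\<close>
  let ?m = "SUP t\<in>{0..1}. \<integral>\<^sup>+\<omega>. ennreal (\<bar>f (B t \<omega>)\<bar> powr 4) \<partial>M"
  have m: "?m < \<infinity>" using assms(6)[of 4 0] by simp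
  have pow: "\<bar>y\<bar> powr 4 = y ^ 4" for y :: real by (simp add: powr_numeral)
  have K: "(\<integral>\<^sup>+\<omega>. ennreal ((f (B t \<omega>)) ^ 4) \<partial>M) \<le> ennreal (enn2real ?m)" if "t \<in> {0..1}" for t
  proof -
    have "(\<integral>\<^sup>+\<omega>. ennreal ((f (B t \<omega>)) ^ 4) \<partial>M) \<le> ?m" unfolding pow[symmetric] by (rule SUP_upper[OF that])
    also have "?m = ennreal (enn2real ?m)" using m by simp
    finally show ?thesis .
  qed
  define I where "I = ito_integral M F W (\<lambda>s \<omega>. f (B s \<omega>))"
  \<comment> \<open>Existence turns the choice in \<open>ito_integral\<close> into a genuine version
    of the integral.\<close>
  have "\<exists>I. has_ito_integral M F W (\<lambda>s \<omega>. f (B s \<omega>)) I"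
    by (rule ito_integral_exists[OF continuous_B cf(1) K]) auto
  then have I: "has_ito_integral M F W (\<lambda>s \<omega>. f (B s \<omega>)) I"
    unfolding I_def ito_integral_def by (rule someI_ex)
  have [measurable]: "I \<in> borel_measurable M" using I by (simp add: has_ito_integral_def)
  define V where "V \<omega> = (LINT s:{0..1}|lborel. (f (B s \<omega>))\<^sup>2)" for \<omega>
  define A where "A \<omega> = (LINT s:{0..1}|lborel. D 2 (B s \<omega>))" for \<omega>
  have VF: "V \<in> borel_measurable (F 0)" and AF: "A \<in> borel_measurable (F 0)"
    unfolding V_def[abs_def] A_def[abs_def]
    by (intro measurable_integral_B_subalgebra measurable_B_F cf cf2; simp add: space_F)+
  have [measurable]: "A \<in> borel_measurable M" unfolding A_def[abs_def] by (rule measurable_integral_B[OF cf(2)])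
  have V0: "0 \<le> V \<omega>" for \<omega> unfolding V_def set_lebesgue_integral_def by (intro integral_nonneg_AE) simp
  have VI: "(\<integral>\<^sup>+s\<in>{0..1}. ennreal ((f (B s \<omega>))\<^sup>2) \<partial>lborel) = ennreal (V \<omega>)" if w: "\<omega> \<in> space M" for \<omega>
  proof -
    have "set_integrable lborel {0..1} (\<lambda>s. (f (B s \<omega>))\<^sup>2)"
      by (rule borel_integrable_atLeastAtMost'[OF continuous_f_B[OF w cf2]])
    then have "(\<integral>\<^sup>+s. ennreal (indicator {0..1} s *\<^sub>R (f (B s \<omega>))\<^sup>2) \<partial>lborel) = ennreal (V \<omega>)"
      unfolding V_def set_lebesgue_integral_def set_integrable_def by (intro nn_integral_eq_integral) auto
    moreover have "(\<integral>\<^sup>+s. ennreal (indicator {0..1} s *\<^sub>R (f (B s \<omega>))\<^sup>2) \<partial>lborel) = (\<integral>\<^sup>+s\<in>{0..1}. ennreal ((f (B s \<omega>))\<^sup>2) \<partial>lborel)"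
      by (intro nn_integral_cong) (auto simp: indicator_def)
    ultimately show ?thesis by simp
  qed
  have fm: "(\<lambda>(s, \<omega>). indicator {0..1} s * f (B s \<omega>)) \<in> borel_measurable (borel \<Otimes>\<^sub>M M)"
    by (intro measurable_path_process continuous_f_B cf measurable_compose[OF _ borel_measurable_continuous_onI[OF cf(1)]] Bm)
  let ?Y = "\<lambda>\<omega>. C_quarter * I \<omega> + 1 / 4 * A \<omega>"
  have Wm: "weighted_quadratic_variation f B n \<in> borel_measurable M" for n
    by (rule measurable_weighted_quadratic_variation[OF cf(1)])
  have "weak_conv_m (\<lambda>n. distr M borel (weighted_quadratic_variation f B n)) (distr M borel ?Y)"
  proof (rule levy_continuity)
    show "real_distribution (distr M borel (weighted_quadratic_variation f B n))" for n
      by (rule real_distribution_distr[OF Wm])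
    show "real_distribution (distr M borel ?Y)" by (rule real_distribution_distr) measurable
    fix \<mu>
    have "char (distr M borel ?Y) \<mu> = expectation (\<lambda>\<omega>. iexp (\<mu> / 4 * A \<omega> + (\<mu> * C_quarter) * I \<omega>))"
      unfolding char_def by (subst integral_distr) (auto intro!: Bochner_Integration.integral_cong simp: algebra_simps)
    also have "\<dots> = expectation (\<lambda>\<omega>. exp (Complex (- ((\<mu> * C_quarter)\<^sup>2 / 2 * V \<omega>)) (\<mu> / 4 * A \<omega>)))"
      using AF by (intro characteristic_function_ito[OF I fm VF V0 VI] borel_measurable_times) auto
    also have "\<dots> = expectation (\<lambda>\<omega>. exp (Complex (- (\<mu>\<^sup>2 / 2 * (C_quarter\<^sup>2 * V \<omega>))) (\<mu> * (A \<omega> / 4))))"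
      by (simp add: power_mult_distrib mult_ac)
    finally have Y: "char (distr M borel ?Y) \<mu> = \<dots>" .
    have "char (distr M borel (weighted_quadratic_variation f B n)) \<mu> = expectation (\<lambda>\<omega>. iexp (\<mu> * weighted_quadratic_variation f B n \<omega>))" for n
      unfolding char_def by (subst integral_distr[OF Wm]) auto
    note X = this
    show "(\<lambda>n. char (distr M borel (weighted_quadratic_variation f B n)) \<mu>) \<longlonglongrightarrow> char (distr M borel ?Y) \<mu>"
      unfolding Y X unfolding V_def A_def by (rule characteristic_function_limit[OF dD cD, unfolded D0])
  qed
  then show "weak_conv_m
           (\<lambda>n. distr M borel (weighted_quadratic_variation f B n))
           (distr M borel (\<lambda>\<omega>.
              C_quarter *
                ito_integral M (initially_enlarged_filtration M B W) W (\<lambda>s \<omega>. f (B s \<omega>)) \<omega>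
              + 1 / 4 * (LINT s:{0..1}|lborel. (deriv ^^ 2) f (B s \<omega>))))"
    unfolding I_def A_def D_def .
  show "\<bar>C_quarter - 1.535\<bar> < 0.0005" by (rule C_quarter_approx)
qed

end
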